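(* Let $\Omega\subset\mathbb{C}$ be a bounded simply connected Jordan domain, let $\varphi$ be a solution of the minimal surface equation over $\Omega$, $\psi$ its dual solution of the maximal surface equation, and $f\colon\mathbb{D}\to\Omega$ the corresponding harmonic mapping. Suppose $\partial\Omega$ contains line segments $I_1,I_2$ which have a common endpoint $z_0$ with interior angle $\alpha$. Assume also that $\varphi$ tends to plus or minus infinity on $I_1$ and $I_2$, and that the signs on $I_1$ and $I_2$ differ if $\alpha=\pi$. Then the following statements hold. (a) The isothermal parametrization $X_{\min}=(f,\varphi\circ f)$ of $\Sigma_{\min}=\mathrm{graph}(\varphi)$ extends to a generalized minimal surface $\widetilde{X_{\min}}$ beyond a vertical line segment $L$ over $z_0$. Further, the extended surface is exactly the $\pi$-rotation of the original surface $\Sigma_{\min}$ with respect to $L$. (b) Similarly, the isothermal parametrization $X_{\max}=(f,\psi\circ f)$ of $\Sigma_{\max}=\mathrm{graph}(\psi)$ extends to a generalized maximal surface $\widetilde{X_{\max}}$ beyond a shrinking singularity $(z_0,\psi(z_0))$, the intersection point of two lightlike line segments. Further, the extended surface is exactly the point symmetry to $(z_0,\psi(z_0))$ of the original surface $\Sigma_{\max}$.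
   Context: Conventions: line segments are open; $\mathbb{D}$ is the open unit disk in $\mathbb{C}$; $\mathbb{E}^3$ is Euclidean 3-space and $\mathbb{L}^3$ is $\mathbb{R}^3$ with the Lorentzian inner product of signature $(+,+,-)$; both are identified with $\mathbb{C}\times\mathbb{R}$, and "vertical" means in the direction of the last coordinate. Minimal surface equation: $\mathrm{div}\big(\nabla\varphi/\sqrt{1+|\nabla\varphi|^2}\big)=0$. Maximal surface equation: $\mathrm{div}\big(\nabla\psi/\sqrt{1-|\nabla\psi|^2}\big)=0$ with $|\nabla\psi|<1$. Dual: for a solution $\varphi$ of the minimal surface equation over a simply connected domain, its dual $\psi$ (unique up to an additive constant, and a solution of the maximal surface equation) is defined by $d\psi=-\frac{\varphi_y}{\sqrt{1+|\nabla\varphi|^2}}dx+\frac{\varphi_x}{\sqrt{1+|\nabla\varphi|^2}}dy$. Since $|\nabla\psi|<1$, $\psi$ extends continuously to $I_1\cup\{z_0\}\cup I_2$, which defines $\psi(z_0)$; the two lightlike line segments in (b) are those which the graph of $\psi$ has over $I_1$ and $I_2$. Corresponding harmonic mapping: the orientation-preserving univalent complex-valued harmonic mapping $f$ from $\mathbb{D}$ onto $\Omega$ such that $(f,\varphi\circ f)$ is an isothermal parametrization of $\mathrm{graph}(\varphi)\subset\mathbb{E}^3$; it exists, is unique up to precomposition with a Möbius transformation of $\mathbb{D}$, and $(f,\psi\circ f)$ is then an isothermal parametrization of $\mathrm{graph}(\psi)\subset\mathbb{L}^3$. "$\varphi$ tends to plus (minus) infinity on $I$" means $\varphi(z)\to+\infty$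 ($-\infty$) as $z\in\Omega$ tends to any point of $I$; the sign may be different on $I_1$ and $I_2$. Generalized surfaces: a non-constant harmonic map $X$ from a Riemann surface to $\mathbb{E}^3$ (resp. $\mathbb{L}^3$) is a generalized minimal (resp. maximal) surface if near every point there is a complex coordinate $w=u+iv$ such that $(\Phi_1,\Phi_2,\Phi_3)=\partial X/\partial w$ satisfies $\Phi_1^2+\Phi_2^2+\Phi_3^2=0$ (resp. $\Phi_1^2+\Phi_2^2-\Phi_3^2=0$ and $|\Phi_1|^2+|\Phi_2|^2-|\Phi_3|^2\not\equiv0$). For a generalized maximal surface let $\mathcal{A}$ be the set of points where $X_u$ or $X_v$ is lightlike. A point $p\in\mathcal{A}$ is a shrinking singular point if there are a neighborhood $U$ of $p$ and a regular curve $\gamma\colon J\to U$ from an interval $J$ such that $\gamma(J)\subset\mathcal{A}$ and $X\circ\gamma(J)$ is a single point of $\mathbb{L}^3$; this image point is called a shrinking singularity. *)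

theory Defs
  imports "HOL-Analysis.Analysis"
begin

text \<open>
  Both Euclidean and Lorentzian 3-space are modelled on \<^typ>\<open>complex \<times> real\<close>, whose library norm
  and inner product are the Euclidean ones.  Points of the plane are complex numbers.
\<close>

definition dx :: "(complex \<Rightarrow> 'a::real_normed_vector) \<Rightarrow> complex \<Rightarrow> 'a" where
  "dx F z = frechet_derivative F (at z) 1"

definition dy :: "(complex \<Rightarrow> 'a::real_normed_vector) \<Rightarrow> complex \<Rightarrow> 'a" where
  "dy F z = frechet_derivative F (at z) \<i>"

definition C1_on :: "(complex \<Rightarrow> 'a::real_normed_vector) \<Rightarrow> complex set \<Rightarrow> bool" where
  "C1_on F S \<longleftrightarrow>
     (\<forall>z\<in>S. F differentiable (at z)) \<and> continuous_on S (dx F) \<and> continuous_on S (dy F)"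

definition C2_on :: "(complex \<Rightarrow> 'a::real_normed_vector) \<Rightarrow> complex set \<Rightarrow> bool" where
  "C2_on F S \<longleftrightarrow> C1_on F S \<and> C1_on (dx F) S \<and> C1_on (dy F) S"

definition harmonic_on :: "(complex \<Rightarrow> 'a::real_normed_vector) \<Rightarrow> complex set \<Rightarrow> bool" where
  "harmonic_on F S \<longleftrightarrow> C2_on F S \<and> (\<forall>z\<in>S. dx (dx F) z + dy (dy F) z = 0)"

definition grad_sq :: "(complex \<Rightarrow> real) \<Rightarrow> complex \<Rightarrow> real" where
  "grad_sq \<phi> z = (dx \<phi> z)\<^sup>2 + (dy \<phi> z)\<^sup>2"

definition minimal_solution :: "(complex \<Rightarrow> real) \<Rightarrow> complex set \<Rightarrow> bool" where
  "minimal_solution \<phi> \<Omega> \<longleftrightarrow> C2_on \<phi> \<Omega> \<and>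
     (\<forall>z\<in>\<Omega>. dx (\<lambda>w. dx \<phi> w / sqrt (1 + grad_sq \<phi> w)) z
           + dy (\<lambda>w. dy \<phi> w / sqrt (1 + grad_sq \<phi> w)) z = 0)"

definition maximal_solution :: "(complex \<Rightarrow> real) \<Rightarrow> complex set \<Rightarrow> bool" where
  "maximal_solution \<psi> \<Omega> \<longleftrightarrow> C2_on \<psi> \<Omega> \<and>
     (\<forall>z\<in>\<Omega>. grad_sq \<psi> z < 1) \<and>
     (\<forall>z\<in>\<Omega>. dx (\<lambda>w. dx \<psi> w / sqrt (1 - grad_sq \<psi> w)) z
           + dy (\<lambda>w. dy \<psi> w / sqrt (1 - grad_sq \<psi> w)) z = 0)"

definition is_dual :: "(complex \<Rightarrow> real) \<Rightarrow> (complex \<Rightarrow> real) \<Rightarrow> complex set \<Rightarrow> bool" where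
  "is_dual \<psi> \<phi> \<Omega> \<longleftrightarrow>
     (\<forall>z\<in>\<Omega>. (\<psi> has_derivative
        (\<lambda>h. - (dy \<phi> z / sqrt (1 + grad_sq \<phi> z)) * Re h
             + (dx \<phi> z / sqrt (1 + grad_sq \<phi> z)) * Im h)) (at z))"

text \<open>
  Positivity of the Jacobian; for univalent harmonic mappings the Jacobian has no zeros (Lewy).
\<close>

definition orientation_preserving_on :: "(complex \<Rightarrow> complex) \<Rightarrow> complex set \<Rightarrow> bool" where
  "orientation_preserving_on f S \<longleftrightarrow>
     (\<forall>w\<in>S. Re (dx f w) * Im (dy f w) - Im (dx f w) * Re (dy f w) > 0)"

definition isothermal_on :: "(complex \<Rightarrow> complex \<times> real) \<Rightarrow> complex set \<Rightarrow> bool" where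
  "isothermal_on X S \<longleftrightarrow> C1_on X S \<and>
     (\<forall>w\<in>S. dx X w \<noteq> 0 \<and> norm (dx X w) = norm (dy X w) \<and> dx X w \<bullet> dy X w = 0)"

definition corresponding_harmonic_mapping ::
  "(complex \<Rightarrow> complex) \<Rightarrow> (complex \<Rightarrow> real) \<Rightarrow> complex set \<Rightarrow> bool" where
  "corresponding_harmonic_mapping f \<phi> \<Omega> \<longleftrightarrow>
     harmonic_on f (ball 0 1) \<and> bij_betw f (ball 0 1) \<Omega> \<and>
     orientation_preserving_on f (ball 0 1) \<and>
     isothermal_on (\<lambda>w. (f w, \<phi> (f w))) (ball 0 1)"

definition simply_connected_jordan_domain :: "complex set \<Rightarrow> bool" where
  "simply_connected_jordan_domain \<Omega> \<longleftrightarrow>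
     open \<Omega> \<and> connected \<Omega> \<and> simply_connected \<Omega> \<and>
     (\<exists>c. simple_path c \<and> pathfinish c = pathstart c \<and> frontier \<Omega> = path_image c)"

text \<open>
  Near the vertex \<open>z0\<close> the domain is the open sector of opening \<open>\<alpha>\<close> bounded by the rays through
  \<open>z1\<close> and \<open>z2\<close>; the disjunction allows both orders of the two sides.  If the sides are
  distinct segments in a Jordan curve there is exactly one such \<open>\<alpha>\<close>, and it satisfies
  \<open>0 < \<alpha> < 2 * pi\<close>.
\<close>

definition interior_angle :: "complex set \<Rightarrow> complex \<Rightarrow> complex \<Rightarrow> complex \<Rightarrow> real \<Rightarrow> bool" where
  "interior_angle \<Omega> z0 z1 z2 \<alpha> \<longleftrightarrow> 0 < \<alpha> \<and> \<alpha> < 2 * pi \<and>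
     (\<exists>\<theta> r. 0 < r \<and>
        \<Omega> \<inter> ball z0 r = {z0 + rcis s t | s t. 0 < s \<and> s < r \<and> \<theta> < t \<and> t < \<theta> + \<alpha>} \<and>
        (z1 - z0 = rcis (dist z0 z1) \<theta> \<and> z2 - z0 = rcis (dist z0 z2) (\<theta> + \<alpha>) \<or>
         z2 - z0 = rcis (dist z0 z2) \<theta> \<and> z1 - z0 = rcis (dist z0 z1) (\<theta> + \<alpha>)))"

definition boundary_extension :: "complex set \<Rightarrow> (complex \<Rightarrow> real) \<Rightarrow> complex \<Rightarrow> real" where
  "boundary_extension \<Omega> \<psi> z = (if z \<in> \<Omega> then \<psi> z else Lim (at z within \<Omega>) \<psi>)"

definition graph_over :: "(complex \<Rightarrow> real) \<Rightarrow> complex set \<Rightarrow> (complex \<times> real) set" where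
  "graph_over g S = (\<lambda>z. (z, g z)) ` S"

definition lorentz :: "complex \<times> real \<Rightarrow> complex \<times> real \<Rightarrow> real" where
  "lorentz v w = fst v \<bullet> fst w - snd v * snd w"

definition lightlike :: "complex \<times> real \<Rightarrow> bool" where
  "lightlike v \<longleftrightarrow> v \<noteq> 0 \<and> lorentz v v = 0"

definition vertical_rotation :: "complex \<Rightarrow> complex \<times> real \<Rightarrow> complex \<times> real" where
  "vertical_rotation z0 P = (2 * z0 - fst P, snd P)"

definition point_symmetry :: "complex \<times> real \<Rightarrow> complex \<times> real \<Rightarrow> complex \<times> real" where
  "point_symmetry Q P = 2 *\<^sub>R Q - P"

text \<open>
  The Riemann surfaces needed are domains \<open>M\<close> of the complex plane.  A complex coordinate near
  \<open>p\<close> is an injective holomorphic function \<open>h\<close> on a neighbourhood \<open>V\<close> of \<open>p\<close> in \<open>M\<close>, and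
  \<open>in_coord X V h\<close> is the map \<open>X\<close> expressed in the coordinate \<open>h\<close>, a function on \<open>h ` V\<close>.
\<close>

definition coordinate_near ::
  "complex set \<Rightarrow> complex \<Rightarrow> complex set \<Rightarrow> (complex \<Rightarrow> complex) \<Rightarrow> bool" where
  "coordinate_near M p V h \<longleftrightarrow>
     open V \<and> p \<in> V \<and> V \<subseteq> M \<and> h holomorphic_on V \<and> inj_on h V"

definition in_coord ::
  "(complex \<Rightarrow> 'a) \<Rightarrow> complex set \<Rightarrow> (complex \<Rightarrow> complex) \<Rightarrow> complex \<Rightarrow> 'a" where
  "in_coord X V h w = X (the_inv_into V h w)"

definition wirtinger :: "(complex \<Rightarrow> real) \<Rightarrow> complex \<Rightarrow> complex" where
  "wirtinger F w = (of_real (dx F w) - \<i> * of_real (dy F w)) / 2"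

definition Phi1 :: "(complex \<Rightarrow> complex \<times> real) \<Rightarrow> complex \<Rightarrow> complex" where
  "Phi1 Y = wirtinger (\<lambda>w. Re (fst (Y w)))"

definition Phi2 :: "(complex \<Rightarrow> complex \<times> real) \<Rightarrow> complex \<Rightarrow> complex" where
  "Phi2 Y = wirtinger (\<lambda>w. Im (fst (Y w)))"

definition Phi3 :: "(complex \<Rightarrow> complex \<times> real) \<Rightarrow> complex \<Rightarrow> complex" where
  "Phi3 Y = wirtinger (\<lambda>w. snd (Y w))"

definition nonconstant_harmonic_map ::
  "(complex \<Rightarrow> complex \<times> real) \<Rightarrow> complex set \<Rightarrow> bool" where
  "nonconstant_harmonic_map X M \<longleftrightarrow>
     open M \<and> connected M \<and> harmonic_on X M \<and> \<not> X constant_on M"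

definition generalized_minimal_surface ::
  "(complex \<Rightarrow> complex \<times> real) \<Rightarrow> complex set \<Rightarrow> bool" where
  "generalized_minimal_surface X M \<longleftrightarrow> nonconstant_harmonic_map X M \<and>
     (\<forall>p\<in>M. \<exists>V h. coordinate_near M p V h \<and>
        (let Y = in_coord X V h in
          \<forall>w \<in> h ` V. (Phi1 Y w)\<^sup>2 + (Phi2 Y w)\<^sup>2 + (Phi3 Y w)\<^sup>2 = 0))"

definition generalized_maximal_surface ::
  "(complex \<Rightarrow> complex \<times> real) \<Rightarrow> complex set \<Rightarrow> bool" where
  "generalized_maximal_surface X M \<longleftrightarrow> nonconstant_harmonic_map X M \<and>
     (\<forall>p\<in>M. \<exists>V h. coordinate_near M p V h \<and>
        (let Y = in_coord X V h in
          (\<forall>w \<in> h ` V. (Phi1 Y w)\<^sup>2 + (Phi2 Y w)\<^sup>2 - (Phi3 Y w)\<^sup>2 = 0) \<and>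
          (\<exists>w \<in> h ` V. (cmod (Phi1 Y w))\<^sup>2 + (cmod (Phi2 Y w))\<^sup>2 - (cmod (Phi3 Y w))\<^sup>2 \<noteq> 0)))"

definition lightlike_points :: "(complex \<Rightarrow> complex \<times> real) \<Rightarrow> complex set \<Rightarrow> complex set" where
  "lightlike_points X M = {p \<in> M. \<exists>V h. coordinate_near M p V h \<and>
     (let Y = in_coord X V h in lightlike (dx Y (h p)) \<or> lightlike (dy Y (h p)))}"

text \<open>The regular curve of the definition is understood to pass through \<open>p\<close>.\<close>

definition shrinking_singular_point ::
  "(complex \<Rightarrow> complex \<times> real) \<Rightarrow> complex set \<Rightarrow> complex \<Rightarrow> bool" where
  "shrinking_singular_point X M p \<longleftrightarrow> p \<in> lightlike_points X M \<and>
     (\<exists>U \<gamma> a b Q. open U \<and> p \<in> U \<and> U \<subseteq> M \<and> a < b \<and>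
        \<gamma> C1_differentiable_on {a<..<b} \<and>
        (\<forall>t\<in>{a<..<b}. vector_derivative \<gamma> (at t) \<noteq> 0) \<and>
        p \<in> \<gamma> ` {a<..<b} \<and> \<gamma> ` {a<..<b} \<subseteq> U \<and>
        \<gamma> ` {a<..<b} \<subseteq> lightlike_points X M \<and>
        X ` \<gamma> ` {a<..<b} = {Q})"

text \<open>
  To let the unit disk continue across a boundary arc inside the plane, with all of its mirror
  image, it is parametrized by the upper half-plane: the arc becomes a real interval and the
  reflection in the unit circle becomes complex conjugation.  (Doubling the disk itself across
  the arc would need the point at infinity as the mirror image of \<open>0\<close>.)
\<close>

definition upper_half_plane :: "complex set" where
  "upper_half_plane = {w. Im w > 0}"

definition lower_half_plane :: "complex set" where
  "lower_half_plane = {w. Im w < 0}"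

definition real_interval :: "real \<Rightarrow> real \<Rightarrow> complex set" where
  "real_interval a b = complex_of_real ` {a<..<b}"

definition doubled_domain :: "real \<Rightarrow> real \<Rightarrow> complex set" where
  "doubled_domain a b = upper_half_plane \<union> real_interval a b \<union> lower_half_plane"

text \<open>
  \<open>Xt\<close>, defined on the doubled domain, extends \<open>X\<close> (defined on the unit disk and reparametrized by
  a conformal map \<open>\<tau>\<close> of the half-plane onto the disk) across the interval, and the
  added part is the image of \<open>X\<close> under the ambient symmetry \<open>R\<close>.
\<close>

definition extends_by_symmetry ::
  "(complex \<Rightarrow> complex \<times> real) \<Rightarrow> (complex \<Rightarrow> complex \<times> real) \<Rightarrow>
   (complex \<times> real \<Rightarrow> complex \<times> real) \<Rightarrow> real \<Rightarrow> real \<Rightarrow> bool" where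
  "extends_by_symmetry Xt X R a b \<longleftrightarrow> a < b \<and>
     (\<exists>\<tau>. \<tau> holomorphic_on upper_half_plane \<and> bij_betw \<tau> upper_half_plane (ball 0 1) \<and>
        (\<forall>w\<in>upper_half_plane. Xt w = X (\<tau> w))) \<and>
     (\<forall>w\<in>upper_half_plane. Xt (cnj w) = R (Xt w)) \<and>
     Xt ` lower_half_plane = R ` X ` ball 0 1"

end

theory Submission
  imports Defs "HOL-Complex_Analysis.Complex_Analysis"
begin

text \<open>
  Write \<open>f = H1 + cnj H2\<close> and \<open>h = \<phi> \<circ> f + \<i> * (\<psi> \<circ> f)\<close>.  Conformality says \<open>h'\<^sup>2 = - 4 * H1' * H2'\<close>, and
  \<open>\<omega> = H2' / H1'\<close> has modulus less than \<open>1\<close>.  On convex sets of the coordinate \<open>\<xi> = 2 * H1\<close> both \<open>f\<close> and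
  \<open>h\<close> are 1-Lipschitz, so a branch of this coordinate continues along a segment until \<open>f\<close> reaches a
  boundary point near which \<open>\<phi>\<close> stays bounded; inside the sector this can only be the vertex \<open>z0\<close>.
  Near a side with infinite data Harnack's inequality forces \<open>\<omega>\<close> towards \<open>1\<close>: there \<open>f\<close> is almost the
  projection of \<open>\<xi>\<close> to the side, and the continuation towards the vertex does stop.  Two stopping points
  bound a chord of points that are not reached, so a whole strip of parallel rays stops over \<open>z0\<close>.
  On such a strip \<open>K = H1 + H2\<close> is injective, its image has a straight boundary segment over which
  \<open>f\<close> tends to \<open>z0\<close>, and by reflection that segment corresponds to an arc of the unit circle.
  On this arc \<open>f = z0\<close> and \<open>\<psi> \<circ> f\<close> is constant.  The coordinates of \<open>f\<close> and \<open>\<psi> \<circ> f\<close> are, up to constants,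
  imaginary parts of holomorphic functions that are real on the arc, hence odd under reflection, whereas
  \<open>\<phi> \<circ> f\<close> is a real part and hence even: this is the rotation in (a) and the point symmetry in (b).
\<close>

section \<open>Harnack bounds and extension by limits\<close>

lemma Re_pos_ball_bounds:
  fixes E :: "complex \<Rightarrow> complex"
  assumes hol: "E holomorphic_on ball a R" and R: "0 < R"
    and pos: "\<And>x. x \<in> ball a R \<Longrightarrow> 0 < Re (E x)"
  shows "norm (deriv E a) \<le> 2 * Re (E a) / R"
    and "x \<in> ball a R \<Longrightarrow> norm (E x) \<le> norm (E a) * (R + dist a x) / (R - dist a x)"
proof -
  define T where "T z = (E (a + of_real R * z) - E a) / (E (a + of_real R * z) + cnj (E a))" for z
  have inb: "a + of_real R * z \<in> ball a R" if "norm z < 1" for z :: complex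
    using that R by (simp add: dist_norm norm_mult)
  have Ea: "0 < Re (E a)" using pos[of a] R by simp
  have nz: "u + cnj (E a) \<noteq> 0" if "0 < Re u" for u
  proof
    assume "u + cnj (E a) = 0"
    then have "Re u + Re (E a) = 0" by (metis complex_cnj plus_complex.simps(1) complex.sel(1) zero_complex.sel(1) cnj.simps(1))
    with that Ea show False by simp
  qed
  have Tlt: "norm ((u - E a) / (u + cnj (E a))) < 1" if "0 < Re u" for u
  proof -
    have "(Re u - Re (E a))^2 < (Re u + Re (E a))^2"
      using that Ea by (simp add: power2_eq_square algebra_simps)
    then have "norm (u - E a) < norm (u + cnj (E a))"
      by (simp add: cmod_def)
    then show ?thesis using nz[OF that] by (simp add: norm_divide divide_less_eq)
  qed
  have hE: "(\<lambda>z. E (a + of_real R * z)) holomorphic_on ball 0 1"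
  proof -
    have "(E \<circ> (\<lambda>z. a + of_real R * z)) holomorphic_on ball 0 1"
      by (rule holomorphic_on_compose_gen[OF _ hol]) (auto intro!: holomorphic_intros inb)
    then show ?thesis by (simp add: o_def)
  qed
  have holT: "T holomorphic_on ball 0 1"
    unfolding T_def using hE
    by (intro holomorphic_intros) (auto intro!: nz pos inb)
  have T0: "T 0 = 0" by (simp add: T_def)
  have Tno: "norm (T z) < 1" if "norm z < 1" for z
    unfolding T_def by (rule Tlt) (intro pos inb that)
  have S1: "norm (T z) \<le> norm z" if "norm z < 1" for z
    by (rule Schwarz_Lemma(1)[OF holT T0 Tno that])
  have S2: "norm (deriv T 0) \<le> 1"
    by (rule Schwarz_Lemma(2)[OF holT T0 Tno, of 0]) auto
  have dE: "(E has_field_derivative deriv E a) (at a)"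
    using hol R by (metis centre_in_ball holomorphic_derivI open_ball)
  have d0: "((\<lambda>z. E (a + of_real R * z)) has_field_derivative deriv E a * of_real R) (at 0)"
  proof -
    have "((\<lambda>z. a + of_real R * z) has_field_derivative of_real R) (at 0)"
      by (auto intro!: derivative_eq_intros)
    then show ?thesis
      using DERIV_chain2[of E "deriv E a" "\<lambda>z. a + of_real R * z" 0] dE by simp
  qed
  have sumEa: "E a + cnj (E a) = of_real (2 * Re (E a))"
    by (simp add: complex_add_cnj)
  have "(T has_field_derivative (deriv E a * of_real R) / of_real (2 * Re (E a))) (at 0)"
    unfolding T_def
    by (rule derivative_eq_intros d0 | (use nz[OF Ea] sumEa Ea in \<open>simp add: field_simps\<close>; fail))+
  then have dT: "deriv T 0 = (deriv E a * of_real R) / of_real (2 * Re (E a))"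
    by (rule DERIV_imp_deriv)
  show "norm (deriv E a) \<le> 2 * Re (E a) / R"
    using S2 R Ea unfolding dT by (simp add: norm_mult norm_divide divide_le_eq field_simps)
  show "norm (E x) \<le> norm (E a) * (R + dist a x) / (R - dist a x)" if x: "x \<in> ball a R"
  proof -
    define z where "z = (x - a) / of_real R"
    have xz: "x = a + of_real R * z" using R by (simp add: z_def)
    have nz1: "norm z < 1" using x R by (simp add: z_def norm_divide dist_norm norm_minus_commute)
    have Ep: "0 < Re (E x)" by (rule pos[OF x])
    have "T z * (E x + cnj (E a)) = E x - E a"
      using nz[OF Ep] by (simp add: T_def xz)
    then have eq: "E x * (1 - T z) = E a + cnj (E a) * T z" by (simp add: algebra_simps)
    have "norm (E x) * (1 - norm (T z)) \<le> norm (E x) * norm (1 - T z)"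
      by (intro mult_left_mono) (metis norm_one norm_triangle_ineq2, simp)
    also have "\<dots> = norm (E a + cnj (E a) * T z)" by (metis eq norm_mult)
    also have "\<dots> \<le> norm (E a) * (1 + norm (T z))"
      by (rule order_trans[OF norm_triangle_ineq]) (simp add: norm_mult algebra_simps)
    finally have A: "norm (E x) * (1 - norm (T z)) \<le> norm (E a) * (1 + norm (T z))" .
    have Tz1: "norm (T z) \<le> norm z" by (rule S1[OF nz1])
    have "norm (E x) * (1 - norm z) \<le> norm (E x) * (1 - norm (T z))"
      by (intro mult_left_mono) (use Tz1 in auto)
    also note A
    also have "norm (E a) * (1 + norm (T z)) \<le> norm (E a) * (1 + norm z)"
      by (intro mult_left_mono) (use Tz1 in auto)
    finally have B: "norm (E x) * (1 - norm z) \<le> norm (E a) * (1 + norm z)" .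
    have d: "dist a x = R * norm z" using R by (simp add: z_def norm_divide dist_norm norm_minus_commute)
    have "norm (E x) * (R - R * norm z) = R * (norm (E x) * (1 - norm z))" by (simp add: algebra_simps)
    also have "\<dots> \<le> R * (norm (E a) * (1 + norm z))" using B R by simp
    also have "\<dots> = norm (E a) * (R + R * norm z)" by (simp add: algebra_simps)
    finally have "norm (E x) * (R - dist a x) \<le> norm (E a) * (R + dist a x)" by (simp add: d)
    moreover have "0 < R - dist a x" using x by simp
    ultimately show ?thesis by (simp add: le_divide_eq)
  qed
qed

lemma continuous_extension_by_limits:
  fixes f :: "'a::metric_space \<Rightarrow> 'b::metric_space"
  assumes A: "open A" "continuous_on A f"
    and B: "\<And>q. q \<in> B \<Longrightarrow> q \<in> closure A"
    and lim: "\<And>q. q \<in> B \<Longrightarrow> q \<notin> A \<Longrightarrow> (f \<longlongrightarrow> l q) (at q within A)"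
  shows "continuous_on (A \<union> B) (\<lambda>z. if z \<in> A then f z else l z)" (is "continuous_on _ ?g")
proof -
  have key: "\<exists>d>0. \<forall>a\<in>A. dist a q < d \<longrightarrow> dist (f a) (?g q) < e"
    if q: "q \<in> A \<union> B" and e: "e > 0" for q e
  proof (cases "q \<in> A")
    case True
    then show ?thesis using A(2) e unfolding continuous_on_iff by auto
  next
    case False
    then have "(f \<longlongrightarrow> l q) (at q within A)" using lim q by auto
    then have "eventually (\<lambda>x. dist (f x) (l q) < e) (at q within A)" using e by (rule tendstoD)
    then obtain d where "d > 0" "\<forall>x\<in>A. x \<noteq> q \<and> dist x q < d \<longrightarrow> dist (f x) (l q) < e"
      unfolding eventually_at by blast
    then show ?thesis using False by (intro exI[of _ d]) auto
  qed
  show ?thesis unfolding continuous_on_iff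
  proof (intro ballI allI impI)
    fix q and e :: real assume q: "q \<in> A \<union> B" and e: "0 < e"
    obtain d where d: "d > 0" "\<forall>a\<in>A. dist a q < d \<longrightarrow> dist (f a) (?g q) < e/2"
      using key[OF q, of "e/2"] e by auto
    show "\<exists>d>0. \<forall>x'\<in>A \<union> B. dist x' q < d \<longrightarrow> dist (?g x') (?g q) < e"
    proof (intro exI[of _ d] conjI d(1) ballI impI)
      fix x assume x: "x \<in> A \<union> B" and xd: "dist x q < d"
      obtain d' where d': "d' > 0" "\<forall>a\<in>A. dist a x < d' \<longrightarrow> dist (f a) (?g x) < e/2"
        using key[OF x, of "e/2"] e by auto
      have "x \<in> closure A" using x B closure_subset by auto
      moreover have "0 < min d' (d - dist x q)" using d' xd by auto
      ultimately obtain a where a: "a \<in> A" "dist a x < min d' (d - dist x q)"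
        unfolding closure_approachable by blast
      have "dist a q \<le> dist a x + dist x q" by (rule dist_triangle)
      then have "dist a q < d" using a by auto
      then have "dist (f a) (?g q) < e/2" "dist (f a) (?g x) < e/2" using d d' a by auto
      then show "dist (?g x) (?g q) < e"
        using dist_triangle_half_r by blast
    qed
  qed
qed

section \<open>Mixed derivatives and a barrier\<close>

lemma norm_diff_le_vector_derivative:
  fixes g :: "real \<Rightarrow> 'a::real_normed_vector"
  assumes "0 \<le> s" "\<And>x. \<lbrakk>0 \<le> x; x \<le> s\<rbrakk> \<Longrightarrow> (g has_vector_derivative g' x) (at x)"
    and "\<And>x. \<lbrakk>0 \<le> x; x \<le> s\<rbrakk> \<Longrightarrow> norm (g' x) \<le> B"
  shows "norm (g s - g 0) \<le> B * s"
proof -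
  have "norm (g s - g 0) \<le> B * norm (s - 0)"
  proof (rule differentiable_bound[of "{0..s}" g "\<lambda>x h. h *\<^sub>R g' x"])
    show "(g has_derivative (\<lambda>h. h *\<^sub>R g' x)) (at x within {0..s})" if "x \<in> {0..s}" for x
      using assms(2)[of x] that has_derivative_at_withinI
      by (auto simp: has_vector_derivative_def)
    show "onorm (\<lambda>h. h *\<^sub>R g' x) \<le> B" if "x \<in> {0..s}" for x
      by (rule onorm_le) (use assms(3)[of x] that in \<open>auto simp: mult.commute[of B] intro!: mult_left_mono\<close>)
  qed (use assms(1) in auto)
  then show ?thesis using assms(1) by simp
qed

lemma has_derivative_dx_dy:
  fixes F :: "complex \<Rightarrow> 'a::real_normed_vector"
  assumes "F differentiable (at z)"
  shows "(F has_derivative (\<lambda>h. Re h *\<^sub>R dx F z + Im h *\<^sub>R dy F z)) (at z)"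
proof -
  have D: "(F has_derivative frechet_derivative F (at z)) (at z)"
    using assms frechet_derivative_works by blast
  then interpret bounded_linear "frechet_derivative F (at z)" by (rule has_derivative_bounded_linear)
  have "frechet_derivative F (at z) h = Re h *\<^sub>R dx F z + Im h *\<^sub>R dy F z" for h
  proof -
    have "h = Re h *\<^sub>R 1 + Im h *\<^sub>R \<i>" by (simp add: complex_eq_iff)
    then have "frechet_derivative F (at z) h = frechet_derivative F (at z) (Re h *\<^sub>R 1 + Im h *\<^sub>R \<i>)" by simp
    then show ?thesis by (simp add: add scaleR dx_def dy_def)
  qed
  then have "frechet_derivative F (at z) = (\<lambda>h. Re h *\<^sub>R dx F z + Im h *\<^sub>R dy F z)" by blast
  with D show ?thesis by simp
qed

lemma dx_dy_eqI:
  assumes "(F has_derivative F') (at z)"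
  shows "dx F z = F' 1" "dy F z = F' \<i>"
  using frechet_derivative_at[OF assms] by (simp_all add: dx_def dy_def)

lemma partial_vector_derivatives:
  fixes F :: "complex \<Rightarrow> 'a::real_normed_vector"
  assumes "F differentiable (at (a + of_real x * e))" and "e = 1 \<or> e = \<i>"
  shows "((\<lambda>x. F (a + of_real x * e)) has_vector_derivative (if e = 1 then dx F (a + of_real x * e) else dy F (a + of_real x * e))) (at x)"
proof -
  have D: "((\<lambda>x. a + of_real x * e) has_derivative (\<lambda>h. of_real h * e)) (at x)"
    by (auto intro!: derivative_eq_intros)
  have "((F \<circ> (\<lambda>x. a + of_real x * e)) has_derivative
      ((\<lambda>h. Re h *\<^sub>R dx F (a + of_real x * e) + Im h *\<^sub>R dy F (a + of_real x * e)) \<circ> (\<lambda>h. of_real h * e))) (at x)"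
    by (rule diff_chain_at[OF D]) (rule has_derivative_dx_dy[OF assms(1)])
  then show ?thesis using assms(2)
    by (auto simp: has_vector_derivative_def o_def)
qed

text \<open>Second differences: both mixed derivatives are the limit of the same double difference quotient.\<close>

lemma mixed_difference_bound:
  fixes F :: "complex \<Rightarrow> 'a::real_normed_vector"
  assumes d: "(d = 1 \<and> e = \<i>) \<or> (d = \<i> \<and> e = 1)" and s: "0 \<le> s"
    and p: "p = (if d = 1 then dx F else dy F)" and q: "q = (if e = 1 then dx p else dy p)"
    and F: "\<And>x y. \<lbrakk>0 \<le> x; x \<le> s; 0 \<le> y; y \<le> s\<rbrakk> \<Longrightarrow> F differentiable (at (a + of_real x * d + of_real y * e))"
    and dp: "\<And>x y. \<lbrakk>0 \<le> x; x \<le> s; 0 \<le> y; y \<le> s\<rbrakk> \<Longrightarrow> p differentiable (at (a + of_real x * d + of_real y * e))"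
    and B: "\<And>x y. \<lbrakk>0 \<le> x; x \<le> s; 0 \<le> y; y \<le> s\<rbrakk> \<Longrightarrow> norm (q (a + of_real x * d + of_real y * e) - q a) \<le> B"
  shows "norm (F (a + of_real s * d + of_real s * e) - F (a + of_real s * e) - (F (a + of_real s * d) - F a)
           - (s * s) *\<^sub>R q a) \<le> B * s * s"
proof -
  have e: "d = 1 \<or> d = \<i>" "e = 1 \<or> e = \<i>" using d by auto
  define u where "u x = F ((a + of_real s * e) + of_real x * d) - F (a + of_real x * d) - (x * s) *\<^sub>R q a" for x :: real
  have FD: "((\<lambda>x. F (b + of_real x * d)) has_vector_derivative p (b + of_real x * d)) (at x)"
    if "F differentiable (at (b + of_real x * d))" for b x
    using partial_vector_derivatives[OF that e(1)] e(1) p by auto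
  have PD: "((\<lambda>y. p (b + of_real y * e)) has_vector_derivative q (b + of_real y * e)) (at y)"
    if "p differentiable (at (b + of_real y * e))" for b y
    using partial_vector_derivatives[OF that e(2)] e(2) q by auto
  have inner: "norm (p ((a + of_real s * e) + of_real x * d) - p (a + of_real x * d) - s *\<^sub>R q a) \<le> B * s"
    if x: "0 \<le> x" "x \<le> s" for x
  proof -
    have "norm ((p ((a + of_real x * d) + of_real s * e) - s *\<^sub>R q a) - (p ((a + of_real x * d) + of_real 0 * e) - 0 *\<^sub>R q a)) \<le> B * s"
      by (rule norm_diff_le_vector_derivative[where g' = "\<lambda>y. q (a + of_real x * d + of_real y * e) - q a"])
        (use s x dp B in \<open>auto intro!: PD derivative_eq_intros\<close>)
    then show ?thesis by (simp add: algebra_simps)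
  qed
  have "norm (u s - u 0) \<le> (B * s) * s"
  proof (rule norm_diff_le_vector_derivative[where g' = "\<lambda>x. p ((a + of_real s * e) + of_real x * d) - p (a + of_real x * d) - s *\<^sub>R q a"])
    show "(u has_vector_derivative p ((a + of_real s * e) + of_real x * d) - p (a + of_real x * d) - s *\<^sub>R q a) (at x)"
      if x: "0 \<le> x" "x \<le> s" for x
    proof -
      have "F differentiable (at ((a + of_real s * e) + of_real x * d))" "F differentiable (at (a + of_real x * d))"
        using F[of x s] F[of x 0] x s by (simp_all add: algebra_simps)
      then show ?thesis
        unfolding u_def by (auto intro!: derivative_eq_intros FD)
    qed
  qed (use s inner in auto)
  then show ?thesis by (simp add: u_def algebra_simps)
qed

lemma C2_mixed_partials:
  fixes F :: "complex \<Rightarrow> 'a::real_normed_vector"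
  assumes C2: "C2_on F S" and S: "open S" and a: "a \<in> S"
  shows "dy (dx F) a = dx (dy F) a"
proof (rule ccontr)
  assume ne: "dy (dx F) a \<noteq> dx (dy F) a"
  define e where "e = norm (dy (dx F) a - dx (dy F) a) / 4"
  have e: "e > 0" using ne by (simp add: e_def)
  have cont: "continuous_on S (dy (dx F))" "continuous_on S (dx (dy F))"
    using C2 by (auto simp: C2_on_def C1_on_def)
  obtain d1 where d1: "d1 > 0" "\<forall>z\<in>S. dist z a < d1 \<longrightarrow> dist (dy (dx F) z) (dy (dx F) a) < e"
    using cont(1) a e unfolding continuous_on_iff by blast
  obtain d2 where d2: "d2 > 0" "\<forall>z\<in>S. dist z a < d2 \<longrightarrow> dist (dx (dy F) z) (dx (dy F) a) < e"
    using cont(2) a e unfolding continuous_on_iff by blast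
  obtain r where r: "r > 0" "ball a r \<subseteq> S" using S a openE by blast
  define s where "s = min r (min d1 d2) / 3"
  have s: "s > 0" using r d1 d2 by (simp add: s_def)
  have near: "dist (a + of_real x * d + of_real y * c) a < min r (min d1 d2)"
    if "0 \<le> x" "x \<le> s" "0 \<le> y" "y \<le> s" "norm d = 1" "norm c = 1" for x y and d c :: complex
  proof -
    have "norm (of_real x * d + of_real y * c) \<le> x + y"
      by (rule order_trans[OF norm_triangle_ineq]) (use that in \<open>simp add: norm_mult\<close>)
    also have "\<dots> \<le> 2 * s" using that by simp
    also have "\<dots> < min r (min d1 d2)"
    proof -
      have "min r (min d1 d2) = 3 * s" by (simp add: s_def)
      then show ?thesis using s by linarith
    qed
    finally show ?thesis by (simp add: dist_norm add.assoc)
  qed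
  have inS: "a + of_real x * d + of_real y * c \<in> S"
    if "0 \<le> x" "x \<le> s" "0 \<le> y" "y \<le> s" "norm d = 1" "norm c = 1" for x y and d c :: complex
    using near[OF that] r by (auto simp: dist_commute subset_iff)
  have diff: "F differentiable (at z)" "dx F differentiable (at z)" "dy F differentiable (at z)" if "z \<in> S" for z
    using C2 that by (auto simp: C2_on_def C1_on_def)
  have b1: "norm (F (a + of_real s * 1 + of_real s * \<i>) - F (a + of_real s * \<i>) - (F (a + of_real s * 1) - F a)
           - (s * s) *\<^sub>R dy (dx F) a) \<le> e * s * s"
  proof (rule mixed_difference_bound[where p = "dx F"])
    fix x y assume xy: "0 \<le> x" "x \<le> s" "0 \<le> y" "y \<le> s"
    show "F differentiable (at (a + of_real x * 1 + of_real y * \<i>))"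
      "dx F differentiable (at (a + of_real x * 1 + of_real y * \<i>))"
      using inS[OF xy, of 1 \<i>] diff by auto
    show "norm (dy (dx F) (a + of_real x * 1 + of_real y * \<i>) - dy (dx F) a) \<le> e"
      using inS[OF xy, of 1 \<i>] d1 near[OF xy, of 1 \<i>] by (auto simp: dist_norm less_imp_le)
  qed (use s in auto)
  have b2: "norm (F (a + of_real s * \<i> + of_real s * 1) - F (a + of_real s * 1) - (F (a + of_real s * \<i>) - F a)
           - (s * s) *\<^sub>R dx (dy F) a) \<le> e * s * s"
  proof (rule mixed_difference_bound[where p = "dy F"])
    fix x y assume xy: "0 \<le> x" "x \<le> s" "0 \<le> y" "y \<le> s"
    show "F differentiable (at (a + of_real x * \<i> + of_real y * 1))"
      "dy F differentiable (at (a + of_real x * \<i> + of_real y * 1))"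
      using inS[OF xy, of \<i> 1] diff by auto
    show "norm (dx (dy F) (a + of_real x * \<i> + of_real y * 1) - dx (dy F) a) \<le> e"
      using inS[OF xy, of \<i> 1] d2 near[OF xy, of \<i> 1] by (auto simp: dist_norm less_imp_le)
  qed (use s in auto)
  define \<Delta> where "\<Delta> = F (a + of_real s * 1 + of_real s * \<i>) - F (a + of_real s * \<i>) - (F (a + of_real s * 1) - F a)"
  have D2: "F (a + of_real s * \<i> + of_real s * 1) - F (a + of_real s * 1) - (F (a + of_real s * \<i>) - F a) = \<Delta>"
    by (simp add: \<Delta>_def algebra_simps)
  have "norm ((s * s) *\<^sub>R (dy (dx F) a - dx (dy F) a)) \<le> e * s * s + e * s * s"
    using norm_triangle_ineq4[of "\<Delta> - (s * s) *\<^sub>R dx (dy F) a" "\<Delta> - (s * s) *\<^sub>R dy (dx F) a"] b1 b2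
    unfolding D2 \<Delta>_def[symmetric] by (simp add: algebra_simps)
  then have "s * s * norm (dy (dx F) a - dx (dy F) a) \<le> e * s * s + e * s * s"
    using s by (simp only: norm_scaleR) simp
  then have "s * s * (4 * e) \<le> s * s * (2 * e)" by (simp add: e_def algebra_simps)
  then show False using s e by simp
qed

lemma vertical_linear_bound:
  fixes F :: "complex \<Rightarrow> complex" and x0 :: real
  assumes r: "r > 0" and hol: "F holomorphic_on (ball (of_real x0) r \<inter> {z. 0 < Im z})"
    and bd: "\<And>z. z \<in> ball (complex_of_real x0) r \<Longrightarrow> 0 < Im z \<Longrightarrow> \<bar>Im (F z)\<bar> \<le> 1"
    and lim: "\<And>x. of_real x \<in> ball (complex_of_real x0) r \<Longrightarrow>
       ((\<lambda>z. Im (F z)) \<longlongrightarrow> 0) (at (of_real x) within (ball (of_real x0) r \<inter> {z. 0 < Im z}))"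
  shows "\<exists>\<rho> C. 0 < \<rho> \<and> \<rho> \<le> r \<and> 0 < C \<and>
    (\<forall>z \<in> ball (complex_of_real x0) \<rho>. 0 < Im z \<longrightarrow> \<bar>Im (F z)\<bar> \<le> C * Im z)"
proof -
  define A where "A = ball (complex_of_real x0) r \<inter> {z. 0 < Im z}"
  define B where "B = ball (complex_of_real x0) r \<inter> {z. Im z = 0}"
  have oA: "open A" unfolding A_def by (intro open_Int open_ball open_halfspace_Im_gt)
  have clB: "q \<in> closure A" if "q \<in> B" for q
    unfolding closure_approachable
  proof (intro allI impI)
    fix e :: real assume e: "0 < e"
    define d where "d = min e (r - dist x0 q) / 2"
    have d: "0 < d" "d < e" "d < r - dist x0 q" using e that by (auto simp: d_def B_def)
    have "dist (complex_of_real x0) (q + \<i> * d) \<le> dist (complex_of_real x0) q + dist q (q + \<i> * d)" by (rule dist_triangle)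
    also have "dist q (q + \<i> * d) = d" using d by (simp add: dist_norm norm_mult)
    finally have "q + \<i> * d \<in> A" using d that by (auto simp: A_def B_def)
    moreover have "dist (q + \<i> * d) q < e" using d by (simp add: dist_norm norm_mult)
    ultimately show "\<exists>y\<in>A. dist y q < e" by blast
  qed
  have contF: "continuous_on A (\<lambda>z. Im (F z))"
    using hol unfolding A_def by (intro continuous_intros holomorphic_on_imp_continuous_on) auto
  define v where "v z = (if z \<in> A then Im (F z) else 0)" for z
  have contv: "continuous_on (A \<union> B) v"
    unfolding v_def
  proof (rule continuous_extension_by_limits[OF oA contF clB])
    fix q assume q: "q \<in> B"
    then have eq: "of_real (Re q) = q" by (simp add: B_def complex_eq_iff)
    show "((\<lambda>z. Im (F z)) \<longlongrightarrow> 0) (at q within A)"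
      using lim[of "Re q"] q unfolding A_def B_def eq by blast
  qed
  define s where "s = r/4"
  define \<kappa> where "\<kappa> = ln 2 / (2::real)"
  have s: "s > 0" using r by (simp add: s_def)
  have \<kappa>: "\<kappa> > 0" by (simp add: \<kappa>_def)
  have main: "\<sigma> * Im (F z) \<le> Im z / (2 * s * \<kappa>)"
    if z: "z \<in> ball (complex_of_real x0) s" "0 < Im z" and \<sigma>: "\<sigma> = 1 \<or> \<sigma> = -1" for z and \<sigma> :: real
  proof -
    define c where "c = complex_of_real (Re z)"
    define R where "R = 2 * s"
    have R: "R > 0" using s by (simp add: R_def)
    define Q where "Q = ball c R \<inter> {z. 0 < Im z}"
    define K where "K = cball c R \<inter> {z. 0 \<le> Im z}"
    have cx: "dist (complex_of_real x0) c < s"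
    proof -
      have "dist (complex_of_real x0) c = \<bar>Re (x0 - z)\<bar>" by (simp add: c_def dist_norm flip: of_real_diff)
      also have "\<dots> \<le> norm (x0 - z)" by (rule abs_Re_le_cmod)
      finally show ?thesis using z by (simp add: dist_norm)
    qed
    have KAB: "K \<subseteq> A \<union> B"
    proof
      fix y assume y: "y \<in> K"
      have "dist (complex_of_real x0) y \<le> dist (complex_of_real x0) c + dist c y" by (rule dist_triangle)
      also have "\<dots> < r"
      proof -
        have "dist c y \<le> r / 2" using y by (simp add: K_def R_def s_def)
        then show ?thesis using cx r unfolding s_def by linarith
      qed
      finally show "y \<in> A \<union> B" using y by (auto simp: A_def B_def K_def)
    qed
    have cK: "compact K" unfolding K_def
      by (intro compact_Int_closed compact_cball closed_halfspace_Im_ge)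
    have arg: "1 - \<i> * (y - c) / R \<notin> \<real>\<^sub>\<le>\<^sub>0" if "0 \<le> Im y" for y
    proof -
      have "Im c = 0" by (simp add: c_def)
      then have "Re (1 - \<i> * (y - c) / R) = 1 + Im y / R" using R by simp
      moreover have "0 \<le> Im y / R" using that R by simp
      ultimately have "Re (1 - \<i> * (y - c) / R) > 0" by linarith
      then show ?thesis using complex_nonpos_Reals_iff by force
    qed
    define b where "b y = ln (norm (1 - \<i> * (y - c) / R))" for y
    have nb: "(norm (1 - \<i> * (y - c) / R))\<^sup>2 = 1 + 2 * Im y / R + (norm (y - c) / R)\<^sup>2" for y
    proof -
      have "norm (1 - \<i> * (y - c) / R)^2 = (1 + Im y / R)^2 + ((Re y - Re c) / R)^2"
        using R by (simp add: cmod_power2 c_def)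
      moreover have "(norm (y - c) / R)^2 = ((Re y - Re c) / R)^2 + (Im y / R)^2"
        by (simp add: power_divide cmod_power2 c_def add_divide_distrib)
      ultimately show ?thesis by (simp add: power2_eq_square algebra_simps)
    qed
    have n1: "1 \<le> norm (1 - \<i> * (y - c) / R)" if "0 \<le> Im y" for y
    proof -
      have "1 \<le> (norm (1 - \<i> * (y - c) / R))\<^sup>2" using nb[of y] that R by simp
      then have "1\<^sup>2 \<le> (norm (1 - \<i> * (y - c) / R))\<^sup>2" by (simp only: one_power2)
      then show ?thesis by (rule power2_le_imp_le) (rule norm_ge_zero)
    qed
    have b0: "0 \<le> b y" if "0 \<le> Im y" for y using n1[OF that] by (simp add: b_def)
    have bk: "\<kappa> \<le> b y" if "0 \<le> Im y" "norm (y - c) = R" for y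
    proof -
      have "2 \<le> (norm (1 - \<i> * (y - c) / R))\<^sup>2" using nb[of y] that R by simp
      then have "ln 2 \<le> ln ((norm (1 - \<i> * (y - c) / R))\<^sup>2)" by (intro ln_mono) auto
      also have "\<dots> = 2 * b y" unfolding b_def using n1[OF that(1)] by (subst ln_realpow) auto
      finally show ?thesis by (simp add: \<kappa>_def)
    qed
    have contb: "continuous_on K b"
      unfolding b_def using R n1 by (intro continuous_intros) (force simp: K_def)+
    define V where "V y = exp (\<sigma> * v y - b y / \<kappa>)" for y
    have contV: "continuous_on K V"
      unfolding V_def using \<kappa> by (intro continuous_intros continuous_on_subset[OF contv KAB] contb) auto
    define G where "G y = exp (- \<i> * of_real \<sigma> * F y - Ln (1 - \<i> * (y - c) / R) / of_real \<kappa>)" for y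
    have QA: "Q \<subseteq> A"
    proof
      fix y assume "y \<in> Q"
      then have "y \<in> K" "Im y \<noteq> 0" by (auto simp: Q_def K_def)
      then show "y \<in> A" using KAB by (auto simp: B_def)
    qed
    have holG: "G holomorphic_on Q"
      unfolding G_def using QA hol arg R \<kappa>
      by (intro holomorphic_intros holomorphic_on_subset[OF hol[folded A_def]]) (auto simp: Q_def)
    have VG: "V y = norm (G y)" if "y \<in> Q" for y
    proof -
      have "1 - \<i> * (y - c) / R \<noteq> 0" using arg[of y] that by (force simp: Q_def)
      then show ?thesis using that QA by (auto simp: V_def G_def v_def b_def)
    qed
    have QK: "Q \<subseteq> K" by (auto simp: Q_def K_def)
    have zQ: "z \<in> Q"
    proof -
      have "norm (z - c) = \<bar>Im z\<bar>" by (simp add: c_def cmod_def)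
      also have "\<dots> = \<bar>Im (z - x0)\<bar>" by simp
      also have "\<dots> \<le> norm (z - x0)" by (rule abs_Im_le_cmod)
      also have "\<dots> < R" using z s by (simp add: dist_norm R_def norm_minus_commute)
      finally show ?thesis using z by (simp add: Q_def dist_norm norm_minus_commute)
    qed
    obtain m where m: "m \<in> K" "\<And>y. y \<in> K \<Longrightarrow> V y \<le> V m"
      using continuous_attains_sup[OF cK _ contV] zQ QK by auto
    have "V m \<le> 1"
    proof (cases "m \<in> Q")
      case False
      then consider "Im m = 0" | "norm (m - c) = R" "0 < Im m"
        using m(1) by (fastforce simp: K_def Q_def dist_norm norm_minus_commute)
      then show ?thesis
      proof cases
        case 1
        then have "v m = 0" by (simp add: v_def A_def)
        then show ?thesis using b0[of m] 1 \<kappa> by (simp add: V_def)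
      next
        case 2
        then have "1 \<le> b m / \<kappa>" using bk[of m] \<kappa> by simp
        moreover have "\<bar>v m\<bar> \<le> 1" using bd[of m] by (auto simp: v_def A_def)
        ultimately show ?thesis using \<sigma> by (auto simp: V_def)
      qed
    next
      case True
      have "open Q" "connected Q" unfolding Q_def
        by (auto intro!: open_Int open_halfspace_Im_gt convex_connected convex_Int convex_halfspace_Im_gt)
      then have "G constant_on Q"
        using maximum_modulus_principle[OF holG, of Q m] True m VG QK by (metis order_refl subsetD)
      then obtain k where "\<And>y. y \<in> Q \<Longrightarrow> G y = k" unfolding constant_on_def by blast
      then have Vk: "V y = norm k" if "y \<in> Q" for y using VG that by auto
      have clK: "closure Q \<subseteq> K" using QK compact_imp_closed[OF cK] by (rule closure_minimal)
      have cc: "c \<in> closure Q" unfolding closure_approachable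
      proof (intro allI impI)
        fix e :: real assume e: "0 < e"
        have "c + \<i> * (min e R / 2) \<in> Q" using e R by (auto simp: Q_def dist_norm norm_mult c_def)
        moreover have "dist (c + \<i> * (min e R / 2)) c < e" using e R by (auto simp: dist_norm norm_mult)
        ultimately show "\<exists>y\<in>Q. dist y c < e" by blast
      qed
      have "V c = norm k"
        using continuous_constant_on_closure[OF continuous_on_subset[OF contV clK] Vk cc] by simp
      moreover have "V c = 1"
      proof -
        have "v c = 0" by (simp add: v_def A_def c_def)
        then show ?thesis by (simp add: V_def b_def)
      qed
      ultimately show ?thesis using Vk[OF True] by simp
    qed
    then have "V z \<le> 1" using m(2)[of z] zQ QK by force
    then have "\<sigma> * v z \<le> b z / \<kappa>" by (simp add: V_def)
    moreover have "v z = Im (F z)" using zQ QA by (auto simp: v_def)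
    moreover have "b z \<le> Im z / R"
    proof -
      have "1 - \<i> * (z - c) / R = of_real (1 + Im z / R)" using R by (simp add: c_def complex_eq_iff)
      then have "b z = ln (1 + Im z / R)" using z R by (simp add: b_def del: of_real_add of_real_divide)
      then show ?thesis using ln_add_one_self_le_self[of "Im z / R"] z R by simp
    qed
    then have "b z / \<kappa> \<le> Im z / R / \<kappa>" using \<kappa> by (intro divide_right_mono) auto
    ultimately show ?thesis by (simp add: R_def mult.assoc)
  qed
  show ?thesis
  proof (intro exI conjI ballI impI)
    show "s > 0" "s \<le> r" using s by (auto simp: s_def)
    show "1 / (2 * s * \<kappa>) > 0" using s \<kappa> by simp
    show "\<bar>Im (F z)\<bar> \<le> 1 / (2 * s * \<kappa>) * Im z" if "z \<in> ball (complex_of_real x0) s" "0 < Im z" for z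
      using main[OF that, of 1] main[OF that, of "-1"] by simp
  qed
qed

section \<open>Schwarz reflection\<close>

lemma limit_at_real_point:
  fixes F :: "complex \<Rightarrow> complex" and x0 :: real
  assumes S: "open S" "of_real x0 \<in> S" and hol: "F holomorphic_on (S \<inter> {z. 0 < Im z})"
    and lim: "\<And>x. of_real x \<in> S \<Longrightarrow>
       ((\<lambda>z. Im (F z)) \<longlongrightarrow> 0) (at (of_real x) within (S \<inter> {z. 0 < Im z}))"
  shows "\<exists>l. (F \<longlongrightarrow> of_real l) (at (of_real x0) within (S \<inter> {z. 0 < Im z}))"
proof -
  have "eventually (\<lambda>z. dist (Im (F z)) 0 < 1) (at (of_real x0) within (S \<inter> {z. 0 < Im z}))"
    by (rule tendstoD[OF lim[OF S(2)]]) simp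
  then obtain r1 where r1: "r1 > 0" "\<And>z. z \<in> S \<Longrightarrow> 0 < Im z \<Longrightarrow> z \<noteq> of_real x0 \<Longrightarrow> dist z (of_real x0) < r1 \<Longrightarrow> \<bar>Im (F z)\<bar> < 1"
    unfolding eventually_at by (auto simp: dist_real_def)
  obtain r2 where r2: "r2 > 0" "ball (of_real x0) r2 \<subseteq> S" using S openE by blast
  define r where "r = min r1 r2"
  have r: "r > 0" "ball (of_real x0) r \<subseteq> S" using r1 r2 by (auto simp: r_def)
  have sub: "ball (of_real x0) r \<inter> {z. 0 < Im z} \<subseteq> S \<inter> {z. 0 < Im z}" using r by auto
  have bd: "\<bar>Im (F z)\<bar> \<le> 1" if "z \<in> ball (of_real x0) r" "0 < Im z" for z
    using r1(2)[of z] that r by (force simp: r_def dist_commute)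
  have "\<exists>\<rho> C. 0 < \<rho> \<and> \<rho> \<le> r \<and> 0 < C \<and>
    (\<forall>z \<in> ball (complex_of_real x0) \<rho>. 0 < Im z \<longrightarrow> \<bar>Im (F z)\<bar> \<le> C * Im z)"
  proof (rule vertical_linear_bound[OF r(1) holomorphic_on_subset[OF hol sub] bd])
    show "((\<lambda>z. Im (F z)) \<longlongrightarrow> 0) (at (of_real x) within (ball (of_real x0) r \<inter> {z. 0 < Im z}))"
      if "complex_of_real x \<in> ball (of_real x0) r" for x
      by (rule tendsto_within_subset[OF lim sub]) (use that r in blast)
  qed
  then obtain \<rho> C where \<rho>: "\<rho> > 0" "C > 0" "\<rho> \<le> r"
    "\<And>z. z \<in> ball (complex_of_real x0) \<rho> \<Longrightarrow> 0 < Im z \<Longrightarrow> \<bar>Im (F z)\<bar> \<le> C * Im z"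
    by blast
  define N where "N = ball (complex_of_real x0) (\<rho>/2) \<inter> {z. 0 < Im z}"
  have der: "norm (deriv F z) \<le> 8 * C" if z: "z \<in> N" for z
  proof -
    define t where "t = Im z"
    have t: "t > 0" using z by (simp add: N_def t_def)
    have t2: "t < \<rho>/2"
    proof -
      have "t \<le> norm (z - x0)" using abs_Im_le_cmod[of "z - x0"] by (simp add: t_def)
      then show ?thesis using z by (simp add: N_def dist_norm norm_minus_commute)
    qed
    have ball: "y \<in> ball (of_real x0) \<rho> \<and> 0 < Im y \<and> Im y < 2 * t" if y: "y \<in> ball z t" for y
    proof -
      have "\<bar>Im y - Im z\<bar> \<le> norm (y - z)" using abs_Im_le_cmod[of "y - z"] by simp
      also have "\<dots> < t" using y by (simp add: dist_norm norm_minus_commute)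
      finally have "\<bar>Im y - t\<bar> < t" by (simp add: t_def)
      moreover have "dist (of_real x0) y \<le> dist (of_real x0) z + dist z y" by (rule dist_triangle)
      then have "dist (of_real x0) y < \<rho>" using y z t2 by (auto simp: N_def)
      ultimately show ?thesis by auto
    qed
    define E where "E y = of_real (3 * C * t) - \<i> * F y" for y
    have "ball z t \<subseteq> S \<inter> {z. 0 < Im z}"
    proof
      fix y assume "y \<in> ball z t"
      then have "y \<in> ball (of_real x0) r" "0 < Im y" using ball[of y] \<rho>(3) by auto
      then show "y \<in> S \<inter> {z. 0 < Im z}" using r(2) by auto
    qed
    then have hF: "F holomorphic_on ball z t" by (rule holomorphic_on_subset[OF hol])
    then have hE: "E holomorphic_on ball z t" unfolding E_def by (intro holomorphic_intros)
    have ReE: "0 < Re (E y)" if y: "y \<in> ball z t" for y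
    proof -
      have "\<bar>Im (F y)\<bar> \<le> C * Im y" using ball[OF y] \<rho>(4) by blast
      also have "\<dots> < C * (3 * t)" using ball[OF y] \<rho>(2) t by (intro mult_strict_left_mono) auto
      finally show ?thesis by (auto simp: E_def)
    qed
    have "norm (deriv E z) \<le> 2 * Re (E z) / t" by (rule Re_pos_ball_bounds(1)[OF hE t ReE])
    moreover have "deriv E z = - \<i> * deriv F z"
    proof -
      have "(F has_field_derivative deriv F z) (at z)"
        using hF t by (metis centre_in_ball holomorphic_derivI open_ball)
      then have "(E has_field_derivative - \<i> * deriv F z) (at z)"
        unfolding E_def by (auto intro!: derivative_eq_intros)
      then show ?thesis by (rule DERIV_imp_deriv)
    qed
    moreover have "Re (E z) \<le> 4 * C * t"
      using \<rho>(4)[of z] z t2 \<rho>(1) unfolding E_def N_def t_def by auto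
    then have "2 * Re (E z) / t \<le> 8 * C" using t by (simp add: divide_le_eq)
    ultimately show ?thesis by (simp add: norm_mult)
  qed
  have cN: "convex N" "open N" unfolding N_def by (auto intro!: convex_Int open_Int convex_halfspace_Im_gt open_halfspace_Im_gt)
  have NS: "N \<subseteq> S \<inter> {z. 0 < Im z}" using \<rho>(1,3) r(2) by (auto simp: N_def)
  have hN: "F holomorphic_on N" by (rule holomorphic_on_subset[OF hol NS])
  have lip: "dist (F x) (F y) \<le> (8 * C) * dist x y" if "x \<in> N" "y \<in> N" for x y
    unfolding dist_norm
    by (rule field_differentiable_bound[OF cN(1), of F "deriv F"])
      (use der that hN cN in \<open>auto intro: holomorphic_derivI has_field_derivative_at_within\<close>)
  have uc: "uniformly_continuous_on N F"
    unfolding uniformly_continuous_on_def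
  proof (intro allI impI)
    fix e :: real assume e: "0 < e"
    show "\<exists>d>0. \<forall>x\<in>N. \<forall>x'\<in>N. dist x' x < d \<longrightarrow> dist (F x') (F x) < e"
    proof (intro exI[of _ "e / (8 * C)"] conjI ballI impI)
      fix x x' assume "x \<in> N" "x' \<in> N" "dist x' x < e / (8 * C)"
      then have "8 * C * dist x' x < e" using \<rho>(2) by (simp add: less_divide_eq mult.commute)
      then show "dist (F x') (F x) < e" using lip[OF \<open>x' \<in> N\<close> \<open>x \<in> N\<close>] by simp
    qed (use e \<rho>(2) in auto)
  qed
  have clN: "of_real x0 \<in> closure N" unfolding closure_approachable
  proof (intro allI impI)
    fix e :: real assume e: "0 < e"
    define d where "d = min e (\<rho>/2) / 2"
    have d: "0 < d" "d < e" "d < \<rho>/2" using e \<rho>(1) by (auto simp: d_def)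
    have "of_real x0 + \<i> * d \<in> N" "dist (of_real x0 + \<i> * d) (of_real x0) < e"
      using d by (auto simp: N_def dist_norm norm_mult)
    then show "\<exists>y\<in>N. dist y (of_real x0) < e" by blast
  qed
  obtain l where l: "(F \<longlongrightarrow> l) (at (of_real x0) within N)"
    by (rule uniformly_continuous_on_extension_at_closure[OF uc clN])
  have atN: "at (of_real x0) within N = at (of_real x0) within (S \<inter> {z. 0 < Im z})"
    by (rule at_within_nhd[of _ "ball (of_real x0) (\<rho>/2)"]) (use \<rho>(1,3) r(2) in \<open>auto simp: N_def\<close>)
  have "at (of_real x0) within N \<noteq> bot"
  proof -
    have "of_real x0 \<notin> N" by (simp add: N_def)
    then show ?thesis using clN by (metis closure_def UnE at_within_eq_bot_iff islimpt_in_closure Diff_empty Diff_insert0)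
  qed
  then have "Im l = 0"
    using tendsto_unique[OF _ tendsto_Im[OF l] lim[OF S(2), folded atN]] by blast
  then have "l = of_real (Re l)" by (simp add: complex_eq_iff)
  then show ?thesis using l unfolding atN by metis
qed

text \<open>Only the imaginary part is assumed to have boundary values; the barrier estimate makes the
  derivative bounded near the real axis, so that the whole function extends continuously.\<close>

theorem Schwarz_reflection_Im:
  fixes F :: "complex \<Rightarrow> complex"
  assumes S: "open S" and cnjS: "\<And>z. z \<in> S \<Longrightarrow> cnj z \<in> S"
    and hol: "F holomorphic_on (S \<inter> {z. 0 < Im z})"
    and lim: "\<And>x. of_real x \<in> S \<Longrightarrow>
       ((\<lambda>z. Im (F z)) \<longlongrightarrow> 0) (at (of_real x) within (S \<inter> {z. 0 < Im z}))"
  obtains G where "G holomorphic_on S" "\<And>z. z \<in> S \<Longrightarrow> 0 < Im z \<Longrightarrow> G z = F z"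
    "\<And>z. z \<in> S \<Longrightarrow> G (cnj z) = cnj (G z)"
proof -
  define A where "A = S \<inter> {z. 0 < Im z}"
  define B where "B = S \<inter> {z. Im z = 0}"
  have "\<exists>l. (F \<longlongrightarrow> of_real l) (at (of_real x) within A)" if "of_real x \<in> S" for x
    unfolding A_def by (rule limit_at_real_point[OF S that hol lim])
  then obtain l where l: "\<And>x. of_real x \<in> S \<Longrightarrow> (F \<longlongrightarrow> of_real (l x)) (at (of_real x) within A)" by metis
  define F1 where "F1 z = (if z \<in> A then F z else of_real (l (Re z)))" for z
  have oA: "open A" unfolding A_def using S by (intro open_Int open_halfspace_Im_gt)
  have AB: "A \<union> B = S \<inter> {z. 0 \<le> Im z}" by (auto simp: A_def B_def)
  have "continuous_on (A \<union> B) F1" unfolding F1_def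
  proof (rule continuous_extension_by_limits[OF oA])
    show "continuous_on A F" using hol unfolding A_def by (rule holomorphic_on_imp_continuous_on)
    show "q \<in> closure A" if q: "q \<in> B" for q unfolding closure_approachable
    proof (intro allI impI)
      fix e :: real assume e: "0 < e"
      obtain r where r: "r > 0" "ball q r \<subseteq> S" using S q openE unfolding B_def by blast
      define d where "d = min e r / 2"
      have d: "0 < d" "d < e" "d < r" using e r(1) by (auto simp: d_def)
      have "q + \<i> * d \<in> ball q r" using d by (simp add: dist_norm norm_mult)
      then have "q + \<i> * d \<in> A" "dist (q + \<i> * d) q < e"
        using r d q by (auto simp: A_def B_def dist_norm norm_mult)
      then show "\<exists>y\<in>A. dist y q < e" by blast
    qed
    show "(F \<longlongrightarrow> of_real (l (Re q))) (at q within A)" if q: "q \<in> B" for q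
    proof -
      have eq: "of_real (Re q) = q" using q by (simp add: B_def complex_eq_iff)
      show ?thesis using l[of "Re q"] q unfolding B_def eq by auto
    qed
  qed
  then have cont: "continuous_on (S \<inter> {z. 0 \<le> Im z}) F1" unfolding AB .
  have "F holomorphic_on A" using hol by (simp add: A_def)
  then have holF1: "F1 holomorphic_on (S \<inter> {z. 0 < Im z})"
    unfolding A_def[symmetric] by (rule holomorphic_transform) (simp add: F1_def)
  have F1r: "F1 z = of_real (l (Re z))" if "Im z = 0" for z using that by (simp add: F1_def A_def)
  define G where "G z = (if 0 \<le> Im z then F1 z else cnj (F1 (cnj z)))" for z
  show thesis
  proof
    show "G holomorphic_on S" unfolding G_def
      by (rule Schwarz_reflection[OF S _ holF1 cont]) (use cnjS F1r in \<open>auto simp: complex_is_Real_iff\<close>)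
    show "G z = F z" if "z \<in> S" "0 < Im z" for z using that by (simp add: G_def F1_def A_def)
    show "G (cnj z) = cnj (G z)" if "z \<in> S" for z
      by (cases "Im z = 0") (auto simp: G_def F1r)
  qed
qed

section \<open>The canonical decomposition\<close>

theorem harmonic_decomposition:
  fixes f :: "complex \<Rightarrow> complex"
  assumes harm: "harmonic_on f S" and S: "open S" "convex S"
  obtains H1 H2 where "H1 holomorphic_on S" "H2 holomorphic_on S"
    "\<And>z. z \<in> S \<Longrightarrow> f z = H1 z + cnj (H2 z)"
    "\<And>z. z \<in> S \<Longrightarrow> dx f z = deriv H1 z + cnj (deriv H2 z)"
    "\<And>z. z \<in> S \<Longrightarrow> dy f z = \<i> * (deriv H1 z - cnj (deriv H2 z))"
proof -
  have C2: "C2_on f S" and lap: "\<And>z. z \<in> S \<Longrightarrow> dx (dx f) z + dy (dy f) z = 0"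
    using harm by (auto simp: harmonic_on_def)
  have diff: "f differentiable (at z)" "dx f differentiable (at z)" "dy f differentiable (at z)" if "z \<in> S" for z
    using C2 that by (auto simp: C2_on_def C1_on_def)
  have mix: "dy (dx f) z = dx (dy f) z" if "z \<in> S" for z using C2_mixed_partials[OF C2 S(1) that] .
  define p where "p z = (dx f z - \<i> * dy f z) / 2" for z
  define q where "q z = cnj ((dx f z + \<i> * dy f z) / 2)" for z
  have dp: "(p has_field_derivative (dx (dx f) z - \<i> * dx (dy f) z) / 2) (at z)" if z: "z \<in> S" for z
  proof -
    have "(p has_derivative (\<lambda>h. ((Re h *\<^sub>R dx (dx f) z + Im h *\<^sub>R dy (dx f) z)
        - \<i> * (Re h *\<^sub>R dx (dy f) z + Im h *\<^sub>R dy (dy f) z)) / 2)) (at z)"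
      unfolding p_def using diff[OF z]
      by (intro derivative_eq_intros has_derivative_dx_dy refl) (auto intro: has_derivative_dx_dy)
    also have "(\<lambda>h. ((Re h *\<^sub>R dx (dx f) z + Im h *\<^sub>R dy (dx f) z)
        - \<i> * (Re h *\<^sub>R dx (dy f) z + Im h *\<^sub>R dy (dy f) z)) / 2) = (*) ((dx (dx f) z - \<i> * dx (dy f) z) / 2)"
    proof
      fix h
      have e: "dy (dy f) z = - dx (dx f) z" using lap[OF z] by (simp add: add_eq_0_iff)
      show "((Re h *\<^sub>R dx (dx f) z + Im h *\<^sub>R dy (dx f) z)
        - \<i> * (Re h *\<^sub>R dx (dy f) z + Im h *\<^sub>R dy (dy f) z)) / 2 = (dx (dx f) z - \<i> * dx (dy f) z) / 2 * h"
        unfolding e mix[OF z] by (simp add: complex_eq_iff algebra_simps)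
    qed
    finally show ?thesis unfolding has_field_derivative_def .
  qed
  have dq: "(q has_field_derivative cnj ((dx (dx f) z + \<i> * dx (dy f) z) / 2)) (at z)" if z: "z \<in> S" for z
  proof -
    have "(q has_derivative (\<lambda>h. cnj (((Re h *\<^sub>R dx (dx f) z + Im h *\<^sub>R dy (dx f) z)
        + \<i> * (Re h *\<^sub>R dx (dy f) z + Im h *\<^sub>R dy (dy f) z)) / 2))) (at z)"
      unfolding q_def using diff[OF z]
      by (intro has_derivative_cnj derivative_eq_intros has_derivative_dx_dy refl) (auto intro: has_derivative_dx_dy)
    also have "(\<lambda>h. cnj (((Re h *\<^sub>R dx (dx f) z + Im h *\<^sub>R dy (dx f) z)
        + \<i> * (Re h *\<^sub>R dx (dy f) z + Im h *\<^sub>R dy (dy f) z)) / 2)) = (*) (cnj ((dx (dx f) z + \<i> * dx (dy f) z) / 2))"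
    proof
      fix h
      have e: "dy (dy f) z = - dx (dx f) z" using lap[OF z] by (simp add: add_eq_0_iff)
      show "cnj (((Re h *\<^sub>R dx (dx f) z + Im h *\<^sub>R dy (dx f) z)
        + \<i> * (Re h *\<^sub>R dx (dy f) z + Im h *\<^sub>R dy (dy f) z)) / 2) = cnj ((dx (dx f) z + \<i> * dx (dy f) z) / 2) * h"
        unfolding e mix[OF z] by (simp add: complex_eq_iff algebra_simps)
    qed
    finally show ?thesis unfolding has_field_derivative_def .
  qed
  have prim: "\<exists>P. \<forall>z\<in>S. (P has_field_derivative k z) (at z)"
    if k: "\<And>z. z \<in> S \<Longrightarrow> \<exists>k'. (k has_field_derivative k') (at z)" for k
  proof -
    have "continuous_on S k"
      by (meson k DERIV_isCont continuous_at_imp_continuous_on)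
    then obtain P where "\<And>z. z \<in> S \<Longrightarrow> (P has_field_derivative k z) (at z within S)"
      using holomorphic_convex_primitive[OF S(2), of "{}" k] k interior_subset[of S]
      by (metis Diff_empty field_differentiable_def finite.emptyI subsetD)
    then show ?thesis using S(1) by (metis at_within_open)
  qed
  obtain P where P: "\<And>z. z \<in> S \<Longrightarrow> (P has_field_derivative p z) (at z)" using prim[of p] dp by blast
  obtain Q where Q: "\<And>z. z \<in> S \<Longrightarrow> (Q has_field_derivative q z) (at z)" using prim[of q] dq by blast
  have "((\<lambda>z. f z - (P z + cnj (Q z))) has_derivative (\<lambda>h. 0)) (at z within S)" if z: "z \<in> S" for z
  proof -
    have "((\<lambda>z. f z - (P z + cnj (Q z))) has_derivative
       (\<lambda>h. (Re h *\<^sub>R dx f z + Im h *\<^sub>R dy f z) - (p z * h + cnj (q z * h)))) (at z)"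
      by (intro has_derivative_diff has_derivative_add has_derivative_cnj has_derivative_dx_dy diff z
          has_field_derivative_imp_has_derivative P Q)
    also have "(\<lambda>h. (Re h *\<^sub>R dx f z + Im h *\<^sub>R dy f z) - (p z * h + cnj (q z * h))) = (\<lambda>h. 0)"
    proof
      fix h
      have "p z * h + cnj (q z * h) = Re h *\<^sub>R dx f z + Im h *\<^sub>R dy f z"
        unfolding p_def q_def complex_eq_iff by (auto simp: field_simps)
      then show "(Re h *\<^sub>R dx f z + Im h *\<^sub>R dy f z) - (p z * h + cnj (q z * h)) = 0" by simp
    qed
    finally show ?thesis by (rule has_derivative_at_withinI)
  qed
  then have "\<exists>c. \<forall>z\<in>S. f z - (P z + cnj (Q z)) = c"
    by (rule has_derivative_zero_constant[OF S(2)])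
  then obtain c where c: "\<And>z. z \<in> S \<Longrightarrow> f z - (P z + cnj (Q z)) = c" by auto
  show thesis
  proof
    have D: "((\<lambda>z. P z + c) has_field_derivative p z) (at z)" if "z \<in> S" for z
      using P[OF that] by (auto intro!: derivative_eq_intros)
    show "(\<lambda>z. P z + c) holomorphic_on S" "Q holomorphic_on S"
      unfolding holomorphic_on_open[OF S(1)] using D Q by blast+
    show "f z = P z + c + cnj (Q z)" if "z \<in> S" for z using c[OF that] by (simp add: algebra_simps)
    have e: "deriv (\<lambda>z. P z + c) z = p z" "deriv Q z = q z" if "z \<in> S" for z
      using D[OF that] Q[OF that] by (auto intro: DERIV_imp_deriv)
    show "dx f z = deriv (\<lambda>z. P z + c) z + cnj (deriv Q z)"
      "dy f z = \<i> * (deriv (\<lambda>z. P z + c) z - cnj (deriv Q z))" if "z \<in> S" for z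
      unfolding e[OF that] p_def q_def by (auto simp: complex_eq_iff field_simps)
  qed
qed

section \<open>Branches of the inverse of \<open>2 * H1\<close>\<close>

locale harmonic_graph =
  fixes H1 H2 h :: "complex \<Rightarrow> complex"
  assumes hol1: "H1 holomorphic_on ball 0 1" and hol2: "H2 holomorphic_on ball 0 1"
    and holh: "h holomorphic_on ball 0 1"
    and dil: "w \<in> ball 0 1 \<Longrightarrow> norm (deriv H2 w) < norm (deriv H1 w)"
    and conf: "w \<in> ball 0 1 \<Longrightarrow> (deriv h w)\<^sup>2 = - 4 * deriv H1 w * deriv H2 w"
    and inj: "inj_on (\<lambda>w. H1 w + cnj (H2 w)) (ball 0 1)"
begin

definition hmap :: "complex \<Rightarrow> complex" where "hmap w = H1 w + cnj (H2 w)"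

definition img :: "complex set" where "img = hmap ` ball 0 1"

definition om :: "complex \<Rightarrow> complex" where "om w = deriv H2 w / deriv H1 w"

definition blow :: "complex \<Rightarrow> bool" where
  "blow q \<longleftrightarrow> (\<forall>B. \<exists>\<delta>>0. \<forall>w\<in>ball 0 1. dist (hmap w) q < \<delta> \<longrightarrow> B < \<bar>Re (h w)\<bar>)"

definition branch :: "complex set \<Rightarrow> (complex \<Rightarrow> complex) \<Rightarrow> bool" where
  "branch U \<eta> \<longleftrightarrow> open U \<and> \<eta> holomorphic_on U \<and> \<eta> ` U \<subseteq> ball 0 1 \<and> (\<forall>\<xi>\<in>U. 2 * H1 (\<eta> \<xi>) = \<xi>)"

lemma dH1_nz: "w \<in> ball 0 1 \<Longrightarrow> deriv H1 w \<noteq> 0"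
  using dil[of w] by auto

lemma om_less_1: "w \<in> ball 0 1 \<Longrightarrow> norm (om w) < 1"
  using dil[of w] dH1_nz[of w] by (simp add: om_def norm_divide divide_less_eq)

lemma om_holomorphic: "om holomorphic_on ball 0 1"
  unfolding om_def using dH1_nz by (intro holomorphic_intros holomorphic_deriv hol1 hol2 open_ball) auto

lemma inj_hmap: "inj_on hmap (ball 0 1)"
  using inj unfolding hmap_def .

lemma cont_hmap: "continuous_on (ball 0 1) hmap"
  unfolding hmap_def by (intro continuous_intros holomorphic_on_imp_continuous_on hol1 hol2)

lemma cont_inverse: "continuous_on img (inv_into (ball 0 1) hmap)"
  unfolding img_def by (rule continuous_on_inverse_open[OF open_ball cont_hmap]) (simp_all add: inv_into_f_f[OF inj_hmap])

lemma branchD: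
  assumes "branch U \<eta>"
  shows "open U" "\<eta> holomorphic_on U" "\<xi> \<in> U \<Longrightarrow> \<eta> \<xi> \<in> ball 0 1" "\<xi> \<in> U \<Longrightarrow> 2 * H1 (\<eta> \<xi>) = \<xi>"
  using assms by (auto simp: branch_def)

lemma branch_subset: "\<lbrakk>branch U \<eta>; open V; V \<subseteq> U\<rbrakk> \<Longrightarrow> branch V \<eta>"
  unfolding branch_def by (meson holomorphic_on_subset image_mono subset_iff subset_trans)

lemma branch_transform: "\<lbrakk>branch U \<eta>; \<And>\<xi>. \<xi> \<in> U \<Longrightarrow> \<eta> \<xi> = \<eta>' \<xi>\<rbrakk> \<Longrightarrow> branch U \<eta>'"
  unfolding branch_def using holomorphic_transform[of \<eta> U \<eta>'] by fastforce

lemma branch_Un: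
  assumes "branch U \<eta>" "branch V \<eta>'" "\<And>\<xi>. \<xi> \<in> U \<inter> V \<Longrightarrow> \<eta> \<xi> = \<eta>' \<xi>"
  shows "branch (U \<union> V) (\<lambda>\<xi>. if \<xi> \<in> U then \<eta> \<xi> else \<eta>' \<xi>)" (is "branch _ ?c")
proof -
  have "branch U ?c" by (rule branch_transform[OF assms(1)]) simp
  moreover have "branch V ?c" by (rule branch_transform[OF assms(2)]) (use assms(3) in auto)
  ultimately show ?thesis unfolding branch_def
    using holomorphic_on_Un[of ?c U V] by blast
qed

lemma branch_deriv:
  assumes b: "branch U \<eta>" and \<xi>: "\<xi> \<in> U"
  shows "(\<eta> has_field_derivative 1 / (2 * deriv H1 (\<eta> \<xi>))) (at \<xi>)"
proof -
  have d: "(\<eta> has_field_derivative deriv \<eta> \<xi>) (at \<xi>)"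
    by (rule holomorphic_derivI[OF branchD(2)[OF b] branchD(1)[OF b] \<xi>])
  have w: "\<eta> \<xi> \<in> ball 0 1" by (rule branchD(3)[OF b \<xi>])
  have d1: "(H1 has_field_derivative deriv H1 (\<eta> \<xi>)) (at (\<eta> \<xi>))"
    by (rule holomorphic_derivI[OF hol1 open_ball w])
  have "((\<lambda>\<xi>. 2 * H1 (\<eta> \<xi>)) has_field_derivative 2 * (deriv H1 (\<eta> \<xi>) * deriv \<eta> \<xi>)) (at \<xi>)"
    by (intro DERIV_cmult DERIV_chain2[OF d1 d])
  moreover have "((\<lambda>\<xi>. 2 * H1 (\<eta> \<xi>)) has_field_derivative 1) (at \<xi>)"
    by (rule has_field_derivative_transform_within_open[OF DERIV_ident branchD(1)[OF b] \<xi>])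
      (simp add: branchD(4)[OF b])
  ultimately have "2 * (deriv H1 (\<eta> \<xi>) * deriv \<eta> \<xi>) = 1" by (rule DERIV_unique)
  then have "deriv \<eta> \<xi> = 1 / (2 * deriv H1 (\<eta> \<xi>))"
    using dH1_nz[OF w] by (simp add: field_simps)
  then show ?thesis using d by simp
qed

lemma branch_deriv_H2:
  assumes b: "branch U \<eta>" and \<xi>: "\<xi> \<in> U"
  shows "((\<lambda>\<xi>. H2 (\<eta> \<xi>)) has_field_derivative om (\<eta> \<xi>) / 2) (at \<xi>)"
proof -
  have w: "\<eta> \<xi> \<in> ball 0 1" by (rule branchD(3)[OF b \<xi>])
  have "(H2 has_field_derivative deriv H2 (\<eta> \<xi>)) (at (\<eta> \<xi>))"
    by (rule holomorphic_derivI[OF hol2 open_ball w])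
  from DERIV_chain2[OF this branch_deriv[OF b \<xi>]] show ?thesis by (simp add: om_def field_simps)
qed

lemma branch_deriv_h:
  assumes b: "branch U \<eta>" and \<xi>: "\<xi> \<in> U"
  shows "((\<lambda>\<xi>. h (\<eta> \<xi>)) has_field_derivative deriv h (\<eta> \<xi>) / (2 * deriv H1 (\<eta> \<xi>))) (at \<xi>)"
    and "(deriv h (\<eta> \<xi>) / (2 * deriv H1 (\<eta> \<xi>)))\<^sup>2 = - om (\<eta> \<xi>)"
proof -
  have w: "\<eta> \<xi> \<in> ball 0 1" by (rule branchD(3)[OF b \<xi>])
  have "(h has_field_derivative deriv h (\<eta> \<xi>)) (at (\<eta> \<xi>))"
    by (rule holomorphic_derivI[OF holh open_ball w])
  from DERIV_chain2[OF this branch_deriv[OF b \<xi>]]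
  show "((\<lambda>\<xi>. h (\<eta> \<xi>)) has_field_derivative deriv h (\<eta> \<xi>) / (2 * deriv H1 (\<eta> \<xi>))) (at \<xi>)" by simp
  show "(deriv h (\<eta> \<xi>) / (2 * deriv H1 (\<eta> \<xi>)))\<^sup>2 = - om (\<eta> \<xi>)"
    unfolding power_divide conf[OF w] om_def using dH1_nz[OF w] by (simp add: power2_eq_square)
qed

lemma branch_hmap: "branch U \<eta> \<Longrightarrow> \<xi> \<in> U \<Longrightarrow> hmap (\<eta> \<xi>) = \<xi> / 2 + cnj (H2 (\<eta> \<xi>))"
  using branchD(4)[of U \<eta> \<xi>] by (simp add: hmap_def field_simps)

lemma branch_lipschitz:
  assumes b: "branch U \<eta>" and c: "convex U" and x: "x \<in> U" "y \<in> U"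
  shows "norm (hmap (\<eta> x) - hmap (\<eta> y)) \<le> norm (x - y)"
    and "norm (h (\<eta> x) - h (\<eta> y)) \<le> norm (x - y)"
proof -
  have om: "norm (om (\<eta> z)) \<le> 1" if "z \<in> U" for z
    using om_less_1[OF branchD(3)[OF b that]] by simp
  have "norm (H2 (\<eta> x) - H2 (\<eta> y)) \<le> (1/2) * norm (x - y)"
    by (rule field_differentiable_bound[OF c, where f' = "\<lambda>z. om (\<eta> z) / 2"])
      (use x om in \<open>auto intro!: has_field_derivative_at_within branch_deriv_H2[OF b] simp: norm_divide\<close>)
  moreover have "hmap (\<eta> x) - hmap (\<eta> y) = (x - y) / 2 + cnj (H2 (\<eta> x) - H2 (\<eta> y))"
    using branch_hmap[OF b x(1)] branch_hmap[OF b x(2)] by (simp add: field_simps)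
  moreover have "norm ((x - y) / 2 + cnj (H2 (\<eta> x) - H2 (\<eta> y))) \<le> norm ((x - y) / 2) + norm (cnj (H2 (\<eta> x) - H2 (\<eta> y)))"
    by (rule norm_triangle_ineq)
  ultimately show "norm (hmap (\<eta> x) - hmap (\<eta> y)) \<le> norm (x - y)"
    by (simp only: complex_mod_cnj norm_divide) simp
  have "norm (h (\<eta> x) - h (\<eta> y)) \<le> 1 * norm (x - y)"
  proof (rule field_differentiable_bound[OF c, where f' = "\<lambda>z. deriv h (\<eta> z) / (2 * deriv H1 (\<eta> z))"])
    show "norm (deriv h (\<eta> z) / (2 * deriv H1 (\<eta> z))) \<le> 1" if z: "z \<in> U" for z
    proof -
      have "(norm (deriv h (\<eta> z) / (2 * deriv H1 (\<eta> z))))\<^sup>2 = norm (om (\<eta> z))"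
        using branch_deriv_h(2)[OF b z] by (metis norm_power norm_minus_cancel)
      then have "(norm (deriv h (\<eta> z) / (2 * deriv H1 (\<eta> z))))\<^sup>2 \<le> 1\<^sup>2" using om[OF z] by simp
      then show ?thesis by (rule power2_le_imp_le) simp
    qed
  qed (use x in \<open>auto intro!: has_field_derivative_at_within branch_deriv_h(1)[OF b]\<close>)
  then show "norm (h (\<eta> x) - h (\<eta> y)) \<le> norm (x - y)" by simp
qed

lemma local_branch:
  assumes w: "w \<in> ball 0 1"
  obtains r \<eta> M where "r > 0" "branch (ball (2 * H1 w) r) \<eta>" "\<eta> (2 * H1 w) = w" "open M" "w \<in> M"
    "\<And>v. v \<in> M \<Longrightarrow> 2 * H1 v \<in> ball (2 * H1 w) r \<Longrightarrow> \<eta> (2 * H1 v) = v"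
proof -
  have holL: "(\<lambda>w. 2 * H1 w) holomorphic_on ball 0 1" by (intro holomorphic_intros hol1)
  have "((\<lambda>w. 2 * H1 w) has_field_derivative 2 * deriv H1 w) (at w)"
    by (intro DERIV_cmult holomorphic_derivI[OF hol1 open_ball w])
  then have "deriv (\<lambda>w. 2 * H1 w) w \<noteq> 0" using dH1_nz[OF w] by (simp add: DERIV_imp_deriv)
  then obtain s where s: "s > 0" "ball w s \<subseteq> ball 0 1" "open ((\<lambda>w. 2 * H1 w) ` ball w s)" "inj_on (\<lambda>w. 2 * H1 w) (ball w s)"
    by (rule has_complex_derivative_locally_invertible[OF holL w open_ball])
  have hb: "(\<lambda>w. 2 * H1 w) holomorphic_on ball w s" by (rule holomorphic_on_subset[OF holL s(2)])
  obtain g where g: "g holomorphic_on ((\<lambda>w. 2 * H1 w) ` ball w s)" "\<And>z. z \<in> ball w s \<Longrightarrow> g (2 * H1 z) = z"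
    by (rule holomorphic_has_inverse[OF hb open_ball s(4)]) blast
  obtain r where r: "r > 0" "ball (2 * H1 w) r \<subseteq> (\<lambda>w. 2 * H1 w) ` ball w s"
    using s(1,3) openE[of "(\<lambda>w. 2 * H1 w) ` ball w s" "2 * H1 w"] by force
  have "branch (ball (2 * H1 w) r) g"
    unfolding branch_def
  proof (intro conjI ballI)
    show "g holomorphic_on ball (2 * H1 w) r" by (rule holomorphic_on_subset[OF g(1) r(2)])
    show "g ` ball (2 * H1 w) r \<subseteq> ball 0 1" using r(2) g(2) s(2) by force
    show "2 * H1 (g \<xi>) = \<xi>" if "\<xi> \<in> ball (2 * H1 w) r" for \<xi> using that r(2) g(2) by force
  qed simp
  moreover have "g (2 * H1 w) = w" using g(2) s(1) by simp
  ultimately show thesis using that[of r g "ball w s"] r(1) s(1) g(2) by simp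
qed

lemma branch_unique:
  assumes b: "branch U \<eta>" "branch V \<eta>'" and c: "convex U" "convex V"
    and \<xi>: "\<xi> \<in> U" "\<xi> \<in> V" "\<eta> \<xi> = \<eta>' \<xi>" and z: "z \<in> U" "z \<in> V"
  shows "\<eta> z = \<eta>' z"
proof -
  have w: "\<eta> \<xi> \<in> ball 0 1" by (rule branchD(3)[OF b(1) \<xi>(1)])
  obtain r g M where g: "r > 0" "branch (ball (2 * H1 (\<eta> \<xi>)) r) g" "open M" "\<eta> \<xi> \<in> M"
    "\<And>v. v \<in> M \<Longrightarrow> 2 * H1 v \<in> ball (2 * H1 (\<eta> \<xi>)) r \<Longrightarrow> g (2 * H1 v) = v"
    using local_branch[OF w] by metis
  have eq: "2 * H1 (\<eta> \<xi>) = \<xi>" by (rule branchD(4)[OF b(1) \<xi>(1)])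
  have nb: "\<exists>N. open N \<and> \<xi> \<in> N \<and> N \<subseteq> W \<and> (\<forall>z\<in>N. k z = g z)" if k: "branch W k" "\<xi> \<in> W" "k \<xi> = \<eta> \<xi>" for W k
  proof (intro exI conjI ballI)
    have "continuous_on W k" using branchD(2)[OF k(1)] by (rule holomorphic_on_imp_continuous_on)
    then have "open (W \<inter> k -` M)" using branchD(1)[OF k(1)] g(3) by (rule continuous_open_preimage)
    then show "open ((W \<inter> k -` M) \<inter> ball \<xi> r)" by blast
    show "\<xi> \<in> (W \<inter> k -` M) \<inter> ball \<xi> r" using k g by simp
    show "k z = g z" if "z \<in> (W \<inter> k -` M) \<inter> ball \<xi> r" for z
      using g(5)[of "k z"] branchD(4)[OF k(1), of z] that eq by auto
  qed auto
  obtain N where N: "open N" "\<xi> \<in> N" "N \<subseteq> U" "\<forall>z\<in>N. \<eta> z = g z" using nb[OF b(1) \<xi>(1)] by auto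
  obtain N' where N': "open N'" "\<xi> \<in> N'" "N' \<subseteq> V" "\<forall>z\<in>N'. \<eta>' z = g z" using nb[OF b(2) \<xi>(2)] \<xi>(3) by auto
  show ?thesis
  proof (rule analytic_continuation_open[where s = "N \<inter> N'" and s' = "U \<inter> V" and f = \<eta> and g = "\<eta>'"])
    show "open (N \<inter> N')" "N \<inter> N' \<noteq> {}" "N \<inter> N' \<subseteq> U \<inter> V" using N N' by auto
    show "open (U \<inter> V)" using branchD(1)[OF b(1)] branchD(1)[OF b(2)] by blast
    show "connected (U \<inter> V)" using c by (simp add: convex_Int convex_connected)
    show "\<eta> holomorphic_on U \<inter> V" using branchD(2)[OF b(1)] by (rule holomorphic_on_subset) simp
    show "\<eta>' holomorphic_on U \<inter> V" using branchD(2)[OF b(2)] by (rule holomorphic_on_subset) simp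
  qed (use N N' z in auto)
qed

text \<open>Analytic continuation of a base branch \<open>\<beta>\<close> along the segments from \<open>\<pi> \<xi>\<close> to \<open>\<xi>\<close>; the projection \<open>\<pi>\<close> is
  either constant (continuation along rays) or horizontal onto a vertical line.\<close>

definition projection :: "(complex \<Rightarrow> complex) \<Rightarrow> bool" where
  "projection \<pi> \<longleftrightarrow> continuous_on UNIV \<pi> \<and> (\<forall>\<xi>. \<forall>x\<in>closed_segment (\<pi> \<xi>) \<xi>. \<pi> x = \<pi> \<xi>)"

definition visible :: "(complex \<Rightarrow> complex) \<Rightarrow> complex set \<Rightarrow> (complex \<Rightarrow> complex) \<Rightarrow> complex set" where
  "visible \<pi> B \<beta> = {\<xi>. \<pi> \<xi> \<in> B \<and> (\<exists>U \<eta>. branch U \<eta> \<and> convex U \<and> \<xi> \<in> U \<and> \<pi> \<xi> \<in> U \<and> \<eta> (\<pi> \<xi>) = \<beta> (\<pi> \<xi>))}"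

definition continuation :: "(complex \<Rightarrow> complex) \<Rightarrow> (complex \<Rightarrow> complex) \<Rightarrow> complex \<Rightarrow> complex" where
  "continuation \<pi> \<beta> \<xi> =
    (SOME v. \<exists>U \<eta>. branch U \<eta> \<and> convex U \<and> \<xi> \<in> U \<and> \<pi> \<xi> \<in> U \<and> \<eta> (\<pi> \<xi>) = \<beta> (\<pi> \<xi>) \<and> v = \<eta> \<xi>)"

lemma continuation_eq:
  assumes "branch U \<eta>" "convex U" "\<xi> \<in> U" "\<pi> \<xi> \<in> U" "\<eta> (\<pi> \<xi>) = \<beta> (\<pi> \<xi>)"
  shows "continuation \<pi> \<beta> \<xi> = \<eta> \<xi>"
proof -
  let ?P = "\<lambda>v. \<exists>U \<eta>. branch U \<eta> \<and> convex U \<and> \<xi> \<in> U \<and> \<pi> \<xi> \<in> U \<and> \<eta> (\<pi> \<xi>) = \<beta> (\<pi> \<xi>) \<and> v = \<eta> \<xi>"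
  have "?P (\<eta> \<xi>)" using assms by blast
  then have "?P (continuation \<pi> \<beta> \<xi>)" unfolding continuation_def by (rule someI)
  then obtain V \<eta>' where V: "branch V \<eta>'" "convex V" "\<xi> \<in> V" "\<pi> \<xi> \<in> V" "\<eta>' (\<pi> \<xi>) = \<beta> (\<pi> \<xi>)"
    "continuation \<pi> \<beta> \<xi> = \<eta>' \<xi>" by blast
  have "\<eta>' \<xi> = \<eta> \<xi>"
    by (rule branch_unique[OF V(1) assms(1) V(2) assms(2) V(4) assms(4) _ V(3) assms(3)]) (simp add: V(5) assms(5))
  then show ?thesis using V(6) by simp
qed

lemma visible_local:
  assumes B: "branch B \<beta>" and \<pi>: "projection \<pi>" and \<xi>: "\<xi> \<in> visible \<pi> B \<beta>"
  obtains U \<eta> e where "branch U \<eta>" "convex U" "\<xi> \<in> U" "\<pi> \<xi> \<in> U" "\<eta> (\<pi> \<xi>) = \<beta> (\<pi> \<xi>)" "e > 0"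
    "ball \<xi> e \<subseteq> U" "ball \<xi> e \<subseteq> visible \<pi> B \<beta>" "\<And>x. x \<in> ball \<xi> e \<Longrightarrow> continuation \<pi> \<beta> x = \<eta> x"
proof -
  obtain U \<eta> where U: "branch U \<eta>" "convex U" "\<xi> \<in> U" "\<pi> \<xi> \<in> U" "\<eta> (\<pi> \<xi>) = \<beta> (\<pi> \<xi>)" and b: "\<pi> \<xi> \<in> B"
    using \<xi> unfolding visible_def by blast
  have oU: "open U" "open B" using U(1) B by (auto simp: branch_def)
  obtain e1 where e1: "e1 > 0" "ball (\<pi> \<xi>) e1 \<subseteq> U \<inter> B"
    using openE[of "U \<inter> B" "\<pi> \<xi>"] oU U(4) b by blast
  have agree: "\<eta> y = \<beta> y" if "y \<in> ball (\<pi> \<xi>) e1" for y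
    by (rule branch_unique[of "ball (\<pi> \<xi>) e1" \<eta> "ball (\<pi> \<xi>) e1" \<beta> "\<pi> \<xi>"])
      (use that e1 U B branch_subset[OF U(1), of "ball (\<pi> \<xi>) e1"] branch_subset[OF B, of "ball (\<pi> \<xi>) e1"] in auto)
  have "isCont \<pi> \<xi>" using \<pi> unfolding projection_def by (simp add: continuous_on_eq_continuous_at)
  then obtain e2 where e2: "e2 > 0" "\<And>x. dist x \<xi> < e2 \<Longrightarrow> dist (\<pi> x) (\<pi> \<xi>) < e1"
    unfolding continuous_at using e1(1) by (auto simp: tendsto_iff eventually_at) (metis dist_self)
  obtain e3 where e3: "e3 > 0" "ball \<xi> e3 \<subseteq> U" using openE[OF oU(1) U(3)] by blast
  have near: "x \<in> U \<and> \<pi> x \<in> U \<and> \<pi> x \<in> B \<and> \<eta> (\<pi> x) = \<beta> (\<pi> x)" if "x \<in> ball \<xi> (min e2 e3)" for x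
  proof -
    have "\<pi> x \<in> ball (\<pi> \<xi>) e1" using e2(2)[of x] that by (simp add: dist_commute)
    then show ?thesis using e1(2) e3(2) that agree by auto
  qed
  show thesis
  proof (rule that[OF U])
    show "0 < min e2 e3" using e2 e3 by simp
    show "ball \<xi> (min e2 e3) \<subseteq> U" using near by blast
    show "ball \<xi> (min e2 e3) \<subseteq> visible \<pi> B \<beta>" unfolding visible_def using near U(1,2) by blast
    show "continuation \<pi> \<beta> x = \<eta> x" if "x \<in> ball \<xi> (min e2 e3)" for x
      using near[OF that] by (intro continuation_eq[OF U(1,2)]) auto
  qed
qed

lemma branch_visible:
  assumes B: "branch B \<beta>" and \<pi>: "projection \<pi>"
  shows "branch (visible \<pi> B \<beta>) (continuation \<pi> \<beta>)"
proof -
  let ?V = "visible \<pi> B \<beta>" and ?c = "continuation \<pi> \<beta>"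
  have o: "open ?V"
    unfolding open_contains_ball using visible_local[OF B \<pi>] by metis
  have "?c holomorphic_on ?V"
    unfolding holomorphic_on_open[OF o]
  proof
    fix \<xi> assume "\<xi> \<in> ?V"
    then obtain U \<eta> e where U: "branch U \<eta>" "convex U" "\<xi> \<in> U" "e > 0" "\<And>x. x \<in> ball \<xi> e \<Longrightarrow> ?c x = \<eta> x"
      by (metis visible_local[OF B \<pi>])
    have "(\<eta> has_field_derivative 1 / (2 * deriv H1 (\<eta> \<xi>))) (at \<xi>)" by (rule branch_deriv[OF U(1,3)])
    then have "(?c has_field_derivative 1 / (2 * deriv H1 (\<eta> \<xi>))) (at \<xi>)"
      by (rule has_field_derivative_transform_within_open[of _ _ _ "ball \<xi> e"]) (use U in auto)
    then show "\<exists>f'. (?c has_field_derivative f') (at \<xi>)" by blast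
  qed
  moreover have "?c \<xi> \<in> ball 0 1 \<and> 2 * H1 (?c \<xi>) = \<xi>" if "\<xi> \<in> ?V" for \<xi>
  proof -
    obtain U \<eta> e where U: "branch U \<eta>" "\<xi> \<in> U" "e > 0" "\<And>x. x \<in> ball \<xi> e \<Longrightarrow> ?c x = \<eta> x"
      using \<open>\<xi> \<in> ?V\<close> by (metis visible_local[OF B \<pi>])
    then show ?thesis using branchD(3,4)[OF U(1,2)] by simp
  qed
  ultimately show ?thesis using o unfolding branch_def by blast
qed

lemma visible_segment:
  assumes \<pi>: "projection \<pi>" and \<xi>: "\<xi> \<in> visible \<pi> B \<beta>"
  obtains U \<eta> where "branch U \<eta>" "convex U" "closed_segment (\<pi> \<xi>) \<xi> \<subseteq> U" "\<eta> (\<pi> \<xi>) = \<beta> (\<pi> \<xi>)"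
    "closed_segment (\<pi> \<xi>) \<xi> \<subseteq> visible \<pi> B \<beta>"
    "\<And>x. x \<in> closed_segment (\<pi> \<xi>) \<xi> \<Longrightarrow> continuation \<pi> \<beta> x = \<eta> x"
proof -
  obtain U \<eta> where U: "branch U \<eta>" "convex U" "\<xi> \<in> U" "\<pi> \<xi> \<in> U" "\<eta> (\<pi> \<xi>) = \<beta> (\<pi> \<xi>)" and b: "\<pi> \<xi> \<in> B"
    using \<xi> unfolding visible_def by blast
  have seg: "closed_segment (\<pi> \<xi>) \<xi> \<subseteq> U" using closed_segment_subset U by metis
  have p: "\<pi> x = \<pi> \<xi>" if "x \<in> closed_segment (\<pi> \<xi>) \<xi>" for x using \<pi> that unfolding projection_def by blast
  show thesis
  proof (rule that[OF U(1,2) seg U(5)])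
    show "closed_segment (\<pi> \<xi>) \<xi> \<subseteq> visible \<pi> B \<beta>"
    proof
      fix x assume x: "x \<in> closed_segment (\<pi> \<xi>) \<xi>"
      then have "\<pi> x \<in> B \<and> branch U \<eta> \<and> convex U \<and> x \<in> U \<and> \<pi> x \<in> U \<and> \<eta> (\<pi> x) = \<beta> (\<pi> x)"
        using p[OF x] U b seg by auto
      then show "x \<in> visible \<pi> B \<beta>" unfolding visible_def by blast
    qed
    show "continuation \<pi> \<beta> x = \<eta> x" if x: "x \<in> closed_segment (\<pi> \<xi>) \<xi>" for x
      by (rule continuation_eq[OF U(1,2)]) (use p[OF x] x U seg in auto)
  qed
qed

lemma base_visible:
  assumes B: "branch B \<beta>" and b: "b \<in> B" "\<pi> b = b"
  shows "b \<in> visible \<pi> B \<beta>" "continuation \<pi> \<beta> b = \<beta> b"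
proof -
  obtain e where e: "e > 0" "ball b e \<subseteq> B" using branchD(1)[OF B] b openE by blast
  then have be: "branch (ball b e) \<beta>" using B branch_subset by blast
  show "b \<in> visible \<pi> B \<beta>" unfolding visible_def
    using be e(1) b by (auto intro!: exI[of _ "ball b e"] exI[of _ \<beta>])
  show "continuation \<pi> \<beta> b = \<beta> b" by (rule continuation_eq[OF be]) (use e b in auto)
qed

lemma visible_end:
  assumes B: "branch B \<beta>" and \<pi>: "projection \<pi>" and b: "\<pi> p \<in> B" "\<pi> (\<pi> p) = \<pi> p" and p: "p \<notin> visible \<pi> B \<beta>"
    and vis: "\<And>x. x \<in> closed_segment (\<pi> p) p \<Longrightarrow> x \<noteq> p \<Longrightarrow> x \<in> visible \<pi> B \<beta>"
  obtains z where "z \<notin> img" "z \<in> closure img" "\<not> blow z"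
    "\<And>x. x \<in> closed_segment (\<pi> p) p \<Longrightarrow> x \<noteq> p \<Longrightarrow> norm (hmap (continuation \<pi> \<beta> x) - z) \<le> norm (x - p)"
proof -
  let ?V = "visible \<pi> B \<beta>" and ?c = "continuation \<pi> \<beta>" and ?b = "\<pi> p"
  let ?S = "closed_segment ?b p"
  have pb: "p \<noteq> ?b" using base_visible(1)[of B \<beta> ?b \<pi>] B b p by metis
  have pi: "\<pi> x = ?b" if "x \<in> ?S" for x using \<pi> that unfolding projection_def by blast
  have lip: "norm (hmap (?c x) - hmap (?c y)) \<le> norm (x - y) \<and> norm (h (?c x) - h (?c y)) \<le> norm (x - y)"
    if x: "x \<in> ?S" "x \<noteq> p" and y: "y \<in> ?S" "y \<noteq> p" for x y
  proof -
    have main: "norm (hmap (?c x) - hmap (?c y)) \<le> norm (x - y) \<and> norm (h (?c x) - h (?c y)) \<le> norm (x - y)"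
      if y: "y \<in> ?S" "y \<noteq> p" and x: "x \<in> closed_segment ?b y" for x y
    proof -
      have yV: "y \<in> ?V" by (rule vis[OF y])
      obtain U \<eta> where U: "branch U \<eta>" "convex U" "closed_segment (\<pi> y) y \<subseteq> U" "\<eta> (\<pi> y) = \<beta> (\<pi> y)"
        "closed_segment (\<pi> y) y \<subseteq> visible \<pi> B \<beta>" "\<And>x. x \<in> closed_segment (\<pi> y) y \<Longrightarrow> ?c x = \<eta> x"
        by (rule visible_segment[OF \<pi> yV]) (rule that)
      have "x \<in> closed_segment (\<pi> y) y" "y \<in> closed_segment (\<pi> y) y" using x pi[OF y(1)] by auto
      then show ?thesis using branch_lipschitz[OF U(1,2), of x y] U(3,6) by auto
    qed
    from x(1) y(1) have "x \<in> closed_segment ?b y \<or> y \<in> closed_segment ?b x"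
    proof -
      obtain s t where st: "0 \<le> s" "s \<le> 1" "x = ?b + s *\<^sub>R (p - ?b)" "0 \<le> t" "t \<le> 1" "y = ?b + t *\<^sub>R (p - ?b)"
        using x(1) y(1) unfolding in_segment by (auto simp: algebra_simps)
      have aux: "?b + s *\<^sub>R (p - ?b) \<in> closed_segment ?b (?b + t *\<^sub>R (p - ?b))" if "0 \<le> s" "s \<le> t" for s t :: real
      proof (cases "t = 0")
        case False
        then have "?b + s *\<^sub>R (p - ?b) = (1 - s/t) *\<^sub>R ?b + (s/t) *\<^sub>R (?b + t *\<^sub>R (p - ?b))"
          by (simp add: algebra_simps)
        moreover have "0 \<le> s/t" "s/t \<le> 1" using that False by (auto simp: divide_le_eq)
        ultimately show ?thesis unfolding in_segment by blast
      qed (use that in simp)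
      show ?thesis using aux[of s t] aux[of t s] st by (metis linear)
    qed
    then show ?thesis using main[OF y] main[OF x] by (metis norm_minus_commute)
  qed
  define x where "x n = p + (1 / (real n + 1)) *\<^sub>R (?b - p)" for n
  have xS: "x n \<in> ?S" "x n \<noteq> p" for n
  proof -
    have "x n = (1 - (1 - 1 / (real n + 1))) *\<^sub>R ?b + (1 - 1 / (real n + 1)) *\<^sub>R p" by (simp add: x_def algebra_simps)
    moreover have "0 \<le> 1 - 1 / (real n + 1)" "1 - 1 / (real n + 1) \<le> 1" by (auto simp: field_simps)
    ultimately show "x n \<in> ?S" unfolding in_segment by blast
    show "x n \<noteq> p" using pb by (simp add: x_def)
  qed
  have xlim: "x \<longlonglongrightarrow> p"
  proof -
    have "(\<lambda>n. 1 / (real n + 1)) \<longlonglongrightarrow> 0" using LIMSEQ_inverse_real_of_nat by (simp add: inverse_eq_divide add.commute)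
    then have "(\<lambda>n. p + (1 / (real n + 1)) *\<^sub>R (?b - p)) \<longlonglongrightarrow> p + 0 *\<^sub>R (?b - p)" by (intro tendsto_intros)
    then show ?thesis by (simp add: x_def[abs_def])
  qed
  have "Cauchy (\<lambda>n. hmap (?c (x n)))"
  proof (rule metric_CauchyI)
    fix e :: real assume "0 < e"
    then obtain M where "\<forall>m\<ge>M. \<forall>n\<ge>M. dist (x m) (x n) < e"
      using metric_CauchyD[OF LIMSEQ_imp_Cauchy[OF xlim]] by blast
    then show "\<exists>M. \<forall>m\<ge>M. \<forall>n\<ge>M. dist (hmap (?c (x m))) (hmap (?c (x n))) < e"
      using lip[OF xS xS] unfolding dist_norm by (meson le_less_trans)
  qed
  then obtain z where z: "(\<lambda>n. hmap (?c (x n))) \<longlonglongrightarrow> z" using Cauchy_convergent convergent_def by blast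
  have xV: "x n \<in> ?V" for n by (rule vis[OF xS])
  have cD: "?c (x n) \<in> ball 0 1" for n by (rule branchD(3)[OF branch_visible[OF B \<pi>] xV])
  have cI: "hmap (?c (x n)) \<in> img" for n using cD unfolding img_def by blast
  show thesis
  proof
    show "z \<in> closure img" unfolding closure_sequential by (intro exI[of _ "\<lambda>n. hmap (?c (x n))"] conjI allI cI z)
    show "norm (hmap (?c y) - z) \<le> norm (y - p)" if y: "y \<in> ?S" "y \<noteq> p" for y
    proof (rule LIMSEQ_le)
      show "(\<lambda>n. norm (hmap (?c y) - hmap (?c (x n)))) \<longlonglongrightarrow> norm (hmap (?c y) - z)" by (intro tendsto_intros z)
      show "(\<lambda>n. norm (y - x n)) \<longlonglongrightarrow> norm (y - p)" by (intro tendsto_intros xlim)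
      show "\<exists>N. \<forall>n\<ge>N. norm (hmap (?c y) - hmap (?c (x n))) \<le> norm (y - x n)" using lip[OF y xS] by blast
    qed
    show "\<not> blow z"
    proof
      assume bl: "blow z"
      define C where "C = norm (h (?c (x 0))) + norm (?b - p)"
      obtain \<delta> where \<delta>: "\<delta> > 0" "\<And>w. w \<in> ball 0 1 \<Longrightarrow> dist (hmap w) z < \<delta> \<Longrightarrow> C < \<bar>Re (h w)\<bar>"
        using bl unfolding blow_def by blast
      obtain n where n: "dist (hmap (?c (x n))) z < \<delta>"
        using metric_LIMSEQ_D[OF z \<delta>(1)] by blast
      have "C < \<bar>Re (h (?c (x n)))\<bar>" by (rule \<delta>(2)[OF cD n])
      also have "\<dots> \<le> norm (h (?c (x n)))" by (rule abs_Re_le_cmod)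
      also have "\<dots> \<le> norm (h (?c (x 0))) + norm (h (?c (x n)) - h (?c (x 0)))" by (rule norm_triangle_sub)
      also have "norm (h (?c (x n)) - h (?c (x 0))) \<le> norm (x n - x 0)" using lip[OF xS xS] by blast
      also have "\<dots> \<le> norm (?b - p)"
        using dist_in_closed_segment[OF xS(1)[of n]] by (auto simp: x_def dist_norm norm_minus_commute)
      finally show False by (simp add: C_def)
    qed
    show "z \<notin> img"
    proof
      assume zi: "z \<in> img"
      define w where "w = inv_into (ball 0 1) hmap z"
      have w: "w \<in> ball 0 1" using zi unfolding w_def img_def by (rule inv_into_into)
      have "(\<lambda>n. inv_into (ball 0 1) hmap (hmap (?c (x n)))) \<longlonglongrightarrow> w"
        unfolding w_def by (rule continuous_on_tendsto_compose[OF cont_inverse z zi]) (use cI in auto)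
      then have cw: "(\<lambda>n. ?c (x n)) \<longlonglongrightarrow> w" using cD inv_into_f_f[OF inj_hmap] by simp
      have "(\<lambda>n. 2 * H1 (?c (x n))) \<longlonglongrightarrow> 2 * H1 w"
        by (intro tendsto_intros continuous_on_tendsto_compose[OF holomorphic_on_imp_continuous_on[OF hol1] cw w]) (use cD in auto)
      moreover have "2 * H1 (?c (x n)) = x n" for n by (rule branchD(4)[OF branch_visible[OF B \<pi>] xV])
      ultimately have wp: "2 * H1 w = p" using LIMSEQ_unique xlim by simp
      obtain r g M where g: "r > 0" "branch (ball p r) g" "open M" "w \<in> M"
        "\<And>v. v \<in> M \<Longrightarrow> 2 * H1 v \<in> ball p r \<Longrightarrow> g (2 * H1 v) = v"
        using local_branch[OF w] unfolding wp by metis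
      have "eventually (\<lambda>n. ?c (x n) \<in> M) sequentially" using cw g(3,4) topological_tendstoD by blast
      moreover have "eventually (\<lambda>n. x n \<in> ball p r) sequentially"
        using xlim g(1) topological_tendstoD[of x p sequentially "ball p r"] by simp
      ultimately have "eventually (\<lambda>n. ?c (x n) \<in> M \<and> x n \<in> ball p r) sequentially" by (rule eventually_conj)
      then obtain n where n: "?c (x n) \<in> M" "x n \<in> ball p r" using eventually_happens'[OF sequentially_bot] by blast
      have gx: "g (x n) = ?c (x n)"
        using g(5)[OF n(1)] n(2) branchD(4)[OF branch_visible[OF B \<pi>] xV] by simp
      obtain U \<eta> where U: "branch U \<eta>" "convex U" "closed_segment (\<pi> (x n)) (x n) \<subseteq> U" "\<eta> (\<pi> (x n)) = \<beta> (\<pi> (x n))"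
        "closed_segment (\<pi> (x n)) (x n) \<subseteq> ?V" "\<And>y. y \<in> closed_segment (\<pi> (x n)) (x n) \<Longrightarrow> ?c y = \<eta> y"
        by (rule visible_segment[OF \<pi> xV]) (rule that)
      have pix: "\<pi> (x n) = ?b" by (rule pi[OF xS(1)])
      have xU: "x n \<in> U" "?b \<in> U" using U(3) unfolding pix by auto
      have "\<eta> (x n) = g (x n)" using U(6)[of "x n"] gx by simp
      then have "\<eta> y = g y" if "y \<in> U \<inter> ball p r" for y
        using branch_unique[OF U(1) g(2) U(2) convex_ball xU(1) n(2)] that by auto
      then have bU: "branch (U \<union> ball p r) (\<lambda>\<xi>. if \<xi> \<in> U then \<eta> \<xi> else g \<xi>)" by (rule branch_Un[OF U(1) g(2)])
      have "?S \<subseteq> U \<union> ball p r"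
      proof -
        have "?S = closed_segment ?b (x n) \<union> closed_segment (x n) p" using Un_closed_segment[OF xS(1)] by simp
        moreover have "closed_segment (x n) p \<subseteq> ball p r" using closed_segment_subset[of "x n" "ball p r" p] n(2) g(1) by auto
        ultimately show ?thesis using U(3) unfolding pix by blast
      qed
      then obtain e where e: "e > 0" "(\<Union>y\<in>?S. ball y e) \<subseteq> U \<union> ball p r"
        using compact_subset_open_imp_ball_epsilon_subset[OF compact_segment] branchD(1)[OF bU] by blast
      have eq: "(\<Union>y\<in>?S. ball y e) = (\<Union>y\<in>?S. \<Union>v\<in>ball 0 e. {y + v})"
      proof (intro set_eqI iffI)
        fix u assume "u \<in> (\<Union>y\<in>?S. ball y e)"
        then obtain y where y: "y \<in> ?S" "u - y \<in> ball 0 e" by (auto simp: dist_norm norm_minus_commute)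
        have "u \<in> (\<Union>v\<in>ball 0 e. {y + v})" by (rule UN_I[OF y(2)]) simp
        then show "u \<in> (\<Union>y\<in>?S. \<Union>v\<in>ball 0 e. {y + v})" using y(1) by blast
      next
        fix u assume "u \<in> (\<Union>y\<in>?S. \<Union>v\<in>ball 0 e. {y + v})"
        then obtain y v where y: "y \<in> ?S" "v \<in> ball 0 e" "u = y + v" by blast
        then have "u \<in> ball y e" by (simp add: dist_norm)
        then show "u \<in> (\<Union>y\<in>?S. ball y e)" using y(1) by blast
      qed
      have conv: "convex (\<Union>y\<in>?S. ball y e)" unfolding eq by (rule convex_sums) auto
      have bb: "branch (\<Union>y\<in>?S. ball y e) (\<lambda>\<xi>. if \<xi> \<in> U then \<eta> \<xi> else g \<xi>)"
        by (rule branch_subset[OF bU _ e(2)]) auto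
      have "p \<in> (\<Union>y\<in>?S. ball y e)" "?b \<in> (\<Union>y\<in>?S. ball y e)" using e(1) by force+
      moreover have "(if ?b \<in> U then \<eta> ?b else g ?b) = \<beta> ?b" using xU(2) U(4) pix by simp
      ultimately have "p \<in> ?V" unfolding visible_def using bb conv b(1) by blast
      then show False using p by blast
    qed
  qed
qed

lemma maximal_disc:
  assumes w: "w \<in> ball 0 1" and R: "R > 0"
  obtains (full) \<eta> where "branch (ball (2 * H1 w) R) \<eta>" "\<eta> (2 * H1 w) = w"
  | (stop) \<eta> p z where "branch (ball (2 * H1 w) (dist (2 * H1 w) p)) \<eta>" "\<eta> (2 * H1 w) = w"
      "p \<noteq> 2 * H1 w" "dist (2 * H1 w) p < R" "z \<notin> img" "z \<in> closure img" "\<not> blow z"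
      "\<And>x. x \<in> ball (2 * H1 w) (dist (2 * H1 w) p) \<Longrightarrow> norm (hmap (\<eta> x) - z) \<le> norm (x - p)"
proof -
  define \<xi> where "\<xi> = 2 * H1 w"
  obtain r g M where g: "r > 0" "branch (ball \<xi> r) g" "g \<xi> = w"
    using local_branch[OF w] unfolding \<xi>_def by metis
  define \<pi> where "\<pi> = (\<lambda>x::complex. \<xi>)"
  have \<pi>: "projection \<pi>" unfolding projection_def \<pi>_def by auto
  let ?V = "visible \<pi> (ball \<xi> r) g" and ?c = "continuation \<pi> g"
  have br: "branch ?V ?c" by (rule branch_visible[OF g(2) \<pi>])
  have base: "\<xi> \<in> ?V" "?c \<xi> = w" using base_visible[OF g(2), of \<xi> \<pi>] g by (auto simp: \<pi>_def)
  show thesis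
  proof (cases "ball \<xi> R \<subseteq> ?V")
    case True
    then show thesis using full[of ?c] branch_subset[OF br] base unfolding \<xi>_def by auto
  next
    case False
    have "closed (- ?V)" using branchD(1)[OF br] by (rule closed_Compl)
    then obtain p where p: "p \<in> - ?V" "\<And>y. y \<in> - ?V \<Longrightarrow> dist \<xi> p \<le> dist \<xi> y"
      using distance_attains_inf[of "- ?V" \<xi>] False by blast
    have sub: "ball \<xi> (dist \<xi> p) \<subseteq> ?V" using p(2) by force
    have pR: "dist \<xi> p < R" using False p(2) by force
    have p\<xi>: "p \<noteq> \<xi>" using p(1) base by auto
    have seg: "x \<in> ball \<xi> (dist \<xi> p)" if "x \<in> closed_segment \<xi> p" "x \<noteq> p" for x
      using that p\<xi> dist_decreases_open_segment[of x \<xi> p \<xi>] by (cases "x = \<xi>") (auto simp: open_segment_def dist_commute)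
    obtain z where z: "z \<notin> img" "z \<in> closure img" "\<not> blow z"
      "\<And>x. x \<in> closed_segment (\<pi> p) p \<Longrightarrow> x \<noteq> p \<Longrightarrow> norm (hmap (?c x) - z) \<le> norm (x - p)"
      by (rule visible_end[OF g(2) \<pi>, of p]) (use p(1) g(1) seg sub in \<open>auto simp: \<pi>_def\<close>)
    have bb: "branch (ball \<xi> (dist \<xi> p)) ?c" by (rule branch_subset[OF br _ sub]) simp
    have "norm (hmap (?c x) - z) \<le> norm (x - p)" if x: "x \<in> ball \<xi> (dist \<xi> p)" for x
    proof (rule field_le_epsilon)
      fix e :: real assume e: "e > 0"
      define t where "t = min 1 (e / (2 * dist \<xi> p))"
      have d: "dist \<xi> p > 0" using p\<xi> by simp
      have t: "0 < t" "t \<le> 1" "t * dist \<xi> p \<le> e/2" using e d by (auto simp: t_def min_def field_simps)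
      define y where "y = p + t *\<^sub>R (\<xi> - p)"
      have "y = (1 - (1 - t)) *\<^sub>R \<xi> + (1 - t) *\<^sub>R p" by (simp add: y_def algebra_simps)
      then have yS: "y \<in> closed_segment \<xi> p" unfolding in_segment using t by (intro exI[of _ "1 - t"]) auto
      have yp: "y \<noteq> p" using t p\<xi> by (simp add: y_def)
      have ny: "norm (y - p) \<le> e/2" using t by (simp add: y_def dist_norm)
      have "norm (hmap (?c x) - z) \<le> norm (hmap (?c x) - hmap (?c y)) + norm (hmap (?c y) - z)"
        using norm_triangle_ineq[of "hmap (?c x) - hmap (?c y)" "hmap (?c y) - z"] by simp
      also have "norm (hmap (?c x) - hmap (?c y)) \<le> norm (x - y)"
        by (rule branch_lipschitz(1)[OF bb convex_ball x seg[OF yS yp]])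
      also have "norm (x - y) \<le> norm (x - p) + norm (y - p)" by (metis norm_triangle_sub norm_minus_commute add.commute dist_norm dist_triangle2)
      also have "norm (hmap (?c y) - z) \<le> norm (y - p)" using z(4)[of y] yS yp by (simp add: \<pi>_def)
      finally show "norm (hmap (?c x) - z) \<le> norm (x - p) + e" using ny by simp
    qed
    then show thesis
      using stop[of p ?c z] bb base p\<xi> pR z(1-3) unfolding \<xi>_def by auto
  qed
qed

end

section \<open>Sectors with infinite data\<close>

context harmonic_graph
begin

lemma om_near:
  assumes b: "branch (ball \<xi> R) \<eta>" and s: "0 \<le> s" "s < R" and x: "dist \<xi> x \<le> s"
  shows "norm (1 - om (\<eta> x)) \<le> norm (1 - om (\<eta> \<xi>)) * (2 * R) / (R - s)"
proof -
  have R: "R > 0" using s by simp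
  have hE: "(\<lambda>y. 1 - om (\<eta> y)) holomorphic_on ball \<xi> R"
  proof -
    have "(om \<circ> \<eta>) holomorphic_on ball \<xi> R"
      by (rule holomorphic_on_compose_gen[OF branchD(2)[OF b] om_holomorphic]) (use b in \<open>auto simp: branch_def\<close>)
    then show ?thesis by (intro holomorphic_intros) (simp add: o_def)
  qed
  have pos: "0 < Re (1 - om (\<eta> y))" if "y \<in> ball \<xi> R" for y
    using om_less_1[OF branchD(3)[OF b that]] complex_Re_le_cmod[of "om (\<eta> y)"] by simp
  have xb: "x \<in> ball \<xi> R" using x s by simp
  have "norm (1 - om (\<eta> x)) \<le> norm (1 - om (\<eta> \<xi>)) * (R + dist \<xi> x) / (R - dist \<xi> x)"
    by (rule Re_pos_ball_bounds(2)[OF hE R pos xb])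
  also have "\<dots> \<le> norm (1 - om (\<eta> \<xi>)) * (2 * R) / (R - s)"
    using x s by (intro frac_le mult_left_mono mult_nonneg_nonneg) auto
  finally show ?thesis .
qed

lemma near_horizontal_projection:
  assumes b: "branch (ball \<xi> R) \<eta>" and s: "0 \<le> s" "s < R" and x: "dist \<xi> x \<le> s"
  shows "norm (hmap (\<eta> x) - (hmap (\<eta> \<xi>) + of_real (Re (x - \<xi>)))) \<le> norm (1 - om (\<eta> \<xi>)) * (R / (R - s)) * s"
proof -
  have R: "R > 0" using s by simp
  have bound: "norm ((om (\<eta> y) - 1) / 2) \<le> norm (1 - om (\<eta> \<xi>)) * (R / (R - s))" if y: "y \<in> cball \<xi> s" for y
  proof -
    have "norm (1 - om (\<eta> y)) \<le> norm (1 - om (\<eta> \<xi>)) * (2 * R) / (R - s)"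
      by (rule om_near[OF assms(1) s]) (use y in simp)
    also have "\<dots> = 2 * (norm (1 - om (\<eta> \<xi>)) * (R / (R - s)))" by (simp only: times_divide_eq_right mult.assoc mult.left_commute)
    finally have "norm (1 - om (\<eta> y)) \<le> 2 * (norm (1 - om (\<eta> \<xi>)) * (R / (R - s)))" .
    then have "norm (1 - om (\<eta> y)) / 2 \<le> norm (1 - om (\<eta> \<xi>)) * (R / (R - s))" by linarith
    moreover have "norm ((om (\<eta> y) - 1) / 2) = norm (1 - om (\<eta> y)) / 2" by (simp add: norm_divide norm_minus_commute)
    ultimately show ?thesis by metis
  qed
  let ?u = "\<lambda>y. H2 (\<eta> y) - y / 2"
  have "norm (?u x - ?u \<xi>) \<le> norm (1 - om (\<eta> \<xi>)) * (R / (R - s)) * norm (x - \<xi>)"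
  proof (rule field_differentiable_bound[of "cball \<xi> s" ?u "\<lambda>y. (om (\<eta> y) - 1) / 2"])
    show "(?u has_field_derivative (om (\<eta> y) - 1) / 2) (at y within cball \<xi> s)" if y: "y \<in> cball \<xi> s" for y
    proof -
      have "y \<in> ball \<xi> R" using y s by simp
      then have "((\<lambda>y. H2 (\<eta> y)) has_field_derivative om (\<eta> y) / 2) (at y within cball \<xi> s)"
        using branch_deriv_H2[OF b] has_field_derivative_at_within by blast
      then show ?thesis by (auto intro!: derivative_eq_intros simp: diff_divide_distrib)
    qed
  qed (use bound x s in auto)
  also have "\<dots> \<le> norm (1 - om (\<eta> \<xi>)) * (R / (R - s)) * s"
    using x s by (intro mult_left_mono mult_nonneg_nonneg) (auto simp: dist_norm norm_minus_commute)
  finally have A: "norm (?u x - ?u \<xi>) \<le> norm (1 - om (\<eta> \<xi>)) * (R / (R - s)) * s" .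
  have xi: "x \<in> ball \<xi> R" "\<xi> \<in> ball \<xi> R" using x s by auto
  have "hmap (\<eta> x) - (hmap (\<eta> \<xi>) + of_real (Re (x - \<xi>))) = cnj (?u x - ?u \<xi>)"
    using branch_hmap[OF b xi(1)] branch_hmap[OF b xi(2)] by (simp add: complex_eq_iff field_simps)
  then show ?thesis using A by (simp only: complex_mod_cnj)
qed

lemma half_disc_branch:
  assumes c: "c > 0" and HD: "img \<inter> ball p c = {z \<in> ball p c. Im p < Im z}"
    and bl: "\<And>q. q \<in> ball p c \<Longrightarrow> Im q = Im p \<Longrightarrow> blow q"
    and w: "w \<in> ball 0 1" and hw: "hmap w \<in> ball p (c/2)"
  obtains \<eta> where "branch (ball (2 * H1 w) (c/2)) \<eta>" "\<eta> (2 * H1 w) = w"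
    "norm (1 - om w) \<le> 8 * (Im (hmap w) - Im p) / c"
proof -
  have c2: "c/2 > 0" using c by simp
  show thesis
  proof (rule maximal_disc[OF w c2])
    fix \<eta> assume b: "branch (ball (2 * H1 w) (c/2)) \<eta>" and \<eta>: "\<eta> (2 * H1 w) = w"
    let ?\<xi> = "2 * H1 w"
    have in_img: "hmap (\<eta> x) \<in> img" if "x \<in> ball ?\<xi> (c/2)" for x
      using branchD(3)[OF b that] by (simp add: img_def)
    have up: "Im p < Im (hmap (\<eta> x))" if x: "x \<in> ball ?\<xi> (c/2)" for x
    proof -
      have "norm (hmap (\<eta> x) - hmap (\<eta> ?\<xi>)) \<le> norm (x - ?\<xi>)"
        by (rule branch_lipschitz(1)[OF b convex_ball x]) (use c in simp)
      also have "\<dots> < c/2" using x by (simp add: dist_norm norm_minus_commute)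
      finally have "dist (hmap w) (hmap (\<eta> x)) < c/2" by (simp add: \<eta> dist_norm norm_minus_commute)
      moreover have "dist p (hmap (\<eta> x)) \<le> dist p (hmap w) + dist (hmap w) (hmap (\<eta> x))" by (rule dist_triangle)
      ultimately have "hmap (\<eta> x) \<in> ball p c" using hw by simp
      then show ?thesis using HD in_img[OF x] by blast
    qed
    define P where "P x = - \<i> * (x / 2 - H2 (\<eta> x)) - of_real (Im p)" for x
    have dP: "(P has_field_derivative - \<i> * ((1 - om (\<eta> x)) / 2)) (at x)" if x: "x \<in> ball ?\<xi> (c/2)" for x
      unfolding P_def using branch_deriv_H2[OF b x] by (auto intro!: derivative_eq_intros simp: field_simps)
    have ReP: "Re (P x) = Im (hmap (\<eta> x)) - Im p" if x: "x \<in> ball ?\<xi> (c/2)" for x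
      using branch_hmap[OF b x] by (simp add: P_def)
    have "norm (deriv P ?\<xi>) \<le> 2 * Re (P ?\<xi>) / (c/2)"
    proof (rule Re_pos_ball_bounds(1)[OF _ c2])
      show "P holomorphic_on ball ?\<xi> (c/2)" unfolding holomorphic_on_open[OF open_ball] using dP by blast
    qed (use up ReP in auto)
    moreover have "deriv P ?\<xi> = - \<i> * ((1 - om w) / 2)"
      using DERIV_imp_deriv[OF dP[of ?\<xi>]] c by (simp add: \<eta>)
    moreover have "Re (P ?\<xi>) = Im (hmap w) - Im p" using ReP[of ?\<xi>] c by (simp add: \<eta>)
    moreover have "norm (- \<i> * ((1 - om w) / 2)) = norm (1 - om w) / 2" by (simp only: norm_mult norm_divide) simp
    ultimately have "norm (1 - om w) / 2 \<le> 2 * (Im (hmap w) - Im p) / (c/2)" by metis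
    then have "norm (1 - om w) \<le> 8 * (Im (hmap w) - Im p) / c" by simp
    then show thesis using that[OF b \<eta>] by blast
  next
    fix \<eta> q z assume b: "branch (ball (2 * H1 w) (dist (2 * H1 w) q)) \<eta>" and \<eta>: "\<eta> (2 * H1 w) = w"
      and q: "q \<noteq> 2 * H1 w" "dist (2 * H1 w) q < c/2" and z: "z \<notin> img" "z \<in> closure img" "\<not> blow z"
      and near: "\<And>x. x \<in> ball (2 * H1 w) (dist (2 * H1 w) q) \<Longrightarrow> norm (hmap (\<eta> x) - z) \<le> norm (x - q)"
    have "norm (hmap w - z) \<le> norm (2 * H1 w - q)" using near[of "2 * H1 w"] q(1) \<eta> by simp
    then have "dist (hmap w) z < c/2" using q(2) by (simp add: dist_norm)
    moreover have "dist p z \<le> dist p (hmap w) + dist (hmap w) z" by (rule dist_triangle)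
    ultimately have zb: "z \<in> ball p c" using hw by simp
    then have "Im z \<le> Im p" using HD z(1) by force
    moreover have "Im p \<le> Im z"
    proof -
      have "z \<in> closure (ball p c \<inter> img)" using open_Int_closure_subset[OF open_ball, of p c img] zb z(2) by blast
      also have "closure (ball p c \<inter> img) \<subseteq> {z. Im p \<le> Im z}"
      proof (rule closure_minimal)
        show "ball p c \<inter> img \<subseteq> {z. Im p \<le> Im z}"
        proof
          fix y assume "y \<in> ball p c \<inter> img"
          then have "y \<in> img \<inter> ball p c" by blast
          then have "Im p < Im y" unfolding HD by blast
          then show "y \<in> {z. Im p \<le> Im z}" by simp
        qed
      qed (rule closed_halfspace_Im_ge)
      finally show ?thesis by simp
    qed
    ultimately have "blow z" using bl[OF zb] by simp
    then show thesis using z(3) by simp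
  qed
qed

end

locale harmonic_sector = harmonic_graph +
  fixes r \<alpha> :: real
  assumes r_pos: "0 < r" and alpha: "0 < \<alpha>" "\<alpha> < 2 * pi"
    and sector: "img \<inter> ball 0 r = {rcis s t | s t. 0 < s \<and> s < r \<and> 0 < t \<and> t < \<alpha>}"
    and up_first: "\<lbrakk>0 < s; s < r\<rbrakk> \<Longrightarrow> \<exists>\<delta>>0. \<forall>w\<in>ball 0 1. dist (hmap w) (of_real s) < \<delta> \<longrightarrow> N < Re (h w)"
    and blow_second: "\<lbrakk>0 < s; s < r\<rbrakk> \<Longrightarrow> blow (rcis s \<alpha>)"
    and bounded_opposite: "\<lbrakk>0 < s; s < r\<rbrakk> \<Longrightarrow> \<exists>B. \<exists>\<delta>>0. \<forall>w\<in>ball 0 1. dist (hmap w) (- of_real s) < \<delta> \<longrightarrow> Re (h w) \<le> B"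
begin

lemma blow_first: assumes "0 < s" "s < r" shows "blow (of_real s)"
  unfolding blow_def
proof
  fix B
  obtain \<delta> where "\<delta> > 0" "\<forall>w\<in>ball 0 1. dist (hmap w) (of_real s) < \<delta> \<longrightarrow> B < Re (h w)"
    using up_first[OF assms, of B] by blast
  then show "\<exists>\<delta>>0. \<forall>w\<in>ball 0 1. dist (hmap w) (of_real s) < \<delta> \<longrightarrow> B < \<bar>Re (h w)\<bar>"
    by (intro exI[of _ \<delta>]) force
qed

lemma zero_notin_img: "0 \<notin> img"
proof
  assume "0 \<in> img"
  then have "0 \<in> img \<inter> ball 0 r" using r_pos by simp
  then show False unfolding sector by auto
qed

lemma sector_closure:
  assumes "z \<in> closure img" "norm z < r"
  shows "\<exists>t. 0 \<le> t \<and> t \<le> \<alpha> \<and> z = rcis (norm z) t"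
proof -
  let ?K = "(\<lambda>(s, t). rcis s t) ` ({0..r} \<times> {0..\<alpha>})"
  have "compact ?K"
    by (intro compact_continuous_image compact_Times compact_Icc)
      (auto simp: case_prod_unfold rcis_def intro!: continuous_intros)
  then have "closed ?K" by (rule compact_imp_closed)
  moreover have "ball 0 r \<inter> img \<subseteq> ?K" using sector by (auto simp: Int_commute)
  ultimately have "closure (ball 0 r \<inter> img) \<subseteq> ?K" by (rule closure_minimal[rotated])
  moreover have "z \<in> closure (ball 0 r \<inter> img)"
    using open_Int_closure_subset[OF open_ball, of 0 r img] assms by auto
  ultimately have "z \<in> ?K" by blast
  then obtain x where "x \<in> {0..r} \<times> {0..\<alpha>}" "z = (\<lambda>(s, t). rcis s t) x" by blast
  then obtain s t where "0 \<le> s" "0 \<le> t" "t \<le> \<alpha>" "z = rcis s t" by (cases x) auto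
  then show ?thesis by (intro exI[of _ t]) auto
qed

lemma sector_end:
  assumes "z \<notin> img" "z \<in> closure img" "\<not> blow z" "norm z < r"
  shows "z = 0"
proof (rule ccontr)
  assume nz: "z \<noteq> 0"
  obtain t where t: "0 \<le> t" "t \<le> \<alpha>" "z = rcis (norm z) t" using sector_closure[OF assms(2,4)] by blast
  have p: "0 < norm z" using nz by simp
  consider "t = 0" | "t = \<alpha>" | "0 < t" "t < \<alpha>" using t by linarith
  then show False
  proof cases
    case 1
    then have "z = of_real (norm z)" using t(3) by (simp add: rcis_def)
    then show False using blow_first[OF p assms(4)] assms(3) by simp
  next
    case 2
    then show False using blow_second[OF p assms(4)] t(3) assms(3) by simp
  next
    case 3
    then have "z \<in> img \<inter> ball 0 r" unfolding sector using t(3) p assms(4) by blast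
    then show False using assms(1) by simp
  qed
qed

lemma half_disc_at:
  assumes \<rho>: "0 < \<rho>" "\<rho> < r"
  obtains c where "c > 0" "img \<inter> ball (of_real \<rho>) c = {z \<in> ball (of_real \<rho>) c. 0 < Im z}"
    "\<And>q. q \<in> ball (of_real \<rho>) c \<Longrightarrow> Im q = 0 \<Longrightarrow> blow q"
proof -
  define m where "m = max 0 (cos \<alpha>)"
  have cos1: "cos \<alpha> < 1"
  proof -
    have "cos \<alpha> \<noteq> 1"
    proof
      assume "cos \<alpha> = 1"
      then obtain n :: int where n: "\<alpha> = n * 2 * pi" using cos_one_2pi_int by auto
      then have "0 < n" using alpha(1) by (simp add: zero_less_mult_iff)
      then have "1 \<le> real_of_int n" by simp
      then have "1 * (2 * pi) \<le> real_of_int n * (2 * pi)" by (intro mult_right_mono) auto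
      then show False using alpha n by simp
    qed
    then show ?thesis using cos_le_one[of \<alpha>] by linarith
  qed
  have m: "0 \<le> m" "m < 1" using cos1 by (auto simp: m_def)
  define c where "c = min (\<rho> * (1 - m) / 2) (r - \<rho>)"
  have c: "c > 0" "c \<le> \<rho> * (1 - m) / 2" "c \<le> r - \<rho>"
    using \<rho> m unfolding c_def by (simp, intro min.cobounded1, intro min.cobounded2)
  have loc: "0 < Re z \<and> m * norm z < Re z \<and> norm z < r" if z: "z \<in> ball (of_real \<rho>) c" for z
  proof -
    have d: "norm (z - of_real \<rho>) < c" using z by (simp add: dist_norm norm_minus_commute)
    have "\<bar>Re (z - of_real \<rho>)\<bar> < c" using abs_Re_le_cmod[of "z - of_real \<rho>"] d by simp
    then have 1: "\<rho> - c < Re z" by auto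
    have 2: "norm z < \<rho> + c" using norm_triangle_ineq2[of z "of_real \<rho>"] d \<rho>(1) by simp
    have "m * (\<rho> + c) \<le> \<rho> - c"
    proof -
      have "c * (1 + m) \<le> c * 2" using m c by (intro mult_left_mono) auto
      also have "\<dots> \<le> \<rho> * (1 - m)" using c(2) by simp
      finally show ?thesis by (simp add: algebra_simps)
    qed
    moreover have "m * norm z \<le> m * (\<rho> + c)" using 2 m by (intro mult_left_mono) auto
    ultimately have 3: "m * norm z < Re z" using 1 by linarith
    then have "0 < Re z" using m(1) by (meson le_less_trans mult_nonneg_nonneg norm_ge_zero)
    then show ?thesis using 3 2 c(3) by auto
  qed
  show thesis
  proof
    show "c > 0" by fact
    show "blow q" if q: "q \<in> ball (of_real \<rho>) c" "Im q = 0" for q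
    proof -
      have "q = of_real (Re q)" using q(2) by (simp add: complex_eq_iff)
      moreover have "Re q < r" using loc[OF q(1)] complex_Re_le_cmod[of q] by linarith
      ultimately show ?thesis using blow_first[of "Re q"] loc[OF q(1)] by metis
    qed
    show "img \<inter> ball (of_real \<rho>) c = {z \<in> ball (of_real \<rho>) c. 0 < Im z}"
    proof (intro set_eqI iffI)
      fix z assume "z \<in> {z \<in> ball (complex_of_real \<rho>) c. 0 < Im z}"
      then have z: "z \<in> ball (of_real \<rho>) c" "0 < Im z" by auto
      have nz: "0 < norm z" using z(2) by auto
      have A: "0 < Arg z" "Arg z < pi" using Arg_lt_pi z(2) by auto
      have zr: "z = rcis (norm z) (Arg z)" by (simp add: rcis_cmod_Arg)
      have "Re z = norm z * cos (Arg z)" using arg_cong[OF zr, of Re] by simp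
      then have "norm z * m < norm z * cos (Arg z)" using loc[OF z(1)] by (simp add: mult.commute)
      then have "cos \<alpha> < cos (Arg z)" using nz by (auto simp: m_def)
      then have "Arg z < \<alpha>"
        using cos_mono_less_eq[of \<alpha> "Arg z"] A alpha by (cases "\<alpha> \<le> pi") auto
      then have "z \<in> img \<inter> ball 0 r" unfolding sector using A nz loc[OF z(1)] zr by blast
      then show "z \<in> img \<inter> ball (of_real \<rho>) c" using z by blast
    next
      fix z assume z: "z \<in> img \<inter> ball (of_real \<rho>) c"
      then have "z \<in> img \<inter> ball 0 r" using loc[of z] by simp
      then obtain s t where st: "z = rcis s t" "0 < s" "0 < t" "t < \<alpha>" unfolding sector by blast
      have "0 < sin t"
      proof (rule ccontr)
        assume "\<not> 0 < sin t"
        then have "pi \<le> t" using sin_gt_zero[OF st(3)] by linarith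
        then have "cos (2 * pi - t) \<le> cos (2 * pi - \<alpha>)"
          using st alpha by (intro cos_monotone_0_pi_le) auto
        then have "cos t \<le> m" by (simp add: m_def cos_diff)
        then have "Re z \<le> m * norm z" using st by (simp add: mult.commute)
        then show False using loc[of z] z by auto
      qed
      then show "z \<in> {z \<in> ball (of_real \<rho>) c. 0 < Im z}" using z st by simp
    qed
  qed
qed

text \<open>Near the first side the surface is almost a vertical plane. If the maximal disc were larger than the
  distance to the vertex, the image would pass beyond the vertex at a great height.\<close>

lemma disc_reaches_vertex:
  assumes \<rho>: "0 < \<rho>" "8 * \<rho> < r" and e: "0 < e"
  obtains d where "d > 0" "\<And>w. w \<in> ball 0 1 \<Longrightarrow> dist (hmap w) (of_real \<rho>) < d \<Longrightarrow>
    \<exists>\<eta> p. branch (ball (2 * H1 w) (dist (2 * H1 w) p)) \<eta> \<and> \<eta> (2 * H1 w) = w \<and>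
      (\<forall>x \<in> ball (2 * H1 w) (dist (2 * H1 w) p). norm (hmap (\<eta> x)) \<le> norm (x - p)) \<and>
      999/1000 * \<rho> \<le> dist (2 * H1 w) p \<and> dist (2 * H1 w) p \<le> 1001/1000 * \<rho> \<and>
      Re (p - 2 * H1 w) < 0 \<and> \<bar>Im (p - 2 * H1 w)\<bar> \<le> \<rho>/10 \<and>
      (\<forall>x \<in> cball (2 * H1 w) (9/10 * \<rho>). norm (hmap (\<eta> x) - (hmap w + of_real (Re (x - 2 * H1 w)))) \<le> e)"
proof -
  have \<rho>r: "\<rho> < r" using \<rho> by linarith
  obtain c where c: "c > 0" "img \<inter> ball (of_real \<rho>) c = {z \<in> ball (of_real \<rho>) c. 0 < Im z}"
    "\<And>q. q \<in> ball (of_real \<rho>) c \<Longrightarrow> Im q = 0 \<Longrightarrow> blow q"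
    using half_disc_at[OF \<rho>(1) \<rho>r] by metis
  have "0 < \<rho>/2000" "\<rho>/2000 < r" using \<rho> by auto
  from bounded_opposite[OF this] obtain B \<delta>0 where B: "\<delta>0 > 0"
    "\<And>w. w \<in> ball 0 1 \<Longrightarrow> dist (hmap w) (- of_real (\<rho>/2000)) < \<delta>0 \<Longrightarrow> Re (h w) \<le> B" by blast
  obtain \<delta>1 where \<delta>1: "\<delta>1 > 0"
    "\<And>w. w \<in> ball 0 1 \<Longrightarrow> dist (hmap w) (of_real \<rho>) < \<delta>1 \<Longrightarrow> B + 2 * \<rho> < Re (h w)"
    using up_first[OF \<rho>(1) \<rho>r, of "B + 2 * \<rho>"] by blast
  define k where "k = min (min e (\<rho>/1000)) (\<delta>0/4)"
  have k: "k > 0" "k \<le> e" "k \<le> \<rho>/1000" "k \<le> \<delta>0/4" using e \<rho> B by (auto simp: k_def)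
  define d where "d = min (min \<delta>1 k) (min (c/2) (c * k / (24000 * \<rho>)))"
  have d: "d > 0" "d \<le> \<delta>1" "d \<le> k" "d \<le> c/2" "d \<le> c * k / (24000 * \<rho>)" using \<delta>1 k c \<rho> by (auto simp: d_def)
  show thesis
  proof (rule that[OF d(1)])
    fix w assume w: "w \<in> ball 0 1" and wd: "dist (hmap w) (of_real \<rho>) < d"
    let ?\<xi> = "2 * H1 w"
    have hw: "hmap w \<in> ball (of_real \<rho>) (c/2)" using wd d by (simp add: dist_commute)
    have om: "norm (1 - om w) * (3000 * \<rho>) \<le> k"
    proof -
      have "norm (1 - om w) \<le> 8 * (Im (hmap w) - Im (of_real \<rho>)) / c"
        by (rule half_disc_branch[OF c(1) _ _ w hw]) (use c in auto)
      also have "\<dots> \<le> 8 * d / c"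
      proof -
        have "Im (hmap w) \<le> norm (hmap w - of_real \<rho>)" using abs_Im_le_cmod[of "hmap w - of_real \<rho>"] by simp
        then have "Im (hmap w) \<le> d" using wd by (simp add: dist_norm)
        then show ?thesis using c by (intro divide_right_mono) auto
      qed
      also have "\<dots> \<le> 8 * (c * k / (24000 * \<rho>)) / c" using d c by (intro divide_right_mono) auto
      also have "\<dots> = k / (3000 * \<rho>)" using c \<rho> by (simp add: field_simps)
      finally show ?thesis using \<rho> by (simp add: field_simps)
    qed
    have approx: "norm (hmap (\<eta> x) - (hmap w + of_real (Re (x - ?\<xi>)))) \<le> k"
      if b: "branch (ball ?\<xi> R) \<eta>" "\<eta> ?\<xi> = w" and s: "0 \<le> s" "s < R" "dist ?\<xi> x \<le> s" and Rs: "R / (R - s) * s \<le> 3000 * \<rho>"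
      for \<eta> R s x
    proof -
      have "norm (hmap (\<eta> x) - (hmap w + of_real (Re (x - ?\<xi>)))) \<le> norm (1 - om w) * (R / (R - s)) * s"
        using near_horizontal_projection[OF b(1) s] by (simp only: b(2))
      also have "\<dots> = norm (1 - om w) * (R / (R - s) * s)" by simp
      also have "\<dots> \<le> norm (1 - om w) * (3000 * \<rho>)" using Rs by (intro mult_left_mono) auto
      finally show ?thesis using om by linarith
    qed
    have Rpos: "1001/1000 * \<rho> > 0" using \<rho> by simp
    show "\<exists>\<eta> p. branch (ball ?\<xi> (dist ?\<xi> p)) \<eta> \<and> \<eta> ?\<xi> = w \<and>
      (\<forall>x \<in> ball ?\<xi> (dist ?\<xi> p). norm (hmap (\<eta> x)) \<le> norm (x - p)) \<and>
      999/1000 * \<rho> \<le> dist ?\<xi> p \<and> dist ?\<xi> p \<le> 1001/1000 * \<rho> \<and> Re (p - ?\<xi>) < 0 \<and> \<bar>Im (p - ?\<xi>)\<bar> \<le> \<rho>/10 \<and>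
      (\<forall>x \<in> cball ?\<xi> (9/10 * \<rho>). norm (hmap (\<eta> x) - (hmap w + of_real (Re (x - ?\<xi>)))) \<le> e)"
    proof (rule maximal_disc[OF w Rpos])
      fix \<eta> assume b: "branch (ball ?\<xi> (1001/1000 * \<rho>)) \<eta>" and \<eta>: "\<eta> ?\<xi> = w"
      define s where "s = 2001/2000 * \<rho>"
      define x where "x = ?\<xi> - of_real s"
      have s: "0 \<le> s" "s < 1001/1000 * \<rho>" "dist ?\<xi> x \<le> s" using \<rho> by (auto simp: s_def x_def dist_norm)
      have xb: "x \<in> ball ?\<xi> (1001/1000 * \<rho>)" using s by simp
      have Rs: "1001/1000 * \<rho> / (1001/1000 * \<rho> - s) * s \<le> 3000 * \<rho>"
      proof -
        have eq: "1001/1000 * \<rho> - s = \<rho> / 2000" by (simp add: s_def)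
        have "1001/1000 * \<rho> / (1001/1000 * \<rho> - s) = 2002" unfolding eq using \<rho> by simp
        then show ?thesis using \<rho> by (simp only: s_def)
      qed
      have "norm (hmap (\<eta> x) - (hmap w + of_real (Re (x - ?\<xi>)))) \<le> k" by (rule approx[OF b \<eta> s Rs])
      then have n1: "norm (hmap (\<eta> x) - (hmap w - of_real s)) \<le> k" by (simp add: x_def)
      have "dist (hmap (\<eta> x)) (- of_real (\<rho>/2000)) = norm ((hmap (\<eta> x) - (hmap w - of_real s)) + (hmap w - of_real \<rho>))"
        by (simp add: dist_norm s_def field_simps)
      also have "\<dots> \<le> norm (hmap (\<eta> x) - (hmap w - of_real s)) + norm (hmap w - of_real \<rho>)" by (rule norm_triangle_ineq)
      also have "\<dots> < \<delta>0" using n1 wd d k B by (simp add: dist_norm)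
      finally have "Re (h (\<eta> x)) \<le> B" by (rule B(2)[OF branchD(3)[OF b xb]])
      moreover have "norm (h (\<eta> x) - h (\<eta> ?\<xi>)) \<le> norm (x - ?\<xi>)"
        by (rule branch_lipschitz(2)[OF b convex_ball xb]) (use \<rho> in simp)
      then have "norm (h (\<eta> x) - h w) < 2 * \<rho>" using s \<rho> unfolding \<eta> by (simp add: x_def)
      then have "Re (h w) < Re (h (\<eta> x)) + 2 * \<rho>" using abs_Re_le_cmod[of "h (\<eta> x) - h w"] by auto
      ultimately show ?thesis using \<delta>1(2)[OF w] wd d by auto
    next
      fix \<eta> p z assume b: "branch (ball ?\<xi> (dist ?\<xi> p)) \<eta>" and \<eta>: "\<eta> ?\<xi> = w"
        and p: "p \<noteq> ?\<xi>" "dist ?\<xi> p < 1001/1000 * \<rho>" and z: "z \<notin> img" "z \<in> closure img" "\<not> blow z"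
        and near: "\<And>x. x \<in> ball ?\<xi> (dist ?\<xi> p) \<Longrightarrow> norm (hmap (\<eta> x) - z) \<le> norm (x - p)"
      let ?R = "dist ?\<xi> p"
      have R0: "?R > 0" using p by simp
      have "norm (hmap w - z) \<le> ?R" using near[of ?\<xi>] R0 \<eta> by (simp add: dist_norm)
      moreover have "norm z \<le> norm (hmap w - z) + norm (hmap w - of_real \<rho>) + norm (complex_of_real \<rho>)"
        using norm_triangle_ineq4[of "hmap w - of_real \<rho>" "hmap w - z"] norm_triangle_sub[of z "complex_of_real \<rho>"]
        by (simp add: norm_minus_commute)
      ultimately have "norm z < r" using wd d k p \<rho> by (simp add: dist_norm)
      then have z0: "z = 0" by (rule sector_end[OF z])
      have near0: "norm (hmap (\<eta> x)) \<le> norm (x - p)" if "x \<in> ball ?\<xi> ?R" for x using near[OF that] z0 by simp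
      have Rlow: "999/1000 * \<rho> \<le> ?R"
      proof -
        have "norm (hmap w) \<le> ?R" using near0[of ?\<xi>] R0 \<eta> by (simp add: dist_norm)
        moreover have "\<rho> \<le> norm (hmap w) + norm (hmap w - of_real \<rho>)"
          using norm_triangle_ineq2[of "complex_of_real \<rho>" "hmap w"] norm_triangle_sub[of "complex_of_real \<rho>" "hmap w"] \<rho>
          by (simp add: norm_minus_commute)
        ultimately show ?thesis using wd d k by (simp add: dist_norm)
      qed
      have ap: "norm (hmap (\<eta> x) - (hmap w + of_real (Re (x - ?\<xi>)))) \<le> k" if x: "dist ?\<xi> x \<le> 999/1000 * ?R" for x
      proof (rule approx[OF b \<eta> _ _ x])
        have "?R / (?R - 999/1000 * ?R) = 1000" using R0 by (simp add: field_simps)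
        then show "?R / (?R - 999/1000 * ?R) * (999/1000 * ?R) \<le> 3000 * \<rho>" using p(2) \<rho>(1) by simp
      qed (use R0 in \<open>linarith+\<close>)
      define x where "x = ?\<xi> + (999/1000) * (p - ?\<xi>)"
      have Rn: "?R = norm (p - ?\<xi>)" by (simp add: dist_norm norm_minus_commute)
      have "dist ?\<xi> x = norm (999/1000 * (p - ?\<xi>))" by (metis x_def dist_commute dist_norm add_diff_cancel_left')
      then have dx: "dist ?\<xi> x = 999/1000 * ?R" by (simp only: norm_mult Rn) simp
      then have xb: "x \<in> ball ?\<xi> ?R" using R0 dx unfolding mem_ball by linarith
      have "x - p = - (1/1000) * (p - ?\<xi>)" by (simp add: x_def field_simps)
      then have "norm (x - p) = 1/1000 * ?R" by (simp only: norm_mult norm_minus_cancel Rn) simp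
      then have h1: "norm (hmap (\<eta> x)) \<le> 1/1000 * ?R" using near0[OF xb] by simp
      have h2: "norm (hmap (\<eta> x) - (hmap w + of_real (Re (x - ?\<xi>)))) \<le> k" using ap[of x] dx by simp
      have "\<bar>Re (hmap (\<eta> x) - (hmap w + of_real (Re (x - ?\<xi>))))\<bar> \<le> k" using abs_Re_le_cmod h2 order_trans by blast
      then have "Re (hmap w) + 999/1000 * Re (p - ?\<xi>) - k \<le> Re (hmap (\<eta> x))" by (auto simp: x_def)
      moreover have "Re (hmap (\<eta> x)) \<le> 1/1000 * ?R" using complex_Re_le_cmod h1 order_trans by blast
      moreover have "\<bar>Re (hmap w - of_real \<rho>)\<bar> \<le> d" using abs_Re_le_cmod[of "hmap w - of_real \<rho>"] wd by (simp add: dist_norm)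
      then have "\<rho> - d \<le> Re (hmap w)" by auto
      ultimately have Re: "Re (p - ?\<xi>) \<le> - (9965/10000 * \<rho>)" using p(2) d(3) k(3) \<rho>(1) by linarith
      have "(Re (p - ?\<xi>))\<^sup>2 + (Im (p - ?\<xi>))\<^sup>2 = ?R\<^sup>2" by (simp add: dist_norm norm_minus_commute cmod_power2)
      moreover have "(9965/10000 * \<rho>)\<^sup>2 \<le> (- Re (p - ?\<xi>))\<^sup>2" using Re \<rho> by (intro power_mono) auto
      moreover have "?R\<^sup>2 \<le> (1001/1000 * \<rho>)\<^sup>2" using p by (intro power_mono) auto
      ultimately have "(Im (p - ?\<xi>))\<^sup>2 \<le> (1001/1000 * \<rho>)\<^sup>2 - (9965/10000 * \<rho>)\<^sup>2"
        unfolding power2_minus by linarith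
      also have "\<dots> \<le> (\<rho>/10)\<^sup>2" using zero_le_square[of \<rho>] by (simp add: power2_eq_square)
      finally have "\<bar>Im (p - ?\<xi>)\<bar> \<le> \<bar>\<rho>/10\<bar>" by (simp only: abs_le_square_iff)
      then have "\<bar>Im (p - ?\<xi>)\<bar> \<le> \<rho>/10" using \<rho>(1) by linarith
      moreover have "norm (hmap (\<eta> x) - (hmap w + of_real (Re (x - ?\<xi>)))) \<le> e" if "x \<in> cball ?\<xi> (9/10 * \<rho>)" for x
        using ap[of x] that Rlow k \<rho> by auto
      moreover have "Re (p - ?\<xi>) < 0" using Re \<rho> by simp
      ultimately show ?thesis using b \<eta> near0 Rlow p by (intro exI[of _ \<eta>] exI[of _ p]) auto
    qed
  qed
qed

end

section \<open>Chords between stopping points\<close>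

context harmonic_graph
begin

definition Kmap :: "complex \<Rightarrow> complex" where "Kmap w = H1 w + H2 w"

lemma branch_Kmap: "branch U \<eta> \<Longrightarrow> \<xi> \<in> U \<Longrightarrow> Kmap (\<eta> \<xi>) = \<xi> / 2 + H2 (\<eta> \<xi>)"
  using branchD(4)[of U \<eta> \<xi>] by (simp add: Kmap_def field_simps)

lemma branch_increasing:
  assumes b: "branch U \<eta>" and seg: "closed_segment x y \<subseteq> U" and ne: "x \<noteq> y"
  shows "0 < Re (cnj (y - x) * (hmap (\<eta> y) - hmap (\<eta> x)))"
    and "0 < Re (cnj (y - x) * (Kmap (\<eta> y) - Kmap (\<eta> x)))"
proof -
  define e where "e = y - x"
  have e: "e \<noteq> 0" using ne by (simp add: e_def)
  have inU: "x + of_real l * e \<in> U" if "0 \<le> l" "l \<le> 1" for l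
  proof -
    have "x + of_real l * e = (1 - l) *\<^sub>R x + l *\<^sub>R y" by (simp add: e_def scaleR_conv_of_real algebra_simps)
    then show ?thesis using seg that unfolding closed_segment_def by blast
  qed
  have d: "((\<lambda>l. H2 (\<eta> (x + of_real l * e))) has_vector_derivative (om (\<eta> (x + of_real l * e)) / 2) * e) (at l)"
    if l: "0 \<le> l" "l \<le> 1" for l
  proof -
    have "((\<lambda>l. x + of_real l * e) has_vector_derivative e) (at l)"
      by (auto intro!: derivative_eq_intros simp: has_vector_derivative_def scaleR_conv_of_real)
    from field_vector_diff_chain_at[OF this branch_deriv_H2[OF b inU[OF l]]]
    show ?thesis by (simp add: o_def mult.commute)
  qed
  have dl: "((\<lambda>l. (x + of_real l * e) / 2) has_vector_derivative e / 2) (at l)" for l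
    by (auto intro!: derivative_eq_intros simp: has_vector_derivative_def scaleR_conv_of_real)
  have omb: "norm (om (\<eta> (x + of_real l * e))) < 1" if "0 \<le> l" "l \<le> 1" for l
    by (rule om_less_1[OF branchD(3)[OF b inU[OF that]]])
  have n2: "0 < (norm e)\<^sup>2" using e by simp
  have ee: "cnj e * e = of_real ((norm e)\<^sup>2)" by (metis complex_norm_square mult.commute)
  have r1: "((\<lambda>l. Re (cnj e * ((x + of_real l * e) / 2 + cnj (H2 (\<eta> (x + of_real l * e))))))
      has_real_derivative Re (cnj e * (e / 2 + cnj ((om (\<eta> (x + of_real l * e)) / 2) * e)))) (at l)" if l: "0 \<le> l" "l \<le> 1" for l
  proof -
    have "((\<lambda>l. (x + of_real l * e) / 2 + cnj (H2 (\<eta> (x + of_real l * e)))) has_vector_derivative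
        (e / 2 + cnj ((om (\<eta> (x + of_real l * e)) / 2) * e))) (at l)"
      by (intro has_vector_derivative_add dl bounded_linear.has_vector_derivative[OF bounded_linear_cnj] d l)
    then have "((\<lambda>l. Re (cnj e * ((x + of_real l * e) / 2 + cnj (H2 (\<eta> (x + of_real l * e))))))
       has_vector_derivative Re (cnj e * (e / 2 + cnj ((om (\<eta> (x + of_real l * e)) / 2) * e)))) (at l)"
      by (intro bounded_linear.has_vector_derivative[OF bounded_linear_Re]
          bounded_linear.has_vector_derivative[OF bounded_linear_mult_right])
    then show ?thesis by (simp add: has_real_derivative_iff_has_vector_derivative)
  qed
  have r2: "((\<lambda>l. Re (cnj e * ((x + of_real l * e) / 2 + H2 (\<eta> (x + of_real l * e)))))
      has_real_derivative Re (cnj e * (e / 2 + (om (\<eta> (x + of_real l * e)) / 2) * e))) (at l)" if l: "0 \<le> l" "l \<le> 1" for l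
  proof -
    have "((\<lambda>l. (x + of_real l * e) / 2 + H2 (\<eta> (x + of_real l * e))) has_vector_derivative
        (e / 2 + (om (\<eta> (x + of_real l * e)) / 2) * e)) (at l)"
      by (intro has_vector_derivative_add dl d l)
    then have "((\<lambda>l. Re (cnj e * ((x + of_real l * e) / 2 + H2 (\<eta> (x + of_real l * e)))))
       has_vector_derivative Re (cnj e * (e / 2 + (om (\<eta> (x + of_real l * e)) / 2) * e))) (at l)"
      by (intro bounded_linear.has_vector_derivative[OF bounded_linear_Re]
          bounded_linear.has_vector_derivative[OF bounded_linear_mult_right])
    then show ?thesis by (simp add: has_real_derivative_iff_has_vector_derivative)
  qed
  have p1: "0 < Re (cnj e * (e / 2 + cnj ((om (\<eta> (x + of_real l * e)) / 2) * e)))" if l: "0 \<le> l" "l \<le> 1" for l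
  proof -
    let ?o = "om (\<eta> (x + of_real l * e))"
    have "Re (cnj e * (e / 2 + cnj ((?o / 2) * e))) = (norm e)\<^sup>2 / 2 + Re (cnj e * cnj (?o * e)) / 2"
      using ee by (simp add: distrib_left add_divide_distrib)
    moreover have "norm (cnj e * cnj (?o * e)) < (norm e)\<^sup>2 * 1"
    proof -
      have "norm (cnj e * cnj (?o * e)) = (norm e)\<^sup>2 * norm ?o" by (simp add: norm_mult power2_eq_square)
      also have "\<dots> < (norm e)\<^sup>2 * 1" using omb[OF l] n2 by (intro mult_strict_left_mono)
      finally show ?thesis .
    qed
    ultimately show ?thesis using abs_Re_le_cmod[of "cnj e * cnj (?o * e)"] by linarith
  qed
  have p2: "0 < Re (cnj e * (e / 2 + (om (\<eta> (x + of_real l * e)) / 2) * e))" if l: "0 \<le> l" "l \<le> 1" for l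
  proof -
    let ?o = "om (\<eta> (x + of_real l * e))"
    have "cnj e * (e / 2 + (?o / 2) * e) = (cnj e * e) * ((1 + ?o) / 2)" by (simp add: algebra_simps add_divide_distrib)
    then have "Re (cnj e * (e / 2 + (?o / 2) * e)) = Re (of_real ((norm e)\<^sup>2) * ((1 + ?o) / 2))" unfolding ee by (rule arg_cong)
    also have "\<dots> = (norm e)\<^sup>2 * Re ((1 + ?o) / 2)" by (simp only: times_complex.sel Re_complex_of_real Im_complex_of_real)
    finally have "Re (cnj e * (e / 2 + (?o / 2) * e)) = (norm e)\<^sup>2 * ((1 + Re ?o) / 2)" by simp
    moreover have "0 < (1 + Re ?o) / 2"
    proof (rule half_gt_zero)
      show "0 < 1 + Re ?o" using abs_Re_le_cmod[of ?o] omb[OF l] by linarith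
    qed
    ultimately show ?thesis using n2 by (metis mult_pos_pos)
  qed
  have ends: "x + of_real 0 * e = x" "x + of_real 1 * e = y" by (simp_all add: e_def)
  have xU: "x \<in> U" "y \<in> U" using seg by auto
  have "Re (cnj e * ((x + of_real 0 * e) / 2 + cnj (H2 (\<eta> (x + of_real 0 * e)))))
      < Re (cnj e * ((x + of_real 1 * e) / 2 + cnj (H2 (\<eta> (x + of_real 1 * e)))))"
    by (rule DERIV_pos_imp_increasing[of 0 1]) (use r1 p1 in auto)
  then show "0 < Re (cnj (y - x) * (hmap (\<eta> y) - hmap (\<eta> x)))"
    unfolding ends branch_hmap[OF b xU(1)] branch_hmap[OF b xU(2)] e_def[symmetric]
    by (simp only: right_diff_distrib minus_complex.sel diff_gt_0_iff_gt)
  have "Re (cnj e * ((x + of_real 0 * e) / 2 + H2 (\<eta> (x + of_real 0 * e))))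
      < Re (cnj e * ((x + of_real 1 * e) / 2 + H2 (\<eta> (x + of_real 1 * e))))"
    by (rule DERIV_pos_imp_increasing[of 0 1]) (use r2 p2 in auto)
  then show "0 < Re (cnj (y - x) * (Kmap (\<eta> y) - Kmap (\<eta> x)))"
    unfolding ends branch_Kmap[OF b xU(1)] branch_Kmap[OF b xU(2)] e_def[symmetric]
    by (simp only: right_diff_distrib minus_complex.sel diff_gt_0_iff_gt)
qed

definition to_line :: "real \<Rightarrow> complex \<Rightarrow> complex" where "to_line s \<xi> = Complex s (Im \<xi>)"

lemma to_line_simps [simp]: "Re (to_line s \<xi>) = s" "Im (to_line s \<xi>) = Im \<xi>" "to_line s (to_line s \<xi>) = to_line s \<xi>"
  by (simp_all add: to_line_def)

lemma segment_to_line: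
  assumes "Re p \<le> s"
  shows "closed_segment (to_line s p) p = {x. Im x = Im p \<and> Re p \<le> Re x \<and> Re x \<le> s}"
  using assms closed_segment_same_Im[of "to_line s p" p] by (auto simp: closed_segment_eq_real_ivl)

lemma projection_to_line: "projection (to_line s)"
  unfolding projection_def
proof (intro conjI allI ballI)
  have "to_line s = (\<lambda>\<xi>. of_real s + \<i> * of_real (Im \<xi>))" by (auto simp: to_line_def complex_eq_iff)
  then show "continuous_on UNIV (to_line s)" by (auto intro!: continuous_intros)
  show "to_line s x = to_line s \<xi>" if "x \<in> closed_segment (to_line s \<xi>) \<xi>" for \<xi> x
    using that closed_segment_same_Im[of "to_line s \<xi>" \<xi>] by (auto simp: to_line_def)
qed

text \<open>If a chord between two stopping points met the visible set, a support line of the obstacle would carry two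
  stopping points with a visible point between them. Both ends lie over the vertex, contrary to \<open>branch_increasing\<close>.\<close>

lemma chord_invisible:
  fixes a b c :: complex
  defines "V \<equiv> \<lambda>B \<beta> s0. visible (to_line s0) B \<beta>" and "C \<equiv> \<lambda>\<beta> s0. continuation (to_line s0) \<beta>"
  assumes B: "branch B \<beta>" and ab: "Im a < Im b" "Re a < s0" "Re b < s0"
    and base: "\<And>\<tau>. Im a \<le> \<tau> \<Longrightarrow> \<tau> \<le> Im b \<Longrightarrow> Complex s0 \<tau> \<in> B"
    and inv: "a \<notin> V B \<beta> s0" "b \<notin> V B \<beta> s0"
    and stop: "\<And>p x. \<lbrakk>p \<notin> V B \<beta> s0; Im a \<le> Im p; Im p \<le> Im b; min (Re a) (Re b) \<le> Re p; Re p < s0;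
        \<And>y. \<lbrakk>Im y = Im p; Re p < Re y; Re y \<le> s0\<rbrakk> \<Longrightarrow> y \<in> V B \<beta> s0;
        Im x = Im p; Re p < Re x; Re x \<le> s0\<rbrakk> \<Longrightarrow> norm (hmap (C \<beta> s0 x)) \<le> norm (x - p)"
    and c: "c \<in> open_segment a b"
  shows "c \<notin> V B \<beta> s0"
proof
  define W where "W = V B \<beta> s0"
  define g where "g x = hmap (C \<beta> s0 x)" for x
  assume cV: "c \<in> V B \<beta> s0"
  have br: "branch W (C \<beta> s0)" unfolding W_def V_def C_def by (rule branch_visible[OF B projection_to_line])
  have oW: "open W" by (rule branchD(1)[OF br])
  define k where "k = (Re b - Re a) / (Im b - Im a)"
  define m where "m = min (Re a) (Re b)"
  define Q where "Q = {x. Im a \<le> Im x \<and> Im x \<le> Im b \<and> Re x \<le> s0 \<and> Re a + k * (Im x - Im a) \<le> Re x}"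
  have kb: "Re a + k * (Im b - Im a) = Re b" using ab by (simp add: k_def)
  have chord_ge: "m \<le> Re a + k * (t - Im a)" if t: "Im a \<le> t" "t \<le> Im b" for t
  proof -
    define u where "u = (t - Im a) / (Im b - Im a)"
    have u: "0 \<le> u" "u \<le> 1" using t ab by (auto simp: u_def divide_le_eq)
    have "Re a + k * (t - Im a) = (1 - u) * Re a + u * Re b"
      by (simp add: k_def u_def algebra_simps diff_divide_distrib add_divide_distrib)
    moreover have "(1 - u) * m \<le> (1 - u) * Re a" "u * m \<le> u * Re b" using u by (auto simp: m_def intro!: mult_left_mono)
    ultimately show ?thesis by (simp add: algebra_simps)
  qed
  have Qm: "m \<le> Re x" if "x \<in> Q" for x using that chord_ge[of "Im x"] by (simp add: Q_def)
  have abQ: "a \<in> Q" "b \<in> Q" using ab kb by (auto simp: Q_def)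
  have Qeq: "Q = {x. Im x \<ge> Im a} \<inter> {x. Im x \<le> Im b} \<inter> {x. Re x \<le> s0} \<inter> {x. inner (Complex 1 (- k)) x \<ge> Re a - k * Im a}"
    by (auto simp: Q_def inner_complex_def algebra_simps)
  have convQ: "convex Q" unfolding Qeq
    by (intro convex_Int convex_halfspace_Im_ge convex_halfspace_Im_le convex_halfspace_Re_le convex_halfspace_ge)
  have clQ: "closed Q" unfolding Qeq
    by (intro closed_Int closed_halfspace_Im_ge closed_halfspace_Im_le closed_halfspace_Re_le closed_halfspace_ge)
  have "bounded Q"
  proof (rule bounded_subset[OF bounded_cbox])
    show "Q \<subseteq> cbox (Complex m (Im a)) (Complex s0 (Im b))" using Qm by (auto simp: Q_def in_cbox_complex_iff)
  qed
  then have cQ: "compact Q" using clQ compact_eq_bounded_closed by blast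
  define F where "F = Q \<inter> - W"
  have cF: "compact F" unfolding F_def using cQ oW by (intro compact_Int_closed closed_Compl)
  have abF: "a \<in> F" "b \<in> F" using abQ inv by (auto simp: F_def W_def)
  have Fs: "Re x < s0" if x: "x \<in> F" for x
  proof (rule ccontr)
    assume "\<not> Re x < s0"
    then have "x = Complex s0 (Im x)" using x by (auto simp: F_def Q_def complex_eq_iff)
    moreover have "Complex s0 (Im x) \<in> W" unfolding W_def V_def
      by (rule base_visible(1)[OF B base]) (use x in \<open>auto simp: F_def Q_def to_line_def\<close>)
    ultimately show False using x by (auto simp: F_def)
  qed
  define H where "H = convex hull F"
  have Hs: "Re x < s0" if "x \<in> H" for x
  proof -
    have "H \<subseteq> {x. Re x < s0}" unfolding H_def by (rule hull_minimal) (use Fs in \<open>auto simp: convex_halfspace_Re_lt\<close>)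
    then show ?thesis using that by auto
  qed
  have cH: "compact H" "convex H" unfolding H_def using cF by (auto intro: compact_convex_hull)
  have "c \<in> closed_segment a b" using c by (simp add: open_segment_def)
  moreover have "closed_segment a b \<subseteq> H"
    by (rule closed_segment_subset) (use abF hull_subset[of F convex] cH in \<open>auto simp: H_def\<close>)
  ultimately have cH': "c \<in> H" by blast
  have Imc: "Im a < Im c" "Im c < Im b"
  proof -
    obtain u where u: "0 < u" "u < 1" "c = (1 - u) *\<^sub>R a + u *\<^sub>R b" using c ab unfolding in_segment by auto
    have "Im c = Im ((1 - u) *\<^sub>R a + u *\<^sub>R b)" by (simp only: u(3))
    then have "Im c = Im a + u * (Im b - Im a)" by (simp add: algebra_simps)
    moreover have "0 < u * (Im b - Im a)" "u * (Im b - Im a) < 1 * (Im b - Im a)"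
      using u ab by (auto intro!: mult_strict_right_mono)
    ultimately show "Im a < Im c" "Im c < Im b" by auto
  qed
  have Rec: "Re c < s0" by (rule Hs[OF cH'])
  have segc: "closed_segment (to_line s0 c) c \<subseteq> W"
    using visible_segment[OF projection_to_line cV[unfolded V_def]] unfolding W_def V_def by metis
  define T where "T = closed_segment (to_line s0 c) c \<inter> H"
  have "closed T" unfolding T_def using cH by (intro closed_Int compact_imp_closed) auto
  moreover have "c \<in> T" using cH' by (simp add: T_def)
  ultimately obtain c' where c': "c' \<in> T" "\<And>y. y \<in> T \<Longrightarrow> dist (to_line s0 c) c' \<le> dist (to_line s0 c) y"
    using distance_attains_inf[of T "to_line s0 c"] by blast
  have c'p: "Im c' = Im c" "Re c \<le> Re c'" "Re c' < s0" "c' \<in> H" "c' \<in> W"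
    using c'(1) Hs segc Rec unfolding T_def segment_to_line[OF less_imp_le[OF Rec]] by auto
  define S where "S = {x. Im x \<ge> Im c} \<inter> {x. Im x \<le> Im c} \<inter> {x. Re x > Re c'} \<inter> {x. Re x \<le> s0}"
  have "convex S" unfolding S_def
    by (intro convex_Int convex_halfspace_Im_ge convex_halfspace_Im_le convex_halfspace_Re_le convex_halfspace_Re_gt)
  moreover have "to_line s0 c \<in> S" using c'p by (simp add: S_def)
  moreover have "S \<inter> H = {}"
  proof (rule ccontr)
    assume "S \<inter> H \<noteq> {}"
    then obtain x where x: "x \<in> S" "x \<in> H" by blast
    then have "x \<in> T" using c'p unfolding T_def S_def segment_to_line[OF less_imp_le[OF Rec]] by auto
    then have "dist (to_line s0 c) c' \<le> dist (to_line s0 c) x" by (rule c'(2))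
    moreover have "dist (to_line s0 c) y = s0 - Re y" if "Im y = Im c" "Re y \<le> s0" for y
    proof -
      have "to_line s0 c - y = of_real (s0 - Re y)" using that by (simp add: complex_eq_iff)
      then show ?thesis using that by (simp add: dist_norm del: of_real_diff)
    qed
    ultimately show False using x c'p by (auto simp: S_def)
  qed
  ultimately obtain n \<gamma> where n: "n \<noteq> 0" "\<And>x. x \<in> S \<Longrightarrow> inner n x \<le> \<gamma>" "\<And>x. x \<in> H \<Longrightarrow> \<gamma> \<le> inner n x"
    using separating_hyperplane_sets[of S H] cH cH' by blast
  have inn: "inner n x = Re n * Re x + Im n * Im x" for x by (simp add: inner_complex_def)
  have onS: "inner n c' + t * Re n \<le> \<gamma>" if "0 < t" "t \<le> s0 - Re c'" for t
  proof -
    have "c' + of_real t \<in> S" using that c'p by (simp add: S_def)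
    then have "inner n (c' + of_real t) \<le> \<gamma>" by (rule n(2))
    then show ?thesis by (simp add: inn algebra_simps)
  qed
  have Ren: "Re n < 0"
  proof -
    have "(s0 - Re c') * Re n \<le> 0" using onS[of "s0 - Re c'"] n(3)[OF c'p(4)] c'p(3) by simp
    then have "Re n \<le> 0" using c'p(3) by (simp add: mult_le_0_iff)
    moreover have "Re n \<noteq> 0"
    proof
      assume z: "Re n = 0"
      have "Im n * Im c \<le> \<gamma>" using onS[of "s0 - Re c'"] c'p z by (simp add: inn)
      moreover have "\<gamma> \<le> Im n * Im a" "\<gamma> \<le> Im n * Im b"
        using n(3)[of a] n(3)[of b] abF hull_subset[of F convex] z by (auto simp: H_def inn)
      ultimately have "0 \<le> Im n * (Im a - Im c)" "0 \<le> Im n * (Im b - Im c)" by (auto simp: algebra_simps)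
      then have "Im n = 0" using Imc by (auto simp: zero_le_mult_iff)
      then show False using n(1) z by (simp add: complex_eq_iff)
    qed
    ultimately show ?thesis by simp
  qed
  have nc': "inner n c' = \<gamma>"
  proof (rule antisym)
    show "\<gamma> \<le> inner n c'" by (rule n(3)[OF c'p(4)])
    show "inner n c' \<le> \<gamma>"
    proof (rule field_le_epsilon)
      fix e :: real assume e: "0 < e"
      define t where "t = min (s0 - Re c') (e / - Re n)"
      have "0 < e / - Re n" using e Ren by (intro divide_pos_pos) auto
      then have t: "0 < t" using c'p(3) unfolding t_def min_less_iff_conj by simp
      have t': "t \<le> s0 - Re c'" "t \<le> e / - Re n"
        unfolding t_def by (rule min.cobounded1, rule min.cobounded2)
      have "t * - Re n \<le> e" using t'(2) Ren pos_le_divide_eq[of "- Re n" t e] by linarith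
      then show "inner n c' \<le> \<gamma> + e" using onS[OF t t'(1)] by simp
    qed
  qed
  have face: "(H \<inter> {x. inner n x = \<gamma>}) face_of (convex hull F)"
    unfolding H_def[symmetric] by (rule face_of_Int_supporting_hyperplane_ge) (use cH n in auto)
  obtain F' where F': "F' \<subseteq> F" "H \<inter> {x. inner n x = \<gamma>} = convex hull F'"
    by (rule face_of_convex_hull_subset[OF cF face]) blast
  have c'F': "c' \<in> convex hull F'" using c'p(4) nc' F'(2) by blast
  have onL: "inner n y = \<gamma>" if "y \<in> F'" for y using that F'(2) hull_subset[of F' convex] by blast
  have Imne: "Im y \<noteq> Im c'" if y: "y \<in> F'" for y
  proof
    assume eq: "Im y = Im c'"
    have "Re n * Re y = Re n * Re c'" using onL[OF y] nc' unfolding inn eq by linarith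
    then have "y = c'" using eq Ren by (simp add: complex_eq_iff)
    then show False using y F'(1) c'p(5) by (auto simp: F_def)
  qed
  obtain pl where pl: "pl \<in> F'" "Im pl < Im c'"
  proof (rule ccontr)
    assume "\<not> thesis"
    then have "F' \<subseteq> {x. Im x > Im c'}" using that Imne by (force simp: not_less)
    then have "convex hull F' \<subseteq> {x. Im x > Im c'}" by (intro hull_minimal convex_halfspace_Im_gt)
    then show False using c'F' by auto
  qed
  obtain pr where pr: "pr \<in> F'" "Im c' < Im pr"
  proof (rule ccontr)
    assume "\<not> thesis"
    then have "F' \<subseteq> {x. Im x < Im c'}" using that Imne by (force simp: not_less)
    then have "convex hull F' \<subseteq> {x. Im x < Im c'}" by (intro hull_minimal convex_halfspace_Im_lt)
    then show False using c'F' by auto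
  qed
  have nearW: "x \<in> W" if "x \<in> Q" "inner n x < \<gamma>" for x
  proof (rule ccontr)
    assume "x \<notin> W"
    then have "x \<in> H" using that hull_subset[of F convex] by (auto simp: H_def F_def)
    then show False using n(3) that by force
  qed
  have st: "norm (g (p + of_real t)) \<le> t" if p: "p \<in> F'" and t: "0 < t" "t \<le> s0 - Re p" for p t
  proof -
    have pF: "p \<in> F" using p F'(1) by blast
    have pQ: "p \<in> Q" using pF by (simp add: F_def)
    have "norm (hmap (C \<beta> s0 (p + of_real t))) \<le> norm (p + of_real t - p)"
    proof (rule stop)
      show "p \<notin> V B \<beta> s0" using pF by (simp add: F_def W_def)
      show "min (Re a) (Re b) \<le> Re p" using Qm[OF pQ] by (simp add: m_def)
      show "Re p < s0" by (rule Fs[OF pF])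
      show "y \<in> V B \<beta> s0" if y: "Im y = Im p" "Re p < Re y" "Re y \<le> s0" for y
      proof -
        have "inner n y = \<gamma> + Re n * (Re y - Re p)" using onL[OF p] y by (simp add: inn algebra_simps)
        also have "\<dots> < \<gamma>" using Ren y by (simp add: mult_neg_pos)
        finally have "inner n y < \<gamma>" .
        moreover have "y \<in> Q" using pQ y by (auto simp: Q_def)
        ultimately show ?thesis using nearW unfolding W_def by blast
      qed
    qed (use pQ t in \<open>auto simp: Q_def\<close>)
    then show ?thesis using t by (simp add: g_def)
  qed
  define e where "e = pr - pl"
  have Ime: "Im e > 0" using pl pr by (simp add: e_def)
  define l0 where "l0 = (Im c' - Im pl) / Im e"
  have l0: "0 < l0" "l0 < 1" using pl pr by (auto simp: l0_def e_def divide_less_eq)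
  have ne: "inner n e = 0" using onL[OF pl(1)] onL[OF pr(1)] by (simp add: e_def inner_diff_right)
  have c'eq: "c' = pl + of_real l0 * e"
  proof -
    have i: "Im (pl + of_real l0 * e) = Im c'" using Ime by (simp add: l0_def)
    have "inner n (pl + of_real l0 * e) = inner n pl + l0 * inner n e" by (simp add: inn algebra_simps)
    then have "inner n (pl + of_real l0 * e) = inner n c'" using onL[OF pl(1)] nc' ne by simp
    then have "Re n * Re (pl + of_real l0 * e) = Re n * Re c'" unfolding inn i by linarith
    then show ?thesis using i Ren by (simp add: complex_eq_iff)
  qed
  have plF: "pl \<in> Q" "pr \<in> Q" "Re pl < s0" "Re pr < s0" using pl pr F' Fs by (auto simp: F_def)
  define T0 where "T0 = min (s0 - Re pl) (s0 - Re pr)"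
  have T0: "T0 > 0" "T0 \<le> s0 - Re pl" "T0 \<le> s0 - Re pr" using plF by (auto simp: T0_def)
  have segW: "pl + of_real t + of_real l * e \<in> W" if t: "0 < t" "t \<le> T0" and l: "0 \<le> l" "l \<le> 1" for t l
  proof (rule nearW)
    have "pl + of_real t \<in> Q" "pr + of_real t \<in> Q" using plF t T0 by (auto simp: Q_def)
    then have "(1 - l) *\<^sub>R (pl + of_real t) + l *\<^sub>R (pr + of_real t) \<in> Q" using convexD[OF convQ] l by simp
    then show "pl + of_real t + of_real l * e \<in> Q" by (simp add: e_def scaleR_conv_of_real algebra_simps)
    have "inner n (pl + of_real t + of_real l * e) = inner n pl + t * Re n + l * inner n e" by (simp add: inn algebra_simps)
    then show "inner n (pl + of_real t + of_real l * e) < \<gamma>" using onL[OF pl(1)] ne Ren t by (simp add: mult_pos_neg)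
  qed
  define u where "u t l = Re (cnj e * g (pl + of_real t + of_real l * e))" for t l
  have mono: "u t l \<le> u t l'" if t: "0 < t" "t \<le> T0" and l: "0 \<le> l" "l \<le> l'" "l' \<le> 1" for t l l'
  proof (cases "l = l'")
    case False
    define x where "x = pl + of_real t + of_real l * e"
    define y where "y = pl + of_real t + of_real l' * e"
    have yx: "y - x = of_real (l' - l) * e" by (simp add: x_def y_def algebra_simps)
    have "closed_segment x y \<subseteq> W"
    proof
      fix z assume "z \<in> closed_segment x y"
      then obtain v where v: "0 \<le> v" "v \<le> 1" "z = (1 - v) *\<^sub>R x + v *\<^sub>R y" unfolding in_segment by blast
      have "z = pl + of_real t + of_real (l + v * (l' - l)) * e"
        by (simp add: v(3) x_def y_def scaleR_conv_of_real algebra_simps)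
      moreover have "0 \<le> l + v * (l' - l)" using v l by simp
      moreover have "v * (l' - l) \<le> 1 * (l' - l)" using v l by (intro mult_right_mono) auto
      ultimately show "z \<in> W" using segW[OF t, of "l + v * (l' - l)"] l by simp
    qed
    moreover have "x \<noteq> y" using yx False Ime by auto
    ultimately have "0 < Re (cnj (y - x) * (hmap (C \<beta> s0 y) - hmap (C \<beta> s0 x)))" by (rule branch_increasing(1)[OF br])
    also have "cnj (y - x) * (hmap (C \<beta> s0 y) - hmap (C \<beta> s0 x)) = of_real (l' - l) * (cnj e * (g y - g x))"
      by (simp add: yx g_def)
    finally have "0 < (l' - l) * Re (cnj e * (g y - g x))" by simp
    then have "0 < Re (cnj e * (g y - g x))" using l False by (simp add: zero_less_mult_iff)
    then show ?thesis by (simp add: u_def x_def y_def right_diff_distrib)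
  qed simp
  have small: "\<bar>u t l\<bar> \<le> norm e * t" if t: "0 < t" "t \<le> T0" and l: "0 \<le> l" "l \<le> 1" for t l
  proof -
    have "pl + of_real t + of_real 0 * e = pl + of_real t" by simp
    then have "\<bar>u t 0\<bar> \<le> norm (cnj e * g (pl + of_real t))" unfolding u_def by (metis abs_Re_le_cmod)
    also have "\<dots> \<le> norm e * t" using st[OF pl(1), of t] t T0 by (simp add: norm_mult mult_left_mono)
    finally have 1: "\<bar>u t 0\<bar> \<le> norm e * t" .
    have "pl + of_real t + of_real 1 * e = pr + of_real t" by (simp add: e_def)
    then have "\<bar>u t 1\<bar> \<le> norm (cnj e * g (pr + of_real t))" unfolding u_def by (metis abs_Re_le_cmod)
    also have "\<dots> \<le> norm e * t" using st[OF pr(1), of t] t T0 by (simp add: norm_mult mult_left_mono)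
    finally have 2: "\<bar>u t 1\<bar> \<le> norm e * t" .
    show ?thesis using 1 2 mono[OF t, of 0 l] mono[OF t, of l 1] l by simp
  qed
  obtain d where d: "d > 0" "ball c' d \<subseteq> W" using openE[OF oW c'p(5)] by blast
  have bd: "branch (ball c' d) (C \<beta> s0)" by (rule branch_subset[OF br open_ball d(2)])
  have vanish: "u 0 l = 0" if l: "0 \<le> l" "l \<le> 1" and lb: "pl + of_real l * e \<in> ball c' (d/2)" for l
  proof -
    define q where "q = pl + of_real l * e"
    have "\<bar>u 0 l\<bar> \<le> 0 + x" if x: "x > 0" for x
    proof -
      define t where "t = min (min T0 (d/2)) (x / (2 * (norm e + 1)))"
      have pos: "0 < 2 * (norm e + 1)" by (smt (verit) norm_ge_zero)
      have "0 < x / (2 * (norm e + 1))" using x pos by simp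
      then have t: "0 < t" "t \<le> T0" "t \<le> d/2" "t \<le> x / (2 * (norm e + 1))"
        using T0(1) d(1) unfolding t_def by linarith+
      have tx: "2 * (norm e + 1) * t \<le> x" using t(4) pos by (simp add: pos_le_divide_eq mult.commute)
      have qb: "q \<in> ball c' d" "q + of_real t \<in> ball c' d"
      proof -
        have "dist c' (q + of_real t) \<le> dist c' q + dist q (q + of_real t)" by (rule dist_triangle)
        also have "\<dots> < d/2 + d/2" using lb t by (intro add_less_le_mono) (auto simp: q_def dist_norm)
        finally show "q + of_real t \<in> ball c' d" by simp
        show "q \<in> ball c' d" using lb d(1) by (auto simp: q_def)
      qed
      have "norm (g q - g (q + of_real t)) \<le> norm (q - (q + of_real t))"
        unfolding g_def by (rule branch_lipschitz(1)[OF bd convex_ball qb])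
      then have gl: "norm (g q - g (q + of_real t)) \<le> t" using t by simp
      have "u 0 l - u t l = Re (cnj e * (g q - g (q + of_real t)))"
      proof -
        have "pl + of_real t + of_real l * e = q + of_real t" "pl + of_real 0 + of_real l * e = q"
          by (simp_all add: q_def)
        then show ?thesis unfolding u_def by (simp only: right_diff_distrib minus_complex.sel)
      qed
      then have "\<bar>u 0 l - u t l\<bar> \<le> norm (cnj e * (g q - g (q + of_real t)))" by (metis abs_Re_le_cmod)
      also have "\<dots> \<le> norm e * t" using gl by (simp add: norm_mult mult_left_mono)
      finally have "\<bar>u 0 l\<bar> \<le> norm e * t + norm e * t" using small[OF t(1,2) l] by linarith
      also have "\<dots> \<le> 2 * (norm e + 1) * t" using t by (simp add: algebra_simps)
      finally show ?thesis using tx by simp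
    qed
    then have "\<bar>u 0 l\<bar> \<le> 0" by (rule field_le_epsilon)
    then show ?thesis by simp
  qed
  have epos: "norm e > 0" using Ime by auto
  define v where "v = min (1 - l0) (d / (4 * norm e))"
  have v: "0 < v" "v \<le> 1 - l0" "v * norm e < d/2" 
    using l0 d epos by (auto simp: v_def min_def field_simps)
  define x where "x = pl + of_real l0 * e"
  define y where "y = pl + of_real (l0 + v) * e"
  have yx: "y - x = of_real v * e" by (simp add: x_def y_def algebra_simps)
  have xy: "x \<in> ball c' (d/2)" "y \<in> ball c' (d/2)"
  proof -
    show xb: "x \<in> ball c' (d/2)" using d c'eq by (simp add: x_def)
    have "dist c' y = norm (y - x)" using c'eq by (simp add: x_def dist_norm norm_minus_commute)
    then show "y \<in> ball c' (d/2)" using v by (simp add: yx norm_mult)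
  qed
  have "closed_segment x y \<subseteq> ball c' (d/2)" by (rule closed_segment_subset[OF xy convex_ball])
  also have "\<dots> \<subseteq> ball c' d" using d(1) by (intro subset_ball) simp
  also note d(2)
  finally have "closed_segment x y \<subseteq> W" .
  moreover have "x \<noteq> y" using yx v epos by auto
  ultimately have "0 < Re (cnj (y - x) * (hmap (C \<beta> s0 y) - hmap (C \<beta> s0 x)))" by (rule branch_increasing(1)[OF br])
  also have "cnj (y - x) * (hmap (C \<beta> s0 y) - hmap (C \<beta> s0 x)) = of_real v * (cnj e * (g y - g x))"
    by (simp add: yx g_def)
  finally have "0 < v * Re (cnj e * (g y - g x))" by simp
  moreover have "Re (cnj e * (g y - g x)) = u 0 (l0 + v) - u 0 l0"
    unfolding u_def x_def y_def by (simp only: right_diff_distrib minus_complex.sel of_real_0 add_0_right)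
  moreover have "u 0 (l0 + v) = 0" "u 0 l0 = 0"
    using vanish[of "l0 + v"] vanish[of l0] xy l0 v by (auto simp: x_def y_def)
  ultimately show False by simp
qed

end

section \<open>Strips of rays ending over the vertex\<close>

context harmonic_graph
begin

lemma Kmap_hmap: "branch U \<eta> \<Longrightarrow> x \<in> U \<Longrightarrow> Kmap (\<eta> x) = \<i> * of_real (Im x) + cnj (hmap (\<eta> x))"
  using branch_Kmap[of U \<eta> x] branch_hmap[of U \<eta> x] by (simp add: complex_eq_iff)

text \<open>Along horizontal lines the speed of \<open>hmap\<close> is controlled by the derivative of its real part:
  \<open>\<bar>1 + \<omega>\<bar>\<^sup>2 \<le> 2 * Re (1 + \<omega>)\<close> for \<open>\<bar>\<omega>\<bar> \<le> 1\<close>.\<close>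

lemma horizontal_bound:
  assumes b: "branch U \<eta>" and seg: "closed_segment y x \<subseteq> U" and h: "Im x = Im y" "Re y \<le> Re x" and \<mu>: "0 < \<mu>"
  shows "norm (hmap (\<eta> x) - hmap (\<eta> y)) \<le> (\<mu> * (Re x - Re y) + (Re (hmap (\<eta> x)) - Re (hmap (\<eta> y))) / \<mu>) / 2"
proof -
  define L where "L = Re x - Re y"
  have L: "0 \<le> L" using h by (simp add: L_def)
  have xy: "x = y + of_real L" using h by (simp add: L_def complex_eq_iff)
  have inU: "y + of_real (l * L) \<in> U" if "0 \<le> l" "l \<le> 1" for l
  proof -
    have "y + of_real (l * L) = (1 - l) *\<^sub>R y + l *\<^sub>R x" by (simp add: xy scaleR_conv_of_real algebra_simps)
    then show ?thesis using seg that unfolding closed_segment_def by blast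
  qed
  define \<Delta> where "\<Delta> = hmap (\<eta> x) - hmap (\<eta> y)"
  define v where "v = (if \<Delta> = 0 then 0 else \<Delta> / of_real (norm \<Delta>))"
  have v: "norm v \<le> 1" by (simp add: v_def norm_divide)
  have v\<Delta>: "Re (cnj v * \<Delta>) = norm \<Delta>"
  proof (cases "\<Delta> = 0")
    case False
    have "cnj v * \<Delta> = (cnj \<Delta> * \<Delta>) / of_real (norm \<Delta>)" using False by (simp add: v_def)
    also have "cnj \<Delta> * \<Delta> = of_real ((norm \<Delta>)\<^sup>2)" by (metis complex_norm_square mult.commute)
    also have "of_real ((norm \<Delta>)\<^sup>2) / of_real (norm \<Delta>) = complex_of_real (norm \<Delta>)"
      using False by (simp add: power2_eq_square)
    finally show ?thesis by simp
  qed (simp add: v_def)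
  define G where "G l = (y + of_real (l * L)) / 2 + cnj (H2 (\<eta> (y + of_real (l * L))))" for l
  define o' where "o' l = om (\<eta> (y + of_real (l * L)))" for l
  have d: "(G has_vector_derivative of_real L * ((1 + cnj (o' l)) / 2)) (at l)" if l: "0 \<le> l" "l \<le> 1" for l
  proof -
    have D: "((\<lambda>l. y + of_real (l * L)) has_vector_derivative of_real L) (at l)"
      by (auto intro!: derivative_eq_intros simp: has_vector_derivative_def scaleR_conv_of_real)
    have "((\<lambda>l. H2 (\<eta> (y + of_real (l * L)))) has_vector_derivative of_real L * (o' l / 2)) (at l)"
      using field_vector_diff_chain_at[OF D branch_deriv_H2[OF b inU[OF l]]] by (simp add: o_def o'_def)
    then have 1: "((\<lambda>l. cnj (H2 (\<eta> (y + of_real (l * L))))) has_vector_derivative cnj (of_real L * (o' l / 2))) (at l)"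
      by (rule bounded_linear.has_vector_derivative[OF bounded_linear_cnj])
    have 2: "((\<lambda>l. (y + of_real (l * L)) / 2) has_vector_derivative of_real L / 2) (at l)"
      by (auto intro!: derivative_eq_intros simp: has_vector_derivative_def scaleR_conv_of_real)
    have "(G has_vector_derivative of_real L / 2 + cnj (of_real L * (o' l / 2))) (at l)"
      unfolding G_def by (rule has_vector_derivative_add[OF 2 1])
    moreover have "of_real L / 2 + cnj (of_real L * (o' l / 2)) = of_real L * ((1 + cnj (o' l)) / 2)" by (simp add: field_simps)
    ultimately show ?thesis by metis
  qed
  define F where "F l = \<mu> * L * l / 2 + Re (G l) / (2 * \<mu>) - Re (cnj v * G l)" for l
  have dF: "(F has_real_derivative \<mu> * L / 2 + Re (of_real L * ((1 + cnj (o' l)) / 2)) / (2 * \<mu>)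
      - Re (cnj v * (of_real L * ((1 + cnj (o' l)) / 2)))) (at l)" if l: "0 \<le> l" "l \<le> 1" for l
  proof -
    have 1: "((\<lambda>l. Re (G l)) has_real_derivative Re (of_real L * ((1 + cnj (o' l)) / 2))) (at l)"
      unfolding has_real_derivative_iff_has_vector_derivative
      by (rule bounded_linear.has_vector_derivative[OF bounded_linear_Re d[OF l]])
    have 2: "((\<lambda>l. Re (cnj v * G l)) has_real_derivative Re (cnj v * (of_real L * ((1 + cnj (o' l)) / 2)))) (at l)"
      unfolding has_real_derivative_iff_has_vector_derivative
      by (intro bounded_linear.has_vector_derivative[OF bounded_linear_Re]
          bounded_linear.has_vector_derivative[OF bounded_linear_mult_right] d[OF l])
    have 3: "((\<lambda>l. \<mu> * L * l / 2) has_real_derivative \<mu> * L / 2) (at l)"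
      by (auto intro!: derivative_eq_intros)
    show ?thesis unfolding F_def by (intro DERIV_diff DERIV_add 3 DERIV_cdivide 1 2)
  qed
  have nonneg: "0 \<le> \<mu> * L / 2 + Re (of_real L * ((1 + cnj (o' l)) / 2)) / (2 * \<mu>)
      - Re (cnj v * (of_real L * ((1 + cnj (o' l)) / 2)))" if l: "0 \<le> l" "l \<le> 1" for l
  proof -
    define c where "c = (1 + cnj (o' l)) / 2"
    have o1: "norm (o' l) \<le> 1" unfolding o'_def using om_less_1[OF branchD(3)[OF b inU[OF l]]] by simp
    have "(norm (o' l))\<^sup>2 \<le> 1" using power_mono[OF o1, of 2] by simp
    have rc: "Re c = (1 + Re (o' l)) / 2" "Im c = - Im (o' l) / 2" by (simp_all add: c_def)
    have "(norm c)\<^sup>2 = (1 + 2 * Re (o' l) + (norm (o' l))\<^sup>2) / 4"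
      unfolding cmod_power2 rc by (simp add: power2_eq_square field_simps)
    then have c2: "(norm c)\<^sup>2 \<le> Re c" using \<open>(norm (o' l))\<^sup>2 \<le> 1\<close> unfolding rc by (simp add: field_simps)
    have "0 \<le> (\<mu> - norm c)\<^sup>2" by simp
    then have am: "2 * \<mu> * norm c \<le> \<mu>\<^sup>2 + (norm c)\<^sup>2" by (simp add: power2_eq_square algebra_simps)
    have "Re (cnj v * c) \<le> norm (cnj v * c)" by (rule complex_Re_le_cmod)
    also have "\<dots> \<le> 1 * norm c" unfolding norm_mult using v by (intro mult_right_mono) auto
    finally have "2 * \<mu> * Re (cnj v * c) \<le> 2 * \<mu> * norm c" using \<mu> by simp
    with am c2 have "2 * \<mu> * Re (cnj v * c) \<le> \<mu>\<^sup>2 + Re c" by linarith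
    then have "Re (cnj v * c) \<le> (\<mu>\<^sup>2 + Re c) / (2 * \<mu>)" using \<mu> by (simp add: le_divide_eq mult.commute)
    also have "\<dots> = \<mu> / 2 + Re c / (2 * \<mu>)" using \<mu> by (simp add: power2_eq_square add_divide_distrib)
    finally have "0 \<le> L * (\<mu> / 2 + Re c / (2 * \<mu>) - Re (cnj v * c))" using L by simp
    moreover have "Re (cnj v * (of_real L * c)) = L * Re (cnj v * c)" "Re (of_real L * c) = L * Re c"
      by (simp_all add: algebra_simps)
    ultimately show ?thesis unfolding c_def[symmetric] by (simp add: algebra_simps)
  qed
  have "F 0 \<le> F 1"
    by (rule DERIV_nonneg_imp_nondecreasing) (use dF nonneg in force)+
  moreover have "G 0 = hmap (\<eta> y)" "G 1 = hmap (\<eta> x)"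
    using inU[of 0] inU[of 1] branch_hmap[OF b] by (simp_all add: G_def xy)
  ultimately have "Re (cnj v * \<Delta>) \<le> \<mu> * L / 2 + (Re (hmap (\<eta> x)) - Re (hmap (\<eta> y))) / (2 * \<mu>)"
    by (simp add: F_def \<Delta>_def right_diff_distrib diff_divide_distrib)
  then show ?thesis unfolding v\<Delta> by (simp add: \<Delta>_def L_def add_divide_distrib)
qed

lemma branch_holomorphic_H2: "branch U \<eta> \<Longrightarrow> (\<lambda>x. H2 (\<eta> x)) holomorphic_on U"
  using branchD(1) holomorphic_on_open branch_deriv_H2 by meson

lemma branch_cont_hmap: "branch U \<eta> \<Longrightarrow> continuous_on U (\<lambda>x. hmap (\<eta> x))"
proof -
  assume b: "branch U \<eta>"
  have "continuous_on U (\<lambda>x. x / 2 + cnj (H2 (\<eta> x)))"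
    by (intro continuous_intros holomorphic_on_imp_continuous_on branch_holomorphic_H2[OF b]) simp
  then show ?thesis by (rule continuous_on_eq) (simp add: branch_hmap[OF b])
qed

end

text \<open>All horizontal rays of a strip stop over the vertex \<open>0\<close>.\<close>

locale harmonic_strip = harmonic_graph +
  fixes V :: "complex set" and \<eta> :: "complex \<Rightarrow> complex" and s0 \<tau>1 \<tau>2 ell \<kappa> :: real
  assumes V: "branch V \<eta>" and \<tau>12: "\<tau>1 < \<tau>2" and ell: "0 < ell" and \<kappa>: "0 < \<kappa>" and zero_img: "0 \<notin> img"
    and right: "\<lbrakk>x \<in> V; Im y = Im x; Re x \<le> Re y; Re y \<le> s0\<rbrakk> \<Longrightarrow> y \<in> V"
    and ray: "\<lbrakk>\<tau>1 < \<tau>; \<tau> < \<tau>2\<rbrakk> \<Longrightarrow> \<exists>p. Im p = \<tau> \<and> s0 - ell \<le> Re p \<and> Re p < s0 \<and> p \<notin> V \<and>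
        (\<forall>x. Im x = \<tau> \<and> Re p < Re x \<and> Re x \<le> s0 \<longrightarrow> x \<in> V \<and> norm (hmap (\<eta> x)) \<le> norm (x - p))"
    and base: "\<lbrakk>\<tau>1 < \<tau>; \<tau> < \<tau>2\<rbrakk> \<Longrightarrow> \<kappa> \<le> Re (hmap (\<eta> (Complex s0 \<tau>)))"
begin

definition g :: "complex \<Rightarrow> complex" where "g x = hmap (\<eta> x)"

definition K :: "complex \<Rightarrow> complex" where "K x = Kmap (\<eta> x)"

definition V1 :: "complex set" where "V1 = {x \<in> V. \<tau>1 < Im x \<and> Im x < \<tau>2 \<and> Re x < s0}"

lemma open_V1: "open V1"
proof -
  have "V1 = V \<inter> {x. Im x > \<tau>1} \<inter> {x. Im x < \<tau>2} \<inter> {x. Re x < s0}" by (auto simp: V1_def)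
  then show ?thesis using branchD(1)[OF V]
    by (simp add: open_Int open_halfspace_Im_gt open_halfspace_Im_lt open_halfspace_Re_lt)
qed

lemma K_g: "x \<in> V \<Longrightarrow> K x = \<i> * of_real (Im x) + cnj (g x)"
  unfolding K_def g_def by (rule Kmap_hmap[OF V])

lemma Re_K: "x \<in> V \<Longrightarrow> Re (K x) = Re (g x)" and Im_K: "x \<in> V \<Longrightarrow> Im (K x) = Im x - Im (g x)"
  using K_g[of x] by simp_all

lemma cont_g: "continuous_on V g"
  unfolding g_def by (rule branch_cont_hmap[OF V])

lemma K_holomorphic: "K holomorphic_on V"
proof -
  have "(\<lambda>x. x / 2 + H2 (\<eta> x)) holomorphic_on V"
    by (intro holomorphic_intros branch_holomorphic_H2[OF V]) auto
  then show ?thesis by (rule holomorphic_transform) (simp add: K_def branch_Kmap[OF V])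
qed

lemma horizontal_segment:
  assumes "x \<in> V" "Im y = Im x" "Re x \<le> Re y" "Re y \<le> s0"
  shows "closed_segment x y \<subseteq> V"
proof
  fix z assume "z \<in> closed_segment x y"
  then have "Im z = Im x" "Re z \<in> closed_segment (Re x) (Re y)" using closed_segment_same_Im[of x y] assms(2) by auto
  then have "Im z = Im x" "Re x \<le> Re z" "Re z \<le> s0" using assms(3,4) by (auto simp: closed_segment_eq_real_ivl)
  then show "z \<in> V" by (rule right[OF assms(1)])
qed

lemma Re_g_less:
  assumes "x \<in> V" "Im y = Im x" "Re x < Re y" "Re y \<le> s0"
  shows "Re (g x) < Re (g y)"
proof -
  have "closed_segment x y \<subseteq> V" using horizontal_segment assms by simp
  moreover have "x \<noteq> y" using assms by auto
  ultimately have "0 < Re (cnj (y - x) * (hmap (\<eta> y) - hmap (\<eta> x)))" by (rule branch_increasing(1)[OF V])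
  moreover have "y - x = of_real (Re y - Re x)" using assms by (simp add: complex_eq_iff)
  ultimately have "0 < (Re y - Re x) * (Re (g y) - Re (g x))" by (simp add: g_def)
  then show ?thesis using assms by (simp add: zero_less_mult_iff)
qed

lemma end_point:
  assumes x: "x \<in> V1"
  obtains p where "Im p = Im x" "s0 - ell \<le> Re p" "Re p < Re x"
    "\<And>y. \<lbrakk>Im y = Im x; Re p < Re y; Re y \<le> s0\<rbrakk> \<Longrightarrow> y \<in> V \<and> norm (g y) \<le> norm (y - p)"
proof -
  obtain p where p: "Im p = Im x" "s0 - ell \<le> Re p" "Re p < s0" "p \<notin> V"
    "\<forall>y. Im y = Im x \<and> Re p < Re y \<and> Re y \<le> s0 \<longrightarrow> y \<in> V \<and> norm (hmap (\<eta> y)) \<le> norm (y - p)"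
    using ray[of "Im x"] x by (auto simp: V1_def)
  have "Re p < Re x"
  proof (rule ccontr)
    assume "\<not> Re p < Re x"
    then have "p \<in> V" using right[of x p] x p by (auto simp: V1_def)
    then show False using p by simp
  qed
  then show thesis using that[of p] p by (auto simp: g_def)
qed

lemma g_bound:
  assumes x: "x \<in> V1" and \<mu>: "0 < \<mu>"
  shows "norm (g x) \<le> (\<mu> * ell + Re (g x) / \<mu>) / 2"
proof -
  obtain p where p: "Im p = Im x" "s0 - ell \<le> Re p" "Re p < Re x"
    "\<And>y. \<lbrakk>Im y = Im x; Re p < Re y; Re y \<le> s0\<rbrakk> \<Longrightarrow> y \<in> V \<and> norm (g y) \<le> norm (y - p)"
    using end_point[OF x] by metis
  show ?thesis
  proof (rule field_le_epsilon)
    fix e :: real assume e: "0 < e"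
    define k where "k = 1 + 1 / (2 * \<mu>)"
    have k: "k > 0" using \<mu> by (simp add: k_def add_pos_pos)
    define t where "t = min (Re x - Re p) (e / k)"
    have t: "0 < t" "t \<le> Re x - Re p" "t \<le> e / k" using p(3) e k by (auto simp: t_def)
    have tk: "t * k \<le> e" using t(3) k by (simp add: pos_le_divide_eq)
    define y where "y = p + of_real t"
    have y: "y \<in> V" "norm (g y) \<le> t" using p(4)[of y] t p x by (auto simp: y_def V1_def)
    have seg: "closed_segment y x \<subseteq> V" using horizontal_segment[OF y(1), of x] p t x by (auto simp: y_def V1_def)
    have "norm (g x - g y) \<le> (\<mu> * (Re x - Re y) + (Re (g x) - Re (g y)) / \<mu>) / 2"
      unfolding g_def by (rule horizontal_bound[OF V seg]) (use p t \<mu> in \<open>auto simp: y_def\<close>)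
    then have "2 * norm (g x - g y) \<le> \<mu> * (Re x - Re y) + (Re (g x) - Re (g y)) / \<mu>" by simp
    moreover have "\<mu> * (Re x - Re y) \<le> \<mu> * ell" using p t x \<mu> by (intro mult_left_mono) (auto simp: y_def V1_def)
    moreover have "(Re (g x) - Re (g y)) / \<mu> \<le> Re (g x) / \<mu> + t / \<mu>"
      using y(2) abs_Re_le_cmod[of "g y"] \<mu> by (simp add: divide_right_mono flip: add_divide_distrib)
    moreover have "norm (g x) \<le> norm (g x - g y) + norm (g y)" by (metis norm_triangle_sub add.commute)
    moreover have "t / \<mu> + 2 * t = 2 * (t * k)" by (simp add: k_def algebra_simps)
    ultimately have "2 * norm (g x) \<le> \<mu> * ell + Re (g x) / \<mu> + 2 * e" using y(2) tk by linarith
    then show "norm (g x) \<le> (\<mu> * ell + Re (g x) / \<mu>) / 2 + e" by argo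
  qed
qed

lemma Re_g_pos:
  assumes x: "x \<in> V1" shows "0 < Re (g x)"
proof -
  obtain p where p: "Im p = Im x" "s0 - ell \<le> Re p" "Re p < Re x"
    "\<And>y. \<lbrakk>Im y = Im x; Re p < Re y; Re y \<le> s0\<rbrakk> \<Longrightarrow> y \<in> V \<and> norm (g y) \<le> norm (y - p)"
    using end_point[OF x] by metis
  define y where "y = Complex ((Re p + Re x) / 2) (Im x)"
  have y: "y \<in> V" using p(4)[of y] p(3) x by (auto simp: y_def V1_def)
  have "0 \<le> Re (g y) + e" if e: "0 < e" for e
  proof -
    define a where "a = (Re x - Re p) / 4"
    have a: "0 < a" using p(3) by (simp add: a_def)
    define t where "t = min e a"
    have t': "0 < t" "t \<le> e" "t \<le> a" using e a unfolding t_def by linarith+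
    note t = t'(1,2) t'(3)[unfolded a_def]
    define z where "z = p + of_real t"
    have z: "z \<in> V" "norm (g z) \<le> t" using p(4)[of z] t p x by (auto simp: z_def V1_def)
    have "Re (g z) < Re (g y)" by (rule Re_g_less[OF z(1)]) (use p t x in \<open>auto simp: y_def z_def V1_def\<close>)
    then show ?thesis using z(2) t abs_Re_le_cmod[of "g z"] by linarith
  qed
  then have "0 \<le> Re (g y)" by (rule field_le_epsilon)
  also have "\<dots> < Re (g x)" by (rule Re_g_less[OF y]) (use p x in \<open>auto simp: y_def V1_def\<close>)
  finally show ?thesis .
qed

lemma level_unique:
  assumes "x \<in> V1" "y \<in> V1" "Im x = Im y" "Re (g x) = Re (g y)"
  shows "x = y"
proof (rule ccontr)
  assume "x \<noteq> y"
  then consider "Re x < Re y" | "Re y < Re x" using assms(3) by (metis complex_eq_iff linorder_neqE)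
  then show False
  proof cases
    case 1 then show False using Re_g_less[of x y] assms by (auto simp: V1_def)
  next
    case 2 then show False using Re_g_less[of y x] assms by (auto simp: V1_def)
  qed
qed

lemma level_exists:
  assumes \<tau>: "\<tau>1 < \<tau>" "\<tau> < \<tau>2" and c: "0 < c" "c < \<kappa>"
  shows "\<exists>x. x \<in> V1 \<and> Im x = \<tau> \<and> Re (g x) = c"
proof -
  obtain p where p: "Im p = \<tau>" "Re p < s0"
    "\<And>y. \<lbrakk>Im y = \<tau>; Re p < Re y; Re y \<le> s0\<rbrakk> \<Longrightarrow> y \<in> V \<and> norm (g y) \<le> norm (y - p)"
    using ray[OF \<tau>] unfolding g_def by metis
  define a where "a = s0 - Re p"
  have a: "0 < a" using p(2) by (simp add: a_def)
  define t where "t = min a c / 2"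
  have "0 < t" "t < a" "t < c" using a c unfolding t_def by linarith+
  then have t: "0 < t" "t < s0 - Re p" "t < c" by (simp_all add: a_def)
  have inV: "Complex s \<tau> \<in> V" if "s \<in> {Re p + t..s0}" for s using p(3)[of "Complex s \<tau>"] that t by auto
  have "Complex (Re p + t) \<tau> - p = of_real t" using p(1) by (simp add: complex_eq_iff)
  then have "norm (g (Complex (Re p + t) \<tau>)) \<le> t" using p(3)[of "Complex (Re p + t) \<tau>"] t by simp
  then have lo: "Re (g (Complex (Re p + t) \<tau>)) \<le> c" using complex_Re_le_cmod[of "g (Complex (Re p + t) \<tau>)"] t by linarith
  have hi: "c \<le> Re (g (Complex s0 \<tau>))" using base[OF \<tau>] c by (simp add: g_def)
  have "continuous_on {Re p + t..s0} (\<lambda>s. Re (g (Complex s \<tau>)))"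
  proof -
    have "continuous_on {Re p + t..s0} (\<lambda>s. of_real s + \<i> * of_real \<tau>)" by (intro continuous_intros)
    then have "continuous_on {Re p + t..s0} (\<lambda>s. Complex s \<tau>)" by (rule continuous_on_eq) (simp add: complex_eq_iff)
    then have "continuous_on {Re p + t..s0} (\<lambda>s. g (Complex s \<tau>))"
      by (rule continuous_on_compose2[OF cont_g]) (use inV in auto)
    then show ?thesis by (rule continuous_on_Re)
  qed
  then obtain s where s: "Re p + t \<le> s" "s \<le> s0" "Re (g (Complex s \<tau>)) = c"
    using IVT'[of "\<lambda>s. Re (g (Complex s \<tau>))" "Re p + t" c s0] lo hi t by auto
  have "s \<noteq> s0" using s(3) base[OF \<tau>] c by (auto simp: g_def)
  then show ?thesis using s inV[of s] \<tau> by (intro exI[of _ "Complex s \<tau>"]) (auto simp: V1_def)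
qed

definition \<sigma> :: "real \<Rightarrow> real \<Rightarrow> complex" where "\<sigma> c \<tau> = (SOME x. x \<in> V1 \<and> Im x = \<tau> \<and> Re (g x) = c)"

lemma \<sigma>:
  assumes "\<tau>1 < \<tau>" "\<tau> < \<tau>2" "0 < c" "c < \<kappa>"
  shows "\<sigma> c \<tau> \<in> V1" "Im (\<sigma> c \<tau>) = \<tau>" "Re (g (\<sigma> c \<tau>)) = c"
  using someI_ex[OF level_exists[OF assms]] unfolding \<sigma>_def by auto

lemma \<sigma>_near:
  assumes \<tau>: "\<tau>1 < \<tau>" "\<tau> < \<tau>2" and c: "0 < c" "c < \<kappa>" and e: "0 < e"
  shows "\<exists>d>0. \<forall>t. \<bar>t - \<tau>\<bar> < d \<longrightarrow> \<tau>1 < t \<and> t < \<tau>2 \<and> dist (\<sigma> c t) (\<sigma> c \<tau>) < e"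
proof -
  let ?x = "\<sigma> c \<tau>"
  note x = \<sigma>[OF \<tau> c]
  obtain r where r: "r > 0" "ball ?x r \<subseteq> V1" using openE[OF open_V1 x(1)] by blast
  define q where "q = min r e / 2"
  have q: "0 < q" "q < r" "q \<le> e / 2" using r(1) e unfolding q_def by linarith+
  have lV: "?x - of_real q \<in> V1" "?x + of_real q \<in> V1" using r q by (auto simp: subset_iff dist_norm)
  have VV: "y \<in> V" if "y \<in> V1" for y using that by (simp add: V1_def)
  have lo: "Re (g (?x - of_real q)) < c"
    using Re_g_less[OF VV[OF lV(1)], of ?x] q x by (auto simp: V1_def)
  have hi: "c < Re (g (?x + of_real q))"
    using Re_g_less[OF VV[OF x(1)], of "?x + of_real q"] q x lV(2) by (auto simp: V1_def)
  have cg: "continuous_on V1 (\<lambda>x. Re (g x))"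
    by (intro continuous_on_Re continuous_on_subset[OF cont_g]) (auto simp: V1_def)
  have "open (V1 \<inter> (\<lambda>x. Re (g x)) -` {..<c})" by (rule continuous_open_preimage[OF cg open_V1]) simp
  then obtain d1 where d1: "d1 > 0" "\<And>y. dist y (?x - of_real q) < d1 \<Longrightarrow> y \<in> V1 \<and> Re (g y) < c"
    unfolding open_dist using lV(1) lo by force
  have "open (V1 \<inter> (\<lambda>x. Re (g x)) -` {c<..})" by (rule continuous_open_preimage[OF cg open_V1]) simp
  then obtain d2 where d2: "d2 > 0" "\<And>y. dist y (?x + of_real q) < d2 \<Longrightarrow> y \<in> V1 \<and> c < Re (g y)"
    unfolding open_dist using lV(2) hi by force
  define e2 where "e2 = e / 2"
  have e2: "0 < e2" using e by (simp add: e2_def)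
  define d where "d = min (min d1 d2) (min e2 (min (\<tau> - \<tau>1) (\<tau>2 - \<tau>)))"
  have d: "0 < d" "d \<le> d1" "d \<le> d2" "d \<le> e2" "d \<le> \<tau> - \<tau>1" "d \<le> \<tau>2 - \<tau>"
    using d1(1) d2(1) e2 \<tau> unfolding d_def by auto
  show ?thesis
  proof (intro exI[of _ d] conjI allI impI d(1))
    fix t assume t: "\<bar>t - \<tau>\<bar> < d"
    show t12: "\<tau>1 < t" "t < \<tau>2" using t d by auto
    note z = \<sigma>[OF t12 c]
    let ?z = "\<sigma> c t"
    define l where "l = Complex (Re ?x - q) t"
    define u where "u = Complex (Re ?x + q) t"
    have "l - (?x - of_real q) = \<i> * of_real (t - \<tau>)" "u - (?x + of_real q) = \<i> * of_real (t - \<tau>)"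
      using x by (simp_all add: l_def u_def complex_eq_iff)
    then have "dist l (?x - of_real q) = \<bar>t - \<tau>\<bar>" "dist u (?x + of_real q) = \<bar>t - \<tau>\<bar>"
      by (simp_all only: dist_norm norm_mult norm_of_real norm_ii mult_1)
    then have lu: "Re (g l) < c" "c < Re (g u)" "l \<in> V1" "u \<in> V1" using t d d1(2)[of l] d2(2)[of u] by auto
    have "Re l < Re ?z"
    proof (rule ccontr)
      assume "\<not> Re l < Re ?z"
      then consider "Re ?z < Re l" | "?z = l" using z by (force simp: l_def complex_eq_iff)
      then show False
        using Re_g_less[OF VV[OF z(1)], of l] lu z by cases (auto simp: V1_def l_def)
    qed
    moreover have "Re ?z < Re u"
    proof (rule ccontr)
      assume "\<not> Re ?z < Re u"
      then consider "Re u < Re ?z" | "?z = u" using z by (force simp: u_def complex_eq_iff)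
      then show False
        using Re_g_less[OF VV[OF lu(4)], of ?z] lu z by cases (auto simp: V1_def u_def)
    qed
    ultimately have "\<bar>Re (?z - ?x)\<bar> < q" by (auto simp: l_def u_def)
    moreover have "\<bar>Im (?z - ?x)\<bar> < d" using t x z by simp
    ultimately have "dist ?z ?x < q + d" using cmod_le[of "?z - ?x"] unfolding dist_norm by linarith
    then show "dist ?z ?x < e" using q d(4) unfolding e2_def by linarith
  qed
qed

lemma level_increasing:
  assumes c: "0 < c" "c < \<kappa>" and t: "\<tau>1 < t" "t < t'" "t' < \<tau>2"
  shows "Im (K (\<sigma> c t)) < Im (K (\<sigma> c t'))"
proof -
  define P where "P a b \<longleftrightarrow> (a < b \<longrightarrow> Im (K (\<sigma> c a)) < Im (K (\<sigma> c b)))" for a b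
  have "P t t'"
  proof (rule Bolzano)
    show "t \<le> t'" using t by simp
    show "P a c'" if "P a b" "P b c'" "a \<le> b" "b \<le> c'" for a b c'
    proof (cases "a = b \<or> b = c'")
      case True then show ?thesis using that by auto
    next
      case False then show ?thesis using that unfolding P_def by fastforce
    qed
    fix \<tau> assume "t \<le> \<tau>" "\<tau> \<le> t'"
    then have \<tau>: "\<tau>1 < \<tau>" "\<tau> < \<tau>2" using t by auto
    note x = \<sigma>[OF \<tau> c]
    obtain r where r: "r > 0" "ball (\<sigma> c \<tau>) r \<subseteq> V1" using openE[OF open_V1 x(1)] by blast
    have bb: "branch (ball (\<sigma> c \<tau>) r) \<eta>" by (rule branch_subset[OF V]) (use r in \<open>auto simp: V1_def\<close>)
    obtain d where d: "d > 0" "\<And>t. \<bar>t - \<tau>\<bar> < d \<Longrightarrow> \<tau>1 < t \<and> t < \<tau>2 \<and> dist (\<sigma> c t) (\<sigma> c \<tau>) < r"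
      using \<sigma>_near[OF \<tau> c r(1)] by blast
    have loc: "0 < (u - \<tau>) * (Im (K (\<sigma> c u)) - Im (K (\<sigma> c \<tau>)))" if u: "\<bar>u - \<tau>\<bar> < d" "u \<noteq> \<tau>" for u
    proof -
      have u12: "\<tau>1 < u" "u < \<tau>2" using d(2)[OF u(1)] by auto
      note y = \<sigma>[OF u12 c]
      let ?x = "\<sigma> c \<tau>" and ?y = "\<sigma> c u"
      have "closed_segment ?x ?y \<subseteq> ball ?x r"
        by (rule closed_segment_subset) (use r d(2)[OF u(1)] in \<open>auto simp: dist_commute\<close>)
      moreover have "?x \<noteq> ?y" using x(2) y(2) u(2) by metis
      ultimately have pos: "0 < Re (cnj (?y - ?x) * (K ?y - K ?x))"
        unfolding K_def by (rule branch_increasing(2)[OF bb])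
      have "Re (K ?y) = Re (K ?x)" using Re_K x y by (auto simp: V1_def)
      then have "K ?y - K ?x = \<i> * of_real (Im (K ?y) - Im (K ?x))" by (simp add: complex_eq_iff)
      then have "Re (cnj (?y - ?x) * (K ?y - K ?x)) = Re (cnj (?y - ?x) * (\<i> * of_real (Im (K ?y) - Im (K ?x))))" by (simp only:)
      also have "\<dots> = (Im ?y - Im ?x) * (Im (K ?y) - Im (K ?x))" by (simp add: algebra_simps)
      finally show ?thesis using pos x(2) y(2) by simp
    qed
    show "\<exists>d>0. \<forall>a b. a \<le> \<tau> \<and> \<tau> \<le> b \<and> b - a < d \<longrightarrow> P a b"
    proof (intro exI[of _ d] conjI allI impI d(1))
      fix a b assume ab: "a \<le> \<tau> \<and> \<tau> \<le> b \<and> b - a < d"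
      have "a = \<tau> \<or> Im (K (\<sigma> c a)) < Im (K (\<sigma> c \<tau>))" using loc[of a] ab by (auto simp: zero_less_mult_iff)
      moreover have "b = \<tau> \<or> Im (K (\<sigma> c \<tau>)) < Im (K (\<sigma> c b))" using loc[of b] ab by (auto simp: zero_less_mult_iff)
      ultimately show "P a b" unfolding P_def by auto
    qed
  qed
  then show ?thesis using t by (simp add: P_def)
qed

definition V2 :: "complex set" where "V2 = {x \<in> V1. Re (g x) < \<kappa>}"

lemma V2_\<sigma>: "x \<in> V2 \<Longrightarrow> x = \<sigma> (Re (g x)) (Im x)"
  using level_unique[of x "\<sigma> (Re (g x)) (Im x)"] \<sigma>[of "Im x" "Re (g x)"] Re_g_pos[of x] by (auto simp: V2_def V1_def)

lemma inj_K: "inj_on K V2"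
proof (rule inj_onI)
  fix x y assume x: "x \<in> V2" and y: "y \<in> V2" and eq: "K x = K y"
  have V: "x \<in> V" "y \<in> V" "x \<in> V1" "y \<in> V1" using x y by (auto simp: V2_def V1_def)
  have Re: "Re (g x) = Re (g y)" using Re_K eq V by metis
  have c: "0 < Re (g x)" "Re (g x) < \<kappa>" using Re_g_pos V x by (auto simp: V2_def)
  have sx: "x = \<sigma> (Re (g x)) (Im x)" "y = \<sigma> (Re (g x)) (Im y)" using V2_\<sigma>[OF x] V2_\<sigma>[OF y] Re by auto
  have "Im x = Im y"
  proof (rule ccontr)
    assume "Im x \<noteq> Im y"
    then consider "Im x < Im y" | "Im y < Im x" by linarith
    then show False
    proof cases
      case 1
      then have "Im (K x) < Im (K y)" using level_increasing[OF c _ 1] V sx by (simp add: V1_def)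
      then show False using eq by simp
    next
      case 2
      then have "Im (K y) < Im (K x)" using level_increasing[OF c _ 2] V sx by (simp add: V1_def)
      then show False using eq by simp
    qed
  qed
  then show "x = y" using level_unique V Re by blast
qed

lemma open_V2: "open V2"
proof -
  have "continuous_on V1 (\<lambda>x. Re (g x))"
    by (intro continuous_on_Re continuous_on_subset[OF cont_g]) (auto simp: V1_def)
  then have "open (V1 \<inter> (\<lambda>x. Re (g x)) -` {..<\<kappa>})" by (rule continuous_open_preimage[OF _ open_V1]) simp
  moreover have "V1 \<inter> (\<lambda>x. Re (g x)) -` {..<\<kappa>} = V2" by (auto simp: V2_def)
  ultimately show ?thesis by simp
qed

lemma K_rectangle:
  defines "L \<equiv> \<tau>2 - \<tau>1"
  defines "c1 \<equiv> min (\<kappa>/2) ((L / (8 * ell)) * L / 8)"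
  assumes k: "0 < Re k" "Re k < c1" "\<tau>1 + 3 * L / 8 < Im k" "Im k < \<tau>2 - 3 * L / 8"
  shows "k \<in> K ` V2"
proof -
  define c where "c = Re k"
  define \<mu> where "\<mu> = L / (8 * ell)"
  have L: "L > 0" using \<tau>12 by (simp add: L_def)
  have \<mu>: "\<mu> > 0" using L ell by (simp add: \<mu>_def)
  have c1: "c1 \<le> \<kappa>/2" "c1 \<le> \<mu> * L / 8" unfolding c1_def \<mu>_def by (rule min.cobounded1, rule min.cobounded2)
  have c: "0 < c" "c < \<kappa>" using k(1,2) c1 \<kappa> unfolding c_def by linarith+
  have near: "\<bar>Im (K (\<sigma> c \<tau>)) - \<tau>\<bar> \<le> L / 8" if \<tau>: "\<tau>1 < \<tau>" "\<tau> < \<tau>2" for \<tau>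
  proof -
    note x = \<sigma>[OF \<tau> c]
    have "norm (g (\<sigma> c \<tau>)) \<le> (\<mu> * ell + c / \<mu>) / 2" using g_bound[OF x(1) \<mu>] x(3) by simp
    also have "\<mu> * ell = L / 8" using ell by (simp add: \<mu>_def)
    also have "c / \<mu> \<le> L / 8" using k(2) c1(2) \<mu> unfolding c_def by (simp add: pos_divide_le_eq mult.commute)
    finally have "norm (g (\<sigma> c \<tau>)) \<le> L / 8" by simp
    moreover have "Im (K (\<sigma> c \<tau>)) - \<tau> = - Im (g (\<sigma> c \<tau>))" using Im_K[of "\<sigma> c \<tau>"] x by (auto simp: V1_def)
    ultimately show ?thesis using abs_Im_le_cmod[of "g (\<sigma> c \<tau>)"] by linarith
  qed
  define t1 where "t1 = \<tau>1 + L / 8"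
  define t2 where "t2 = \<tau>2 - L / 8"
  have t: "\<tau>1 < t1" "t1 < t2" "t2 < \<tau>2" using \<tau>12 by (simp_all add: t1_def t2_def L_def field_simps)
  have in12: "\<tau>1 < s" "s < \<tau>2" if "t1 \<le> s" "s \<le> t2" for s using that t by auto
  have "continuous_on {t1..t2} (\<lambda>s. Im (K (\<sigma> c s)))"
  proof -
    have "continuous_on {t1..t2} (\<sigma> c)"
      unfolding continuous_on_iff dist_real_def using \<sigma>_near[OF in12 c] by (metis atLeastAtMost_iff)
    then have "continuous_on {t1..t2} (\<lambda>s. K (\<sigma> c s))"
      by (rule continuous_on_compose2[OF holomorphic_on_imp_continuous_on[OF K_holomorphic]])
        (use \<sigma>(1)[OF in12 c] in \<open>auto simp: V1_def\<close>)
    then show ?thesis by (rule continuous_on_Im)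
  qed
  moreover have "Im (K (\<sigma> c t1)) \<le> Im k" 
  proof -
    have "\<bar>Im (K (\<sigma> c t1)) - t1\<bar> \<le> L / 8" by (rule near) (use t in auto)
    then show ?thesis using k(3) L unfolding t1_def abs_le_iff by argo
  qed
  moreover have "Im k \<le> Im (K (\<sigma> c t2))" 
  proof -
    have "\<bar>Im (K (\<sigma> c t2)) - t2\<bar> \<le> L / 8" by (rule near) (use t in auto)
    then show ?thesis using k(4) L unfolding t2_def abs_le_iff by argo
  qed
  ultimately obtain s where s: "t1 \<le> s" "s \<le> t2" "Im (K (\<sigma> c s)) = Im k"
    using IVT'[of "\<lambda>s. Im (K (\<sigma> c s))" t1 "Im k" t2] t by auto
  note x = \<sigma>[OF in12[OF s(1,2)] c]
  have "K (\<sigma> c s) = k" using s(3) x Re_K[of "\<sigma> c s"] by (auto simp: complex_eq_iff c_def V1_def)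
  moreover have "\<sigma> c s \<in> V2" using x c by (simp add: V2_def)
  ultimately show ?thesis by blast
qed

lemma half_disc_map:
  obtains M t0 q where "q > 0" "M holomorphic_on ball (complex_of_real t0) q \<inter> {w. 0 < Im w}"
    "inj_on M (ball (complex_of_real t0) q \<inter> {w. 0 < Im w})"
    "\<And>w. w \<in> ball (complex_of_real t0) q \<Longrightarrow> 0 < Im w \<Longrightarrow> M w \<in> ball 0 1"
    "\<And>w \<mu>. w \<in> ball (complex_of_real t0) q \<Longrightarrow> 0 < Im w \<Longrightarrow> 0 < \<mu> \<Longrightarrow> norm (hmap (M w)) \<le> (\<mu> * ell + Im w / \<mu>) / 2"
proof -
  define L where "L = \<tau>2 - \<tau>1"
  define c1 where "c1 = min (\<kappa>/2) ((L / (8 * ell)) * L / 8)"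
  have L: "L > 0" using \<tau>12 by (simp add: L_def)
  have c1: "c1 > 0" unfolding c1_def using \<kappa> ell L by simp
  define q where "q = min c1 (L/8)"
  define t0 where "t0 = - (\<tau>1 + L/2)"
  define S where "S = ball (complex_of_real t0) q \<inter> {w. 0 < Im w}"
  have KV2: "K holomorphic_on V2" by (rule holomorphic_on_subset[OF K_holomorphic]) (auto simp: V2_def V1_def)
  obtain G where G: "G holomorphic_on (K ` V2)" "\<And>x. x \<in> V2 \<Longrightarrow> G (K x) = x"
    by (rule holomorphic_has_inverse[OF KV2 open_V2 inj_K]) blast
  have rect: "- \<i> * w \<in> K ` V2" if w: "w \<in> S" for w
  proof (rule K_rectangle[folded L_def, folded c1_def])
    have n: "norm (w - of_real t0) < q" "0 < Im w" using w by (auto simp: S_def dist_norm norm_minus_commute)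
    have "\<bar>Im w\<bar> < q" "\<bar>Re w - t0\<bar> < q"
      using abs_Im_le_cmod[of "w - of_real t0"] abs_Re_le_cmod[of "w - of_real t0"] n by auto
    then have a: "Im w < c1" "\<bar>Re w - t0\<bar> < L/8" using n(2) unfolding q_def by auto
    show "0 < Re (- \<i> * w)" "Re (- \<i> * w) < c1" using n a by auto
    have i: "Im (- \<i> * w) = - Re w" "\<tau>2 = \<tau>1 + L" by (simp_all add: L_def)
    show "\<tau>1 + 3 * L / 8 < Im (- \<i> * w)" unfolding i using a(2) unfolding t0_def abs_less_iff by argo
    show "Im (- \<i> * w) < \<tau>2 - 3 * L / 8" unfolding i using a(2) unfolding t0_def abs_less_iff by argo
  qed
  define M where "M w = \<eta> (G (- \<i> * w))" for w
  have GV: "G (- \<i> * w) \<in> V2" "K (G (- \<i> * w)) = - \<i> * w" if w: "w \<in> S" for w using rect[OF w] G(2) by auto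
  have V2V: "V2 \<subseteq> V" by (auto simp: V2_def V1_def)
  show thesis
  proof
    show "q > 0" using c1 L by (simp add: q_def)
    have 1: "(G \<circ> (\<lambda>w. - \<i> * w)) holomorphic_on S"
      by (rule holomorphic_on_compose_gen[OF _ G(1)]) (use rect in \<open>auto intro!: holomorphic_intros\<close>)
    have "(\<eta> \<circ> (G \<circ> (\<lambda>w. - \<i> * w))) holomorphic_on S"
      by (rule holomorphic_on_compose_gen[OF 1 branchD(2)[OF V]]) (use GV V2V in auto)
    then show "M holomorphic_on ball (complex_of_real t0) q \<inter> {w. 0 < Im w}"
      unfolding S_def M_def by (simp add: o_def)
    show "inj_on M (ball (complex_of_real t0) q \<inter> {w. 0 < Im w})"
      unfolding S_def[symmetric]
    proof (rule inj_onI)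
      fix w w' assume w: "w \<in> S" "w' \<in> S" "M w = M w'"
      then have "G (- \<i> * w) = G (- \<i> * w')"
        using branchD(4)[OF V] GV V2V unfolding M_def by (metis subsetD)
      then have "- \<i> * w = - \<i> * w'" using GV w by metis
      then show "w = w'" by simp
    qed
    fix w assume w: "w \<in> ball (complex_of_real t0) q" "0 < Im w"
    then have wS: "w \<in> S" by (simp add: S_def)
    show "M w \<in> ball 0 1" unfolding M_def by (rule branchD(3)[OF V]) (use GV[OF wS] V2V in auto)
    show "norm (hmap (M w)) \<le> (\<mu> * ell + Im w / \<mu>) / 2" if \<mu>: "0 < \<mu>" for \<mu>
    proof -
      let ?x = "G (- \<i> * w)"
      have x: "?x \<in> V1" "?x \<in> V" using GV[OF wS] by (auto simp: V2_def V1_def)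
      have "Re (g ?x) = Im w" using Re_K[OF x(2)] GV(2)[OF wS] by simp
      then show ?thesis using g_bound[OF x(1) \<mu>] by (simp add: M_def g_def)
    qed
  qed
qed

lemma boundary_arc:
  obtains e0 \<delta> where "norm e0 = 1" "\<delta> > 0"
    "\<And>e. norm e = 1 \<Longrightarrow> dist e e0 < \<delta> \<Longrightarrow> (hmap \<longlongrightarrow> 0) (at e within ball 0 1)"
proof -
  obtain M t0 q where M: "q > 0" "M holomorphic_on ball (complex_of_real t0) q \<inter> {w. 0 < Im w}"
    "inj_on M (ball (complex_of_real t0) q \<inter> {w. 0 < Im w})"
    "\<And>w. w \<in> ball (complex_of_real t0) q \<Longrightarrow> 0 < Im w \<Longrightarrow> M w \<in> ball 0 1"
    "\<And>w \<mu>. w \<in> ball (complex_of_real t0) q \<Longrightarrow> 0 < Im w \<Longrightarrow> 0 < \<mu> \<Longrightarrow> norm (hmap (M w)) \<le> (\<mu> * ell + Im w / \<mu>) / 2"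
    by (rule half_disc_map) blast
  have small: "\<exists>\<delta>>0. \<forall>w. w \<in> ball (complex_of_real t0) q \<and> 0 < Im w \<and> Im w < \<delta> \<longrightarrow> norm (hmap (M w)) < d" if d: "d > 0" for d
  proof -
    define \<mu> where "\<mu> = d / (2 * ell)"
    have \<mu>: "\<mu> > 0" "\<mu> * ell = d / 2" using d ell by (auto simp: \<mu>_def)
    show ?thesis
    proof (intro exI[of _ "\<mu> * d"] conjI allI impI)
      show "0 < \<mu> * d" using \<mu> d by simp
      fix w assume w: "w \<in> ball (complex_of_real t0) q \<and> 0 < Im w \<and> Im w < \<mu> * d"
      then have "norm (hmap (M w)) \<le> (d / 2 + Im w / \<mu>) / 2" using M(5)[of w \<mu>] \<mu> by simp
      moreover have "Im w / \<mu> < d" using w \<mu> by (simp add: pos_divide_less_eq mult.commute)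
      ultimately show "norm (hmap (M w)) < d" using d by argo
    qed
  qed
  have to_circle: "\<exists>\<delta>>0. \<forall>w. w \<in> ball (complex_of_real t0) q \<and> 0 < Im w \<and> Im w < \<delta> \<longrightarrow> \<rho> < norm (M w)" if \<rho>: "\<rho> < 1" "0 \<le> \<rho>" for \<rho>
  proof -
    have "compact (hmap ` cball 0 \<rho>)"
      by (intro compact_continuous_image continuous_on_subset[OF cont_hmap]) (use \<rho> in auto)
    moreover have "hmap ` cball 0 \<rho> \<subseteq> img" unfolding img_def using \<rho> by (intro image_mono) auto
    then have "0 \<notin> hmap ` cball 0 \<rho>" using zero_img by blast
    ultimately obtain d where d: "d > 0" "\<And>y. y \<in> hmap ` cball 0 \<rho> \<Longrightarrow> d \<le> dist 0 y"
      using separate_point_closed[OF compact_imp_closed] by metis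
    obtain \<delta> where \<delta>: "\<delta> > 0" "\<And>w. w \<in> ball (complex_of_real t0) q \<and> 0 < Im w \<and> Im w < \<delta> \<Longrightarrow> norm (hmap (M w)) < d"
      using small[OF d(1)] by blast
    show ?thesis
    proof (intro exI[of _ \<delta>] conjI allI impI \<delta>(1))
      fix w assume w: "w \<in> ball (complex_of_real t0) q \<and> 0 < Im w \<and> Im w < \<delta>"
      show "\<rho> < norm (M w)"
      proof (rule ccontr)
        assume "\<not> \<rho> < norm (M w)"
        then have "d \<le> dist 0 (hmap (M w))" by (intro d(2)) auto
        then show False using \<delta>(2)[OF w] by simp
      qed
    qed
  qed
  obtain \<delta>1 where \<delta>1: "\<delta>1 > 0" "\<And>w. w \<in> ball (complex_of_real t0) q \<and> 0 < Im w \<and> Im w < \<delta>1 \<Longrightarrow> 1/2 < norm (M w)"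
    using to_circle[of "1/2"] by auto
  define q' where "q' = min q \<delta>1"
  have q': "0 < q'" "q' \<le> q" "q' \<le> \<delta>1" using M(1) \<delta>1(1) by (auto simp: q'_def)
  define S where "S = ball (complex_of_real t0) q'"
  define SH where "SH = S \<inter> {w. 0 < Im w}"
  have Sq: "w \<in> ball (complex_of_real t0) q" "Im w < \<delta>1" if "w \<in> S" for w
  proof -
    show "w \<in> ball (complex_of_real t0) q" using that q' by (auto simp: S_def)
    have "Im w \<le> norm (w - of_real t0)" using abs_Im_le_cmod[of "w - of_real t0"] by simp
    then show "Im w < \<delta>1" using that q' by (auto simp: S_def dist_norm norm_minus_commute)
  qed
  have SHq: "SH \<subseteq> ball (complex_of_real t0) q \<inter> {w. 0 < Im w}" using Sq by (auto simp: SH_def)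
  have SHq': "w \<in> ball (complex_of_real t0) q" "0 < Im w" if "w \<in> SH" for w using that SHq by blast+
  have MD: "norm (M w) < 1" if "w \<in> SH" for w using M(4)[OF SHq'[OF that]] by simp
  have Mnz: "M w \<noteq> 0" if "w \<in> SH" for w using \<delta>1(2)[of w] Sq[of w] that unfolding SH_def by force
  have hM: "M holomorphic_on SH" by (rule holomorphic_on_subset[OF M(2) SHq])
  have cSH: "convex SH" unfolding SH_def S_def by (intro convex_Int convex_ball convex_halfspace_Im_gt)
  obtain Lg where Lg: "Lg holomorphic_on SH" "\<And>w. w \<in> SH \<Longrightarrow> M w = exp (Lg w)"
    by (rule contractible_imp_holomorphic_log[OF hM convex_imp_contractible[OF cSH] Mnz]) blast+
  define F where "F w = - \<i> * Lg w" for w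
  have hF: "F holomorphic_on SH" unfolding F_def by (intro holomorphic_intros Lg(1))
  have MF: "M w = exp (\<i> * F w)" if "w \<in> SH" for w using Lg(2)[OF that] by (simp add: F_def)
  have nMF: "norm (M w) = exp (- Im (F w))" if "w \<in> SH" for w using MF[OF that] by simp
  have ImF: "0 < Im (F w)" if "w \<in> SH" for w using MD[OF that] nMF[OF that] by simp
  have limF: "((\<lambda>w. Im (F w)) \<longlongrightarrow> 0) (at (of_real x) within (S \<inter> {z. 0 < Im z}))" for x
  proof (rule tendstoI)
    fix e :: real assume e: "0 < e"
    obtain \<delta> where \<delta>: "\<delta> > 0" "\<And>w. w \<in> ball (complex_of_real t0) q \<and> 0 < Im w \<and> Im w < \<delta> \<Longrightarrow> exp (- e) < norm (M w)"
      using to_circle[of "exp (- e)"] e by auto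
    have "dist (Im (F w)) 0 < e" if w: "w \<in> SH" "dist w (of_real x) < \<delta>" for w
    proof -
      have "Im w \<le> norm (w - of_real x)" using abs_Im_le_cmod[of "w - of_real x"] by simp
      then have "Im w < \<delta>" using w by (simp add: dist_norm)
      then have "exp (- e) < exp (- Im (F w))" using \<delta>(2)[of w] SHq'[OF w(1)] nMF[OF w(1)] by simp
      then show ?thesis using ImF[OF w(1)] by simp
    qed
    then show "eventually (\<lambda>w. dist (Im (F w)) 0 < e) (at (of_real x) within (S \<inter> {z. 0 < Im z}))"
      unfolding eventually_at SH_def[symmetric] using \<delta>(1) by blast
  qed
  have cnjS: "cnj z \<in> S" if "z \<in> S" for z
  proof -
    have "dist (of_real t0) (cnj z) = norm (cnj (of_real t0 - z))" by (simp add: dist_norm)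
    also have "\<dots> = dist (of_real t0) z" by (simp only: complex_mod_cnj dist_norm)
    finally show ?thesis using that by (simp add: S_def)
  qed
  obtain G where G: "G holomorphic_on S" "\<And>z. z \<in> S \<Longrightarrow> 0 < Im z \<Longrightarrow> G z = F z" "\<And>z. z \<in> S \<Longrightarrow> G (cnj z) = cnj (G z)"
    by (rule Schwarz_reflection_Im[of S F]) (use hF limF cnjS in \<open>auto simp: S_def SH_def\<close>)
  have oS: "open S" "connected S" by (auto simp: S_def)
  have ImG: "0 < Im (G z) \<longleftrightarrow> 0 < Im z" if z: "z \<in> S" for z
  proof -
    consider "0 < Im z" | "Im z = 0" | "Im z < 0" by linarith
    then show ?thesis
    proof cases
      case 1
      then show ?thesis using G(2)[OF z] ImF[of z] z by (simp add: SH_def)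
    next
      case 2
      then have "cnj z = z" by (simp add: complex_eq_iff)
      then have "Im (G z) = 0" using G(3)[OF z] by (metis Reals_cnj_iff complex_is_Real_iff)
      then show ?thesis using 2 by simp
    next
      case 3
      then have "0 < Im (G (cnj z))" using G(2)[OF cnjS[OF z]] ImF[of "cnj z"] cnjS[OF z] by (simp add: SH_def)
      then show ?thesis using G(3)[OF z] 3 by simp
    qed
  qed
  have ImG0: "Im z = 0" if z: "z \<in> S" "Im (G z) = 0" for z
  proof (rule ccontr)
    assume "Im z \<noteq> 0"
    then consider "0 < Im z" | "0 < Im (cnj z)" by fastforce
    then show False
    proof cases
      case 1 then show False using ImG[OF z(1)] z(2) by simp
    next
      case 2 then show False using ImG[OF cnjS[OF z(1)]] G(3)[OF z(1)] z(2) by simp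
    qed
  qed
  have "\<exists>x. complex_of_real x \<in> S \<and> deriv G (of_real x) \<noteq> 0"
  proof (rule ccontr)
    assume "\<not> ?thesis"
    then have z: "\<And>x. complex_of_real x \<in> S \<Longrightarrow> deriv G (of_real x) = 0" by blast
    have tS: "of_real t0 \<in> S" using q' by (simp add: S_def)
    have "complex_of_real t0 islimpt (complex_of_real ` {t0<..<t0 + q'})"
      unfolding islimpt_approachable
    proof (intro allI impI)
      fix e :: real assume e: "0 < e"
      define m where "m = t0 + min e q' / 2"
      have "dist (complex_of_real m) (of_real t0) < e" using e q' by (simp add: dist_norm m_def)
      moreover have "m \<in> {t0<..<t0 + q'}" "m \<noteq> t0" using e q' by (auto simp: m_def)
      ultimately show "\<exists>x'\<in>complex_of_real ` {t0<..<t0 + q'}. x' \<noteq> of_real t0 \<and> dist x' (of_real t0) < e"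
        by (intro bexI[of _ "complex_of_real m"]) auto
    qed
    moreover have sub: "complex_of_real ` {t0<..<t0 + q'} \<subseteq> S" by (auto simp: S_def dist_norm simp flip: of_real_diff)
    ultimately have d0: "deriv G w = 0" if "w \<in> S" for w
      using analytic_continuation[OF holomorphic_deriv[OF G(1) oS(1)] oS sub tS _ _ that] z sub by blast
    have "\<exists>c. \<forall>w\<in>S. G w = c"
    proof (rule has_field_derivative_zero_constant)
      show "convex S" by (simp add: S_def)
      show "(G has_field_derivative 0) (at w within S)" if "w \<in> S" for w
        using holomorphic_derivI[OF G(1) oS(1) that] d0[OF that] by (simp add: has_field_derivative_at_within)
    qed
    then obtain c where c: "\<And>w. w \<in> S \<Longrightarrow> G w = c" by blast
    define a where "a = of_real t0 + \<i> * of_real (q'/2)"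
    define b where "b = of_real t0 + \<i> * of_real (q'/4)"
    have ab: "a \<in> SH" "b \<in> SH" "a \<noteq> b" using q' by (auto simp: a_def b_def SH_def S_def dist_norm norm_mult)
    then have "M a = M b" using MF G(2) c by (metis Int_iff SH_def mem_Collect_eq)
    then show False using M(3) ab SHq by (meson inj_onD subsetD)
  qed
  then obtain x1 where x1: "complex_of_real x1 \<in> S" "deriv G (of_real x1) \<noteq> 0" by blast
  define E where "E w = exp (\<i> * G w)" for w
  have hE: "E holomorphic_on S" unfolding E_def by (intro holomorphic_intros G(1))
  have "(E has_field_derivative exp (\<i> * G (of_real x1)) * (\<i> * deriv G (of_real x1))) (at (of_real x1))"
    unfolding E_def by (intro DERIV_chain2[OF DERIV_exp] DERIV_cmult holomorphic_derivI[OF G(1) oS(1) x1(1)])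
  then have dE: "deriv E (of_real x1) \<noteq> 0" using x1(2) by (simp add: DERIV_imp_deriv)
  obtain s where s: "s > 0" "ball (of_real x1) s \<subseteq> S" "open (E ` ball (of_real x1) s)" "inj_on E (ball (of_real x1) s)"
    by (rule has_complex_derivative_locally_invertible[OF hE x1(1) oS(1) dE])
  let ?B = "ball (complex_of_real x1) s"
  have hEB: "E holomorphic_on ?B" by (rule holomorphic_on_subset[OF hE s(2)])
  obtain n where n: "n holomorphic_on (E ` ?B)" "\<And>z. z \<in> ?B \<Longrightarrow> n (E z) = z"
    by (rule holomorphic_has_inverse[OF hEB open_ball s(4)]) blast
  define e0 where "e0 = E (of_real x1)"
  have nE: "norm (E z) = exp (- Im (G z))" for z by (simp add: E_def)
  have Gx1: "Im (G (of_real x1)) = 0"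
    using G(3)[OF x1(1)] by (metis Reals_cnj_iff complex_cnj_complex_of_real complex_is_Real_iff)
  have "norm e0 = 1" unfolding e0_def nE Gx1 by simp
  have "e0 \<in> E ` ?B" using s(1) by (simp add: e0_def)
  then obtain \<delta> where \<delta>: "\<delta> > 0" "ball e0 \<delta> \<subseteq> E ` ?B" using s(3) openE by blast
  have "(hmap \<longlongrightarrow> 0) (at e within ball 0 1)" if e: "norm e = 1" "dist e e0 < \<delta>" for e
  proof (rule tendstoI)
    fix \<epsilon> :: real assume \<epsilon>: "0 < \<epsilon>"
    obtain d where d: "d > 0" "\<And>w. w \<in> ball (complex_of_real t0) q \<and> 0 < Im w \<and> Im w < d \<Longrightarrow> norm (hmap (M w)) < \<epsilon>"
      using small[OF \<epsilon>] by blast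
    have eB: "e \<in> E ` ?B" using \<delta>(2) e(2) by (auto simp: dist_commute)
    have Ene: "E (n v) = v" "n v \<in> ?B" if "v \<in> E ` ?B" for v using that n(2) by auto
    have "exp (- Im (G (n e))) = 1" using nE[of "n e"] Ene(1)[OF eB] e(1) by simp
    then have Ime: "Im (n e) = 0" using ImG0[of "n e"] Ene(2)[OF eB] s(2) by auto
    have "isCont n e" using n(1) s(3) eB by (meson continuous_on_eq_continuous_at holomorphic_on_imp_continuous_on)
    then have "(n \<longlongrightarrow> n e) (at e within ball 0 1)" using isCont_def tendsto_within_subset subset_UNIV by blast
    then have "((\<lambda>v. Im (n v)) \<longlongrightarrow> 0) (at e within ball 0 1)" using tendsto_Im Ime by metis
    then have 1: "eventually (\<lambda>v. \<bar>Im (n v)\<bar> < d) (at e within ball 0 1)"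
      using d(1) tendstoD[of "\<lambda>v. Im (n v)" 0 _ d] by (simp add: dist_real_def)
    have 2: "eventually (\<lambda>v. v \<in> ball e0 \<delta>) (at e within ball 0 1)"
      using e(2) eventually_at_in_open'[of "ball e0 \<delta>" e] eventually_at_filter
      by (metis (mono_tags, lifting) eventually_at_topological mem_ball dist_commute open_ball)
    have 3: "eventually (\<lambda>v. v \<in> ball 0 1) (at e within ball 0 1)"
      by (simp add: eventually_at_filter)
    show "eventually (\<lambda>v. dist (hmap v) 0 < \<epsilon>) (at e within ball 0 1)"
      using 1 2 3
    proof eventually_elim
      case (elim v)
      have vB: "v \<in> E ` ?B" using elim(2) \<delta>(2) by blast
      have nv: "n v \<in> S" using Ene(2)[OF vB] s(2) by blast
      have "exp (- Im (G (n v))) < 1" using nE[of "n v"] Ene(1)[OF vB] elim(3) by simp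
      then have pos: "0 < Im (n v)" using ImG[OF nv] by simp
      then have "E (n v) = M (n v)" using G(2)[OF nv] MF[of "n v"] nv by (simp add: E_def SH_def)
      then have "M (n v) = v" using Ene(1)[OF vB] by simp
      then show ?case using d(2)[of "n v"] Sq(1)[OF nv] pos elim(1) by auto
    qed
  qed
  then show thesis using that[OF \<open>norm e0 = 1\<close> \<delta>(1)] by blast
qed

end

context harmonic_sector
begin

lemma point_near_side:
  assumes "0 < \<rho>" "\<rho> < r" "0 < d"
  obtains w where "w \<in> ball 0 1" "dist (hmap w) (of_real \<rho>) < d"
proof -
  obtain c where c: "c > 0" "img \<inter> ball (of_real \<rho>) c = {z \<in> ball (of_real \<rho>) c. 0 < Im z}"
    using half_disc_at[OF assms(1,2)] by metis
  define t where "t = min c d / 2"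
  have t: "0 < t" "t < c" "t < d" using c assms by (auto simp: t_def)
  have "of_real \<rho> + \<i> * of_real t \<in> {z \<in> ball (complex_of_real \<rho>) c. 0 < Im z}"
    using t by (auto simp: dist_norm norm_mult)
  then have "of_real \<rho> + \<i> * of_real t \<in> img" using c(2) by blast
  then obtain w where "w \<in> ball 0 1" "hmap w = of_real \<rho> + \<i> * of_real t" by (auto simp: img_def)
  then show thesis using that[of w] t by (auto simp: dist_norm norm_mult)
qed

lemma ball_stop:
  assumes b: "branch (ball \<xi> (dist \<xi> p)) \<eta>" and p\<xi>: "p \<noteq> \<xi>"
    and near: "\<And>x. x \<in> ball \<xi> (dist \<xi> p) \<Longrightarrow> norm (hmap (\<eta> x)) \<le> norm (x - p)"
    and q: "to_line s p \<in> ball \<xi> (dist \<xi> p)" "to_line s p \<in> B" "\<beta> (to_line s p) = \<eta> (to_line s p)" and sp: "Re p < s"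
  shows "p \<notin> visible (to_line s) B \<beta>"
    and "\<lbrakk>Im y = Im p; Re p < Re y; Re y \<le> s\<rbrakk> \<Longrightarrow> y \<in> visible (to_line s) B \<beta>"
proof -
  let ?q = "to_line s p" and ?R = "dist \<xi> p"
  have R: "?R > 0" using p\<xi> by simp
  have yb: "y \<in> ball \<xi> ?R" if y: "Im y = Im p" "Re p < Re y" "Re y \<le> s" for y
  proof (cases "y = ?q")
    case False
    have "y \<in> closed_segment ?q p" using y segment_to_line[of p s] sp by auto
    then have "y \<in> open_segment ?q p" using False y by (auto simp: open_segment_def)
    moreover have "open_segment ?q p \<subseteq> interior (ball \<xi> ?R)"
      by (rule in_interior_closure_convex_segment) (use q R in \<open>auto simp: closure_ball interior_open\<close>)
    ultimately show ?thesis by (simp add: interior_open subset_iff)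
  qed (use q in simp)
  show "y \<in> visible (to_line s) B \<beta>" if y: "Im y = Im p" "Re p < Re y" "Re y \<le> s" for y
  proof -
    have "to_line s y = ?q" using y by (simp add: to_line_def)
    then show ?thesis unfolding visible_def using b yb[OF y] q
      by (auto intro!: exI[of _ "ball \<xi> ?R"] exI[of _ \<eta>])
  qed
  show "p \<notin> visible (to_line s) B \<beta>"
  proof
    assume pv: "p \<in> visible (to_line s) B \<beta>"
    obtain U \<eta>' where U: "branch U \<eta>'" "convex U" "closed_segment ?q p \<subseteq> U" "\<eta>' ?q = \<beta> ?q"
      "closed_segment ?q p \<subseteq> visible (to_line s) B \<beta>" "\<And>x. x \<in> closed_segment ?q p \<Longrightarrow> continuation (to_line s) \<beta> x = \<eta>' x"
      by (rule visible_segment[OF projection_to_line pv]) (rule that)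
    have pU: "p \<in> U" "?q \<in> U" using U(3) by auto
    have "norm (hmap (\<eta>' p)) \<le> 0 + e" if e: "0 < e" for e
    proof -
      define t where "t = min (s - Re p) (e/2)"
      have t: "0 < t" "t \<le> s - Re p" "t \<le> e/2" unfolding t_def using sp e by (simp, intro min.cobounded1, intro min.cobounded2)
      define y where "y = p + of_real t"
      have y: "Im y = Im p" "Re p < Re y" "Re y \<le> s" using t by (auto simp: y_def)
      have "y \<in> closed_segment ?q p" unfolding segment_to_line[OF less_imp_le[OF sp]] using y by simp
      then have yU: "y \<in> U" using U(3) by blast
      have "\<eta>' y = \<eta> y"
        by (rule branch_unique[OF U(1) b U(2) convex_ball pU(2) q(1) _ yU yb[OF y]]) (simp add: U(4) q(3))
      then have "norm (hmap (\<eta>' y)) \<le> t" using near[OF yb[OF y]] t by (simp add: y_def)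
      moreover have "norm (hmap (\<eta>' p) - hmap (\<eta>' y)) \<le> norm (p - y)" by (rule branch_lipschitz(1)[OF U(1,2) pU(1) yU])
      then have "norm (hmap (\<eta>' p) - hmap (\<eta>' y)) \<le> t" using t by (simp add: y_def)
      moreover have "norm (hmap (\<eta>' p)) \<le> norm (hmap (\<eta>' p) - hmap (\<eta>' y)) + norm (hmap (\<eta>' y))"
        by (metis norm_triangle_sub add.commute)
      ultimately show ?thesis using t by linarith
    qed
    then have "norm (hmap (\<eta>' p)) \<le> 0" by (rule field_le_epsilon)
    moreover have "hmap (\<eta>' p) \<in> img" using branchD(3)[OF U(1) pU(1)] by (simp add: img_def)
    ultimately show False using zero_notin_img by simp
  qed
qed

theorem boundary_arc:
  obtains e0 \<delta> where "norm e0 = 1" "\<delta> > 0"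
    "\<And>e. norm e = 1 \<Longrightarrow> dist e e0 < \<delta> \<Longrightarrow> (hmap \<longlongrightarrow> 0) (at e within ball 0 1)"
proof -
  define \<rho> where "\<rho> = r / 16"
  have \<rho>: "0 < \<rho>" "8 * \<rho> < r" "\<rho> < r" using r_pos by (auto simp: \<rho>_def)
  define Q where "Q w \<eta> p e \<longleftrightarrow> branch (ball (2 * H1 w) (dist (2 * H1 w) p)) \<eta> \<and> \<eta> (2 * H1 w) = w \<and>
      (\<forall>x \<in> ball (2 * H1 w) (dist (2 * H1 w) p). norm (hmap (\<eta> x)) \<le> norm (x - p)) \<and>
      999/1000 * \<rho> \<le> dist (2 * H1 w) p \<and> dist (2 * H1 w) p \<le> 1001/1000 * \<rho> \<and>
      Re (p - 2 * H1 w) < 0 \<and> \<bar>Im (p - 2 * H1 w)\<bar> \<le> \<rho>/10 \<and>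
      (\<forall>x \<in> cball (2 * H1 w) (9/10 * \<rho>). norm (hmap (\<eta> x) - (hmap w + of_real (Re (x - 2 * H1 w)))) \<le> e)"
    for w \<eta> p and e :: real
  have ex: "\<exists>d>0. \<forall>w\<in>ball 0 1. dist (hmap w) (of_real \<rho>) < d \<longrightarrow> (\<exists>\<eta> p. Q w \<eta> p e)" if "e > 0" for e
    using disc_reaches_vertex[OF \<rho>(1,2) that] unfolding Q_def by metis
  obtain d0 where d0: "d0 > 0" "\<And>w. w \<in> ball 0 1 \<Longrightarrow> dist (hmap w) (of_real \<rho>) < d0 \<Longrightarrow> \<exists>\<eta> p. Q w \<eta> p (\<rho>/4)"
    using ex[of "\<rho>/4"] \<rho> by auto
  define e1 where "e1 = min (d0/2) (\<rho>/4)"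
  have e1: "e1 > 0" "e1 \<le> d0/2" "e1 \<le> \<rho>/4" using d0 \<rho> unfolding e1_def by (simp, intro min.cobounded1, intro min.cobounded2)
  obtain d1 where d1: "d1 > 0" "\<And>w. w \<in> ball 0 1 \<Longrightarrow> dist (hmap w) (of_real \<rho>) < d1 \<Longrightarrow> \<exists>\<eta> p. Q w \<eta> p e1"
    using ex[OF e1(1)] by auto
  define d where "d = min d1 e1"
  have d: "d > 0" "d \<le> d1" "d \<le> e1" using d1 e1 by (auto simp: d_def)
  obtain w0 where w0: "w0 \<in> ball 0 1" "dist (hmap w0) (of_real \<rho>) < d" using point_near_side[OF \<rho>(1,3) d(1)] by metis
  obtain \<eta>0 a where Q0: "Q w0 \<eta>0 a e1" using d1(2)[OF w0(1)] w0(2) d by auto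
  define \<xi>0 where "\<xi>0 = 2 * H1 w0"
  define B where "B = ball \<xi>0 (dist \<xi>0 a)"
  have A: "branch B \<eta>0" "\<eta>0 \<xi>0 = w0" "\<And>x. x \<in> B \<Longrightarrow> norm (hmap (\<eta>0 x)) \<le> norm (x - a)"
    "999/1000 * \<rho> \<le> dist \<xi>0 a" "dist \<xi>0 a \<le> 1001/1000 * \<rho>" "Re (a - \<xi>0) < 0" "\<bar>Im (a - \<xi>0)\<bar> \<le> \<rho>/10"
    "\<And>x. x \<in> cball \<xi>0 (9/10 * \<rho>) \<Longrightarrow> norm (hmap (\<eta>0 x) - (hmap w0 + of_real (Re (x - \<xi>0)))) \<le> e1"
    using Q0 unfolding Q_def \<xi>0_def[symmetric] B_def by blast+
  define \<xi>1 where "\<xi>1 = \<xi>0 + \<i> * of_real (\<rho>/2)"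
  have d\<xi>: "dist \<xi>0 \<xi>1 = \<rho>/2" using \<rho> by (simp add: \<xi>1_def dist_norm norm_mult)
  have \<xi>1B: "\<xi>1 \<in> B" using d\<xi> A(4) \<rho> by (simp add: B_def)
  define w1 where "w1 = \<eta>0 \<xi>1"
  have w1: "w1 \<in> ball 0 1" "2 * H1 w1 = \<xi>1" using branchD(3,4)[OF A(1) \<xi>1B] by (auto simp: w1_def)
  have "norm (hmap w1 - (hmap w0 + of_real (Re (\<xi>1 - \<xi>0)))) \<le> e1" unfolding w1_def by (rule A(8)) (use d\<xi> \<rho> in simp)
  then have "norm (hmap w1 - hmap w0) \<le> e1" by (simp add: \<xi>1_def)
  then have "dist (hmap w1) (hmap w0) \<le> e1" by (simp add: dist_norm)
  moreover have "dist (hmap w1) (of_real \<rho>) \<le> dist (hmap w1) (hmap w0) + dist (hmap w0) (of_real \<rho>)" by (rule dist_triangle)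
  ultimately have "dist (hmap w1) (of_real \<rho>) < d0" using w0(2) d e1 by linarith
  then obtain \<eta>1 b where Q1: "Q w1 \<eta>1 b (\<rho>/4)" using d0(2)[OF w1(1)] by auto
  have Bb: "branch (ball \<xi>1 (dist \<xi>1 b)) \<eta>1" "\<eta>1 \<xi>1 = w1" "\<And>x. x \<in> ball \<xi>1 (dist \<xi>1 b) \<Longrightarrow> norm (hmap (\<eta>1 x)) \<le> norm (x - b)"
    "999/1000 * \<rho> \<le> dist \<xi>1 b" "dist \<xi>1 b \<le> 1001/1000 * \<rho>" "Re (b - \<xi>1) < 0" "\<bar>Im (b - \<xi>1)\<bar> \<le> \<rho>/10"
    using Q1 unfolding Q_def w1(2) by blast+
  define s0 where "s0 = Re \<xi>0"
  have Im1: "Im \<xi>1 = Im \<xi>0 + \<rho>/2" "Re \<xi>1 = s0" by (simp_all add: \<xi>1_def s0_def)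
  have Ima: "Im \<xi>0 - \<rho>/10 \<le> Im a" "Im a \<le> Im \<xi>0 + \<rho>/10" using A(7) unfolding abs_le_iff minus_complex.sel by linarith+
  have Imb: "Im \<xi>0 + 4/10 * \<rho> \<le> Im b" "Im b \<le> Im \<xi>0 + 6/10 * \<rho>" using Bb(7) Im1(1) unfolding abs_le_iff minus_complex.sel by linarith+
  have ab: "Im a < Im b" using Ima Imb \<rho> by linarith
  have Re_ab: "Re a < s0" "Re b < s0" using A(6) Bb(6) Im1 by (auto simp: s0_def)
  have Re_low: "s0 - 1001/1000 * \<rho> \<le> Re a" "s0 - 1001/1000 * \<rho> \<le> Re b"
  proof -
    have "norm (a - \<xi>0) \<le> 1001/1000 * \<rho>" "norm (b - \<xi>1) \<le> 1001/1000 * \<rho>"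
      using A(5) Bb(5) by (simp_all add: dist_norm norm_minus_commute)
    then show "s0 - 1001/1000 * \<rho> \<le> Re a" "s0 - 1001/1000 * \<rho> \<le> Re b"
      using abs_Re_le_cmod[of "a - \<xi>0"] abs_Re_le_cmod[of "b - \<xi>1"] Im1(2)
      unfolding s0_def abs_le_iff minus_complex.sel by linarith+
  qed
  have line: "dist \<xi>0 (Complex s0 \<tau>) = \<bar>\<tau> - Im \<xi>0\<bar>" for \<tau>
  proof -
    have "Complex s0 \<tau> - \<xi>0 = \<i> * of_real (\<tau> - Im \<xi>0)" by (simp add: s0_def complex_eq_iff)
    then have "norm (Complex s0 \<tau> - \<xi>0) = \<bar>\<tau> - Im \<xi>0\<bar>" by (simp only: norm_mult norm_of_real norm_ii mult_1)
    then show ?thesis by (simp add: dist_norm norm_minus_commute)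
  qed
  have line_near: "dist \<xi>0 (Complex s0 \<tau>) \<le> 6/10 * \<rho>" if "Im a \<le> \<tau>" "\<tau> \<le> Im b" for \<tau>
    unfolding line using that Ima Imb \<rho> by linarith
  have baseB: "Complex s0 \<tau> \<in> B" if "Im a \<le> \<tau>" "\<tau> \<le> Im b" for \<tau>
    using line_near[OF that] A(4) \<rho> by (simp add: B_def)
  define V where "V = visible (to_line s0) B \<eta>0"
  define C where "C = continuation (to_line s0) \<eta>0"
  have brV: "branch V C" unfolding V_def C_def by (rule branch_visible[OF A(1) projection_to_line])
  have tl: "to_line s0 p = Complex s0 (Im p)" for p by (simp add: to_line_def)
  have aV: "a \<notin> V" "b \<notin> V"
  proof -
    show "a \<notin> V" unfolding V_def
    proof (rule ball_stop(1)[OF A(1)[unfolded B_def]])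
      show "to_line s0 a \<in> B" unfolding tl by (rule baseB) (use ab in auto)
      then show "to_line s0 a \<in> ball \<xi>0 (dist \<xi>0 a)" unfolding B_def .
      show "norm (hmap (\<eta>0 x)) \<le> norm (x - a)" if "x \<in> ball \<xi>0 (dist \<xi>0 a)" for x by (rule A(3)) (simp add: B_def that[simplified])
    qed (use A(6) Re_ab in auto)
    have qb: "Complex s0 (Im b) \<in> ball \<xi>1 (dist \<xi>1 b)"
    proof -
      have "Complex s0 (Im b) - \<xi>1 = \<i> * of_real (Im (b - \<xi>1))" using Im1 by (simp add: complex_eq_iff)
      then have "norm (Complex s0 (Im b) - \<xi>1) = \<bar>Im (b - \<xi>1)\<bar>" by (simp only: norm_mult norm_of_real norm_ii mult_1)
      then show ?thesis using Bb(4,7) \<rho> by (simp add: dist_norm norm_minus_commute)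
    qed
    have "\<eta>0 (Complex s0 (Im b)) = \<eta>1 (Complex s0 (Im b))"
    proof (rule branch_unique[OF A(1) Bb(1) _ convex_ball \<xi>1B])
      show "convex B" by (simp add: B_def)
      show "\<xi>1 \<in> ball \<xi>1 (dist \<xi>1 b)" using Bb(4) \<rho>(1) unfolding centre_in_ball by linarith
      show "\<eta>0 \<xi>1 = \<eta>1 \<xi>1" using Bb(2) by (simp add: w1_def)
      show "Complex s0 (Im b) \<in> B" using baseB[of "Im b"] ab by simp
    qed (rule qb)
    note eta_eq = this
    show "b \<notin> V" unfolding V_def
    proof (rule ball_stop(1)[OF Bb(1)])
      show "to_line s0 b \<in> B" unfolding tl by (rule baseB) (use ab in auto)
      show "to_line s0 b \<in> ball \<xi>1 (dist \<xi>1 b)" unfolding tl by (rule qb)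
      show "\<eta>0 (to_line s0 b) = \<eta>1 (to_line s0 b)" unfolding tl by (rule eta_eq)
      show "norm (hmap (\<eta>1 x)) \<le> norm (x - b)" if "x \<in> ball \<xi>1 (dist \<xi>1 b)" for x by (rule Bb(3)[OF that])
    qed (use Bb(6) Re_ab in auto)
  qed
  have stop: "norm (hmap (C x)) \<le> norm (x - p)"
    if p: "p \<notin> V" "Im a \<le> Im p" "Im p \<le> Im b" "min (Re a) (Re b) \<le> Re p" "Re p < s0"
      and vis: "\<And>y. \<lbrakk>Im y = Im p; Re p < Re y; Re y \<le> s0\<rbrakk> \<Longrightarrow> y \<in> V"
      and x: "Im x = Im p" "Re p < Re x" "Re x \<le> s0" for p x
  proof -
    have seg: "closed_segment (to_line s0 p) p = {y. Im y = Im p \<and> Re p \<le> Re y \<and> Re y \<le> s0}"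
      using segment_to_line[of p s0] p by simp
    have pB: "to_line s0 p \<in> B" unfolding tl by (rule baseB[OF p(2,3)])
    obtain z where z: "z \<notin> img" "z \<in> closure img" "\<not> blow z"
      "\<And>y. y \<in> closed_segment (to_line s0 p) p \<Longrightarrow> y \<noteq> p \<Longrightarrow> norm (hmap (C y) - z) \<le> norm (y - p)"
    proof (rule visible_end[OF A(1) projection_to_line pB])
      show "to_line s0 (to_line s0 p) = to_line s0 p" by simp
      show "p \<notin> visible (to_line s0) B \<eta>0" using p(1) by (simp add: V_def)
      show "y \<in> visible (to_line s0) B \<eta>0" if "y \<in> closed_segment (to_line s0 p) p" "y \<noteq> p" for y
      proof -
        have "Re p < Re y" using that unfolding seg by (metis (mono_tags, lifting) complex_eq_iff mem_Collect_eq order_le_less)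
        then show ?thesis using vis[of y] that unfolding seg V_def by auto
      qed
    qed (rule that, unfold C_def)
    let ?q = "to_line s0 p"
    have "C ?q = \<eta>0 ?q" unfolding C_def by (rule base_visible(2)[OF A(1) pB]) simp
    then have "norm (hmap (C ?q)) \<le> norm (?q - a)" using A(3)[OF pB] by simp
    also have "\<dots> \<le> dist ?q \<xi>0 + dist \<xi>0 a" unfolding dist_norm[symmetric] by (rule dist_triangle)
    also have "\<dots> \<le> 2 * \<rho>" using line_near[OF p(2,3)] A(5) \<rho> by (simp add: tl dist_commute)
    finally have 1: "norm (hmap (C ?q)) \<le> 2 * \<rho>" .
    have "?q - p = of_real (s0 - Re p)" by (simp add: complex_eq_iff)
    then have "norm (?q - p) = s0 - Re p" using p by (simp del: of_real_diff)
    then have 2: "norm (?q - p) \<le> 2 * \<rho>" using p(4) Re_low \<rho> by (auto simp: min_le_iff_disj)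
    have "norm (hmap (C ?q) - z) \<le> norm (?q - p)" by (rule z(4)) (use p in \<open>auto simp: complex_eq_iff\<close>)
    then have "norm z \<le> 4 * \<rho>" using 1 2 norm_triangle_sub[of z "hmap (C ?q)"] by (simp add: norm_minus_commute)
    then have "z = 0" using sector_end[OF z(1-3)] \<rho> by linarith
    moreover have "x \<in> closed_segment ?q p" "x \<noteq> p" unfolding seg using x by auto
    ultimately show ?thesis using z(4)[of x] by simp
  qed
  have chord: "c \<notin> V" if c: "c \<in> open_segment a b" for c
    unfolding V_def
    by (rule chord_invisible[OF A(1) ab Re_ab baseB aV[unfolded V_def] _ c])
      (assumption+ | rule stop[unfolded V_def C_def])+
  have ray: "\<exists>p. Im p = \<tau> \<and> s0 - 2 * \<rho> \<le> Re p \<and> Re p < s0 \<and> p \<notin> V \<and>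
        (\<forall>x. Im x = \<tau> \<and> Re p < Re x \<and> Re x \<le> s0 \<longrightarrow> x \<in> V \<and> norm (hmap (C x)) \<le> norm (x - p))"
    if \<tau>: "Im a < \<tau>" "\<tau> < Im b" for \<tau>
  proof -
    define u where "u = (\<tau> - Im a) / (Im b - Im a)"
    have u: "0 < u" "u < 1" using \<tau> ab by (auto simp: u_def divide_less_eq)
    define c where "c = (1 - u) *\<^sub>R a + u *\<^sub>R b"
    have cab: "c \<in> open_segment a b" unfolding in_segment c_def using u ab by auto
    have "Im c = Im a + u * (Im b - Im a)" by (simp add: c_def algebra_simps)
    then have Imc: "Im c = \<tau>" using ab by (simp add: u_def)
    have Rec: "min (Re a) (Re b) \<le> Re c" "Re c < s0"
    proof -
      have e: "Re c = (1 - u) * Re a + u * Re b" by (simp add: c_def)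
      have "(1 - u) * min (Re a) (Re b) \<le> (1 - u) * Re a" "u * min (Re a) (Re b) \<le> u * Re b"
        using u by (auto intro!: mult_left_mono)
      then show "min (Re a) (Re b) \<le> Re c" unfolding e by (simp add: algebra_simps)
      have "(1 - u) * Re a < (1 - u) * s0" "u * Re b < u * s0" using u Re_ab by (auto intro!: mult_strict_left_mono)
      then show "Re c < s0" unfolding e by (simp add: algebra_simps)
    qed
    let ?q = "to_line s0 c"
    define T where "T = closed_segment ?q c - V"
    have seg: "closed_segment ?q c = {y. Im y = \<tau> \<and> Re c \<le> Re y \<and> Re y \<le> s0}"
      using segment_to_line[of c s0] Rec Imc by simp
    have clT: "closed T" unfolding T_def using branchD(1)[OF brV] by (intro closed_Diff) auto
    have "c \<in> T" using chord[OF cab] by (simp add: T_def)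
    then obtain p where p: "p \<in> T" "\<And>y. y \<in> T \<Longrightarrow> dist ?q p \<le> dist ?q y" using distance_attains_inf[OF clT, of ?q] by blast
    have qV: "?q \<in> V" unfolding V_def by (rule base_visible(1)[OF A(1)]) (use baseB[of \<tau>] \<tau> Imc in \<open>auto simp: tl\<close>)
    have pp: "Im p = \<tau>" "Re c \<le> Re p" "Re p \<le> s0" "p \<notin> V" using p(1) unfolding T_def seg by auto
    have "p \<noteq> ?q" using qV pp by auto
    then have ps: "Re p < s0" using pp Imc by (metis complex_eq_iff order_le_less to_line_simps(1,2))
    have vis: "y \<in> V" if y: "Im y = \<tau>" "Re p < Re y" "Re y \<le> s0" for y
    proof (rule ccontr)
      assume "y \<notin> V"
      then have "y \<in> T" using y pp unfolding T_def seg by auto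
      then have "dist ?q p \<le> dist ?q y" by (rule p(2))
      moreover have "dist ?q y' = s0 - Re y'" if "Im y' = \<tau>" "Re y' \<le> s0" for y'
      proof -
        have "?q - y' = of_real (s0 - Re y')" using that Imc by (simp add: complex_eq_iff)
        then show ?thesis using that by (simp add: dist_norm del: of_real_diff)
      qed
      ultimately show False using y pp by auto
    qed
    have "s0 - 2 * \<rho> \<le> Re p" using pp Rec Re_low \<rho> by (auto simp: min_le_iff_disj)
    moreover have "norm (hmap (C x)) \<le> norm (x - p)" if "Im x = \<tau>" "Re p < Re x" "Re x \<le> s0" for x
      by (rule stop) (use pp ps Rec \<tau> vis that in auto)
    ultimately show ?thesis using pp ps vis by (intro exI[of _ p]) auto
  qed
  interpret strip: harmonic_strip H1 H2 h V C s0 "Im a" "Im b" "2 * \<rho>" "\<rho>/2"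
  proof unfold_locales
    show "branch V C" by (rule brV)
    show "Im a < Im b" by (rule ab)
    show "0 < 2 * \<rho>" "0 < \<rho>/2" using \<rho> by auto
    show "0 \<notin> img" by (rule zero_notin_img)
    show "y \<in> V" if "x \<in> V" "Im y = Im x" "Re x \<le> Re y" "Re y \<le> s0" for x y
    proof -
      have "closed_segment (to_line s0 x) x \<subseteq> V"
        using visible_segment[OF projection_to_line that(1)[unfolded V_def]] unfolding V_def by metis
      moreover have "y \<in> closed_segment (to_line s0 x) x" using that segment_to_line[of x s0] by auto
      ultimately show ?thesis by blast
    qed
    show "\<exists>p. Im p = \<tau> \<and> s0 - 2 * \<rho> \<le> Re p \<and> Re p < s0 \<and> p \<notin> V \<and>
        (\<forall>x. Im x = \<tau> \<and> Re p < Re x \<and> Re x \<le> s0 \<longrightarrow> x \<in> V \<and> norm (hmap (C x)) \<le> norm (x - p))"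
      if "Im a < \<tau>" "\<tau> < Im b" for \<tau> by (rule ray[OF that])
    show "\<rho>/2 \<le> Re (hmap (C (Complex s0 \<tau>)))" if \<tau>: "Im a < \<tau>" "\<tau> < Im b" for \<tau>
    proof -
      let ?x = "Complex s0 \<tau>"
      have xB: "?x \<in> B" using baseB \<tau> by simp
      have "C ?x = \<eta>0 ?x" unfolding C_def by (rule base_visible(2)[OF A(1) xB]) (simp add: to_line_def)
      moreover have "norm (hmap (\<eta>0 ?x) - (hmap w0 + of_real (Re (?x - \<xi>0)))) \<le> e1"
        by (rule A(8)) (use line_near[of \<tau>] \<tau> \<rho> in simp)
      ultimately have "norm (hmap (C ?x) - hmap w0) \<le> \<rho>/4" using e1 by (simp add: s0_def)
      then have "\<bar>Re (hmap (C ?x) - hmap w0)\<bar> \<le> \<rho>/4" using abs_Re_le_cmod order_trans by blast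
      moreover have "norm (hmap w0 - of_real \<rho>) \<le> \<rho>/4" using w0(2) d e1 by (simp add: dist_norm)
      then have "\<bar>Re (hmap w0 - of_real \<rho>)\<bar> \<le> \<rho>/4" using abs_Re_le_cmod order_trans by blast
      ultimately show ?thesis unfolding abs_le_iff minus_complex.sel Re_complex_of_real by linarith
    qed
  qed
  show thesis using strip.boundary_arc that by metis
qed

end

section \<open>Boundary segments of Jordan domains\<close>

lemma Jordan_segment_isolated:
  fixes c :: "real \<Rightarrow> complex"
  assumes c: "simple_path c" "pathfinish c = pathstart c"
    and seg: "open_segment a b \<subseteq> path_image c" and p: "p \<in> open_segment a b"
  obtains \<delta> where "\<delta> > 0" "path_image c \<inter> ball p \<delta> \<subseteq> open_segment a b"
proof -
  obtain u where u: "a \<noteq> b" "0 < u" "u < 1" "p = (1 - u) *\<^sub>R a + u *\<^sub>R b" using p unfolding in_segment by blast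
  define P where "P t = (1 - t) *\<^sub>R a + t *\<^sub>R b" for t :: real
  have PO: "P t \<in> open_segment a b" if "0 < t" "t < 1" for t using that u(1) unfolding in_segment P_def by blast
  have Pinj: "s = t" if "P s = P t" for s t
  proof -
    have "(s - t) *\<^sub>R (b - a) = P s - P t" by (simp add: P_def algebra_simps)
    then show ?thesis using that u(1) by simp
  qed
  define t0 where "t0 = u / 3"
  define t1 where "t1 = 2 * u / 3"
  define t2 where "t2 = (1 + u) / 2"
  have t: "0 < t0" "t0 < t1" "t1 < u" "u < t2" "t2 < 1" using u by (auto simp: t0_def t1_def t2_def)
  have "P t0 \<in> path_image c" using PO[of t0] t seg by auto
  then obtain \<tau> where \<tau>: "0 \<le> \<tau>" "\<tau> \<le> 1" "c \<tau> = P t0" unfolding path_image_def by force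
  define h where "h = shiftpath \<tau> c"
  have sh: "simple_path h" unfolding h_def by (rule simple_path_shiftpath[OF c \<tau>(1,2)])
  have hi: "path_image h = path_image c" unfolding h_def by (rule path_image_shiftpath) (use \<tau> c in auto)
  have h01: "h 0 = P t0" "h 1 = P t0"
    using endpoints_shiftpath[OF c(2), of \<tau>] \<tau> unfolding h_def[symmetric] pathstart_def pathfinish_def by auto
  have ch: "continuous_on {0..1} h" using sh by (simp add: simple_path_def path_def)
  have hinj: "x = y" if "h x = h y" "x \<in> {0..1}" "y \<in> {0<..<1}" for x y
    using sh that unfolding simple_path_def loop_free_def by fastforce
  define A where "A = P ` {t1..t2}"
  have cP: "continuous_on S P" for S unfolding P_def by (intro continuous_intros)
  have AO: "A \<subseteq> open_segment a b" using PO t by (auto simp: A_def)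
  define T where "T = {0..1} \<inter> h -` A"
  have "compact A" unfolding A_def by (rule compact_continuous_image[OF cP compact_Icc])
  then have "closed T" unfolding T_def by (intro continuous_closed_preimage[OF ch]) (auto simp: compact_imp_closed)
  moreover have "T \<subseteq> {0..1}" by (auto simp: T_def)
  ultimately have cT: "compact T" by (meson bounded_closed_interval bounded_subset compact_eq_bounded_closed)
  have T01: "x \<in> {0<..<1}" if "x \<in> T" for x
  proof -
    have "h x \<noteq> P t0" using that t Pinj unfolding T_def A_def by fastforce
    then have "x \<noteq> 0" "x \<noteq> 1" using h01 by auto
    then show ?thesis using that by (auto simp: T_def less_le)
  qed
  have injT: "inj_on h T" by (rule inj_onI) (use hinj T01 in \<open>auto simp: T_def\<close>)
  have hT: "h ` T = A"
  proof
    show "h ` T \<subseteq> A" by (auto simp: T_def)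
    show "A \<subseteq> h ` T"
    proof
      fix y assume y: "y \<in> A"
      then have "y \<in> path_image h" using AO seg hi by blast
      then obtain x where "x \<in> {0..1}" "y = h x" unfolding path_image_def by blast
      then show "y \<in> h ` T" using y by (auto simp: T_def)
    qed
  qed
  define k where "k s = inv_into T h (P s)" for s
  have "continuous_on A (inv_into T h)"
    unfolding hT[symmetric] by (rule continuous_on_inv[OF continuous_on_subset[OF ch] cT]) (use injT in \<open>auto simp: T_def\<close>)
  then have ck: "continuous_on {t1..t2} k" unfolding k_def
    by (rule continuous_on_compose2[OF _ cP]) (auto simp: A_def)
  have kT: "k s \<in> T" "h (k s) = P s" if "s \<in> {t1..t2}" for s
  proof -
    have "P s \<in> h ` T" using that hT by (auto simp: A_def)
    then show "k s \<in> T" "h (k s) = P s" unfolding k_def by (auto intro: inv_into_into f_inv_into_f)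
  qed
  have injk: "inj_on k {t1..t2}"
    by (rule inj_onI) (metis kT(2) Pinj)
  have "(k t1 < k u \<and> k u < k t2) \<or> (k t2 < k u \<and> k u < k t1)"
    by (rule continuous_inj_imp_mono[OF t(3,4) ck injk])
  define l where "l = min (k t1) (k t2)"
  define m where "m = max (k t1) (k t2)"
  have lm: "l < k u" "k u < m" using \<open>_ \<or> _\<close> by (auto simp: l_def m_def)
  have uT: "u \<in> {t1..t2}" "t1 \<in> {t1..t2}" "t2 \<in> {t1..t2}" using t by auto
  have lm01: "0 < l" "m < 1" using T01[OF kT(1)[OF uT(2)]] T01[OF kT(1)[OF uT(3)]] by (auto simp: l_def m_def)
  have sub: "{l..m} \<subseteq> T"
  proof -
    have "connected (k ` {t1..t2})" by (rule connected_continuous_image[OF ck]) simp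
    moreover have "l \<in> k ` {t1..t2}" "m \<in> k ` {t1..t2}" using uT by (auto simp: l_def m_def min_def max_def)
    ultimately have "{l..m} \<subseteq> k ` {t1..t2}" by (rule connected_contains_Icc)
    then show ?thesis using kT(1) by auto
  qed
  define R where "R = h ` ({0..l} \<union> {m..1})"
  have "compact R" unfolding R_def
    by (intro compact_continuous_image continuous_on_subset[OF ch]) (use lm lm01 in auto)
  moreover have "p \<notin> R"
  proof
    assume "p \<in> R"
    then obtain x where x: "x \<in> {0..l} \<union> {m..1}" "p = h x" unfolding R_def by blast
    moreover have "h (k u) = p" using kT(2)[OF uT(1)] u(4) by (simp add: P_def)
    ultimately have "x = k u" using hinj[of x "k u"] T01[OF kT(1)[OF uT(1)]] lm lm01 by auto
    then show False using x lm by auto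
  qed
  ultimately obtain \<delta> where \<delta>: "\<delta> > 0" "\<And>y. y \<in> R \<Longrightarrow> \<delta> \<le> dist p y"
    using separate_point_closed[OF compact_imp_closed] by metis
  have "path_image c \<inter> ball p \<delta> \<subseteq> open_segment a b"
  proof
    fix y assume y: "y \<in> path_image c \<inter> ball p \<delta>"
    then have "y \<in> path_image h" using hi by simp
    then obtain x where x: "x \<in> {0..1}" "y = h x" unfolding path_image_def by blast
    have "y \<notin> R" using \<delta>(2)[of y] y by force
    then have "x \<in> {l..m}" using x by (auto simp: R_def)
    then have "h x \<in> A" using sub by (auto simp: T_def)
    then show "y \<in> open_segment a b" using AO x by auto
  qed
  then show thesis using that \<delta>(1) by blast
qed

lemma Jordan_domain_half_disc:
  assumes J: "simply_connected_jordan_domain \<Omega>" and seg: "open_segment a b \<subseteq> frontier \<Omega>" and p: "p \<in> open_segment a b"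
  obtains \<delta> e where "\<delta> > 0" "e = sgn (b - a) \<or> e = - sgn (b - a)"
    "\<Omega> \<inter> ball p \<delta> = {z \<in> ball p \<delta>. 0 < Im (cnj e * (z - p))}"
    "{z \<in> ball p \<delta>. Im (cnj e * (z - p)) = 0} \<subseteq> open_segment a b"
proof -
  obtain c where c: "simple_path c" "pathfinish c = pathstart c" "frontier \<Omega> = path_image c"
    and \<Omega>: "open \<Omega>" "connected \<Omega>"
    using J unfolding simply_connected_jordan_domain_def by blast
  obtain u where u: "a \<noteq> b" "0 < u" "u < 1" "p = (1 - u) *\<^sub>R a + u *\<^sub>R b" using p unfolding in_segment by blast
  obtain \<delta>1 where \<delta>1: "\<delta>1 > 0" "path_image c \<inter> ball p \<delta>1 \<subseteq> open_segment a b"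
    by (rule Jordan_segment_isolated[OF c(1,2) seg[unfolded c(3)] p])
  define L where "L = norm (b - a)"
  define e0 where "e0 = sgn (b - a)"
  have L: "L > 0" using u by (simp add: L_def)
  have ba: "b - a = of_real L * e0" using L by (simp add: e0_def L_def sgn_div_norm scaleR_conv_of_real field_simps)
  have ne0: "norm e0 = 1" using u by (simp add: e0_def norm_sgn)
  have ee: "cnj e0 * e0 = 1" using ne0 complex_norm_square[of e0] by (simp add: mult.commute)
  have pa: "p = a + of_real (u * L) * e0" using ba u(4) by (simp add: scaleR_conv_of_real algebra_simps)
  define \<delta> where "\<delta> = min \<delta>1 (min (u * L) ((1 - u) * L))"
  have \<delta>: "\<delta> > 0" "\<delta> \<le> \<delta>1" "\<delta> \<le> u * L" "\<delta> \<le> (1 - u) * L" using \<delta>1 u L by (auto simp: \<delta>_def)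
  define Y where "Y z = Im (cnj e0 * (z - p))" for z
  have line1: "Y z = 0" if "z \<in> open_segment a b" for z
  proof -
    obtain v where "z = (1 - v) *\<^sub>R a + v *\<^sub>R b" using \<open>z \<in> _\<close> unfolding in_segment by blast
    then have "z - p = of_real ((v - u) * L) * e0" using ba pa by (simp add: scaleR_conv_of_real algebra_simps)
    then have "cnj e0 * (z - p) = of_real ((v - u) * L) * (cnj e0 * e0)" by simp
    then show ?thesis by (simp add: Y_def ee)
  qed
  have line2: "z \<in> open_segment a b" if z: "z \<in> ball p \<delta>" "Y z = 0" for z
  proof -
    define x where "x = Re (cnj e0 * (z - p))"
    have "cnj e0 * (z - p) = of_real x" using z(2) by (simp add: x_def Y_def complex_eq_iff)
    moreover have "z - p = (cnj e0 * e0) * (z - p)" by (simp add: ee)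
    then have "z - p = e0 * (cnj e0 * (z - p))" by (simp only: mult.assoc mult.left_commute)
    ultimately have zp: "z - p = of_real x * e0" by (simp only: mult.commute)
    then have "\<bar>x\<bar> = norm (z - p)" using ne0 by (simp add: norm_mult)
    then have x: "\<bar>x\<bar> < \<delta>" using z(1) by (simp add: dist_norm norm_minus_commute)
    define v where "v = u + x / L"
    have vL: "v * L = u * L + x" using L by (simp add: v_def field_simps)
    have "0 < v * L" "v * L < 1 * L" using x \<delta> vL by (auto simp: algebra_simps)
    then have v: "0 < v" "v < 1" using L by (auto simp: zero_less_mult_iff)
    have "z = a + of_real (v * L) * e0" using zp pa vL by (simp add: algebra_simps)
    then have "z = (1 - v) *\<^sub>R a + v *\<^sub>R b" using ba by (simp add: scaleR_conv_of_real algebra_simps)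
    then show ?thesis unfolding in_segment using v u(1) by blast
  qed
  have fr: "frontier \<Omega> \<inter> ball p \<delta> = {z \<in> ball p \<delta>. Y z = 0}"
  proof
    show "frontier \<Omega> \<inter> ball p \<delta> \<subseteq> {z \<in> ball p \<delta>. Y z = 0}" using \<delta>1(2) \<delta>(2) line1 c(3) by auto
    show "{z \<in> ball p \<delta>. Y z = 0} \<subseteq> frontier \<Omega> \<inter> ball p \<delta>" using line2 seg by auto
  qed
  define Up where "Up = {z \<in> ball p \<delta>. 0 < Y z}"
  define Dn where "Dn = {z \<in> ball p \<delta>. Y z < 0}"
  have Yin: "Y z = inner (\<i> * e0) z - inner (\<i> * e0) p" for z
    by (simp add: Y_def inner_complex_def algebra_simps)
  have "Up = ball p \<delta> \<inter> {z. inner (\<i> * e0) z > inner (\<i> * e0) p}" "Dn = ball p \<delta> \<inter> {z. inner (\<i> * e0) z < inner (\<i> * e0) p}"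
    by (auto simp: Up_def Dn_def Yin)
  then have conn: "connected Up" "connected Dn"
    by (auto intro!: convex_connected convex_Int convex_halfspace_gt convex_halfspace_lt)
  have fr0: "Y z = 0" if "z \<in> frontier \<Omega>" "z \<in> ball p \<delta>" for z using fr that by blast
  have dj: "Up \<inter> frontier \<Omega> = {}" "Dn \<inter> frontier \<Omega> = {}"
    unfolding disjoint_iff Up_def Dn_def using fr0 by fastforce+
  have fo: "frontier \<Omega> \<inter> \<Omega> = {}" using \<Omega>(1) by (auto simp: frontier_def interior_open)
  have alt: "Up \<subseteq> \<Omega> \<or> Up \<inter> \<Omega> = {}" "Dn \<subseteq> \<Omega> \<or> Dn \<inter> \<Omega> = {}"
  proof -
    show "Up \<subseteq> \<Omega> \<or> Up \<inter> \<Omega> = {}" using connected_Int_frontier[OF conn(1), of \<Omega>] dj(1) by (metis Diff_eq_empty_iff)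
    show "Dn \<subseteq> \<Omega> \<or> Dn \<inter> \<Omega> = {}" using connected_Int_frontier[OF conn(2), of \<Omega>] dj(2) by (metis Diff_eq_empty_iff)
  qed
  have fr1: "z \<in> frontier \<Omega>" if "Y z = 0" "z \<in> ball p \<delta>" for z using fr that by blast
  have cover: "z \<in> Up \<union> Dn" if z: "z \<in> ball p \<delta>" "z \<notin> frontier \<Omega>" for z
  proof -
    have "Y z \<noteq> 0" using fr1 z by blast
    then show ?thesis using z(1) by (auto simp: Up_def Dn_def)
  qed
  have pfr: "p \<in> frontier \<Omega>" using p seg by blast
  have "\<not> (Up \<inter> \<Omega> = {} \<and> Dn \<inter> \<Omega> = {})"
  proof
    assume no: "Up \<inter> \<Omega> = {} \<and> Dn \<inter> \<Omega> = {}"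
    have "p \<in> closure \<Omega>" using pfr by (simp add: frontier_def)
    then obtain z where z: "z \<in> \<Omega>" "dist z p < \<delta>" using \<delta>(1) unfolding closure_approachable by blast
    then have "z \<in> Up \<union> Dn" using fo by (intro cover) (auto simp: dist_commute)
    then show False using z no by blast
  qed
  moreover have "\<not> (Up \<subseteq> \<Omega> \<and> Dn \<subseteq> \<Omega>)"
  proof
    assume both: "Up \<subseteq> \<Omega> \<and> Dn \<subseteq> \<Omega>"
    note JJ = Jordan_inside_outside[OF c(1,2)]
    have meets: "\<Omega> \<inter> S \<noteq> {}" if S: "frontier S = path_image c" "S \<inter> path_image c = {}" for S
    proof -
      have "p \<in> frontier S" using pfr unfolding c(3) S(1) .
      then have "p \<in> closure S" unfolding frontier_def by blast
      then obtain z where z: "z \<in> S" "dist z p < \<delta>" using \<delta>(1) unfolding closure_approachable by blast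
      then have "z \<in> Up \<union> Dn" using S(2) c(3) by (intro cover) (auto simp: dist_commute)
      then show ?thesis using z both by blast
    qed
    have "inside (path_image c) \<inter> path_image c = {}" "outside (path_image c) \<inter> path_image c = {}"
      using JJ by blast+
    then have "\<Omega> \<inter> inside (path_image c) \<noteq> {}" "\<Omega> \<inter> outside (path_image c) \<noteq> {}" using meets JJ by metis+
    moreover have "\<Omega> \<subseteq> inside (path_image c) \<union> outside (path_image c)" using JJ fo c(3) by blast
    moreover have "open (inside (path_image c))" "open (outside (path_image c))"
      "inside (path_image c) \<inter> outside (path_image c) = {}" using JJ by blast+
    ultimately show False using \<Omega>(2) unfolding connected_def by blast
  qed
  ultimately consider "Up \<subseteq> \<Omega>" "Dn \<inter> \<Omega> = {}" | "Dn \<subseteq> \<Omega>" "Up \<inter> \<Omega> = {}" using alt by blast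
  then show thesis
  proof cases
    case 1
    then have "\<Omega> \<inter> ball p \<delta> = {z \<in> ball p \<delta>. 0 < Im (cnj e0 * (z - p))}"
      using cover fo unfolding Up_def Y_def by blast
    then show thesis using that[of \<delta> e0] \<delta>(1) line2 unfolding e0_def Y_def by blast
  next
    case 2
    have m: "Im (cnj (- e0) * (z - p)) = - Y z" for z by (simp add: Y_def)
    have "Dn \<subseteq> ball p \<delta>" by (auto simp: Dn_def)
    then have "\<Omega> \<inter> ball p \<delta> = Dn" using cover fo 2 by blast
    then have "\<Omega> \<inter> ball p \<delta> = {z \<in> ball p \<delta>. 0 < Im (cnj (- e0) * (z - p))}"
      unfolding m Dn_def by simp
    moreover have "{z \<in> ball p \<delta>. Im (cnj (- e0) * (z - p)) = 0} \<subseteq> open_segment a b"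
      unfolding m using line2 by auto
    ultimately show thesis using that[of \<delta> "- e0"] \<delta>(1) unfolding e0_def by blast
  qed
qed

lemma local_isometry_affine:
  fixes u :: "real \<Rightarrow> real"
  assumes iso: "\<And>t. 0 < t \<Longrightarrow> t < l \<Longrightarrow> \<exists>c>0. \<forall>s s'. \<bar>s - t\<bar> < c \<and> \<bar>s' - t\<bar> < c \<longrightarrow> \<bar>u s - u s'\<bar> = \<bar>s - s'\<bar>"
    and l: "0 < l"
  obtains \<sigma> k where "\<sigma> = 1 \<or> \<sigma> = - 1" "\<And>t. 0 < t \<Longrightarrow> t < l \<Longrightarrow> u t = k + \<sigma> * t"
proof -
  have loc: "\<exists>c>0. \<exists>\<sigma>. (\<sigma> = 1 \<or> \<sigma> = -1) \<and> (\<forall>s. \<bar>s - t\<bar> < c \<longrightarrow> u s = u t + \<sigma> * (s - t))" if t: "0 < t" "t < l" for t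
  proof -
    obtain c where c: "c > 0" "\<And>s s'. \<bar>s - t\<bar> < c \<Longrightarrow> \<bar>s' - t\<bar> < c \<Longrightarrow> \<bar>u s - u s'\<bar> = \<bar>s - s'\<bar>" using iso[OF t] by blast
    define r where "r = t + c / 2"
    have r: "\<bar>r - t\<bar> < c" "r - t > 0" using c by (auto simp: r_def)
    define \<sigma> where "\<sigma> = (u r - u t) / (r - t)"
    have "\<bar>u r - u t\<bar> = \<bar>r - t\<bar>" using c(2)[of r t] r c(1) by simp
    then have \<sigma>: "\<sigma> = 1 \<or> \<sigma> = -1" using r by (auto simp: \<sigma>_def abs_if field_simps split: if_splits)
    have ur: "u r - u t = \<sigma> * (r - t)" using r by (simp add: \<sigma>_def)
    have "u s = u t + \<sigma> * (s - t)" if s: "\<bar>s - t\<bar> < c" for s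
    proof -
      have "\<bar>u s - u t\<bar> = \<bar>s - t\<bar>" "\<bar>u s - u r\<bar> = \<bar>s - r\<bar>" using c(2)[of s t] c(2)[of s r] s r c(1) by auto
      then have "(u s - u t)\<^sup>2 = (s - t)\<^sup>2" "((u s - u t) - (u r - u t))\<^sup>2 = ((s - t) - (r - t))\<^sup>2"
        by (simp_all add: abs_eq_iff power2_eq_iff)
      then have "(u s - u t) * (u r - u t) = (s - t) * (r - t)"
        using \<sigma> unfolding ur by (auto simp: power2_eq_square algebra_simps)
      then have "(u s - u t) * \<sigma> * (r - t) = (s - t) * (r - t)" by (simp add: ur mult.assoc)
      then have "(u s - u t) * \<sigma> = s - t" using r by simp
      then show ?thesis using \<sigma> by auto
    qed
    then show ?thesis using c(1) \<sigma> by blast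
  qed
  then obtain c \<sigma> where cs: "\<And>t. 0 < t \<Longrightarrow> t < l \<Longrightarrow> c t > 0 \<and> (\<sigma> t = 1 \<or> \<sigma> t = -1) \<and> (\<forall>s. \<bar>s - t\<bar> < c t \<longrightarrow> u s = u t + \<sigma> t * (s - t))"
    by metis
  have d: "(u has_real_derivative \<sigma> t) (at t)" if t: "0 < t" "t < l" for t
  proof -
    have "((\<lambda>s. u t + \<sigma> t * (s - t)) has_real_derivative \<sigma> t) (at t)" by (auto intro!: derivative_eq_intros)
    then show ?thesis
    proof (rule has_field_derivative_transform_within[of _ _ _ _ "c t"])
      show "0 < c t" using cs[OF t] by blast
      show "u t + \<sigma> t * (s - t) = u s" if "dist s t < c t" for s using cs[OF t] that by (metis dist_real_def)
    qed simp
  qed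
  have lc: "\<sigma> s = \<sigma> t" if t: "0 < t" "t < l" and s: "0 < s" "s < l" "\<bar>s - t\<bar> < c t" for s t
  proof -
    have lin: "((\<lambda>r. u t + \<sigma> t * (r - t)) has_real_derivative \<sigma> t) (at s)" by (auto intro!: derivative_eq_intros)
    have "u r = u t + \<sigma> t * (r - t)" if "dist r s < c t - \<bar>s - t\<bar>" for r
    proof -
      have "\<bar>r - t\<bar> < c t" using that unfolding dist_real_def by linarith
      then show ?thesis using cs[OF t] by blast
    qed
    note eq = this
    have "(u has_real_derivative \<sigma> t) (at s)"
    proof (rule has_field_derivative_transform_within[OF lin, of "c t - \<bar>s - t\<bar>"])
      show "u t + \<sigma> t * (r - t) = u r" if "dist r s < c t - \<bar>s - t\<bar>" for r using eq[OF that] by simp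
    qed (use s(3) in auto)
    then show ?thesis using d[OF s(1,2)] DERIV_unique by blast
  qed
  have cont: "continuous_on {0<..<l} \<sigma>"
    unfolding continuous_on_iff dist_real_def
  proof (intro ballI allI impI)
    fix t and e :: real assume "t \<in> {0<..<l}" and e: "0 < e"
    then have t: "0 < t" "t < l" by auto
    have "\<bar>\<sigma> x' - \<sigma> t\<bar> < e" if "x' \<in> {0<..<l}" "\<bar>x' - t\<bar> < c t" for x'
      using lc[OF t, of x'] that e by simp
    then show "\<exists>d>0. \<forall>x'\<in>{0<..<l}. \<bar>x' - t\<bar> < d \<longrightarrow> \<bar>\<sigma> x' - \<sigma> t\<bar> < e"
      using cs[OF t] by blast
  qed
  have const: "\<sigma> s = \<sigma> t" if st: "0 < s" "s < t" "t < l" for s t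
  proof (rule ccontr)
    assume ne: "\<sigma> s \<noteq> \<sigma> t"
    have cst: "continuous_on {s..t} \<sigma>" by (rule continuous_on_subset[OF cont]) (use st in auto)
    have pm: "\<sigma> x = 1 \<or> \<sigma> x = -1" if "0 < x" "x < l" for x using cs[OF that] by blast
    have "\<sigma> s \<le> 0 \<and> 0 \<le> \<sigma> t \<or> \<sigma> t \<le> 0 \<and> 0 \<le> \<sigma> s" using pm[of s] pm[of t] st ne by auto
    then obtain x where "s \<le> x" "x \<le> t" "\<sigma> x = 0"
      using IVT'[of \<sigma> s 0 t] IVT2'[of \<sigma> t 0 s] cst st by fastforce
    then show False using pm[of x] st by auto
  qed
  define s0 where "s0 = \<sigma> (l/2)"
  have s0: "\<sigma> t = s0" if "0 < t" "t < l" for t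
  proof -
    consider "t < l/2" | "t = l/2" | "l/2 < t" by linarith
    then show ?thesis
    proof cases
      case 1 then show ?thesis unfolding s0_def by (intro const) (use that l in auto)
    next
      case 3 then show ?thesis unfolding s0_def by (intro const[symmetric]) (use that l in auto)
    next
      case 2 then show ?thesis unfolding s0_def by (simp only:)
    qed
  qed
  have "\<exists>k. \<forall>t\<in>{0<..<l}. u t - s0 * t = k"
  proof (rule has_field_derivative_zero_constant)
    show "((\<lambda>t. u t - s0 * t) has_real_derivative 0) (at t within {0<..<l})" if "t \<in> {0<..<l}" for t
    proof -
      have "((\<lambda>t. u t - s0 * t) has_real_derivative \<sigma> t - s0 * 1) (at t)"
        by (intro DERIV_diff DERIV_cmult DERIV_ident d) (use that in simp_all)
      moreover have "\<sigma> t = s0" by (rule s0) (use that in simp_all)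
      ultimately have "((\<lambda>t. u t - s0 * t) has_real_derivative 0) (at t)" by simp
      then show ?thesis by (rule has_field_derivative_at_within)
    qed
  qed simp
  then obtain k where k: "\<And>t. t \<in> {0<..<l} \<Longrightarrow> u t - s0 * t = k" by blast
  have "u t = k + s0 * t" if "0 < t" "t < l" for t using k[of t] that by simp
  moreover have "0 < l/2" "l/2 < l" using l by auto
  then have "s0 = 1 \<or> s0 = -1" unfolding s0_def using cs by blast
  ultimately show thesis using that by blast
qed

context harmonic_graph
begin

text \<open>Over a side with infinite data \<open>\<omega>\<close> tends to \<open>1\<close>, so \<open>h \<circ> \<eta>\<close> is nearly multiplication by \<open>\<plusminus>\<i>\<close>
  while \<open>hmap \<circ> \<eta>\<close> is nearly the projection to the side.\<close>

lemma boundary_isometry: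
  assumes c: "c > 0" and HD: "img \<inter> ball 0 c = {z \<in> ball 0 c. 0 < Im z}"
    and bl: "\<And>q. q \<in> ball 0 c \<Longrightarrow> Im q = 0 \<Longrightarrow> blow q"
    and nearL: "\<And>t e. \<lbrakk>\<bar>t\<bar> < c; 0 < e\<rbrakk> \<Longrightarrow>
      \<exists>\<delta>>0. \<forall>w\<in>ball 0 1. dist (hmap w) (of_real t) < \<delta> \<longrightarrow> \<bar>Im (h w) - L t\<bar> < e"
    and x: "\<bar>x\<bar> < c/16" and y: "\<bar>y\<bar> < c/16"
  shows "\<bar>L x - L y\<bar> = \<bar>x - y\<bar>"
proof -
  define d where "d = y - x"
  have d: "\<bar>d\<bar> < c/8" using x y unfolding d_def by linarith
  have HDx: "img \<inter> ball (of_real x) (c/2) = {z \<in> ball (of_real x) (c/2). Im (of_real x) < Im z}"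
  proof -
    have "ball (complex_of_real x) (c/2) \<subseteq> ball 0 c"
    proof
      fix z assume "z \<in> ball (complex_of_real x) (c/2)"
      moreover have "dist 0 z \<le> dist 0 (complex_of_real x) + dist (complex_of_real x) z" by (rule dist_triangle)
      ultimately show "z \<in> ball 0 c" using x c by simp
    qed
    then have "img \<inter> ball (of_real x) (c/2) = (img \<inter> ball 0 c) \<inter> ball (of_real x) (c/2)" by blast
    then show ?thesis unfolding HD using \<open>ball (complex_of_real x) (c/2) \<subseteq> ball 0 c\<close> by auto
  qed
  have blx: "blow q" if "q \<in> ball (of_real x) (c/2)" "Im q = Im (of_real x)" for q
  proof (rule bl)
    have "dist 0 q \<le> dist 0 (complex_of_real x) + dist (complex_of_real x) q" by (rule dist_triangle)
    then show "q \<in> ball 0 c" using x c that by simp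
  qed (use that in simp)
  have key: "\<bar>\<bar>L x - L y\<bar> - \<bar>d\<bar>\<bar> \<le> 0 + 3 * e" if e: "0 < e" for e
  proof -
    have xy: "\<bar>x\<bar> < c" "\<bar>y\<bar> < c" using x y c by auto
    obtain \<delta>1 where \<delta>1: "\<delta>1 > 0" "\<And>w. w \<in> ball 0 1 \<Longrightarrow> dist (hmap w) (of_real x) < \<delta>1 \<Longrightarrow> \<bar>Im (h w) - L x\<bar> < e" using nearL[OF xy(1) e] by blast
    obtain \<delta>2 where \<delta>2: "\<delta>2 > 0" "\<And>w. w \<in> ball 0 1 \<Longrightarrow> dist (hmap w) (of_real y) < \<delta>2 \<Longrightarrow> \<bar>Im (h w) - L y\<bar> < e" using nearL[OF xy(2) e] by blast
    define \<kappa> where "\<kappa> = min (1/2) (min (e / c) (\<delta>2 / (2 * c)))"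
    have \<kappa>: "\<kappa> > 0" "\<kappa> \<le> 1/2" "\<kappa> \<le> e / c" "\<kappa> \<le> \<delta>2 / (2 * c)" 
    proof -
      have "0 < e / c" "0 < \<delta>2 / (2 * c)" using e c \<delta>2(1) by auto
      then show "\<kappa> > 0" "\<kappa> \<le> 1/2" "\<kappa> \<le> e / c" "\<kappa> \<le> \<delta>2 / (2 * c)" unfolding \<kappa>_def by linarith+
    qed
    define \<epsilon> where "\<epsilon> = min (min (\<delta>1/2) (\<delta>2/4)) (min (c/8) (\<kappa> * c / 64))"
    have \<epsilon>: "\<epsilon> > 0" "\<epsilon> \<le> \<delta>1/2" "\<epsilon> \<le> \<delta>2/4" "\<epsilon> \<le> c/8" "\<epsilon> \<le> \<kappa> * c / 64"
    proof -
      have "0 < \<kappa> * c / 64" using \<kappa> c by simp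
      then show "\<epsilon> > 0" using \<delta>1 \<delta>2 c unfolding \<epsilon>_def by linarith
      show "\<epsilon> \<le> \<delta>1/2" "\<epsilon> \<le> \<delta>2/4" "\<epsilon> \<le> c/8" "\<epsilon> \<le> \<kappa> * c / 64" unfolding \<epsilon>_def by linarith+
    qed
    have zb: "of_real x + \<i> * of_real \<epsilon> \<in> ball (complex_of_real x) (c/4)" using \<epsilon> c by (simp add: dist_norm norm_mult)
    then have "of_real x + \<i> * of_real \<epsilon> \<in> img \<inter> ball (of_real x) (c/2)" unfolding HDx using \<epsilon> c by auto
    then obtain w where w: "w \<in> ball 0 1" "hmap w = of_real x + \<i> * of_real \<epsilon>" by (auto simp: img_def)
    have c2: "c/2 > 0" using c by simp
    have hw: "hmap w \<in> ball (of_real x) (c/2/2)" using zb by (simp add: w(2))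
    obtain \<eta> where \<eta>: "branch (ball (2 * H1 w) (c/2/2)) \<eta>" "\<eta> (2 * H1 w) = w"
      "norm (1 - om w) \<le> 8 * (Im (hmap w) - Im (of_real x)) / (c/2)"
      by (rule half_disc_branch[OF c2 HDx blx w(1) hw]) auto
    define \<xi> where "\<xi> = 2 * H1 w"
    have b: "branch (ball \<xi> (c/4)) \<eta>" using \<eta>(1) by (simp add: \<xi>_def)
    have b0: "\<eta> \<xi> = w" using \<eta>(2) by (simp add: \<xi>_def)
    have "norm (1 - om w) \<le> 16 * \<epsilon> / c" using \<eta>(3) c by (simp add: w(2))
    also have "\<dots> \<le> 16 * (\<kappa> * c / 64) / c" using \<epsilon> c by (intro divide_right_mono mult_left_mono) auto
    also have "\<dots> = \<kappa> / 4" using c by simp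
    finally have om0: "norm (1 - om (\<eta> \<xi>)) \<le> \<kappa> / 4" by (simp add: b0)
    have s8: "0 \<le> c/8" "c/8 < c/4" using c by auto
    have c48: "c/4 / (c/4 - c/8) = 2" using c by (simp add: field_simps)
    have omk: "norm (1 - om (\<eta> z)) \<le> \<kappa>" if "dist \<xi> z \<le> c/8" for z
    proof -
      have "norm (1 - om (\<eta> z)) \<le> norm (1 - om (\<eta> \<xi>)) * (2 * (c/4)) / (c/4 - c/8)" by (rule om_near[OF b s8 that])
      also have "\<dots> = norm (1 - om (\<eta> \<xi>)) * 4" using c by (simp add: field_simps)
      finally show ?thesis using om0 by simp
    qed
    define q where "q = \<xi> + of_real d"
    have dq: "dist \<xi> q \<le> c/8" using d by (simp add: q_def dist_norm)
    have qb: "q \<in> ball \<xi> (c/4)" "\<xi> \<in> ball \<xi> (c/4)" using dq c by auto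
    have "norm (hmap (\<eta> q) - (hmap w + of_real d)) \<le> \<kappa> / 4 * (2 * (c/8))"
    proof -
      have "norm (hmap (\<eta> q) - (hmap (\<eta> \<xi>) + of_real (Re (q - \<xi>)))) \<le> norm (1 - om (\<eta> \<xi>)) * (c/4 / (c/4 - c/8)) * (c/8)"
        by (rule near_horizontal_projection[OF b s8 dq])
      also have "\<dots> \<le> \<kappa> / 4 * 2 * (c/8)" unfolding c48 using om0 c by (intro mult_right_mono) auto
      finally show ?thesis by (simp add: q_def b0)
    qed
    then have n1: "norm (hmap (\<eta> q) - (hmap w + of_real d)) \<le> \<kappa> * c / 16" by simp
    have "\<kappa> * c \<le> \<delta>2 / 2" using \<kappa>(4) c by (simp add: field_simps)
    have "dist (hmap (\<eta> q)) (of_real y) \<le> norm (hmap (\<eta> q) - (hmap w + of_real d)) + norm (hmap w + of_real d - of_real y)"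
      unfolding dist_norm using norm_triangle_ineq[of "hmap (\<eta> q) - (hmap w + of_real d)" "hmap w + of_real d - of_real y"] by simp
    also have "hmap w + of_real d - of_real y = \<i> * of_real \<epsilon>" by (simp add: w(2) d_def)
    also have "norm (\<i> * complex_of_real \<epsilon>) = \<epsilon>" using \<epsilon> by (simp add: norm_mult)
    finally have "dist (hmap (\<eta> q)) (of_real y) < \<delta>2" using n1 \<epsilon> \<open>\<kappa> * c \<le> \<delta>2 / 2\<close> \<delta>2(1) by linarith
    moreover have "\<eta> q \<in> ball 0 1" by (rule branchD(3)[OF b qb(1)])
    ultimately have y1: "\<bar>Im (h (\<eta> q)) - L y\<bar> < e" by (intro \<delta>2(2))
    have "dist (hmap w) (of_real x) < \<delta>1" using \<epsilon> \<delta>1(1) by (simp add: w(2) dist_norm norm_mult)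
    then have x1: "\<bar>Im (h w) - L x\<bar> < e" by (intro \<delta>1(2) w(1))
    define k where "k z = deriv h (\<eta> z) / (2 * deriv H1 (\<eta> z))" for z
    have dk: "((\<lambda>t. Im (h (\<eta> (\<xi> + of_real (t * d))))) has_real_derivative d * Im (k (\<xi> + of_real (t * d)))) (at t)"
      if t: "0 \<le> t" "t \<le> 1" for t
    proof -
      have "\<bar>t * d\<bar> \<le> \<bar>d\<bar>" using t by (simp add: abs_mult mult_left_le_one_le)
      then have "\<xi> + of_real (t * d) \<in> ball \<xi> (c/4)" using d by (simp add: dist_norm del: of_real_mult)
      from branch_deriv_h(1)[OF b this]
      have D2: "((\<lambda>z. h (\<eta> z)) has_field_derivative k (\<xi> + of_real (t * d))) (at (\<xi> + of_real (t * d)))" by (simp add: k_def)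
      have D1: "((\<lambda>t. \<xi> + of_real (t * d)) has_vector_derivative of_real d) (at t)"
        by (auto intro!: derivative_eq_intros simp: has_vector_derivative_def scaleR_conv_of_real)
      have "((\<lambda>t. h (\<eta> (\<xi> + of_real (t * d)))) has_vector_derivative of_real d * k (\<xi> + of_real (t * d))) (at t)"
        using field_vector_diff_chain_at[OF D1 D2] by (simp add: o_def)
      then have "((\<lambda>t. Im (h (\<eta> (\<xi> + of_real (t * d))))) has_vector_derivative Im (of_real d * k (\<xi> + of_real (t * d)))) (at t)"
        by (rule bounded_linear.has_vector_derivative[OF bounded_linear_Im])
      then show ?thesis by (simp add: has_real_derivative_iff_has_vector_derivative)
    qed
    obtain t where t: "0 < t" "t < 1"
      "Im (h (\<eta> (\<xi> + of_real (1 * d)))) - Im (h (\<eta> (\<xi> + of_real (0 * d)))) = (1 - 0) * (d * Im (k (\<xi> + of_real (t * d))))"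
      using MVT2[of 0 1 "\<lambda>t. Im (h (\<eta> (\<xi> + of_real (t * d))))" "\<lambda>t. d * Im (k (\<xi> + of_real (t * d)))"] dk by auto
    define z where "z = \<xi> + of_real (t * d)"
    have "\<bar>t * d\<bar> \<le> \<bar>d\<bar>" using t by (simp add: abs_mult mult_left_le_one_le)
    then have zd: "dist \<xi> z \<le> c/8" using d by (simp add: z_def dist_norm del: of_real_mult)
    have zb': "z \<in> ball \<xi> (c/4)" using zd c by simp
    have diff: "Im (h (\<eta> q)) - Im (h w) = d * Im (k z)" using t(3) by (simp add: q_def z_def b0)
    have "(k z)\<^sup>2 = - om (\<eta> z)" unfolding k_def by (rule branch_deriv_h(2)[OF b zb'])
    then have k1: "norm ((k z)\<^sup>2 + 1) \<le> \<kappa>" using omk[OF zd] by (simp add: algebra_simps norm_minus_commute)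
    have Imk: "\<bar>\<bar>Im (k z)\<bar> - 1\<bar> \<le> \<kappa>"
    proof -
      define s where "s = (if Im (k z) \<ge> 0 then 1 else -1 :: real)"
      have "(k z)\<^sup>2 + 1 = (k z - \<i> * of_real s) * (k z + \<i> * of_real s)"
        by (simp add: s_def algebra_simps power2_eq_square)
      then have "norm (k z - \<i> * of_real s) * norm (k z + \<i> * of_real s) \<le> \<kappa>" using k1 by (simp only: norm_mult)
      moreover have "1 \<le> norm (k z + \<i> * of_real s)"
        using abs_Im_le_cmod[of "k z + \<i> * of_real s"] by (auto simp: s_def split: if_splits)
      ultimately have "norm (k z - \<i> * of_real s) \<le> \<kappa>"
        by (smt (verit) mult_left_le norm_ge_zero mult_less_cancel_left1 mult_le_cancel_left1)
      then show ?thesis using abs_Im_le_cmod[of "k z - \<i> * of_real s"] by (auto simp: s_def split: if_splits)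
    qed
    have "\<bar>\<bar>Im (h (\<eta> q)) - Im (h w)\<bar> - \<bar>d\<bar>\<bar> = \<bar>d\<bar> * \<bar>\<bar>Im (k z)\<bar> - 1\<bar>"
    proof -
      have "\<bar>d * Im (k z)\<bar> - \<bar>d\<bar> = \<bar>d\<bar> * (\<bar>Im (k z)\<bar> - 1)" by (simp add: abs_mult algebra_simps)
      then show ?thesis unfolding diff by (simp only: abs_mult abs_abs)
    qed
    also have "\<dots> \<le> c * \<kappa>" using Imk d c by (intro mult_mono) auto
    also have "\<dots> \<le> e" using \<kappa>(3) c by (simp add: field_simps)
    finally show ?thesis using x1 y1 by linarith
  qed
  have "\<bar>\<bar>L x - L y\<bar> - \<bar>d\<bar>\<bar> \<le> 0 + e" if "0 < e" for e using key[of "e/3"] that by simp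
  then have "\<bar>\<bar>L x - L y\<bar> - \<bar>d\<bar>\<bar> \<le> 0" by (rule field_le_epsilon)
  then show ?thesis by (simp add: d_def abs_minus_commute)
qed

end

section \<open>The dual solution\<close>

lemma oscillation_limit:
  fixes f :: "'a::metric_space \<Rightarrow> 'b::complete_space"
  assumes q: "q \<in> closure A"
    and osc: "\<And>e. 0 < e \<Longrightarrow> \<exists>\<delta>>0. \<forall>z\<in>A. \<forall>z'\<in>A. dist z q < \<delta> \<and> dist z' q < \<delta> \<longrightarrow> dist (f z) (f z') < e"
  shows "\<exists>l. (f \<longlongrightarrow> l) (at q within A)"
proof -
  obtain s where s: "\<And>n. s n \<in> A" "s \<longlonglongrightarrow> q" using q unfolding closure_sequential by blast
  have "Cauchy (\<lambda>n. f (s n))"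
  proof (rule metric_CauchyI)
    fix e :: real assume "0 < e"
    then obtain \<delta> where \<delta>: "\<delta> > 0" "\<And>z z'. z \<in> A \<Longrightarrow> z' \<in> A \<Longrightarrow> dist z q < \<delta> \<Longrightarrow> dist z' q < \<delta> \<Longrightarrow> dist (f z) (f z') < e"
      using osc by meson
    obtain N where "\<And>n. n \<ge> N \<Longrightarrow> dist (s n) q < \<delta>" using metric_LIMSEQ_D[OF s(2) \<delta>(1)] by blast
    then show "\<exists>M. \<forall>m\<ge>M. \<forall>n\<ge>M. dist (f (s m)) (f (s n)) < e" using \<delta>(2) s(1) by blast
  qed
  then obtain l where l: "(\<lambda>n. f (s n)) \<longlonglongrightarrow> l" using Cauchy_convergent convergent_def by blast
  have "(f \<longlongrightarrow> l) (at q within A)"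
  proof (rule tendstoI)
    fix e :: real assume e: "0 < e"
    then obtain \<delta> where \<delta>: "\<delta> > 0" "\<And>z z'. z \<in> A \<Longrightarrow> z' \<in> A \<Longrightarrow> dist z q < \<delta> \<Longrightarrow> dist z' q < \<delta> \<Longrightarrow> dist (f z) (f z') < e/2"
      using osc[of "e/2"] by (meson half_gt_zero)
    obtain N1 where N1: "\<And>n. n \<ge> N1 \<Longrightarrow> dist (s n) q < \<delta>" using metric_LIMSEQ_D[OF s(2) \<delta>(1)] by blast
    obtain N2 where N2: "\<And>n. n \<ge> N2 \<Longrightarrow> dist (f (s n)) l < e/2" using metric_LIMSEQ_D[OF l, of "e/2"] e by auto
    define n where "n = max N1 N2"
    have "dist (f z) l < e" if "z \<in> A" "dist z q < \<delta>" for z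
    proof -
      have "dist (f z) (f (s n)) < e/2" by (rule \<delta>(2)) (use that s N1 in \<open>auto simp: n_def\<close>)
      moreover have "dist (f (s n)) l < e/2" by (rule N2) (simp add: n_def)
      ultimately show ?thesis using dist_triangle_half_r[of "f (s n)" "f z" e l] by (simp add: dist_commute)
    qed
    then show "eventually (\<lambda>z. dist (f z) l < e) (at q within A)"
      unfolding eventually_at using \<delta>(1) by blast
  qed
  then show ?thesis by blast
qed

definition dual_derivative :: "(complex \<Rightarrow> real) \<Rightarrow> complex \<Rightarrow> complex \<Rightarrow> real" where
  "dual_derivative \<phi> z h = - (dy \<phi> z / sqrt (1 + grad_sq \<phi> z)) * Re h + (dx \<phi> z / sqrt (1 + grad_sq \<phi> z)) * Im h"

lemma is_dual_has_derivative: "is_dual \<psi> \<phi> \<Omega> \<Longrightarrow> z \<in> \<Omega> \<Longrightarrow> (\<psi> has_derivative dual_derivative \<phi> z) (at z)"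
  unfolding is_dual_def dual_derivative_def by blast

lemma dual_derivative_le: "\<bar>dual_derivative \<phi> z h\<bar> \<le> norm h"
proof -
  define W where "W = sqrt (1 + grad_sq \<phi> z)"
  define p where "p = dx \<phi> z / W"
  define q where "q = dy \<phi> z / W"
  have g: "0 \<le> grad_sq \<phi> z" by (simp add: grad_sq_def)
  then have W2: "W\<^sup>2 = 1 + grad_sq \<phi> z" "W > 0" by (auto simp: W_def)
  have "(p\<^sup>2 + q\<^sup>2) * W\<^sup>2 = grad_sq \<phi> z" using W2(2) by (simp add: p_def q_def power_divide grad_sq_def field_simps)
  also have "\<dots> \<le> 1 * W\<^sup>2" using W2 by simp
  finally have pq: "p\<^sup>2 + q\<^sup>2 \<le> 1" using W2(2) by simp
  have "dual_derivative \<phi> z h = p * Im h - q * Re h"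
    by (simp add: dual_derivative_def p_def q_def W_def)
  then have "(dual_derivative \<phi> z h)\<^sup>2 = (p * Im h - q * Re h)\<^sup>2" by simp
  also have "\<dots> = (p\<^sup>2 + q\<^sup>2) * ((Re h)\<^sup>2 + (Im h)\<^sup>2) - (p * Re h + q * Im h)\<^sup>2"
    by (simp add: power2_eq_square algebra_simps)
  also have "\<dots> \<le> (p\<^sup>2 + q\<^sup>2) * ((Re h)\<^sup>2 + (Im h)\<^sup>2)" by simp
  also have "\<dots> \<le> 1 * ((Re h)\<^sup>2 + (Im h)\<^sup>2)" using pq by (intro mult_right_mono) auto
  finally have "(dual_derivative \<phi> z h)\<^sup>2 \<le> (norm h)\<^sup>2" by (simp add: cmod_power2)
  then show ?thesis by (metis abs_le_square_iff abs_norm_cancel)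
qed

lemma dual_lipschitz:
  assumes d: "is_dual \<psi> \<phi> \<Omega>" and C: "convex C" "C \<subseteq> \<Omega>" and z: "z \<in> C" "z' \<in> C"
  shows "\<bar>\<psi> z - \<psi> z'\<bar> \<le> norm (z - z')"
proof -
  have "norm (\<psi> z - \<psi> z') \<le> 1 * norm (z - z')"
  proof (rule differentiable_bound[OF C(1) _ _ z])
    show "(\<psi> has_derivative dual_derivative \<phi> x) (at x within C)" if "x \<in> C" for x
      using C(2) that by (blast intro: has_derivative_at_withinI[OF is_dual_has_derivative[OF d]])
    show "onorm (dual_derivative \<phi> x) \<le> 1" for x
      by (rule onorm_le) (simp add: dual_derivative_le)
  qed
  then show ?thesis by simp
qed

lemma dual_angular:
  assumes d: "is_dual \<psi> \<phi> \<Omega>" and s: "0 \<le> s" and tt: "t \<le> t'"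
    and arc: "\<And>u. t \<le> u \<Longrightarrow> u \<le> t' \<Longrightarrow> z0 + rcis s u \<in> \<Omega>"
  shows "\<bar>\<psi> (z0 + rcis s t') - \<psi> (z0 + rcis s t)\<bar> \<le> s * (t' - t)"
proof -
  let ?g = "\<lambda>v. \<psi> (z0 + rcis s (t + v))"
  have "norm (?g (t' - t) - ?g 0) \<le> s * (t' - t)"
  proof (rule norm_diff_le_vector_derivative[where g' = "\<lambda>v. dual_derivative \<phi> (z0 + rcis s (t + v)) (\<i> * rcis s (t + v))"])
    fix v assume v: "0 \<le> v" "v \<le> t' - t"
    let ?z = "z0 + rcis s (t + v)"
    have "((\<lambda>v. cis (t + v)) has_vector_derivative \<i> * cis (t + v)) (at v)"
    proof -
      have e: "(\<lambda>v. cis (t + v)) = (\<lambda>v. exp (\<i> * (of_real t + of_real v)))" by (simp add: cis_conv_exp)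
      show ?thesis unfolding e
        by (auto intro!: derivative_eq_intros has_vector_derivative_real_field simp: cis_conv_exp)
    qed
    then have "((\<lambda>v. z0 + rcis s (t + v)) has_vector_derivative \<i> * rcis s (t + v)) (at v)"
      unfolding rcis_def by (auto intro!: derivative_eq_intros simp: mult.left_commute)
    then have "((\<lambda>v. z0 + rcis s (t + v)) has_derivative (\<lambda>x. x *\<^sub>R (\<i> * rcis s (t + v)))) (at v)"
      by (simp add: has_vector_derivative_def)
    moreover have "(\<psi> has_derivative dual_derivative \<phi> ?z) (at ?z)"
      by (rule is_dual_has_derivative[OF d arc]) (use v in auto)
    ultimately have "((\<psi> \<circ> (\<lambda>v. z0 + rcis s (t + v))) has_derivative
        dual_derivative \<phi> ?z \<circ> (\<lambda>x. x *\<^sub>R (\<i> * rcis s (t + v)))) (at v)"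
      by (intro diff_chain_at)
    moreover have "dual_derivative \<phi> ?z (x *\<^sub>R y) = x *\<^sub>R dual_derivative \<phi> ?z y" for x y
      by (simp add: dual_derivative_def algebra_simps)
    ultimately show "(?g has_vector_derivative dual_derivative \<phi> ?z (\<i> * rcis s (t + v))) (at v)"
      by (simp add: has_vector_derivative_def o_def)
    show "norm (dual_derivative \<phi> ?z (\<i> * rcis s (t + v))) \<le> s"
      using dual_derivative_le[of \<phi> ?z "\<i> * rcis s (t + v)"] s by (simp add: norm_mult)
  qed (use tt in auto)
  then show ?thesis by simp
qed

lemma dual_limit_at_vertex:
  assumes d: "is_dual \<psi> \<phi> \<Omega>" and r: "0 < r" and \<alpha>: "0 < \<alpha>"
    and sec: "\<Omega> \<inter> ball z0 r = {z0 + rcis s t | s t. 0 < s \<and> s < r \<and> \<theta> < t \<and> t < \<theta> + \<alpha>}"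
  shows "z0 \<in> closure \<Omega>" and "\<exists>l. (\<psi> \<longlongrightarrow> l) (at z0 within \<Omega>)"
proof -
  have in\<Omega>: "z0 + rcis s t \<in> \<Omega>" if "0 < s" "s < r" "\<theta> < t" "t < \<theta> + \<alpha>" for s t
    using sec that by blast
  show cl: "z0 \<in> closure \<Omega>" unfolding closure_approachable
  proof (intro allI impI)
    fix e :: real assume e: "0 < e"
    define s where "s = min e r / 2"
    have s: "0 < s" "s < e" "s < r" using e r unfolding s_def by linarith+
    show "\<exists>y\<in>\<Omega>. dist y z0 < e"
      by (rule bexI[OF _ in\<Omega>[of s "\<theta> + \<alpha>/2"]]) (use s \<alpha> in \<open>auto simp: dist_norm\<close>)
  qed
  have bound: "\<bar>\<psi> z - \<psi> z'\<bar> \<le> \<delta> * (1 + \<alpha>)"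
    if z: "z \<in> \<Omega>" "z' \<in> \<Omega>" "dist z z0 < \<delta>" "dist z' z0 < \<delta>" and \<delta>: "\<delta> \<le> r" for z z' \<delta>
  proof -
    have "z \<in> \<Omega> \<inter> ball z0 r" "z' \<in> \<Omega> \<inter> ball z0 r" using z \<delta> by (auto simp: dist_commute)
    then obtain s t s' t' where st: "z = z0 + rcis s t" "0 < s" "s < r" "\<theta> < t" "t < \<theta> + \<alpha>"
      "z' = z0 + rcis s' t'" "0 < s'" "s' < r" "\<theta> < t'" "t' < \<theta> + \<alpha>" unfolding sec by blast
    have s\<delta>: "s < \<delta>" "s' < \<delta>" using z st by (auto simp: dist_norm)
    have rad: "\<bar>\<psi> (z0 + rcis s t) - \<psi> (z0 + rcis s' t)\<bar> \<le> \<bar>s - s'\<bar>"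
    proof -
      let ?C = "(\<lambda>u. z0 + rcis u t) ` {min s s'..max s s'}"
      have "?C = (+) z0 ` (\<lambda>u. u *\<^sub>R cis t) ` {min s s'..max s s'}"
        by (simp add: image_image rcis_def scaleR_conv_of_real)
      then have "convex ?C" by (simp add: convex_translation_eq convex_linear_image linear_scaleR_left)
      then have "\<bar>\<psi> (z0 + rcis s t) - \<psi> (z0 + rcis s' t)\<bar> \<le> norm ((z0 + rcis s t) - (z0 + rcis s' t))"
        by (rule dual_lipschitz[OF d]) (use st in \<open>auto intro!: in\<Omega>\<close>)
      also have "(z0 + rcis s t) - (z0 + rcis s' t) = of_real (s - s') * cis t" by (simp add: rcis_def algebra_simps)
      also have "norm \<dots> = \<bar>s - s'\<bar>" by (simp only: norm_mult norm_of_real norm_cis mult_1_right)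
      finally show ?thesis .
    qed
    have ang: "\<bar>\<psi> (z0 + rcis s' t) - \<psi> (z0 + rcis s' t')\<bar> \<le> s' * \<alpha>"
    proof -
      have main: "\<bar>\<psi> (z0 + rcis s' b) - \<psi> (z0 + rcis s' a)\<bar> \<le> s' * \<alpha>" if ab: "\<theta> < a" "a \<le> b" "b < \<theta> + \<alpha>" for a b
      proof -
        have "\<bar>\<psi> (z0 + rcis s' b) - \<psi> (z0 + rcis s' a)\<bar> \<le> s' * (b - a)"
          by (rule dual_angular[OF d]) (use ab st in \<open>auto intro!: in\<Omega>\<close>)
        also have "\<dots> \<le> s' * \<alpha>" using ab st by (intro mult_left_mono) auto
        finally show ?thesis .
      qed
      show ?thesis using main[of t t'] main[of t' t] st by (cases "t \<le> t'") (auto simp: abs_minus_commute)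
    qed
    have "s' * \<alpha> \<le> \<delta> * \<alpha>" using s\<delta> \<alpha> by (intro mult_right_mono) auto
    moreover have "\<bar>s - s'\<bar> \<le> \<delta>" using s\<delta> st by auto
    ultimately show ?thesis using rad ang unfolding st(1,6) by (simp add: algebra_simps)
  qed
  show "\<exists>l. (\<psi> \<longlongrightarrow> l) (at z0 within \<Omega>)"
  proof (rule oscillation_limit[OF cl])
    fix e :: real assume e: "0 < e"
    define e' where "e' = e / (2 * (1 + \<alpha>))"
    have e': "e' > 0" using e \<alpha> by (simp add: e'_def)
    define \<delta> where "\<delta> = min r e'"
    have \<delta>: "\<delta> > 0" "\<delta> \<le> r" "\<delta> \<le> e'" using r e' by (auto simp: \<delta>_def)
    have "\<delta> * (1 + \<alpha>) \<le> e' * (1 + \<alpha>)" using \<delta> \<alpha> by (intro mult_right_mono) auto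
    also have "e' * (1 + \<alpha>) = e / 2" using \<alpha> by (simp add: e'_def divide_simps)
    also have "\<dots> < e" using e by simp
    finally have "\<delta> * (1 + \<alpha>) < e" .
    then show "\<exists>\<delta>>0. \<forall>z\<in>\<Omega>. \<forall>z'\<in>\<Omega>. dist z z0 < \<delta> \<and> dist z' z0 < \<delta> \<longrightarrow> dist (\<psi> z) (\<psi> z') < e"
      using bound[OF _ _ _ _ \<delta>(2)] \<delta>(1) unfolding dist_real_def by (meson le_less_trans)
  qed
qed

lemma dual_limit_at_side:
  assumes d: "is_dual \<psi> \<phi> \<Omega>" and q: "q \<in> closure \<Omega>" and \<delta>: "0 < \<delta>" and C: "convex (\<Omega> \<inter> ball q \<delta>)"
  shows "\<exists>l. (\<psi> \<longlongrightarrow> l) (at q within \<Omega>)"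
proof (rule oscillation_limit[OF q])
  fix e :: real assume e: "0 < e"
  show "\<exists>\<delta>>0. \<forall>z\<in>\<Omega>. \<forall>z'\<in>\<Omega>. dist z q < \<delta> \<and> dist z' q < \<delta> \<longrightarrow> dist (\<psi> z) (\<psi> z') < e"
  proof (intro exI[of _ "min \<delta> (e/2)"] conjI ballI impI)
    fix z z' assume z: "z \<in> \<Omega>" "z' \<in> \<Omega>" "dist z q < min \<delta> (e/2) \<and> dist z' q < min \<delta> (e/2)"
    have "\<bar>\<psi> z - \<psi> z'\<bar> \<le> norm (z - z')"
      by (rule dual_lipschitz[OF d C]) (use z in \<open>auto simp: dist_commute\<close>)
    also have "norm (z - z') \<le> dist z q + dist z' q" using dist_triangle2[of z z' q] by (simp add: dist_norm)
    also have "\<dots> < e" using z by auto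
    finally show "dist (\<psi> z) (\<psi> z') < e" by (simp add: dist_real_def)
  qed (use \<delta> e in auto)
qed

text \<open>For a conformal frame \<open>a, b\<close> of a graph with unit normal \<open>N\<close>, \<open>b = N \<times> a\<close>; the third components
  are the Cauchy--Riemann equations of height and dual.\<close>

lemma conformal_frame:
  fixes a1 a2 b1 b2 p q :: real
  defines "a3 \<equiv> p * a1 + q * a2" and "b3 \<equiv> p * b1 + q * b2" and "W \<equiv> sqrt (1 + (p\<^sup>2 + q\<^sup>2))"
  assumes len: "a1\<^sup>2 + a2\<^sup>2 + a3\<^sup>2 = b1\<^sup>2 + b2\<^sup>2 + b3\<^sup>2" and orth: "a1 * b1 + a2 * b2 + a3 * b3 = 0"
    and J: "0 < a1 * b2 - a2 * b1"
  shows "W * b3 = q * a1 - p * a2" and "W * a3 = p * b2 - q * b1"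
proof -
  define J' where "J' = a1 * b2 - a2 * b1"
  define l where "l = a1\<^sup>2 + a2\<^sup>2 + a3\<^sup>2"
  have W: "W > 0" "W\<^sup>2 = 1 + (p\<^sup>2 + q\<^sup>2)" by (auto simp: W_def add_pos_nonneg)
  have "J'\<^sup>2 * (1 + (p\<^sup>2 + q\<^sup>2)) = (a1\<^sup>2 + a2\<^sup>2 + a3\<^sup>2) * (b1\<^sup>2 + b2\<^sup>2 + b3\<^sup>2) - (a1 * b1 + a2 * b2 + a3 * b3)\<^sup>2"
    unfolding a3_def b3_def J'_def by (simp add: power2_eq_square algebra_simps)
  also have "\<dots> = l\<^sup>2" using len orth by (simp add: l_def power2_eq_square)
  finally have "(J' * W)\<^sup>2 = l\<^sup>2" by (simp add: W(2) power_mult_distrib)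
  moreover have "0 \<le> l" "0 \<le> J' * W" using J W by (auto simp: l_def J'_def)
  ultimately have JW: "J' * W = l" by (simp add: power2_eq_iff_nonneg)
  have "J' * (q * a1 - p * a2) = l * b3 - (a1 * b1 + a2 * b2 + a3 * b3) * a3"
    unfolding a3_def b3_def J'_def l_def by (simp add: power2_eq_square algebra_simps)
  then have "J' * (q * a1 - p * a2) = J' * (W * b3)" using orth JW by (simp add: mult.assoc[symmetric])
  then show "W * b3 = q * a1 - p * a2" using J by (simp add: J'_def)
  have "J' * (p * b2 - q * b1) = (b1\<^sup>2 + b2\<^sup>2 + b3\<^sup>2) * a3 - (a1 * b1 + a2 * b2 + a3 * b3) * b3"
    unfolding a3_def b3_def J'_def by (simp add: power2_eq_square algebra_simps)
  then have "J' * (p * b2 - q * b1) = J' * (W * a3)" using orth JW len by (simp add: l_def mult.assoc[symmetric])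
  then show "W * a3 = p * b2 - q * b1" using J by (simp add: J'_def)
qed

theorem harmonic_graph_data:
  assumes f: "corresponding_harmonic_mapping f \<phi> \<Omega>" and dual: "is_dual \<psi> \<phi> \<Omega>"
    and \<phi>: "\<And>z. z \<in> \<Omega> \<Longrightarrow> \<phi> differentiable (at z)"
  obtains H1 H2 h where "harmonic_graph H1 H2 h"
    "\<And>w. w \<in> ball 0 1 \<Longrightarrow> f w = H1 w + cnj (H2 w)"
    "\<And>w. w \<in> ball 0 1 \<Longrightarrow> Re (h w) = \<phi> (f w)" "\<And>w. w \<in> ball 0 1 \<Longrightarrow> Im (h w) = \<psi> (f w)"
proof -
  let ?D = "ball (0::complex) 1"
  have harm: "harmonic_on f ?D" and bij: "bij_betw f ?D \<Omega>" and ori: "orientation_preserving_on f ?D"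
    and iso: "isothermal_on (\<lambda>w. (f w, \<phi> (f w))) ?D"
    using f by (auto simp: corresponding_harmonic_mapping_def)
  obtain H1 H2 where H: "H1 holomorphic_on ?D" "H2 holomorphic_on ?D"
    "\<And>z. z \<in> ?D \<Longrightarrow> f z = H1 z + cnj (H2 z)"
    "\<And>z. z \<in> ?D \<Longrightarrow> dx f z = deriv H1 z + cnj (deriv H2 z)"
    "\<And>z. z \<in> ?D \<Longrightarrow> dy f z = \<i> * (deriv H1 z - cnj (deriv H2 z))"
    by (rule harmonic_decomposition[OF harm open_ball convex_ball]) blast
  define h where "h w = Complex (\<phi> (f w)) (\<psi> (f w))" for w
  have key: "(h has_field_derivative deriv h w) (at w) \<and> (deriv h w)\<^sup>2 = - 4 * deriv H1 w * deriv H2 w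
      \<and> norm (deriv H2 w) < norm (deriv H1 w)" if w: "w \<in> ?D" for w
  proof -
    have fw: "f w \<in> \<Omega>" using bij w by (auto simp: bij_betw_def)
    have df: "f differentiable (at w)" using harm w by (auto simp: harmonic_on_def C2_on_def C1_on_def)
    define A where "A = dx f w"
    define B where "B = dy f w"
    define p where "p = dx \<phi> (f w)"
    define q where "q = dy \<phi> (f w)"
    define W where "W = sqrt (1 + (p\<^sup>2 + q\<^sup>2))"
    have Wg: "sqrt (1 + grad_sq \<phi> (f w)) = W" by (simp add: W_def grad_sq_def p_def q_def)
    have W: "W > 0" by (simp add: W_def add_pos_nonneg)
    have Df: "(f has_derivative (\<lambda>v. Re v *\<^sub>R A + Im v *\<^sub>R B)) (at w)"
      unfolding A_def B_def by (rule has_derivative_dx_dy[OF df])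
    have D\<phi>: "(\<phi> has_derivative (\<lambda>v. Re v *\<^sub>R p + Im v *\<^sub>R q)) (at (f w))"
      unfolding p_def q_def by (rule has_derivative_dx_dy[OF \<phi>[OF fw]])
    define a3 where "a3 = p * Re A + q * Im A"
    define b3 where "b3 = p * Re B + q * Im B"
    have Dpf: "((\<lambda>w. \<phi> (f w)) has_derivative (\<lambda>v. Re v * a3 + Im v * b3)) (at w)"
    proof -
      have "((\<lambda>w. \<phi> (f w)) has_derivative (\<lambda>v. Re (Re v *\<^sub>R A + Im v *\<^sub>R B) *\<^sub>R p + Im (Re v *\<^sub>R A + Im v *\<^sub>R B) *\<^sub>R q)) (at w)"
        using diff_chain_at[OF Df D\<phi>] by (simp add: o_def)
      also have "(\<lambda>v. Re (Re v *\<^sub>R A + Im v *\<^sub>R B) *\<^sub>R p + Im (Re v *\<^sub>R A + Im v *\<^sub>R B) *\<^sub>R q) = (\<lambda>v. Re v * a3 + Im v * b3)"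
        by (rule ext) (simp add: a3_def b3_def algebra_simps)
      finally show ?thesis .
    qed
    have "((\<lambda>w. (f w, \<phi> (f w))) has_derivative (\<lambda>v. (Re v *\<^sub>R A + Im v *\<^sub>R B, Re v * a3 + Im v * b3))) (at w)"
      by (rule has_derivative_Pair[OF Df Dpf])
    from dx_dy_eqI[OF this] have dX: "dx (\<lambda>w. (f w, \<phi> (f w))) w = (A, a3)" "dy (\<lambda>w. (f w, \<phi> (f w))) w = (B, b3)" by simp_all
    have "norm (A, a3) = norm (B, b3)" "(A, a3) \<bullet> (B, b3) = 0"
      using iso w unfolding isothermal_on_def dX[symmetric] by auto
    then have len: "(Re A)\<^sup>2 + (Im A)\<^sup>2 + a3\<^sup>2 = (Re B)\<^sup>2 + (Im B)\<^sup>2 + b3\<^sup>2"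
      and orth: "Re A * Re B + Im A * Im B + a3 * b3 = 0"
      by (auto simp: norm_Pair cmod_power2 inner_complex_def)
    have J: "0 < Re A * Im B - Im A * Re B" using ori w by (auto simp: orientation_preserving_on_def A_def B_def)
    have cf: "W * b3 = q * Re A - p * Im A" "W * a3 = p * Im B - q * Re B"
      using conformal_frame[of "Re A" "Im A" p q "Re B" "Im B"] len orth J by (simp_all add: a3_def b3_def W_def)
    have c1: "- (q / W) * Re A + p / W * Im A = - b3" "- (q / W) * Re B + p / W * Im B = a3"
      using cf W by (simp_all add: field_simps)
    have Dqf: "((\<lambda>w. \<psi> (f w)) has_derivative (\<lambda>v. Re v * (- b3) + Im v * a3)) (at w)"
    proof -
      have "((\<lambda>w. \<psi> (f w)) has_derivative (\<lambda>v. dual_derivative \<phi> (f w) (Re v *\<^sub>R A + Im v *\<^sub>R B))) (at w)"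
        using diff_chain_at[OF Df is_dual_has_derivative[OF dual fw]] by (simp add: o_def)
      also have "(\<lambda>v. dual_derivative \<phi> (f w) (Re v *\<^sub>R A + Im v *\<^sub>R B)) = (\<lambda>v. Re v * (- b3) + Im v * a3)"
      proof
        fix v
        have "dual_derivative \<phi> (f w) (Re v *\<^sub>R A + Im v *\<^sub>R B)
          = Re v * (- (q / W) * Re A + p / W * Im A) + Im v * (- (q / W) * Re B + p / W * Im B)"
          unfolding dual_derivative_def Wg p_def[symmetric] q_def[symmetric] by (simp add: algebra_simps)
        then show "dual_derivative \<phi> (f w) (Re v *\<^sub>R A + Im v *\<^sub>R B) = Re v * (- b3) + Im v * a3" unfolding c1 .
      qed
      finally show ?thesis .
    qed
    have hrep: "h = (\<lambda>w. of_real (\<phi> (f w)) + \<i> * of_real (\<psi> (f w)))" by (rule ext) (simp add: h_def complex_eq_iff)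
    have "(h has_derivative (\<lambda>v. of_real (Re v * a3 + Im v * b3) + \<i> * of_real (Re v * (- b3) + Im v * a3))) (at w)"
      unfolding hrep by (intro has_derivative_add has_derivative_of_real has_derivative_mult_right Dpf Dqf)
    also have "(\<lambda>v. of_real (Re v * a3 + Im v * b3) + \<i> * of_real (Re v * (- b3) + Im v * a3)) = (*) (Complex a3 (- b3))"
      by (rule ext) (simp add: complex_eq_iff algebra_simps)
    finally have Dh: "(h has_field_derivative Complex a3 (- b3)) (at w)" by (simp add: has_field_derivative_def)
    then have dh: "deriv h w = Complex a3 (- b3)" by (rule DERIV_imp_deriv)
    define P where "P = deriv H1 w"
    define Q where "Q = deriv H2 w"
    have AB: "A = P + cnj Q" "B = \<i> * (P - cnj Q)" using H(4,5)[OF w] by (simp_all add: A_def B_def P_def Q_def)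
    have ReIm: "Re A = Re P + Re Q" "Im A = Im P - Im Q" "Re B = - Im P - Im Q" "Im B = Re P - Re Q" by (simp_all add: AB)
    have "(deriv h w)\<^sup>2 = - 4 * P * Q"
    proof (rule complex_eqI)
      have "a3\<^sup>2 - b3\<^sup>2 = - 4 * (Re P * Re Q - Im P * Im Q)" using len unfolding ReIm by (simp add: power2_eq_square algebra_simps)
      then show "Re ((deriv h w)\<^sup>2) = Re (- 4 * P * Q)" by (simp add: dh power2_eq_square)
      have "a3 * b3 = 2 * (Re P * Im Q + Im P * Re Q)" using orth unfolding ReIm by (simp add: algebra_simps)
      moreover have "Im ((deriv h w)\<^sup>2) = - 2 * (a3 * b3)" by (simp add: dh power2_eq_square)
      ultimately show "Im ((deriv h w)\<^sup>2) = Im (- 4 * P * Q)" by simp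
    qed
    moreover have "norm Q < norm P"
    proof -
      have "(norm Q)\<^sup>2 < (norm P)\<^sup>2" using J unfolding ReIm cmod_power2 by (simp add: power2_eq_square algebra_simps)
      then show ?thesis by (rule power_less_imp_less_base) simp
    qed
    ultimately show ?thesis using Dh dh by (simp add: P_def Q_def)
  qed
  show thesis
  proof
    show "harmonic_graph H1 H2 h"
    proof
      show "h holomorphic_on ?D" unfolding holomorphic_on_open[OF open_ball] using key by blast
      have "inj_on f ?D" using bij by (simp add: bij_betw_def)
      then show "inj_on (\<lambda>w. H1 w + cnj (H2 w)) ?D" using inj_on_cong[of ?D f "\<lambda>w. H1 w + cnj (H2 w)"] H(3) by blast
    qed (use H key in auto)
  qed (use H(3) in \<open>auto simp: h_def\<close>)
qed

lemma (in harmonic_graph) normalized: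
  assumes "norm e = 1" "\<sigma> = 1 \<or> \<sigma> = - 1"
  shows "harmonic_graph (\<lambda>w. cnj e * (H1 w - p)) (\<lambda>w. e * H2 w) (\<lambda>w. of_real \<sigma> * h w)"
proof
  have ee: "cnj e * e = 1" using assms(1) complex_norm_square[of e] by (simp add: mult.commute)
  have s2: "\<sigma> * \<sigma> = 1" using assms(2) by auto
  have d1: "deriv (\<lambda>w. cnj e * (H1 w - p)) w = cnj e * deriv H1 w" if "w \<in> ball 0 1" for w
    by (intro DERIV_imp_deriv) (auto intro!: derivative_eq_intros holomorphic_derivI[OF hol1 open_ball that])
  have d2: "deriv (\<lambda>w. e * H2 w) w = e * deriv H2 w" if "w \<in> ball 0 1" for w
    by (intro DERIV_imp_deriv DERIV_cmult holomorphic_derivI[OF hol2 open_ball that])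
  have d3: "deriv (\<lambda>w. of_real \<sigma> * h w) w = of_real \<sigma> * deriv h w" if "w \<in> ball 0 1" for w
    by (intro DERIV_imp_deriv DERIV_cmult holomorphic_derivI[OF holh open_ball that])
  show "(\<lambda>w. cnj e * (H1 w - p)) holomorphic_on ball 0 1" "(\<lambda>w. e * H2 w) holomorphic_on ball 0 1"
    "(\<lambda>w. of_real \<sigma> * h w) holomorphic_on ball 0 1" by (intro holomorphic_intros hol1 hol2 holh)+
  show "norm (deriv (\<lambda>w. e * H2 w) w) < norm (deriv (\<lambda>w. cnj e * (H1 w - p)) w)" if "w \<in> ball 0 1" for w
    using dil[OF that] assms(1) by (simp add: d1[OF that] d2[OF that] norm_mult)
  show "(deriv (\<lambda>w. of_real \<sigma> * h w) w)\<^sup>2 = - 4 * deriv (\<lambda>w. cnj e * (H1 w - p)) w * deriv (\<lambda>w. e * H2 w) w"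
    if "w \<in> ball 0 1" for w
  proof -
    have "(of_real \<sigma> * deriv h w)\<^sup>2 = of_real (\<sigma> * \<sigma>) * (deriv h w)\<^sup>2" by (simp add: power2_eq_square)
    also have "\<dots> = (cnj e * e) * (- 4 * deriv H1 w * deriv H2 w)" by (simp add: s2 ee conf[OF that])
    finally show ?thesis by (simp add: d1[OF that] d2[OF that] d3[OF that])
  qed
  show "inj_on (\<lambda>w. cnj e * (H1 w - p) + cnj (e * H2 w)) (ball 0 1)"
  proof (rule inj_onI)
    fix x y assume xy: "x \<in> ball 0 1" "y \<in> ball 0 1"
      and "cnj e * (H1 x - p) + cnj (e * H2 x) = cnj e * (H1 y - p) + cnj (e * H2 y)"
    then have "cnj e * (H1 x + cnj (H2 x)) = cnj e * (H1 y + cnj (H2 y))" by (simp add: algebra_simps)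
    then have "H1 x + cnj (H2 x) = H1 y + cnj (H2 y)" using assms(1) by auto
    then show "x = y" using inj xy by (simp add: inj_on_def)
  qed
qed

section \<open>Reflected surfaces\<close>

lemma dx_dy_cong:
  assumes S: "open S" "z \<in> S" and eq: "\<And>w. w \<in> S \<Longrightarrow> F w = G w"
  shows "dx F z = dx G z" "dy F z = dy G z" "F differentiable (at z) \<longleftrightarrow> G differentiable (at z)"
proof -
  have "(F has_derivative f') (at z) \<longleftrightarrow> (G has_derivative f') (at z)" for f'
    using has_derivative_transform_within_open[OF _ S, of F f' UNIV G] has_derivative_transform_within_open[OF _ S, of G f' UNIV F] eq
    by metis
  then show "dx F z = dx G z" "dy F z = dy G z" "F differentiable (at z) \<longleftrightarrow> G differentiable (at z)"
    unfolding dx_def dy_def frechet_derivative_def differentiable_def by simp_all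
qed

lemma C1_on_cong:
  assumes S: "open S" and eq: "\<And>w. w \<in> S \<Longrightarrow> F w = G w"
  shows "C1_on F S \<longleftrightarrow> C1_on G S"
proof -
  have c: "dx F z = dx G z" "dy F z = dy G z" "F differentiable (at z) \<longleftrightarrow> G differentiable (at z)" if "z \<in> S" for z
    by (rule dx_dy_cong[OF S that eq]; assumption)+
  have "continuous_on S (dx F) \<longleftrightarrow> continuous_on S (dx G)" "continuous_on S (dy F) \<longleftrightarrow> continuous_on S (dy G)"
    by (intro continuous_on_cong refl c; assumption)+
  then show ?thesis unfolding C1_on_def using c(3) by simp
qed

lemma dx_dy_bounded_linear:
  assumes "F differentiable (at z)" "bounded_linear L"
  shows "dx (\<lambda>w. L (F w)) z = L (dx F z)" "dy (\<lambda>w. L (F w)) z = L (dy F z)"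
proof -
  have "((\<lambda>w. L (F w)) has_derivative (\<lambda>h. L (Re h *\<^sub>R dx F z + Im h *\<^sub>R dy F z))) (at z)"
    by (rule bounded_linear.has_derivative[OF assms(2) has_derivative_dx_dy[OF assms(1)]])
  from dx_dy_eqI[OF this] show "dx (\<lambda>w. L (F w)) z = L (dx F z)" "dy (\<lambda>w. L (F w)) z = L (dy F z)" by simp_all
qed

lemma linear_combination_C1:
  fixes L1 L2 L3 :: "complex \<Rightarrow> 'a::real_normed_vector"
  assumes S: "open S" and L: "bounded_linear L1" "bounded_linear L2" "bounded_linear L3"
    and G: "G1 holomorphic_on S" "G2 holomorphic_on S" "G3 holomorphic_on S"
    and T: "T = (\<lambda>w. c + L1 (G1 w) + L2 (G2 w) + L3 (G3 w))"
  shows "C1_on T S"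
    and "\<And>w. w \<in> S \<Longrightarrow> dx T w = L1 (deriv G1 w) + L2 (deriv G2 w) + L3 (deriv G3 w)"
    and "\<And>w. w \<in> S \<Longrightarrow> dy T w = L1 (\<i> * deriv G1 w) + L2 (\<i> * deriv G2 w) + L3 (\<i> * deriv G3 w)"
proof -
  have D: "(T has_derivative (\<lambda>h. L1 (deriv G1 w * h) + L2 (deriv G2 w * h) + L3 (deriv G3 w * h))) (at w)" if w: "w \<in> S" for w
  proof -
    have d: "(G1 has_derivative (*) (deriv G1 w)) (at w)" "(G2 has_derivative (*) (deriv G2 w)) (at w)" "(G3 has_derivative (*) (deriv G3 w)) (at w)"
      using G holomorphic_derivI[OF _ S w] unfolding has_field_derivative_def by blast+
    have "(T has_derivative (\<lambda>h. 0 + L1 (deriv G1 w * h) + L2 (deriv G2 w * h) + L3 (deriv G3 w * h))) (at w)"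
      unfolding T by (intro has_derivative_add has_derivative_const bounded_linear.has_derivative[OF L(1) d(1)]
        bounded_linear.has_derivative[OF L(2) d(2)] bounded_linear.has_derivative[OF L(3) d(3)])
    then show ?thesis by simp
  qed
  show dxT: "dx T w = L1 (deriv G1 w) + L2 (deriv G2 w) + L3 (deriv G3 w)" if "w \<in> S" for w
    using dx_dy_eqI(1)[OF D[OF that]] by simp
  show dyT: "dy T w = L1 (\<i> * deriv G1 w) + L2 (\<i> * deriv G2 w) + L3 (\<i> * deriv G3 w)" if "w \<in> S" for w
    using dx_dy_eqI(2)[OF D[OF that]] by (simp add: mult.commute)
  have c: "continuous_on S (deriv G1)" "continuous_on S (deriv G2)" "continuous_on S (deriv G3)"
    using G S by (auto intro!: holomorphic_on_imp_continuous_on holomorphic_deriv)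
  have "continuous_on S (\<lambda>w. L1 (deriv G1 w) + L2 (deriv G2 w) + L3 (deriv G3 w))"
    "continuous_on S (\<lambda>w. L1 (\<i> * deriv G1 w) + L2 (\<i> * deriv G2 w) + L3 (\<i> * deriv G3 w))"
    by (intro continuous_intros bounded_linear.continuous_on[OF L(1)] bounded_linear.continuous_on[OF L(2)]
      bounded_linear.continuous_on[OF L(3)] c)+
  then have "continuous_on S (dx T)" "continuous_on S (dy T)"
    by (auto elim!: continuous_on_eq simp: dxT dyT)
  then show "C1_on T S" unfolding C1_on_def using D differentiable_def by blast
qed

lemma linear_combination_harmonic:
  fixes L1 L2 L3 :: "complex \<Rightarrow> 'a::real_normed_vector"
  assumes S: "open S" and L: "bounded_linear L1" "bounded_linear L2" "bounded_linear L3"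
    and G: "G1 holomorphic_on S" "G2 holomorphic_on S" "G3 holomorphic_on S"
    and T: "T = (\<lambda>w. c + L1 (G1 w) + L2 (G2 w) + L3 (G3 w))"
  shows "harmonic_on T S"
proof -
  note A = linear_combination_C1[OF S L G T]
  have G': "deriv G1 holomorphic_on S" "deriv G2 holomorphic_on S" "deriv G3 holomorphic_on S"
    using G S by (auto intro!: holomorphic_deriv)
  have iG': "(\<lambda>w. \<i> * deriv G1 w) holomorphic_on S" "(\<lambda>w. \<i> * deriv G2 w) holomorphic_on S" "(\<lambda>w. \<i> * deriv G3 w) holomorphic_on S"
    by (intro holomorphic_intros G')+
  have ddi: "\<i> * deriv (\<lambda>w. \<i> * deriv F w) w = - deriv (deriv F) w" if "deriv F holomorphic_on S" "w \<in> S" for F w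
  proof -
    have "deriv (\<lambda>w. \<i> * deriv F w) w = \<i> * deriv (deriv F) w"
      by (intro DERIV_imp_deriv DERIV_cmult holomorphic_derivI[OF that(1) S that(2)])
    then show ?thesis by (simp add: mult.assoc[symmetric])
  qed
  define Tx where "Tx = (\<lambda>w. 0 + L1 (deriv G1 w) + L2 (deriv G2 w) + L3 (deriv G3 w))"
  define Ty where "Ty = (\<lambda>w. 0 + L1 (\<i> * deriv G1 w) + L2 (\<i> * deriv G2 w) + L3 (\<i> * deriv G3 w))"
  note X = linear_combination_C1[OF S L G' Tx_def]
  note Y = linear_combination_C1[OF S L iG' Ty_def]
  have eqs: "dx T w = Tx w" "dy T w = Ty w" if "w \<in> S" for w using A(2,3)[OF that] by (simp_all add: Tx_def Ty_def)
  have "C1_on (dx T) S" "C1_on (dy T) S" using X(1) Y(1) C1_on_cong[OF S, of "dx T" Tx] C1_on_cong[OF S, of "dy T" Ty] eqs by blast+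
  moreover have "dx (dx T) w + dy (dy T) w = 0" if w: "w \<in> S" for w
  proof -
    have "dx (dx T) w = dx Tx w" "dy (dy T) w = dy Ty w"
      by (rule dx_dy_cong[OF S w eqs(1)], assumption) (rule dx_dy_cong[OF S w eqs(2)], assumption)
    then show ?thesis
      using X(2)[OF w] Y(3)[OF w] ddi[OF G'(1) w] ddi[OF G'(2) w] ddi[OF G'(3) w]
      by (simp add: bounded_linear.linear[THEN linear_neg] L)
  qed
  ultimately show ?thesis unfolding harmonic_on_def C2_on_def using A(1) by blast
qed

lemma doubled_domain_eq: "doubled_domain a b = {w. 0 < Im w} \<union> ({w. a < Re w} \<inter> {w. Re w < b}) \<union> {w. Im w < 0}"
proof -
  have "w \<in> real_interval a b" if "Im w = 0" "a < Re w" "Re w < b" for w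
    unfolding real_interval_def using that by (intro image_eqI[of _ _ "Re w"]) (auto simp: complex_eq_iff)
  moreover have "a < Re w \<and> Re w < b" if "w \<in> real_interval a b" for w using that by (auto simp: real_interval_def)
  ultimately show ?thesis
    unfolding doubled_domain_def upper_half_plane_def lower_half_plane_def by (auto, metis linorder_less_linear)
qed

lemma open_doubled_domain: "open (doubled_domain a b)"
  unfolding doubled_domain_eq
  by (intro open_Un open_Int open_halfspace_Im_gt open_halfspace_Im_lt open_halfspace_Re_gt open_halfspace_Re_lt)

lemma connected_doubled_domain:
  assumes "a < b" shows "connected (doubled_domain a b)"
proof -
  define m where "m = (a + b) / 2"
  have m: "a < m" "m < b" using assms by (auto simp: m_def)
  let ?S = "{w. a < Re w} \<inter> {w. Re w < b}"
  have cS: "connected ?S" by (intro convex_connected convex_Int convex_halfspace_Re_gt convex_halfspace_Re_lt)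
  have "Complex m 1 \<in> {w. 0 < Im w} \<inter> ?S" "Complex m (- 1) \<in> ({w. 0 < Im w} \<union> ?S) \<inter> {w. Im w < 0}" using m by auto
  then show ?thesis unfolding doubled_domain_eq
    by (intro connected_Un cS convex_connected convex_halfspace_Im_gt convex_halfspace_Im_lt) blast+
qed

lemma doubled_domain_cnj: "w \<in> doubled_domain a b \<Longrightarrow> cnj w \<in> doubled_domain a b"
  unfolding doubled_domain_eq by auto

lemma of_real_in_doubled_domain [simp]: "of_real x \<in> doubled_domain a b \<longleftrightarrow> a < x \<and> x < b"
  unfolding doubled_domain_eq by auto

lemma symmetric_holomorphic_on_reals:
  assumes S: "open S" and G: "G holomorphic_on S" and sym: "\<And>w. w \<in> S \<Longrightarrow> G (cnj w) = cnj (G w)" and x: "of_real x \<in> S"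
  shows "Im (G (of_real x)) = 0" "Im (deriv G (of_real x)) = 0"
    and "((\<lambda>t. Re (G (of_real t))) has_real_derivative Re (deriv G (of_real x))) (at x)"
proof -
  have im: "Im (G (of_real t)) = 0" if "of_real t \<in> S" for t
    using arg_cong[OF sym[OF that], of Im] by simp
  show "Im (G (of_real x)) = 0" by (rule im[OF x])
  have V: "((\<lambda>t. G (of_real t)) has_vector_derivative deriv G (of_real x)) (at x)"
    by (rule has_vector_derivative_real_field[OF holomorphic_derivI[OF G S x]])
  show "((\<lambda>t. Re (G (of_real t))) has_real_derivative Re (deriv G (of_real x))) (at x)"
    using bounded_linear.has_vector_derivative[OF bounded_linear_Re V] by (simp add: has_real_derivative_iff_has_vector_derivative)
  have oV: "open ((of_real :: real \<Rightarrow> complex) -` S)" by (intro open_vimage S continuous_intros)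
  have "((\<lambda>t. Im (G (of_real t))) has_vector_derivative Im (deriv G (of_real x))) (at x)"
    by (rule bounded_linear.has_vector_derivative[OF bounded_linear_Im V])
  moreover have "((\<lambda>t. Im (G (of_real t))) has_vector_derivative 0) (at x)"
    by (rule has_vector_derivative_transform_within_open[OF has_vector_derivative_const oV]) (use im x in auto)
  ultimately show "Im (deriv G (of_real x)) = 0" by (rule vector_derivative_unique_at)
qed

locale reflected_surface =
  fixes a b :: real and G1 G2 G3 :: "complex \<Rightarrow> complex"
  assumes ab: "a < b"
    and hol: "G1 holomorphic_on doubled_domain a b" "G2 holomorphic_on doubled_domain a b" "G3 holomorphic_on doubled_domain a b"
    and sym: "w \<in> doubled_domain a b \<Longrightarrow> G1 (cnj w) = cnj (G1 w)"
      "w \<in> doubled_domain a b \<Longrightarrow> G2 (cnj w) = cnj (G2 w)" "w \<in> doubled_domain a b \<Longrightarrow> G3 (cnj w) = cnj (G3 w)"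
    and quadric: "w \<in> doubled_domain a b \<Longrightarrow> (deriv G1 w)\<^sup>2 + (deriv G2 w)\<^sup>2 = (deriv G3 w)\<^sup>2"
    and regular: "a < x \<Longrightarrow> x < b \<Longrightarrow> deriv G3 (of_real x) \<noteq> 0"
    and spacelike: "w \<in> upper_half_plane \<Longrightarrow> (norm (deriv G1 w))\<^sup>2 + (norm (deriv G2 w))\<^sup>2 - (norm (deriv G3 w))\<^sup>2 \<noteq> 0"
begin

definition surface :: "(complex \<Rightarrow> real) \<Rightarrow> complex \<times> real \<Rightarrow> complex \<Rightarrow> complex \<times> real" where
  "surface L P w = (fst P + Complex (Im (G1 w)) (Im (G2 w)), snd P + L (G3 w))"

lemmas on_reals = symmetric_holomorphic_on_reals[OF open_doubled_domain[of a b]]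

context
  fixes L :: "complex \<Rightarrow> real" and P :: "complex \<times> real"
  assumes L: "bounded_linear L"
begin

lemma surface_calculus:
  shows "harmonic_on (surface L P) (doubled_domain a b)"
    and "w \<in> doubled_domain a b \<Longrightarrow> surface L P differentiable (at w)"
    and "w \<in> doubled_domain a b \<Longrightarrow> dx (surface L P) w = (Complex (Im (deriv G1 w)) (Im (deriv G2 w)), L (deriv G3 w))"
    and "w \<in> doubled_domain a b \<Longrightarrow> dy (surface L P) w = (Complex (Re (deriv G1 w)) (Re (deriv G2 w)), L (\<i> * deriv G3 w))"
proof -
  let ?L1 = "\<lambda>v::complex. (complex_of_real (Im v), 0::real)"
  let ?L2 = "\<lambda>v::complex. (\<i> * complex_of_real (Im v), 0::real)"
  let ?L3 = "\<lambda>v::complex. (0::complex, L v)"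
  have b: "bounded_linear ?L1" "bounded_linear ?L2" "bounded_linear ?L3"
    by (intro bounded_linear_Pair bounded_linear_zero L bounded_linear_compose[OF bounded_linear_of_real bounded_linear_Im]
      bounded_linear_const_mult)+
  have T: "surface L P = (\<lambda>w. P + ?L1 (G1 w) + ?L2 (G2 w) + ?L3 (G3 w))"
    by (rule ext) (simp add: surface_def prod_eq_iff complex_eq_iff)
  show "harmonic_on (surface L P) (doubled_domain a b)"
    by (rule linear_combination_harmonic[OF open_doubled_domain b hol T])
  note C = linear_combination_C1[OF open_doubled_domain b hol T]
  show "surface L P differentiable (at w)" if "w \<in> doubled_domain a b" using C(1) that by (simp add: C1_on_def)
  show "dx (surface L P) w = (Complex (Im (deriv G1 w)) (Im (deriv G2 w)), L (deriv G3 w))" if "w \<in> doubled_domain a b"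
    using C(2)[OF that] by (simp add: complex_eq_iff)
  show "dy (surface L P) w = (Complex (Re (deriv G1 w)) (Re (deriv G2 w)), L (\<i> * deriv G3 w))" if "w \<in> doubled_domain a b"
    using C(3)[OF that] by (simp add: complex_eq_iff)
qed

lemma surface_nonconstant: "nonconstant_harmonic_map (surface L P) (doubled_domain a b)"
  if L0: "\<And>r::real. r \<noteq> 0 \<Longrightarrow> L (of_real r) \<noteq> 0 \<or> L (\<i> * of_real r) \<noteq> 0"
proof -
  define p where "p = complex_of_real ((a + b) / 2)"
  have p: "p \<in> doubled_domain a b" using ab unfolding p_def of_real_in_doubled_domain by auto
  have "\<not> surface L P constant_on doubled_domain a b"
  proof
    assume "surface L P constant_on doubled_domain a b"
    then obtain c where c: "\<And>w. w \<in> doubled_domain a b \<Longrightarrow> surface L P w = c" unfolding constant_on_def by blast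
    have "dx (surface L P) p = dx (\<lambda>w. c) p" "dy (surface L P) p = dy (\<lambda>w. c) p"
      by (rule dx_dy_cong[OF open_doubled_domain p c], assumption)+
    moreover have "dx (\<lambda>w. c) p = 0" "dy (\<lambda>w. c) p = 0" using dx_dy_eqI[OF has_derivative_const[of c "at p"]] by simp_all
    ultimately have "L (deriv G3 p) = 0" "L (\<i> * deriv G3 p) = 0"
      using surface_calculus(3,4)[OF p] by (simp_all add: prod_eq_iff)
    moreover have "deriv G3 p = of_real (Re (deriv G3 p))" "Re (deriv G3 p) \<noteq> 0"
      using on_reals(2)[OF hol(3) sym(3), OF _ p[unfolded p_def]] regular[of "(a + b) / 2"] ab
      unfolding p_def[symmetric] by (auto simp: complex_eq_iff)
    ultimately show False using L0[of "Re (deriv G3 p)"] by metis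
  qed
  then show ?thesis unfolding nonconstant_harmonic_map_def
    using open_doubled_domain connected_doubled_domain[OF ab] surface_calculus(1) by blast
qed

lemma surface_Phi:
  assumes w: "w \<in> doubled_domain a b"
  shows "Phi1 (surface L P) w = - \<i> * deriv G1 w / 2" "Phi2 (surface L P) w = - \<i> * deriv G2 w / 2"
    and "Phi3 (surface L P) w = (of_real (L (deriv G3 w)) - \<i> * of_real (L (\<i> * deriv G3 w))) / 2"
proof -
  have b: "bounded_linear (\<lambda>v::complex\<times>real. Re (fst v))" "bounded_linear (\<lambda>v::complex\<times>real. Im (fst v))"
    by (intro bounded_linear_compose[OF bounded_linear_Re bounded_linear_fst] bounded_linear_compose[OF bounded_linear_Im bounded_linear_fst])+
  note D = dx_dy_bounded_linear[OF surface_calculus(2)[OF w]]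
  show "Phi1 (surface L P) w = - \<i> * deriv G1 w / 2"
    unfolding Phi1_def wirtinger_def D[OF b(1)] surface_calculus(3,4)[OF w] by (simp add: complex_eq_iff)
  show "Phi2 (surface L P) w = - \<i> * deriv G2 w / 2"
    unfolding Phi2_def wirtinger_def D[OF b(2)] surface_calculus(3,4)[OF w] by (simp add: complex_eq_iff)
  show "Phi3 (surface L P) w = (of_real (L (deriv G3 w)) - \<i> * of_real (L (\<i> * deriv G3 w))) / 2"
    unfolding Phi3_def wirtinger_def D[OF bounded_linear_snd] surface_calculus(3,4)[OF w] by simp
qed

end

lemma identity_coordinate:
  assumes "w \<in> doubled_domain a b"
  shows "dx (in_coord X (doubled_domain a b) (\<lambda>x. x)) w = dx X w" "dy (in_coord X (doubled_domain a b) (\<lambda>x. x)) w = dy X w"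
    and "Phi1 (in_coord X (doubled_domain a b) (\<lambda>x. x)) w = Phi1 X w" "Phi2 (in_coord X (doubled_domain a b) (\<lambda>x. x)) w = Phi2 X w"
    and "Phi3 (in_coord X (doubled_domain a b) (\<lambda>x. x)) w = Phi3 X w"
proof -
  have eq: "in_coord X (doubled_domain a b) (\<lambda>x. x) v = X v" if "v \<in> doubled_domain a b" for v
    unfolding in_coord_def using the_inv_into_f_f[of "\<lambda>x. x" "doubled_domain a b" v] that by simp
  show "dx (in_coord X (doubled_domain a b) (\<lambda>x. x)) w = dx X w" "dy (in_coord X (doubled_domain a b) (\<lambda>x. x)) w = dy X w"
    by (rule dx_dy_cong[OF open_doubled_domain assms eq], assumption)+
  have cong: "dx (\<lambda>w. k (in_coord X (doubled_domain a b) (\<lambda>x. x) w)) w = dx (\<lambda>w. k (X w)) w"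
    "dy (\<lambda>w. k (in_coord X (doubled_domain a b) (\<lambda>x. x) w)) w = dy (\<lambda>w. k (X w)) w" for k :: "complex \<times> real \<Rightarrow> real"
    by (rule dx_dy_cong[OF open_doubled_domain assms], simp add: eq)+
  show "Phi1 (in_coord X (doubled_domain a b) (\<lambda>x. x)) w = Phi1 X w" "Phi2 (in_coord X (doubled_domain a b) (\<lambda>x. x)) w = Phi2 X w"
    "Phi3 (in_coord X (doubled_domain a b) (\<lambda>x. x)) w = Phi3 X w"
    unfolding Phi1_def Phi2_def Phi3_def wirtinger_def
    using cong[of "\<lambda>v. Re (fst v)"] cong[of "\<lambda>v. Im (fst v)"] cong[of snd] by simp_all
qed

lemma identity_coordinate_near: "p \<in> doubled_domain a b \<Longrightarrow> coordinate_near (doubled_domain a b) p (doubled_domain a b) (\<lambda>x. x)"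
  unfolding coordinate_near_def using open_doubled_domain by auto

lemma minimal_surface: "generalized_minimal_surface (surface Re P) (doubled_domain a b)"
  unfolding generalized_minimal_surface_def
proof (intro conjI ballI)
  show "nonconstant_harmonic_map (surface Re P) (doubled_domain a b)" by (rule surface_nonconstant[OF bounded_linear_Re]) simp
  fix p assume p: "p \<in> doubled_domain a b"
  have "(Phi1 (surface Re P) w)\<^sup>2 + (Phi2 (surface Re P) w)\<^sup>2 + (Phi3 (surface Re P) w)\<^sup>2 = 0"
    if w: "w \<in> doubled_domain a b" for w
  proof -
    have P3: "Phi3 (surface Re P) w = deriv G3 w / 2"
      unfolding surface_Phi[OF bounded_linear_Re w] by (simp add: complex_eq_iff)
    have "(Phi1 (surface Re P) w)\<^sup>2 + (Phi2 (surface Re P) w)\<^sup>2 + (Phi3 (surface Re P) w)\<^sup>2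
       = ((deriv G3 w)\<^sup>2 - ((deriv G1 w)\<^sup>2 + (deriv G2 w)\<^sup>2)) / 4"
      unfolding P3 surface_Phi(1,2)[OF bounded_linear_Re w] by (simp add: power_divide power_mult_distrib field_simps)
    then show ?thesis using quadric[OF w] by simp
  qed
  then show "\<exists>V h. coordinate_near (doubled_domain a b) p V h \<and>
        (let Y = in_coord (surface Re P) V h in \<forall>w \<in> h ` V. (Phi1 Y w)\<^sup>2 + (Phi2 Y w)\<^sup>2 + (Phi3 Y w)\<^sup>2 = 0)"
    by (intro exI[of _ "doubled_domain a b"] exI[of _ "\<lambda>x. x"] conjI identity_coordinate_near p)
      (simp add: Let_def identity_coordinate)
qed

lemma maximal_surface: "generalized_maximal_surface (surface Im P) (doubled_domain a b)"
  unfolding generalized_maximal_surface_def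
proof (intro conjI ballI)
  show "nonconstant_harmonic_map (surface Im P) (doubled_domain a b)" by (rule surface_nonconstant[OF bounded_linear_Im]) simp
  fix p assume p: "p \<in> doubled_domain a b"
  have P3: "Phi3 (surface Im P) w = - \<i> * deriv G3 w / 2" if w: "w \<in> doubled_domain a b" for w
    unfolding surface_Phi[OF bounded_linear_Im w] by (simp add: complex_eq_iff)
  have "(Phi1 (surface Im P) w)\<^sup>2 + (Phi2 (surface Im P) w)\<^sup>2 - (Phi3 (surface Im P) w)\<^sup>2 = 0"
    if w: "w \<in> doubled_domain a b" for w
  proof -
    have "(Phi1 (surface Im P) w)\<^sup>2 + (Phi2 (surface Im P) w)\<^sup>2 - (Phi3 (surface Im P) w)\<^sup>2
       = ((deriv G3 w)\<^sup>2 - ((deriv G1 w)\<^sup>2 + (deriv G2 w)\<^sup>2)) / 4"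
      unfolding P3[OF w] surface_Phi(1,2)[OF bounded_linear_Im w] by (simp add: power_divide power_mult_distrib field_simps)
    then show ?thesis using quadric[OF w] by simp
  qed
  moreover have "\<exists>w \<in> doubled_domain a b. (cmod (Phi1 (surface Im P) w))\<^sup>2 + (cmod (Phi2 (surface Im P) w))\<^sup>2 - (cmod (Phi3 (surface Im P) w))\<^sup>2 \<noteq> 0"
  proof (rule bexI[of _ \<i>])
    have w: "\<i> \<in> doubled_domain a b" "\<i> \<in> upper_half_plane" by (auto simp: doubled_domain_def upper_half_plane_def)
    show "\<i> \<in> doubled_domain a b" by (rule w(1))
    show "(cmod (Phi1 (surface Im P) \<i>))\<^sup>2 + (cmod (Phi2 (surface Im P) \<i>))\<^sup>2 - (cmod (Phi3 (surface Im P) \<i>))\<^sup>2 \<noteq> 0"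
      unfolding P3[OF w(1)] surface_Phi(1,2)[OF bounded_linear_Im w(1)]
      using spacelike[OF w(2)] by (simp add: norm_mult norm_divide power_divide field_simps)
  qed
  ultimately show "\<exists>V h. coordinate_near (doubled_domain a b) p V h \<and>
        (let Y = in_coord (surface Im P) V h in
          (\<forall>w \<in> h ` V. (Phi1 Y w)\<^sup>2 + (Phi2 Y w)\<^sup>2 - (Phi3 Y w)\<^sup>2 = 0) \<and>
          (\<exists>w \<in> h ` V. (cmod (Phi1 Y w))\<^sup>2 + (cmod (Phi2 Y w))\<^sup>2 - (cmod (Phi3 Y w))\<^sup>2 \<noteq> 0))"
    by (intro exI[of _ "doubled_domain a b"] exI[of _ "\<lambda>x. x"] conjI identity_coordinate_near p)
      (simp add: Let_def identity_coordinate)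
qed

lemma shrinking:
  assumes p: "p \<in> real_interval a b"
  shows "surface Im P p = P" "shrinking_singular_point (surface Im P) (doubled_domain a b) p"
proof -
  have val: "surface Im P q = P" and light: "q \<in> lightlike_points (surface Im P) (doubled_domain a b)"
    if q: "q \<in> real_interval a b" for q
  proof -
    obtain x where x: "q = of_real x" "a < x" "x < b" using q by (auto simp: real_interval_def)
    then have qS: "of_real x \<in> doubled_domain a b" by simp
    note R = on_reals(1,2)[OF hol(1) sym(1) qS] on_reals(1,2)[OF hol(2) sym(2) qS] on_reals(1,2)[OF hol(3) sym(3) qS]
    show "surface Im P q = P" by (simp add: surface_def x R prod_eq_iff complex_eq_iff)
    have "(Re (deriv G1 (of_real x)))\<^sup>2 + (Re (deriv G2 (of_real x)))\<^sup>2 = (Re (deriv G3 (of_real x)))\<^sup>2"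
      using arg_cong[OF quadric[OF qS], of Re] R by (simp add: power2_eq_square)
    moreover have "Re (deriv G3 (of_real x)) \<noteq> 0" using regular[OF x(2,3)] R by (simp add: complex_eq_iff)
    ultimately have "lightlike (dy (surface Im P) (of_real x))"
      unfolding surface_calculus(4)[OF bounded_linear_Im qS]
      by (simp add: lightlike_def lorentz_def inner_complex_def power2_eq_square prod_eq_iff)
    then show "q \<in> lightlike_points (surface Im P) (doubled_domain a b)"
      unfolding lightlike_points_def x(1) mem_Collect_eq
      by (intro conjI qS exI[of _ "doubled_domain a b"] exI[of _ "\<lambda>x. x"] identity_coordinate_near)
        (simp add: Let_def identity_coordinate[OF qS])
  qed
  show "surface Im P p = P" by (rule val[OF p])
  show "shrinking_singular_point (surface Im P) (doubled_domain a b) p"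
    unfolding shrinking_singular_point_def
  proof (intro conjI light[OF p], rule exI[of _ "doubled_domain a b"], rule exI[of _ complex_of_real],
      rule exI[of _ a], rule exI[of _ b], rule exI[of _ P], intro conjI)
    show "p \<in> doubled_domain a b" using p by (auto simp: doubled_domain_def)
    show "(complex_of_real :: real \<Rightarrow> complex) C1_differentiable_on {a<..<b}"
      unfolding C1_differentiable_on_def by (intro exI[of _ "\<lambda>x. 1"]) (auto intro!: derivative_eq_intros continuous_intros)
    have "(complex_of_real has_vector_derivative 1) (at t)" for t by (auto intro!: derivative_eq_intros)
    then have "vector_derivative complex_of_real (at t) = 1" for t by (rule vector_derivative_at)
    then show "\<forall>t\<in>{a<..<b}. vector_derivative complex_of_real (at t) \<noteq> 0" by simp
    show "p \<in> complex_of_real ` {a<..<b}" using p by (simp add: real_interval_def)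
    show "complex_of_real ` {a<..<b} \<subseteq> lightlike_points (surface Im P) (doubled_domain a b)" using light by (auto simp: real_interval_def)
    have "surface Im P ` real_interval a b \<subseteq> {P}" by (rule image_subsetI) (simp add: val)
    moreover have "surface Im P ` real_interval a b \<noteq> {}" using p by blast
    ultimately have "surface Im P ` real_interval a b = {P}" using subset_singletonD by metis
    then show "surface Im P ` complex_of_real ` {a<..<b} = {P}" by (simp only: real_interval_def)
    show "complex_of_real ` {a<..<b} \<subseteq> doubled_domain a b" by auto
  qed (use ab in \<open>simp_all add: open_doubled_domain\<close>)
qed

lemma extension:
  assumes \<tau>: "\<tau> holomorphic_on upper_half_plane" "bij_betw \<tau> upper_half_plane (ball 0 1)"
    and X: "\<And>w. w \<in> upper_half_plane \<Longrightarrow> surface L P w = X (\<tau> w)"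
    and R: "\<And>w. w \<in> upper_half_plane \<Longrightarrow> surface L P (cnj w) = R (surface L P w)"
  shows "extends_by_symmetry (surface L P) X R a b"
  unfolding extends_by_symmetry_def
proof (intro conjI ab exI[of _ \<tau>] \<tau> ballI X R)
  have "lower_half_plane = cnj ` upper_half_plane"
  proof
    show "lower_half_plane \<subseteq> cnj ` upper_half_plane"
    proof
      fix w assume "w \<in> lower_half_plane"
      then show "w \<in> cnj ` upper_half_plane" by (intro image_eqI[of _ _ "cnj w"]) (auto simp: lower_half_plane_def upper_half_plane_def)
    qed
  qed (auto simp: lower_half_plane_def upper_half_plane_def)
  then have "surface L P ` lower_half_plane = (\<lambda>w. surface L P (cnj w)) ` upper_half_plane" by (metis image_image)
  also have "\<dots> = (\<lambda>w. R (X (\<tau> w))) ` upper_half_plane" by (intro image_cong refl) (simp add: R X)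
  also have "\<dots> = R ` X ` \<tau> ` upper_half_plane" by (simp add: image_image)
  finally show "surface L P ` lower_half_plane = R ` X ` ball 0 1" using \<tau>(2) by (simp add: bij_betw_def)
qed auto

lemma rotation: "w \<in> upper_half_plane \<Longrightarrow> surface Re P (cnj w) = vertical_rotation (fst P) (surface Re P w)"
  using sym[of w] by (simp add: surface_def vertical_rotation_def doubled_domain_def complex_eq_iff)

lemma symmetry: "w \<in> upper_half_plane \<Longrightarrow> surface Im P (cnj w) = point_symmetry P (surface Im P w)"
  using sym[of w] by (simp add: surface_def point_symmetry_def doubled_domain_def prod_eq_iff complex_eq_iff)

end

definition Cayley :: "complex \<Rightarrow> complex \<Rightarrow> complex" where
  "Cayley e0 w = e0 * (\<i> - w) / (\<i> + w)"

lemma Cayley_transform: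
  assumes e0: "norm e0 = 1"
  shows "Cayley e0 holomorphic_on {w. - 1 < Im w}" "bij_betw (Cayley e0) upper_half_plane (ball 0 1)"
    and "\<And>x. norm (Cayley e0 (of_real x)) = 1" "Cayley e0 0 = e0"
proof -
  let ?\<tau> = "Cayley e0"
  have nz: "\<i> + w \<noteq> 0" if "- 1 < Im w" for w using that by (auto simp: complex_eq_iff)
  show "?\<tau> holomorphic_on {w. - 1 < Im w}" unfolding Cayley_def[abs_def] using nz by (intro holomorphic_intros) auto
  have sq: "(norm (\<i> + w))\<^sup>2 - (norm (\<i> - w))\<^sup>2 = 4 * Im w" for w
    unfolding cmod_power2 by (simp add: power2_eq_square algebra_simps)
  have n\<tau>: "norm (?\<tau> w) = norm (\<i> - w) / norm (\<i> + w)" for w by (simp add: Cayley_def[abs_def] norm_mult norm_divide e0)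
  show "norm (?\<tau> (of_real x)) = 1" for x
  proof -
    have "norm (\<i> + of_real x) = norm (\<i> - of_real x)" using sq[of "of_real x"] by (simp add: power2_eq_iff_nonneg)
    moreover have "norm (\<i> + complex_of_real x) \<noteq> 0" using nz[of "of_real x"] by auto
    ultimately show ?thesis unfolding n\<tau> by simp
  qed
  show "?\<tau> 0 = e0" by (simp add: Cayley_def[abs_def] complex_eq_iff)
  have e0': "e0 \<noteq> 0" using e0 by auto
  show "bij_betw ?\<tau> upper_half_plane (ball 0 1)"
  proof (rule bij_betwI[where g = "\<lambda>z. \<i> * (e0 - z) / (e0 + z)"])
    show "?\<tau> \<in> upper_half_plane \<rightarrow> ball 0 1"
    proof
      fix w assume w: "w \<in> upper_half_plane"
      then have "0 < Im w" by (simp add: upper_half_plane_def)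
      then have "(norm (\<i> - w))\<^sup>2 < (norm (\<i> + w))\<^sup>2" using sq[of w] by linarith
      then have less: "norm (\<i> - w) < norm (\<i> + w)" by (rule power_less_imp_less_base) simp
      have "0 < norm (\<i> + w)" by (rule le_less_trans[OF norm_ge_zero less])
      with less have "norm (?\<tau> w) < 1" unfolding n\<tau> by (simp only: divide_less_eq_1_pos)
      then show "?\<tau> w \<in> ball 0 1" by simp
    qed
    show "(\<lambda>z. \<i> * (e0 - z) / (e0 + z)) \<in> ball 0 1 \<rightarrow> upper_half_plane"
    proof
      fix z :: complex assume z: "z \<in> ball 0 1"
      have ne: "e0 + z \<noteq> 0" using z e0 by (metis add_eq_0_iff mem_ball_0 norm_minus_cancel order_less_irrefl)
      have "\<i> * (e0 - z) / (e0 + z) = \<i> * ((e0 - z) * cnj (e0 + z)) / of_real ((norm (e0 + z))\<^sup>2)"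
        by (subst complex_div_cnj) simp
      also have "Im \<dots> = Re ((e0 - z) * cnj (e0 + z)) / (norm (e0 + z))\<^sup>2" by simp
      also have "Re ((e0 - z) * cnj (e0 + z)) = (norm e0)\<^sup>2 - (norm z)\<^sup>2"
        unfolding cmod_power2 by (simp add: power2_eq_square algebra_simps)
      finally have "Im (\<i> * (e0 - z) / (e0 + z)) = (1 - (norm z)\<^sup>2) / (norm (e0 + z))\<^sup>2" using e0 by simp
      moreover have "(norm z)\<^sup>2 < 1" using z by (simp add: power_less_one_iff abs_square_less_1)
      ultimately show "\<i> * (e0 - z) / (e0 + z) \<in> upper_half_plane" using ne by (simp add: upper_half_plane_def)
    qed
    show "\<i> * (e0 - ?\<tau> w) / (e0 + ?\<tau> w) = w" if "w \<in> upper_half_plane" for w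
    proof -
      have "\<i> + w \<noteq> 0" using that nz by (simp add: upper_half_plane_def)
      then have E: "e0 - ?\<tau> w = e0 * 2 / (\<i> + w) * w" "e0 + ?\<tau> w = e0 * 2 / (\<i> + w) * \<i>" and nz': "e0 * 2 / (\<i> + w) \<noteq> 0"
        using e0' by (simp_all add: Cayley_def field_simps)
      show ?thesis unfolding E using nz' by simp
    qed
    show "?\<tau> (\<i> * (e0 - z) / (e0 + z)) = z" if "z \<in> ball 0 1" for z
    proof -
      have ne: "e0 + z \<noteq> 0" using that e0 by (metis add_eq_0_iff mem_ball_0 norm_minus_cancel order_less_irrefl)
      have E: "\<i> - \<i> * (e0 - z) / (e0 + z) = 2 * \<i> / (e0 + z) * z" "\<i> + \<i> * (e0 - z) / (e0 + z) = 2 * \<i> / (e0 + z) * e0"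
        and nz': "2 * \<i> / (e0 + z) \<noteq> 0"
        using ne by (simp_all add: field_simps)
      show ?thesis unfolding Cayley_def E using nz' e0' by simp
    qed
  qed
qed

lemma upper_half_plane_facts: "open upper_half_plane" "convex upper_half_plane" "connected upper_half_plane"
  "upper_half_plane \<noteq> {}" "upper_half_plane \<subseteq> doubled_domain a b" "doubled_domain a b \<inter> {w. 0 < Im w} = upper_half_plane"
proof -
  show "open upper_half_plane" "convex upper_half_plane" unfolding upper_half_plane_def by (rule open_halfspace_Im_gt convex_halfspace_Im_gt)+
  then show "connected upper_half_plane" by (simp add: convex_connected)
  have "\<i> \<in> upper_half_plane" by (simp add: upper_half_plane_def)
  then show "upper_half_plane \<noteq> {}" by blast
  show "upper_half_plane \<subseteq> doubled_domain a b" "doubled_domain a b \<inter> {w. 0 < Im w} = upper_half_plane"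
    by (auto simp: doubled_domain_def upper_half_plane_def)
qed

lemma norm_quadric:
  fixes P Q k :: complex
  assumes "k\<^sup>2 = - 4 * P * Q"
  shows "(norm (P + Q))\<^sup>2 + (norm (P - Q))\<^sup>2 - (norm k)\<^sup>2 = 2 * (norm P - norm Q)\<^sup>2"
proof -
  have "(norm k)\<^sup>2 = 4 * norm P * norm Q" using arg_cong[OF assms, of norm] by (simp add: norm_power norm_mult)
  moreover have "(norm (P + Q))\<^sup>2 + (norm (P - Q))\<^sup>2 = 2 * (norm P)\<^sup>2 + 2 * (norm Q)\<^sup>2"
    unfolding cmod_power2 by (simp add: power2_eq_square algebra_simps)
  ultimately show ?thesis by (simp add: power2_eq_square algebra_simps)
qed

context harmonic_graph
begin

lemma reflected_surface_exists:
  assumes e0: "norm e0 = 1" and \<delta>: "0 < \<delta>"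
    and lim: "\<And>e. norm e = 1 \<Longrightarrow> dist e e0 < \<delta> \<Longrightarrow> (hmap \<longlongrightarrow> z0) (at e within ball 0 1)"
    and limh: "\<And>e. norm e = 1 \<Longrightarrow> dist e e0 < \<delta> \<Longrightarrow> ((\<lambda>w. Im (h w)) \<longlongrightarrow> c) (at e within ball 0 1)"
    and nonconst: "\<not> h constant_on ball 0 1"
  obtains \<tau> a b G1 G2 G3 where "reflected_surface a b G1 G2 G3"
    "\<tau> holomorphic_on upper_half_plane" "bij_betw \<tau> upper_half_plane (ball 0 1)"
    "\<And>w. w \<in> upper_half_plane \<Longrightarrow> z0 + Complex (Im (G1 w)) (Im (G2 w)) = hmap (\<tau> w)"
    "\<And>w. w \<in> upper_half_plane \<Longrightarrow> Re (G3 w) = Re (h (\<tau> w))"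
    "\<And>w. w \<in> upper_half_plane \<Longrightarrow> c + Im (G3 w) = Im (h (\<tau> w))"
    "\<exists>s t. s < t \<and> (\<lambda>x. Re (G3 (of_real x))) ` {a<..<b} = {s<..<t}"
proof -
  define \<tau> where "\<tau> = Cayley e0"
  note T = Cayley_transform[OF e0, folded \<tau>_def]
  let ?H = upper_half_plane
  have T1: "\<tau> holomorphic_on ?H" by (rule holomorphic_on_subset[OF T(1)]) (auto simp: upper_half_plane_def)
  have TB: "\<tau> w \<in> ball 0 1" if "w \<in> ?H" for w using T(2) that by (auto simp: bij_betw_def)
  have contT: "isCont \<tau> (of_real x)" for x
  proof -
    have "open {w. - 1 < Im w}" by (rule open_halfspace_Im_gt)
    then show ?thesis using holomorphic_on_imp_continuous_on[OF T(1)] continuous_on_eq_continuous_at[of "{w. - 1 < Im w}" \<tau>] by auto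
  qed
  obtain A where A: "A > 0" "\<And>x. \<bar>x\<bar> < A \<Longrightarrow> dist (\<tau> (of_real x)) e0 < \<delta>"
  proof -
    obtain A where "A > 0" "\<And>w. dist w (of_real 0) < A \<Longrightarrow> dist (\<tau> w) (\<tau> (of_real 0)) < \<delta>"
      using contT[of 0] \<delta> unfolding continuous_at_eps_delta by metis
    then show thesis using that[of A] T(4) by (simp add: dist_norm)
  qed
  let ?S = "doubled_domain (- A) A"
  note U = upper_half_plane_facts
  have Tlim: "filterlim \<tau> (at (\<tau> (of_real x)) within ball 0 1) (at (of_real x) within ?H)" for x
    unfolding filterlim_at
  proof
    have "\<tau> w \<in> ball 0 1 \<and> \<tau> w \<noteq> \<tau> (of_real x)" if "w \<in> ?H" for w using TB[OF that] T(3)[of x] by auto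
    then show "\<forall>\<^sub>F w in at (of_real x) within ?H. \<tau> w \<in> ball 0 1 \<and> \<tau> w \<noteq> \<tau> (of_real x)"
      by (simp add: eventually_at_filter)
    show "(\<tau> \<longlongrightarrow> \<tau> (of_real x)) (at (of_real x) within ?H)"
      using contT[of x] continuous_at_imp_continuous_at_within continuous_within by blast
  qed
  have limT: "((\<lambda>w. hmap (\<tau> w)) \<longlongrightarrow> z0) (at (of_real x) within ?H)"
    "((\<lambda>w. Im (h (\<tau> w))) \<longlongrightarrow> c) (at (of_real x) within ?H)" if "\<bar>x\<bar> < A" for x
    by (rule filterlim_compose[OF lim[OF T(3) A(2)[OF that]] Tlim],
      rule filterlim_compose[OF limh[OF T(3) A(2)[OF that]] Tlim])
  define M1 where "M1 w = \<i> * (H1 (\<tau> w) + H2 (\<tau> w) - of_real (Re z0))" for w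
  define M2 where "M2 w = H1 (\<tau> w) - H2 (\<tau> w) - \<i> * of_real (Im z0)" for w
  define M3 where "M3 w = h (\<tau> w) - \<i> * of_real c" for w
  have ImM: "Im (M1 w) = Re (hmap (\<tau> w)) - Re z0" "Im (M2 w) = Im (hmap (\<tau> w)) - Im z0" "Im (M3 w) = Im (h (\<tau> w)) - c" for w
    by (simp_all add: M1_def M2_def M3_def hmap_def)
  have comp: "(\<lambda>w. H1 (\<tau> w)) holomorphic_on ?H" "(\<lambda>w. H2 (\<tau> w)) holomorphic_on ?H" "(\<lambda>w. h (\<tau> w)) holomorphic_on ?H"
    using holomorphic_on_compose_gen[OF T1 hol1] holomorphic_on_compose_gen[OF T1 hol2] holomorphic_on_compose_gen[OF T1 holh] TB
    unfolding o_def by blast+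
  have holM: "M1 holomorphic_on ?H" "M2 holomorphic_on ?H" "M3 holomorphic_on ?H"
    unfolding M1_def M2_def M3_def by (intro holomorphic_intros comp)+
  have limM: "((\<lambda>w. Im (M1 w)) \<longlongrightarrow> 0) (at (of_real x) within ?H)"
    "((\<lambda>w. Im (M2 w)) \<longlongrightarrow> 0) (at (of_real x) within ?H)"
    "((\<lambda>w. Im (M3 w)) \<longlongrightarrow> 0) (at (of_real x) within ?H)" if "of_real x \<in> ?S" for x
  proof -
    have x: "\<bar>x\<bar> < A" using that by auto
    show "((\<lambda>w. Im (M1 w)) \<longlongrightarrow> 0) (at (of_real x) within ?H)" "((\<lambda>w. Im (M2 w)) \<longlongrightarrow> 0) (at (of_real x) within ?H)"
      "((\<lambda>w. Im (M3 w)) \<longlongrightarrow> 0) (at (of_real x) within ?H)"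
      unfolding ImM using tendsto_diff[OF tendsto_Re[OF limT(1)[OF x]] tendsto_const[of "Re z0"]]
        tendsto_diff[OF tendsto_Im[OF limT(1)[OF x]] tendsto_const[of "Im z0"]] tendsto_diff[OF limT(2)[OF x] tendsto_const[of c]] by simp_all
  qed
  note reflect = Schwarz_reflection_Im[OF open_doubled_domain[of "- A" A] doubled_domain_cnj, unfolded U(6)]
  obtain G1 where G1: "G1 holomorphic_on ?S" "\<And>w. w \<in> ?S \<Longrightarrow> 0 < Im w \<Longrightarrow> G1 w = M1 w" "\<And>w. w \<in> ?S \<Longrightarrow> G1 (cnj w) = cnj (G1 w)"
    by (rule reflect[OF _ holM(1) limM(1)], assumption+, rule that)
  obtain G2 where G2: "G2 holomorphic_on ?S" "\<And>w. w \<in> ?S \<Longrightarrow> 0 < Im w \<Longrightarrow> G2 w = M2 w" "\<And>w. w \<in> ?S \<Longrightarrow> G2 (cnj w) = cnj (G2 w)"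
    by (rule reflect[OF _ holM(2) limM(2)], assumption+, rule that)
  obtain G3 where G3: "G3 holomorphic_on ?S" "\<And>w. w \<in> ?S \<Longrightarrow> 0 < Im w \<Longrightarrow> G3 w = M3 w" "\<And>w. w \<in> ?S \<Longrightarrow> G3 (cnj w) = cnj (G3 w)"
    by (rule reflect[OF _ holM(3) limM(3)], assumption+, rule that)
  have GM: "G1 w = M1 w" "G2 w = M2 w" "G3 w = M3 w" if "w \<in> ?H" for w
    using G1(2) G2(2) G3(2) that U(5)[of "- A" A] unfolding upper_half_plane_def by blast+
  have dG: "deriv G1 w = \<i> * (deriv H1 (\<tau> w) + deriv H2 (\<tau> w)) * deriv \<tau> w"
    "deriv G2 w = (deriv H1 (\<tau> w) - deriv H2 (\<tau> w)) * deriv \<tau> w" "deriv G3 w = deriv h (\<tau> w) * deriv \<tau> w" if w: "w \<in> ?H" for w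
  proof -
    have e: "deriv G1 w = deriv M1 w" "deriv G2 w = deriv M2 w" "deriv G3 w = deriv M3 w"
      by (rule complex_derivative_transform_within_open[OF holomorphic_on_subset[OF G1(1) U(5)] holM(1) U(1) w GM(1)]
          complex_derivative_transform_within_open[OF holomorphic_on_subset[OF G2(1) U(5)] holM(2) U(1) w GM(2)]
          complex_derivative_transform_within_open[OF holomorphic_on_subset[OF G3(1) U(5)] holM(3) U(1) w GM(3)]; assumption)+
    have D: "((\<lambda>w. H1 (\<tau> w)) has_field_derivative deriv H1 (\<tau> w) * deriv \<tau> w) (at w)"
      "((\<lambda>w. H2 (\<tau> w)) has_field_derivative deriv H2 (\<tau> w) * deriv \<tau> w) (at w)"
      "((\<lambda>w. h (\<tau> w)) has_field_derivative deriv h (\<tau> w) * deriv \<tau> w) (at w)"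
      by (rule DERIV_chain2[OF holomorphic_derivI[OF _ open_ball TB[OF w]] holomorphic_derivI[OF T1 U(1) w]], rule hol1 hol2 holh)+
    show "deriv G1 w = \<i> * (deriv H1 (\<tau> w) + deriv H2 (\<tau> w)) * deriv \<tau> w"
      unfolding e M1_def by (rule DERIV_imp_deriv) (rule derivative_eq_intros D refl | simp add: algebra_simps)+
    show "deriv G2 w = (deriv H1 (\<tau> w) - deriv H2 (\<tau> w)) * deriv \<tau> w"
      unfolding e M2_def by (rule DERIV_imp_deriv) (rule derivative_eq_intros D refl | simp add: algebra_simps)+
    show "deriv G3 w = deriv h (\<tau> w) * deriv \<tau> w"
      unfolding e M3_def by (rule DERIV_imp_deriv) (rule derivative_eq_intros D refl | simp add: algebra_simps)+
  qed
  have quad: "(deriv G1 w)\<^sup>2 + (deriv G2 w)\<^sup>2 = (deriv G3 w)\<^sup>2" if w: "w \<in> ?S" for w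
  proof -
    have "(\<lambda>w. (deriv G1 w)\<^sup>2 + (deriv G2 w)\<^sup>2) w = (\<lambda>w. (deriv G3 w)\<^sup>2) w"
    proof (rule analytic_continuation_open[OF U(1) open_doubled_domain U(4) connected_doubled_domain U(5) _ _ _ w])
      show "(\<lambda>w. (deriv G1 w)\<^sup>2 + (deriv G2 w)\<^sup>2) holomorphic_on ?S" "(\<lambda>w. (deriv G3 w)\<^sup>2) holomorphic_on ?S"
        by (intro holomorphic_intros holomorphic_deriv G1(1) G2(1) G3(1) open_doubled_domain)+
      show "(deriv G1 z)\<^sup>2 + (deriv G2 z)\<^sup>2 = (deriv G3 z)\<^sup>2" if z: "z \<in> ?H" for z
      proof -
        have "(deriv G1 z)\<^sup>2 + (deriv G2 z)\<^sup>2 = (- 4 * deriv H1 (\<tau> z) * deriv H2 (\<tau> z)) * (deriv \<tau> z)\<^sup>2"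
          unfolding dG[OF z] by (simp add: power2_eq_square algebra_simps)
        also have "\<dots> = (deriv h (\<tau> z) * deriv \<tau> z)\<^sup>2" unfolding conf[OF TB[OF z], symmetric] by (simp add: power_mult_distrib)
        finally show ?thesis unfolding dG[OF z] .
      qed
    qed (use A in auto)
    then show ?thesis .
  qed
  have space: "(norm (deriv G1 w))\<^sup>2 + (norm (deriv G2 w))\<^sup>2 - (norm (deriv G3 w))\<^sup>2 \<noteq> 0" if w: "w \<in> ?H" for w
  proof -
    have "inj_on \<tau> ?H" using T(2) by (simp add: bij_betw_def)
    then have "deriv \<tau> w \<noteq> 0" by (rule holomorphic_injective_imp_regular[OF T1 U(1) _ w])
    moreover have "(norm (deriv G1 w))\<^sup>2 + (norm (deriv G2 w))\<^sup>2 - (norm (deriv G3 w))\<^sup>2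
      = 2 * (norm (deriv H1 (\<tau> w)) - norm (deriv H2 (\<tau> w)))\<^sup>2 * (norm (deriv \<tau> w))\<^sup>2"
    proof -
      have n: "norm (deriv G1 w) = norm (deriv H1 (\<tau> w) + deriv H2 (\<tau> w)) * norm (deriv \<tau> w)"
        "norm (deriv G2 w) = norm (deriv H1 (\<tau> w) - deriv H2 (\<tau> w)) * norm (deriv \<tau> w)"
        "norm (deriv G3 w) = norm (deriv h (\<tau> w)) * norm (deriv \<tau> w)"
        unfolding dG[OF w] by (simp_all only: norm_mult norm_ii mult_1_left)
      show ?thesis unfolding n power_mult_distrib norm_quadric[OF conf[OF TB[OF w]], symmetric]
        by (simp only: distrib_right left_diff_distrib)
    qed
    ultimately show ?thesis using dil[OF TB[OF w]] by simp
  qed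
  have "\<exists>x. of_real x \<in> ?S \<and> deriv G3 (of_real x) \<noteq> 0"
  proof (rule ccontr)
    assume "\<not> ?thesis"
    then have z: "deriv G3 w = 0" if "w \<in> real_interval (- A) A" for w using that by (auto simp: real_interval_def)
    have 0: "0 \<in> ?S" using A(1) of_real_in_doubled_domain[of 0 "- A" A] by simp
    have lp: "(0::complex) islimpt real_interval (- A) A" unfolding islimpt_approachable
    proof (intro allI impI)
      fix e :: real assume e: "0 < e"
      define x where "x = min e A / 2"
      have "0 < x" "x < e" "x < A" using e A(1) unfolding x_def by linarith+
      then show "\<exists>x'\<in>real_interval (- A) A. x' \<noteq> 0 \<and> dist x' 0 < e"
        by (intro bexI[of _ "of_real x"]) (auto simp: real_interval_def)
    qed
    have d0: "deriv G3 w = 0" if "w \<in> ?S" for w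
      by (rule analytic_continuation[OF holomorphic_deriv[OF G3(1) open_doubled_domain] open_doubled_domain connected_doubled_domain
          _ 0 lp z that]) (use A in \<open>auto simp: doubled_domain_def\<close>)
    have "\<exists>k. \<forall>w\<in>?H. G3 w = k"
    proof (rule has_field_derivative_zero_constant[OF U(2)])
      show "(G3 has_field_derivative 0) (at w within ?H)" if "w \<in> ?H" for w
        using holomorphic_derivI[OF G3(1) open_doubled_domain, of w] d0[of w] that U(5) by (auto simp: has_field_derivative_at_within)
    qed
    then obtain k where "\<And>w. w \<in> ?H \<Longrightarrow> h (\<tau> w) = k + \<i> * of_real c" using GM(3) M3_def by (metis diff_add_cancel)
    moreover have "\<tau> ` ?H = ball 0 1" using T(2) by (simp add: bij_betw_def)
    ultimately show False using nonconst unfolding constant_on_def by (metis imageE)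
  qed
  then obtain x1 where x1: "of_real x1 \<in> ?S" "deriv G3 (of_real x1) \<noteq> 0" by blast
  have "continuous_on ?S (deriv G3)" by (intro holomorphic_on_imp_continuous_on holomorphic_deriv G3(1) open_doubled_domain)
  then have "open (?S \<inter> deriv G3 -` (- {0}))" by (rule continuous_open_preimage[OF _ open_doubled_domain]) auto
  then obtain \<epsilon> where \<epsilon>: "\<epsilon> > 0" "cball (of_real x1) \<epsilon> \<subseteq> ?S \<inter> deriv G3 -` (- {0})"
    using x1 open_contains_cball by (metis ComplI Int_iff singletonD vimage_eq)
  define a where "a = x1 - \<epsilon>"
  define b where "b = x1 + \<epsilon>"
  have in_S: "of_real x \<in> ?S \<and> deriv G3 (of_real x) \<noteq> 0" if "a \<le> x" "x \<le> b" for x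
  proof -
    have "complex_of_real x \<in> cball (of_real x1) \<epsilon>" using that unfolding a_def b_def mem_cball dist_of_real dist_real_def by linarith
    then show ?thesis using \<epsilon>(2) by blast
  qed
  have ab: "a < b" using \<epsilon> by (simp add: a_def b_def)
  have sub: "doubled_domain a b \<subseteq> ?S" using in_S[of a] in_S[of b] ab unfolding doubled_domain_eq by auto
  show thesis
  proof (rule that[of a b G1 G2 G3 \<tau>])
    show "reflected_surface a b G1 G2 G3"
      by unfold_locales (use ab sub quad space in_S G1 G2 G3 in \<open>auto intro: holomorphic_on_subset\<close>)
    show "\<tau> holomorphic_on ?H" "bij_betw \<tau> ?H (ball 0 1)" by (rule T1 T(2))+
    show "z0 + Complex (Im (G1 w)) (Im (G2 w)) = hmap (\<tau> w)" "c + Im (G3 w) = Im (h (\<tau> w))" "Re (G3 w) = Re (h (\<tau> w))" if "w \<in> ?H" for w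
      unfolding GM[OF that] ImM by (simp_all add: complex_eq_iff M3_def)
    define r where "r x = Re (G3 (of_real x))" for x
    have dr: "(r has_real_derivative Re (deriv G3 (of_real x))) (at x)" "Re (deriv G3 (of_real x)) \<noteq> 0" if "a \<le> x" "x \<le> b" for x
      using symmetric_holomorphic_on_reals[OF open_doubled_domain G3(1) G3(3) conjunct1[OF in_S[OF that]]] in_S[OF that]
      by (auto simp: r_def[abs_def] complex_eq_iff)
    have rne: "r x \<noteq> r y" if xy: "a \<le> x" "x < y" "y \<le> b" for x y
    proof
      assume e: "r x = r y"
      obtain z where z: "x < z" "z < y" "r y - r x = (y - x) * Re (deriv G3 (of_real z))"
        using MVT2[OF xy(2), of r "\<lambda>x. Re (deriv G3 (of_real x))"] dr(1) xy by (metis dual_order.trans)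
      then show False using dr(2)[of z] xy e by simp
    qed
    have inj: "inj_on r {a..b}" using rne by (intro linorder_inj_onI) auto
    have cont: "continuous_on {a..b} r" using dr(1) by (intro DERIV_continuous_on[where D = "\<lambda>x. Re (deriv G3 (of_real x))"]) (auto intro: has_field_derivative_at_within)
    have "r ` {a<..<b} = {min (r a) (r b)<..<max (r a) (r b)}"
      using continuous_injective_image_open_segment_1[of a b r] cont inj ab
      by (simp add: closed_segment_eq_real_ivl open_segment_eq_real_ivl min_def max_def)
    moreover have "min (r a) (r b) < max (r a) (r b)" using rne[of a b] ab by (simp add: min_def max_def less_le)
    ultimately show "\<exists>s t. s < t \<and> (\<lambda>x. Re (G3 (of_real x))) ` {a<..<b} = {s<..<t}" unfolding r_def by blast
  qed
qed

theorem symmetric_extensions: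
  assumes e0: "norm e0 = 1" and \<delta>: "0 < \<delta>"
    and lim: "\<And>e. norm e = 1 \<Longrightarrow> dist e e0 < \<delta> \<Longrightarrow> (hmap \<longlongrightarrow> z0) (at e within ball 0 1)"
    and limh: "\<And>e. norm e = 1 \<Longrightarrow> dist e e0 < \<delta> \<Longrightarrow> ((\<lambda>w. Im (h w)) \<longlongrightarrow> c) (at e within ball 0 1)"
    and nonconst: "\<not> h constant_on ball 0 1"
    and f: "\<And>w. w \<in> ball 0 1 \<Longrightarrow> f w = hmap w"
    and \<phi>: "\<And>w. w \<in> ball 0 1 \<Longrightarrow> \<phi> (f w) = Re (h w)" and \<psi>: "\<And>w. w \<in> ball 0 1 \<Longrightarrow> \<psi> (f w) = Im (h w)"
  shows "\<exists>Xt a b s t. s < t \<and> generalized_minimal_surface Xt (doubled_domain a b) \<and>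
        Xt ` real_interval a b = open_segment (z0, s) (z0, t) \<and>
        extends_by_symmetry Xt (\<lambda>w. (f w, \<phi> (f w))) (vertical_rotation z0) a b"
    and "\<exists>Xt a b. generalized_maximal_surface Xt (doubled_domain a b) \<and>
        (\<forall>p\<in>real_interval a b. Xt p = (z0, c) \<and> shrinking_singular_point Xt (doubled_domain a b) p) \<and>
        extends_by_symmetry Xt (\<lambda>w. (f w, \<psi> (f w))) (point_symmetry (z0, c)) a b"
proof -
  obtain \<tau> a b G1 G2 G3 where R: "reflected_surface a b G1 G2 G3"
    and T: "\<tau> holomorphic_on upper_half_plane" "bij_betw \<tau> upper_half_plane (ball 0 1)"
    and G: "\<And>w. w \<in> upper_half_plane \<Longrightarrow> z0 + Complex (Im (G1 w)) (Im (G2 w)) = hmap (\<tau> w)"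
    "\<And>w. w \<in> upper_half_plane \<Longrightarrow> Re (G3 w) = Re (h (\<tau> w))"
    "\<And>w. w \<in> upper_half_plane \<Longrightarrow> c + Im (G3 w) = Im (h (\<tau> w))"
    and st: "\<exists>s t. s < t \<and> (\<lambda>x. Re (G3 (of_real x))) ` {a<..<b} = {s<..<t}"
    by (rule reflected_surface_exists[OF e0 \<delta> lim limh nonconst], assumption+, rule that)
  interpret reflected_surface a b G1 G2 G3 by (rule R)
  have TB: "\<tau> w \<in> ball 0 1" if "w \<in> upper_half_plane" for w using T(2) that by (auto simp: bij_betw_def)
  have "extends_by_symmetry (surface Re (z0, 0)) (\<lambda>w. (f w, \<phi> (f w))) (vertical_rotation z0) a b"
  proof (rule extension[OF T])
    show "surface Re (z0, 0) w = (f (\<tau> w), \<phi> (f (\<tau> w)))" if "w \<in> upper_half_plane" for w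
      using G[OF that] TB[OF that] f \<phi> by (simp add: surface_def)
  qed (use rotation[of _ "(z0, 0)"] in simp)
  moreover obtain s t where s: "s < t" "(\<lambda>x. Re (G3 (of_real x))) ` {a<..<b} = {s<..<t}" using st by blast
  moreover have "surface Re (z0, 0) ` real_interval a b = open_segment (z0, s) (z0, t)"
  proof -
    have "surface Re (z0, 0) (of_real x) = (z0, Re (G3 (of_real x)))" if "x \<in> {a<..<b}" for x
      using that on_reals(1)[OF hol(1) sym(1), of x] on_reals(1)[OF hol(2) sym(2), of x] by (simp add: surface_def complex_eq_iff)
    then have "surface Re (z0, 0) ` real_interval a b = (\<lambda>x. (z0, Re (G3 (of_real x)))) ` {a<..<b}"
      unfolding real_interval_def image_image by (intro image_cong refl)
    also have "\<dots> = Pair z0 ` {s<..<t}" unfolding s(2)[symmetric] image_image ..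
    also have "{s<..<t} = open_segment s t" using s(1) by (simp add: open_segment_eq_real_ivl)
    also have "Pair z0 ` open_segment s t = open_segment (z0, s) (z0, t)"
      unfolding open_segment_image_interval using s(1) by (auto simp: image_image scaleR_prod_def algebra_simps)
    finally show ?thesis .
  qed
  ultimately show "\<exists>Xt a b s t. s < t \<and> generalized_minimal_surface Xt (doubled_domain a b) \<and>
        Xt ` real_interval a b = open_segment (z0, s) (z0, t) \<and>
        extends_by_symmetry Xt (\<lambda>w. (f w, \<phi> (f w))) (vertical_rotation z0) a b"
    using minimal_surface by blast
  have "extends_by_symmetry (surface Im (z0, c)) (\<lambda>w. (f w, \<psi> (f w))) (point_symmetry (z0, c)) a b"
  proof (rule extension[OF T])
    show "surface Im (z0, c) w = (f (\<tau> w), \<psi> (f (\<tau> w)))" if "w \<in> upper_half_plane" for w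
      using G[OF that] TB[OF that] f \<psi> by (simp add: surface_def)
  qed (use symmetry in simp)
  then show "\<exists>Xt a b. generalized_maximal_surface Xt (doubled_domain a b) \<and>
        (\<forall>p\<in>real_interval a b. Xt p = (z0, c) \<and> shrinking_singular_point Xt (doubled_domain a b) p) \<and>
        extends_by_symmetry Xt (\<lambda>w. (f w, \<psi> (f w))) (point_symmetry (z0, c)) a b"
    using maximal_surface shrinking by metis
qed

end

section \<open>Boundary arcs and edges at the vertex\<close>

lemma filterlim_blow_up:
  fixes \<phi> :: "complex \<Rightarrow> real"
  assumes F: "F \<in> {at_top, at_bot}" and lim: "filterlim \<phi> F (at p within \<Omega>)" and p: "p \<notin> \<Omega>"
  shows "\<exists>\<delta>>0. \<forall>z\<in>\<Omega>. dist z p < \<delta> \<longrightarrow> N < (if F = at_top then 1 else - 1) * \<phi> z"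
proof -
  have ev: "\<exists>\<delta>>0. \<forall>z\<in>\<Omega>. dist z p < \<delta> \<longrightarrow> P z" if "eventually P (at p within \<Omega>)" for P
    using that p unfolding eventually_at by metis
  show ?thesis
  proof (cases "F = at_top")
    case True
    then have "eventually (\<lambda>z. N < \<phi> z) (at p within \<Omega>)" using lim by (simp add: filterlim_at_top_dense)
    then show ?thesis using ev[of "\<lambda>z. N < \<phi> z"] True by simp
  next
    case False
    then have "filterlim \<phi> at_bot (at p within \<Omega>)" using lim F by auto
    then have "eventually (\<lambda>z. \<phi> z < - N) (at p within \<Omega>)" by (simp add: filterlim_at_bot_dense)
    then show ?thesis using ev[of "\<lambda>z. \<phi> z < - N"] False by fastforce
  qed
qed

lemma rcis_mult_cis: "cis u * rcis s t = rcis s (u + t)"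
  by (simp add: rcis_def cis_mult)

lemma vertex_arc:
  assumes G: "harmonic_graph H1 H2 h" and \<Omega>: "open \<Omega>"
    and f: "\<And>w. w \<in> ball 0 1 \<Longrightarrow> f w = H1 w + cnj (H2 w)" "f ` ball 0 1 = \<Omega>"
    and \<phi>: "\<And>w. w \<in> ball 0 1 \<Longrightarrow> Re (h w) = \<phi> (f w)" "continuous_on \<Omega> \<phi>"
    and r: "0 < r" and \<alpha>: "0 < \<alpha>" "\<alpha> < 2 * pi"
    and sec: "\<Omega> \<inter> ball z0 r = {z0 + rcis s t | s t. 0 < s \<and> s < r \<and> \<theta> < t \<and> t < \<theta> + \<alpha>}"
    and z: "z1 \<noteq> z0" "z2 \<noteq> z0" "z1 - z0 = rcis (dist z0 z1) \<theta>" "z2 - z0 = rcis (dist z0 z2) (\<theta> + \<alpha>)"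
    and F: "F1 \<in> {at_top, at_bot}" "F2 \<in> {at_top, at_bot}" "\<alpha> = pi \<longrightarrow> F1 \<noteq> F2"
    and lim: "\<forall>p\<in>open_segment z0 z1. filterlim \<phi> F1 (at p within \<Omega>)" "\<forall>p\<in>open_segment z0 z2. filterlim \<phi> F2 (at p within \<Omega>)"
    and out: "open_segment z0 z1 \<inter> \<Omega> = {}" "open_segment z0 z2 \<inter> \<Omega> = {}"
  obtains e0 \<delta> where "norm e0 = 1" "\<delta> > 0"
    "\<And>e. norm e = 1 \<Longrightarrow> dist e e0 < \<delta> \<Longrightarrow> (f \<longlongrightarrow> z0) (at e within ball 0 1)"
proof -
  define sg :: "real filter \<Rightarrow> real" where "sg F = (if F = at_top then 1 else - 1)" for F
  define \<sigma> where "\<sigma> = sg F1"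
  define e where "e = cis \<theta>"
  have ee: "e * cnj e = 1" "norm e = 1" by (simp_all add: e_def cis_mult cis_cnj)
  define K1 where "K1 = (\<lambda>w. cnj e * (H1 w - z0))"
  define K2 where "K2 = (\<lambda>w. e * H2 w)"
  define k where "k = (\<lambda>w. of_real \<sigma> * h w)"
  have "\<sigma> = 1 \<or> \<sigma> = - 1" by (simp add: \<sigma>_def sg_def)
  then have NG: "harmonic_graph K1 K2 k" unfolding K1_def K2_def k_def by (rule harmonic_graph.normalized[OF G ee(2)])
  define hm where "hm = harmonic_graph.hmap K1 K2"
  have hm: "hm w = cnj e * (f w - z0)" if "w \<in> ball 0 1" for w
    unfolding hm_def harmonic_graph.hmap_def[OF NG] f(1)[OF that] unfolding K1_def K2_def by (simp add: algebra_simps)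
  have fhm: "f w = z0 + e * hm w" if "w \<in> ball 0 1" for w
    using ee(1) by (simp add: hm[OF that] mult.assoc[symmetric])
  have disthm: "dist (hm w) q = dist (f w) (z0 + e * q)" if "w \<in> ball 0 1" for w q
  proof -
    have "f w - (z0 + e * q) = e * (hm w - q)" by (simp add: fhm[OF that] algebra_simps)
    then show ?thesis using ee(2) by (simp add: dist_norm norm_mult)
  qed
  have f\<Omega>: "f w \<in> \<Omega>" if "w \<in> ball 0 1" for w using f(2) that by blast
  define r' where "r' = min r (min (dist z0 z1) (dist z0 z2))"
  have r': "0 < r'" "r' \<le> r" "r' \<le> dist z0 z1" "r' \<le> dist z0 z2" using r z by (auto simp: r'_def)
  have on_side: "z0 + rcis s t \<in> open_segment z0 z'" if "0 < s" "s < dist z0 z'" "z' - z0 = rcis (dist z0 z') t" for s t z'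
  proof -
    have ne: "z0 \<noteq> z'" using that(1,2) by auto
    then have "rcis s t = (s / dist z0 z') *\<^sub>R (z' - z0)" by (subst that(3)) (simp add: rcis_def scaleR_conv_of_real)
    then have "z0 + rcis s t = (1 - s / dist z0 z') *\<^sub>R z0 + (s / dist z0 z') *\<^sub>R z'" by (simp add: algebra_simps)
    moreover have "0 < s / dist z0 z'" "s / dist z0 z' < 1" using that(1,2) ne by simp_all
    ultimately show ?thesis unfolding in_segment using ne by blast
  qed
  have side: "z0 + e * of_real s \<in> open_segment z0 z1" "z0 + e * rcis s \<alpha> \<in> open_segment z0 z2" if "0 < s" "s < r'" for s
    using on_side[OF that(1) _ z(3)] on_side[OF that(1) _ z(4)] that r'
    by (auto simp: e_def rcis_mult_cis) (simp add: rcis_def mult.commute)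
  have blow: "\<exists>\<delta>>0. \<forall>w\<in>ball 0 1. dist (hm w) q < \<delta> \<longrightarrow> N < sg F * \<phi> (f w)"
    if "F \<in> {at_top, at_bot}" "filterlim \<phi> F (at (z0 + e * q) within \<Omega>)" "z0 + e * q \<notin> \<Omega>" for F q N
    using filterlim_blow_up[OF that, of N] disthm f\<Omega> unfolding sg_def by metis
  have img: "harmonic_graph.img K1 K2 = (\<lambda>z. cnj e * (z - z0)) ` \<Omega>"
    unfolding harmonic_graph.img_def[OF NG] f(2)[symmetric] image_image using hm unfolding hm_def by (intro image_cong refl) auto
  have up: "\<exists>\<delta>>0. \<forall>w\<in>ball 0 1. dist (hm w) (of_real s) < \<delta> \<longrightarrow> N < Re (k w)" if "0 < s" "s < r'" for s N
    using blow[OF F(1), of "of_real s" N] side(1)[OF that] lim(1) out(1) \<phi>(1) unfolding k_def \<sigma>_def by auto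
  have "harmonic_sector K1 K2 k r' \<alpha>"
  proof (intro harmonic_sector.intro NG harmonic_sector_axioms.intro)
    show "harmonic_graph.img K1 K2 \<inter> ball 0 r' = {rcis s t | s t. 0 < s \<and> s < r' \<and> 0 < t \<and> t < \<alpha>}"
    proof
      show "harmonic_graph.img K1 K2 \<inter> ball 0 r' \<subseteq> {rcis s t | s t. 0 < s \<and> s < r' \<and> 0 < t \<and> t < \<alpha>}"
      proof
        fix y assume "y \<in> harmonic_graph.img K1 K2 \<inter> ball 0 r'"
        then obtain z where z: "z \<in> \<Omega>" "y = cnj e * (z - z0)" "norm y < r'" unfolding img by auto
        then have nz: "norm y = norm (z - z0)" using ee(2) by (simp add: norm_mult)
        then have "z \<in> \<Omega> \<inter> ball z0 r" using z r' by (simp add: dist_norm norm_minus_commute)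
        then obtain s t where st: "z = z0 + rcis s t" "0 < s" "s < r" "\<theta> < t" "t < \<theta> + \<alpha>" unfolding sec by blast
        have "y = rcis s (- \<theta> + t)" by (simp add: z(2) st(1) e_def cis_cnj rcis_mult_cis)
        moreover have "s < r'" using nz z(3) st by simp
        ultimately show "y \<in> {rcis s t | s t. 0 < s \<and> s < r' \<and> 0 < t \<and> t < \<alpha>}" using st
          by (intro CollectI exI[of _ s] exI[of _ "- \<theta> + t"]) auto
      qed
      show "{rcis s t | s t. 0 < s \<and> s < r' \<and> 0 < t \<and> t < \<alpha>} \<subseteq> harmonic_graph.img K1 K2 \<inter> ball 0 r'"
      proof
        fix y assume "y \<in> {rcis s t | s t. 0 < s \<and> s < r' \<and> 0 < t \<and> t < \<alpha>}"
        then obtain s t where st: "y = rcis s t" "0 < s" "s < r'" "0 < t" "t < \<alpha>" by blast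
        have "z0 + rcis s (\<theta> + t) \<in> \<Omega> \<inter> ball z0 r" unfolding sec using st r' by (intro CollectI exI[of _ s] exI[of _ "\<theta> + t"]) auto
        moreover have "y = cnj e * ((z0 + rcis s (\<theta> + t)) - z0)" by (simp add: e_def cis_cnj rcis_mult_cis st(1))
        ultimately have "y \<in> harmonic_graph.img K1 K2" unfolding img by blast
        then show "y \<in> harmonic_graph.img K1 K2 \<inter> ball 0 r'" using st by simp
      qed
    qed
    show "harmonic_graph.blow K1 K2 k (rcis s \<alpha>)" if s: "0 < s" "s < r'" for s
      unfolding harmonic_graph.blow_def[OF NG] hm_def[symmetric]
    proof
      fix B
      obtain \<delta> where d: "\<delta> > 0" "\<forall>w\<in>ball 0 1. dist (hm w) (rcis s \<alpha>) < \<delta> \<longrightarrow> B < sg F2 * \<phi> (f w)"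
        using blow[OF F(2), of "rcis s \<alpha>" B] side(2)[OF s] lim(2) out(2) by blast
      have "\<bar>Re (k w)\<bar> = \<bar>sg F2 * \<phi> (f w)\<bar>" if "w \<in> ball 0 1" for w
        using \<phi>(1)[OF that] by (simp add: k_def \<sigma>_def sg_def)
      then show "\<exists>\<delta>>0. \<forall>w\<in>ball 0 1. dist (hm w) (rcis s \<alpha>) < \<delta> \<longrightarrow> B < \<bar>Re (k w)\<bar>"
        using d by (intro exI[of _ \<delta>]) (auto intro: less_le_trans)
    qed
    show "\<exists>B. \<exists>\<delta>>0. \<forall>w\<in>ball 0 1. dist (harmonic_graph.hmap K1 K2 w) (- complex_of_real s) < \<delta> \<longrightarrow> Re (k w) \<le> B"
      if s: "0 < s" "s < r'" for s
      unfolding hm_def[symmetric]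
    proof (cases \<alpha> pi rule: linorder_cases)
      case less
      define \<delta> where "\<delta> = min (r' - s) (s * sin \<alpha>)"
      have sin: "0 < sin \<alpha>" using less \<alpha> by (intro sin_gt_zero) auto
      have \<delta>: "\<delta> > 0" using sin s by (simp add: \<delta>_def)
      have False if w: "w \<in> ball 0 1" "dist (hm w) (- complex_of_real s) < \<delta>" for w
      proof -
        let ?y = "hm w"
        have d: "norm (?y + of_real s) < \<delta>" using w(2) by (simp add: dist_norm)
        have "norm ?y \<le> norm (?y + of_real s) + norm (complex_of_real s)" using norm_triangle_ineq4[of "?y + of_real s" "of_real s"] by simp
        then have ny: "norm ?y < r'" using d s by (simp add: \<delta>_def)
        have "dist (f w) z0 = norm ?y" using disthm[OF w(1), of 0] by simp
        then have "f w \<in> \<Omega> \<inter> ball z0 r" using f\<Omega>[OF w(1)] ny r' by (simp add: dist_commute)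
        then obtain s' t where st: "f w = z0 + rcis s' t" "0 < s'" "\<theta> < t" "t < \<theta> + \<alpha>" unfolding sec by blast
        have y: "cis (- \<alpha>) * ?y = rcis s' (- \<alpha> + (- \<theta> + t))" by (simp add: hm[OF w(1)] st(1) e_def cis_cnj rcis_mult_cis)
        have "0 < s' * sin (\<alpha> + \<theta> - t)" using st less by (intro mult_pos_pos sin_gt_zero) auto
        moreover have "sin (- \<alpha> + (- \<theta> + t)) = - sin (\<alpha> + \<theta> - t)" using sin_minus[of "\<alpha> + \<theta> - t"] by (simp add: algebra_simps)
        ultimately have "Im (cis (- \<alpha>) * ?y) < 0" unfolding y by simp
        moreover have "Im (cis (- \<alpha>) * (?y + of_real s)) = Im (cis (- \<alpha>) * ?y) - s * sin \<alpha>" by (simp add: algebra_simps)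
        moreover have "\<bar>Im (cis (- \<alpha>) * (?y + of_real s))\<bar> \<le> norm (?y + of_real s)"
          using abs_Im_le_cmod[of "cis (- \<alpha>) * (?y + of_real s)"] by (simp add: norm_mult)
        moreover have "\<delta> \<le> s * sin \<alpha>" by (simp add: \<delta>_def)
        ultimately show False using d by linarith
      qed
      then show "\<exists>B. \<exists>\<delta>>0. \<forall>w\<in>ball 0 1. dist (hm w) (- complex_of_real s) < \<delta> \<longrightarrow> Re (k w) \<le> B" using \<delta> by blast
    next
      case equal
      have e\<pi>: "rcis s \<alpha> = - complex_of_real s" by (simp add: equal rcis_def)
      have "sg F2 = - \<sigma>" using F equal by (auto simp: sg_def \<sigma>_def)
      moreover obtain \<delta> where "\<delta> > 0" "\<forall>w\<in>ball 0 1. dist (hm w) (rcis s \<alpha>) < \<delta> \<longrightarrow> 0 < sg F2 * \<phi> (f w)"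
        using blow[OF F(2), of "rcis s \<alpha>" 0] side(2)[OF s] lim(2) out(2) by blast
      ultimately show "\<exists>B. \<exists>\<delta>>0. \<forall>w\<in>ball 0 1. dist (hm w) (- complex_of_real s) < \<delta> \<longrightarrow> Re (k w) \<le> B"
        unfolding e\<pi> using \<phi>(1) by (intro exI[of _ 0] exI[of _ \<delta>]) (auto simp: k_def less_imp_le)
    next
      case greater
      define p where "p = z0 - e * of_real s"
      have "p = z0 + rcis s (\<theta> + pi)" by (simp add: p_def e_def rcis_def cis_mult[symmetric])
      then have "p \<in> \<Omega> \<inter> ball z0 r" unfolding sec mem_Collect_eq
        using s r' greater by (intro exI[of _ s] exI[of _ "\<theta> + pi"]) auto
      then have p: "p \<in> \<Omega>" by simp
      then obtain \<delta> where \<delta>: "\<delta> > 0" "\<forall>z\<in>\<Omega>. dist z p < \<delta> \<longrightarrow> dist (\<phi> z) (\<phi> p) < 1"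
        using \<phi>(2) unfolding continuous_on_iff by (metis zero_less_one)
      have "Re (k w) \<le> \<bar>\<phi> p\<bar> + 1" if w: "w \<in> ball 0 1" "dist (hm w) (- complex_of_real s) < \<delta>" for w
      proof -
        have "dist (f w) p < \<delta>" using w(2) disthm[OF w(1), of "- of_real s"] by (simp add: p_def)
        then have "\<bar>\<phi> (f w) - \<phi> p\<bar> < 1" using \<delta>(2) f\<Omega>[OF w(1)] by (simp add: dist_real_def)
        moreover have "Re (k w) \<le> \<bar>\<phi> (f w)\<bar>" using \<phi>(1)[OF w(1)] by (auto simp: k_def \<sigma>_def sg_def)
        ultimately show ?thesis by linarith
      qed
      then show "\<exists>B. \<exists>\<delta>>0. \<forall>w\<in>ball 0 1. dist (hm w) (- complex_of_real s) < \<delta> \<longrightarrow> Re (k w) \<le> B" using \<delta>(1) by blast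
    qed
  qed (use r' \<alpha> up in \<open>auto simp: hm_def\<close>)
  from harmonic_sector.boundary_arc[OF this] obtain e0 \<delta> where arc: "norm e0 = 1" "\<delta> > 0"
    "\<And>e. norm e = 1 \<Longrightarrow> dist e e0 < \<delta> \<Longrightarrow> (hm \<longlongrightarrow> 0) (at e within ball 0 1)" unfolding hm_def by metis
  show thesis
  proof (rule that[OF arc(1,2)])
    fix x :: complex assume x: "norm x = 1" "dist x e0 < \<delta>"
    have "((\<lambda>w. z0 + e * hm w) \<longlongrightarrow> z0 + e * 0) (at x within ball 0 1)" by (intro tendsto_intros arc(3) x)
    moreover have "\<forall>\<^sub>F w in at x within ball 0 1. f w = z0 + e * hm w" using fhm by (simp add: eventually_at_filter)
    ultimately show "(f \<longlongrightarrow> z0) (at x within ball 0 1)" using filterlim_cong[OF refl refl, of f "\<lambda>w. z0 + e * hm w"] by simp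
  qed
qed

lemma boundary_extension_limit:
  assumes q: "q \<notin> \<Omega>" "q \<in> closure \<Omega>" and l: "\<exists>l. (\<psi> \<longlongrightarrow> l) (at q within \<Omega>)"
  shows "(\<psi> \<longlongrightarrow> boundary_extension \<Omega> \<psi> q) (at q within \<Omega>)"
proof -
  have "at q within \<Omega> \<noteq> bot" using q by (auto simp: trivial_limit_within closure_def)
  then show ?thesis using l q(1) tendsto_Lim unfolding boundary_extension_def by force
qed

lemma half_disc_convex:
  assumes "\<Omega> \<inter> ball p \<delta> = {z \<in> ball p \<delta>. 0 < Im (cnj e * (z - p))}"
  shows "convex (\<Omega> \<inter> ball p \<delta>)"
proof -
  have "Im (cnj e * (z - p)) = Complex (- Im e) (Re e) \<bullet> z - Complex (- Im e) (Re e) \<bullet> p" for z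
    by (simp add: inner_complex_def algebra_simps)
  then have "\<Omega> \<inter> ball p \<delta> = ball p \<delta> \<inter> {z. Complex (- Im e) (Re e) \<bullet> z > Complex (- Im e) (Re e) \<bullet> p}"
    unfolding assms by auto
  then show ?thesis by (simp only: convex_Int convex_ball convex_halfspace_gt)
qed

lemma edge_segment:
  assumes G: "harmonic_graph H1 H2 h" and J: "simply_connected_jordan_domain \<Omega>"
    and f: "\<And>w. w \<in> ball 0 1 \<Longrightarrow> f w = H1 w + cnj (H2 w)" "f ` ball 0 1 = \<Omega>"
    and h: "\<And>w. w \<in> ball 0 1 \<Longrightarrow> Re (h w) = \<phi> (f w)" "\<And>w. w \<in> ball 0 1 \<Longrightarrow> Im (h w) = \<psi> (f w)"
    and z1: "z1 \<noteq> z0" and fr: "open_segment z0 z1 \<subseteq> frontier \<Omega>"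
    and F: "F \<in> {at_top, at_bot}" and lim: "\<forall>p\<in>open_segment z0 z1. filterlim \<phi> F (at p within \<Omega>)"
    and lim\<psi>: "\<And>q. q \<in> open_segment z0 z1 \<Longrightarrow> (\<psi> \<longlongrightarrow> g q) (at q within \<Omega>)"
    and cont: "continuous_on (insert z0 (open_segment z0 z1)) g"
  obtains Q where "fst Q = z1" "lightlike (Q - (z0, g z0))" "graph_over g (open_segment z0 z1) = open_segment (z0, g z0) Q"
proof -
  let ?I = "open_segment z0 z1"
  have o\<Omega>: "open \<Omega>" using J by (simp add: simply_connected_jordan_domain_def)
  have out: "q \<notin> \<Omega>" if "q \<in> ?I" for q using fr that o\<Omega> by (auto simp: frontier_def interior_open)
  define l where "l = norm (z1 - z0)"
  define d where "d = sgn (z1 - z0)"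
  have l: "l > 0" "z1 - z0 = of_real l * d" using z1 by (auto simp: l_def d_def sgn_div_norm scaleR_conv_of_real)
  have d: "norm d = 1" using z1 by (simp add: d_def norm_sgn)
  have onI: "z0 + of_real t * d \<in> ?I" if "0 < t" "t < l" for t
  proof -
    have "(t / l) *\<^sub>R (z1 - z0) = of_real t * d" using l by (simp add: scaleR_conv_of_real)
    then have "z0 + of_real t * d = (1 - t / l) *\<^sub>R z0 + (t / l) *\<^sub>R z1" by (simp add: algebra_simps)
    then show ?thesis unfolding in_segment using that z1 by (intro conjI exI[of _ "t / l"]) auto
  qed
  define u where "u t = g (z0 + of_real t * d)" for t
  have iso: "\<exists>c>0. \<forall>s s'. \<bar>s - t\<bar> < c \<and> \<bar>s' - t\<bar> < c \<longrightarrow> \<bar>u s - u s'\<bar> = \<bar>s - s'\<bar>" if t: "0 < t" "t < l" for t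
  proof -
    define q where "q = z0 + of_real t * d"
    have qI: "q \<in> ?I" unfolding q_def by (rule onI[OF t])
    obtain c e where c: "c > 0" "e = sgn (z1 - z0) \<or> e = - sgn (z1 - z0)"
      "\<Omega> \<inter> ball q c = {z \<in> ball q c. 0 < Im (cnj e * (z - q))}"
      "{z \<in> ball q c. Im (cnj e * (z - q)) = 0} \<subseteq> ?I"
      by (rule Jordan_domain_half_disc[OF J fr qI])
    have e: "norm e = 1" "e = d \<or> e = - d" using c(2) d unfolding d_def by auto
    have ee: "e * cnj e = 1" using e(1) complex_norm_square[of e] by simp
    define K1 where "K1 = (\<lambda>w. cnj e * (H1 w - q))"
    define K2 where "K2 = (\<lambda>w. e * H2 w)"
    have NG: "harmonic_graph K1 K2 h"
      using harmonic_graph.normalized[OF G e(1), of 1 q] unfolding K1_def K2_def by simp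
    interpret N: harmonic_graph K1 K2 h by (rule NG)
    have hm: "N.hmap w = cnj e * (f w - q)" if "w \<in> ball 0 1" for w
      unfolding N.hmap_def f(1)[OF that] unfolding K1_def K2_def by (simp add: algebra_simps)
    have disthm: "dist (N.hmap w) p = dist (f w) (q + e * p)" if "w \<in> ball 0 1" for w p
    proof -
      have "f w - (q + e * p) = e * (N.hmap w - p)" unfolding hm[OF that] using ee by (simp add: right_diff_distrib mult.assoc[symmetric])
      then show ?thesis using e by (simp add: dist_norm norm_mult)
    qed
    have f\<Omega>: "f w \<in> \<Omega>" if "w \<in> ball 0 1" for w using f(2) that by blast
    have ball: "q + e * p \<in> ball q c \<longleftrightarrow> p \<in> ball 0 c" for p using e by (simp add: dist_norm norm_mult)
    have Im: "cnj e * ((q + e * p) - q) = p" for p using ee by (simp add: mult.assoc[symmetric] mult.commute)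
    have line: "q + e * p \<in> ?I" if "p \<in> ball 0 c" "Im p = 0" for p
    proof -
      have "q + e * p \<in> {z \<in> ball q c. Im (cnj e * (z - q)) = 0}" using that ball[of p] Im[of p] by simp
      then show ?thesis using c(4) by blast
    qed
    have in_img: "p \<in> N.img \<longleftrightarrow> q + e * p \<in> \<Omega>" for p
    proof
      assume "p \<in> N.img"
      then obtain w where w: "w \<in> ball 0 1" "p = N.hmap w" unfolding N.img_def by blast
      have "dist (f w) (q + e * p) = 0" using disthm[OF w(1), of p] w(2) by (simp only: dist_self)
      then have "q + e * p = f w" by (simp only: dist_eq_0_iff)
      then show "q + e * p \<in> \<Omega>" using f\<Omega>[OF w(1)] by simp
    next
      assume "q + e * p \<in> \<Omega>"
      then obtain w where w: "w \<in> ball 0 1" "f w = q + e * p" unfolding f(2)[symmetric] by (metis imageE)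
      have "dist (N.hmap w) p = 0" using disthm[OF w(1), of p] w(2) by (simp only: dist_self)
      then have "N.hmap w = p" by (simp only: dist_eq_0_iff)
      then show "p \<in> N.img" unfolding N.img_def using w(1) by blast
    qed
    define L where "L x = g (q + e * of_real x)" for x
    have L: "\<bar>L x - L y\<bar> = \<bar>x - y\<bar>" if "\<bar>x\<bar> < c/16" "\<bar>y\<bar> < c/16" for x y
    proof (rule N.boundary_isometry[OF c(1) _ _ _ that])
      show "N.img \<inter> ball 0 c = {z \<in> ball 0 c. 0 < Im z}"
      proof (rule set_eqI)
        fix p
        have "p \<in> N.img \<inter> ball 0 c \<longleftrightarrow> q + e * p \<in> \<Omega> \<inter> ball q c" using in_img ball by blast
        also have "\<dots> \<longleftrightarrow> p \<in> {z \<in> ball 0 c. 0 < Im z}" unfolding c(3) mem_Collect_eq Im ball ..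
        finally show "p \<in> N.img \<inter> ball 0 c \<longleftrightarrow> p \<in> {z \<in> ball 0 c. 0 < Im z}" .
      qed
      show "N.blow p" if "p \<in> ball 0 c" "Im p = 0" for p
        unfolding N.blow_def
      proof
        fix B
        have p: "q + e * p \<in> ?I" by (rule line[OF that])
        obtain \<delta> where \<delta>: "\<delta> > 0" "\<forall>z\<in>\<Omega>. dist z (q + e * p) < \<delta> \<longrightarrow> B < (if F = at_top then 1 else - 1) * \<phi> z"
          using filterlim_blow_up[OF F bspec[OF lim p] out[OF p]] by blast
        show "\<exists>\<delta>>0. \<forall>w\<in>ball 0 1. dist (N.hmap w) p < \<delta> \<longrightarrow> B < \<bar>Re (h w)\<bar>"
        proof (intro exI[of _ \<delta>] conjI ballI impI \<delta>(1))
          fix w assume w: "w \<in> ball 0 1" "dist (N.hmap w) p < \<delta>"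
          then have "B < (if F = at_top then 1 else - 1) * \<phi> (f w)" using \<delta>(2) f\<Omega>[OF w(1)] disthm[OF w(1)] by simp
          then show "B < \<bar>Re (h w)\<bar>" using h(1)[OF w(1)] by (auto split: if_splits)
        qed
      qed
      show "\<exists>\<delta>>0. \<forall>w\<in>ball 0 1. dist (N.hmap w) (of_real x) < \<delta> \<longrightarrow> \<bar>Im (h w) - L x\<bar> < \<epsilon>" if x\<epsilon>: "\<bar>x\<bar> < c" "0 < \<epsilon>" for x \<epsilon>
      proof -
        have p: "q + e * of_real x \<in> ?I" using x\<epsilon> by (intro line) auto
        obtain \<delta> where \<delta>: "\<delta> > 0" "\<forall>z\<in>\<Omega>. z \<noteq> q + e * of_real x \<and> dist z (q + e * of_real x) < \<delta> \<longrightarrow> dist (\<psi> z) (L x) < \<epsilon>"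
          using tendstoD[OF lim\<psi>[OF p] x\<epsilon>(2)] unfolding eventually_at L_def by blast
        show ?thesis
        proof (intro exI[of _ \<delta>] conjI ballI impI \<delta>(1))
          fix w assume w: "w \<in> ball 0 1" "dist (N.hmap w) (of_real x) < \<delta>"
          then show "\<bar>Im (h w) - L x\<bar> < \<epsilon>" using \<delta>(2) f\<Omega>[OF w(1)] disthm[OF w(1)] h(2)[OF w(1)] out[OF p]
            by (metis dist_real_def)
        qed
      qed
    qed
    obtain \<epsilon> :: real where \<epsilon>: "\<epsilon> = 1 \<or> \<epsilon> = - 1" "d = of_real \<epsilon> * e" using e(2) by (metis minus_minus mult_1 mult_minus1 of_real_1 of_real_minus)
    have uL: "u s = L (\<epsilon> * (s - t))" for s
      unfolding u_def L_def q_def by (rule arg_cong[of _ _ g]) (simp add: \<epsilon>(2) algebra_simps)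
    have "\<bar>u s - u s'\<bar> = \<bar>s - s'\<bar>" if "\<bar>s - t\<bar> < c/16" "\<bar>s' - t\<bar> < c/16" for s s'
      unfolding uL using L[of "\<epsilon> * (s - t)" "\<epsilon> * (s' - t)"] that \<epsilon>(1) by (auto simp: abs_minus_commute)
    then show ?thesis using c(1) by (intro exI[of _ "c/16"]) auto
  qed
  obtain \<sigma> k where \<sigma>: "\<sigma> = 1 \<or> \<sigma> = - 1" "\<And>t. 0 < t \<Longrightarrow> t < l \<Longrightarrow> u t = k + \<sigma> * t"
    by (rule local_isometry_affine[OF iso l(1)]) (assumption+, rule that)
  have k: "k = g z0"
  proof (rule tendsto_unique)
    show "at 0 within {0<..<l} \<noteq> bot" using l(1) by (simp add: trivial_limit_within islimpt_greaterThanLessThan1)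
    have "((\<lambda>t. k + \<sigma> * t) \<longlongrightarrow> k + \<sigma> * 0) (at 0 within {0<..<l})" by (intro tendsto_intros)
    then show "(u \<longlongrightarrow> k) (at 0 within {0<..<l})"
      using filterlim_cong[OF refl refl, of u "\<lambda>t. k + \<sigma> * t" "at 0 within {0<..<l}"] \<sigma>(2) by (simp add: eventually_at_filter)
    have "continuous_on {0..<l} u" unfolding u_def
    proof (rule continuous_on_compose2[OF cont])
      show "(\<lambda>t. z0 + of_real t * d) ` {0..<l} \<subseteq> insert z0 ?I"
      proof
        fix y assume "y \<in> (\<lambda>t. z0 + of_real t * d) ` {0..<l}"
        then obtain t where t: "0 \<le> t" "t < l" "y = z0 + of_real t * d" by auto
        then show "y \<in> insert z0 ?I" using onI[of t] by (cases "t = 0") auto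
      qed
    qed (intro continuous_intros)
    then have "(u \<longlongrightarrow> u 0) (at 0 within {0..<l})" using l(1) by (simp add: continuous_on_def)
    from tendsto_within_subset[OF this, of "{0<..<l}"] show "(u \<longlongrightarrow> g z0) (at 0 within {0<..<l})" by (simp add: u_def subset_eq)
  qed
  define Q where "Q = (z1, g z0 + \<sigma> * l)"
  show thesis
  proof (rule that[of Q])
    show "fst Q = z1" by (simp add: Q_def)
    have "(z1 - z0) \<bullet> (z1 - z0) = l * l" by (simp add: l_def dot_square_norm power2_eq_square)
    then show "lightlike (Q - (z0, g z0))" using z1 \<sigma>(1) by (auto simp: lightlike_def lorentz_def Q_def prod_eq_iff)
    have gu: "g ((1 - v) *\<^sub>R z0 + v *\<^sub>R z1) = g z0 + \<sigma> * (v * l)" if "0 < v" "v < 1" for v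
    proof -
      have "(1 - v) *\<^sub>R z0 + v *\<^sub>R z1 = z0 + v *\<^sub>R (z1 - z0)" by (simp add: algebra_simps)
      also have "\<dots> = z0 + of_real (v * l) * d" by (simp add: l(2) scaleR_conv_of_real)
      finally show ?thesis using \<sigma>(2)[of "v * l"] that l(1) unfolding u_def k by simp
    qed
    have ne: "(z0, g z0) \<noteq> Q" using z1 by (simp add: Q_def)
    show "graph_over g ?I = open_segment (z0, g z0) Q"
    proof
      show "graph_over g ?I \<subseteq> open_segment (z0, g z0) Q"
      proof
        fix y assume "y \<in> graph_over g ?I"
        then obtain p where p: "p \<in> ?I" "y = (p, g p)" unfolding graph_over_def by blast
        from p(1) obtain v where v: "0 < v" "v < 1" "p = (1 - v) *\<^sub>R z0 + v *\<^sub>R z1"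
          unfolding in_segment by blast
        have "y = (1 - v) *\<^sub>R (z0, g z0) + v *\<^sub>R Q" unfolding p(2) v(3) gu[OF v(1,2)] by (simp add: Q_def algebra_simps)
        then show "y \<in> open_segment (z0, g z0) Q" unfolding in_segment using v ne by blast
      qed
      show "open_segment (z0, g z0) Q \<subseteq> graph_over g ?I"
      proof
        fix y assume "y \<in> open_segment (z0, g z0) Q"
        then obtain v where v: "0 < v" "v < 1" "y = (1 - v) *\<^sub>R (z0, g z0) + v *\<^sub>R Q" unfolding in_segment by blast
        have "y = ((1 - v) *\<^sub>R z0 + v *\<^sub>R z1, g ((1 - v) *\<^sub>R z0 + v *\<^sub>R z1))"
          unfolding v(3) gu[OF v(1,2)] by (simp add: Q_def algebra_simps)
        moreover have "(1 - v) *\<^sub>R z0 + v *\<^sub>R z1 \<in> ?I" unfolding in_segment using v z1 by blast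
        ultimately show "y \<in> graph_over g ?I" unfolding graph_over_def by blast
      qed
    qed
  qed
qed

lemma segments_meet_at_vertex:
  fixes P Q1 Q2 :: "complex \<times> real"
  assumes z: "fst Q1 - fst P = rcis s1 t1" "fst Q2 - fst P = rcis s2 t2" and s: "0 < s1" "0 < s2"
    and t: "t2 = t1 + \<alpha>" "0 < \<alpha>" "\<alpha> < 2 * pi"
  shows "closed_segment P Q1 \<inter> closed_segment P Q2 = {P}"
proof
  show "closed_segment P Q1 \<inter> closed_segment P Q2 \<subseteq> {P}"
  proof
    fix y assume "y \<in> closed_segment P Q1 \<inter> closed_segment P Q2"
    then have y: "y \<in> closed_segment P Q1" "y \<in> closed_segment P Q2" by simp_all
    obtain u where u: "0 \<le> u" "y = (1 - u) *\<^sub>R P + u *\<^sub>R Q1" using y(1) unfolding in_segment by blast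
    obtain v where v: "0 \<le> v" "y = (1 - v) *\<^sub>R P + v *\<^sub>R Q2" using y(2) unfolding in_segment by blast
    note uv = u v
    have y1: "fst y - fst P = u *\<^sub>R (fst Q1 - fst P)" unfolding uv(2) by (simp add: algebra_simps)
    have y2: "fst y - fst P = v *\<^sub>R (fst Q2 - fst P)" unfolding uv(4) by (simp add: algebra_simps)
    have eq: "of_real (u * s1) * cis t1 = of_real (v * s2) * cis t2"
      using y1 y2 unfolding z by (simp add: rcis_def scaleR_conv_of_real mult.assoc)
    have n: "u * s1 = v * s2" using arg_cong[OF eq, of norm] uv s by (simp add: norm_mult)
    have "u * s1 = 0"
    proof (rule ccontr)
      assume ne: "u * s1 \<noteq> 0"
      have "cis t1 = cis t2" using eq ne unfolding n[symmetric] by (metis mult_cancel_left of_real_eq_0_iff)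
      then have "cis t1 * cis \<alpha> = cis t1 * 1" unfolding t(1) by (metis cis_mult mult_1_right)
      then have "cis \<alpha> = 1" using cis_neq_zero[of t1] mult_left_cancel by blast
      then have "cos \<alpha> = 1" by (simp add: complex_eq_iff)
      then obtain n :: int where n: "\<alpha> = of_int n * 2 * pi" using cos_one_2pi_int by auto
      have "0 < of_int n * (2 * pi)" "of_int n * (2 * pi) < 1 * (2 * pi)" using t(2,3) unfolding n by simp_all
      then have "0 < real_of_int n" "real_of_int n < 1" using pi_gt_zero by (simp_all add: zero_less_mult_iff)
      then show False by simp
    qed
    then show "y \<in> {P}" using uv(2) s by auto
  qed
qed auto

theorem theorem1p2:
  fixes \<Omega> :: "complex set" and \<phi> \<psi> :: "complex \<Rightarrow> real" and f :: "complex \<Rightarrow> complex"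
    and z0 z1 z2 :: complex and I1 I2 :: "complex set" and \<alpha> :: real
    and F1 F2 :: "real filter"
  assumes "bounded \<Omega>" and "simply_connected_jordan_domain \<Omega>"
    and "minimal_solution \<phi> \<Omega>"
    and "maximal_solution \<psi> \<Omega>" and "is_dual \<psi> \<phi> \<Omega>"
    and "corresponding_harmonic_mapping f \<phi> \<Omega>"
    and "z1 \<noteq> z0" and "z2 \<noteq> z0"
    and "I1 = open_segment z0 z1" and "I2 = open_segment z0 z2"
    and "I1 \<subseteq> frontier \<Omega>" and "I2 \<subseteq> frontier \<Omega>"
    and "interior_angle \<Omega> z0 z1 z2 \<alpha>"
    and "F1 \<in> {at_top, at_bot}" and "F2 \<in> {at_top, at_bot}"
    and "\<forall>p\<in>I1. filterlim \<phi> F1 (at p within \<Omega>)"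
    and "\<forall>p\<in>I2. filterlim \<phi> F2 (at p within \<Omega>)"
    and "\<alpha> = pi \<longrightarrow> F1 \<noteq> F2"
  shows
    "(\<exists>Xt a b s t. s < t \<and>
        generalized_minimal_surface Xt (doubled_domain a b) \<and>
        Xt ` real_interval a b = open_segment (z0, s) (z0, t) \<and>
        extends_by_symmetry Xt (\<lambda>w. (f w, \<phi> (f w))) (vertical_rotation z0) a b)
     \<and>
     (let \<psi>' = boundary_extension \<Omega> \<psi>; P = (z0, \<psi>' z0) in
       continuous_on (\<Omega> \<union> I1 \<union> {z0} \<union> I2) \<psi>' \<and>
       (\<exists>Q1 Q2. lightlike (Q1 - P) \<and> lightlike (Q2 - P) \<and>
          graph_over \<psi>' I1 = open_segment P Q1 \<and> graph_over \<psi>' I2 = open_segment P Q2 \<and>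
          closed_segment P Q1 \<inter> closed_segment P Q2 = {P}) \<and>
       (\<exists>Xt a b.
          generalized_maximal_surface Xt (doubled_domain a b) \<and>
          (\<forall>p\<in>real_interval a b. Xt p = P \<and> shrinking_singular_point Xt (doubled_domain a b) p) \<and>
          extends_by_symmetry Xt (\<lambda>w. (f w, \<psi> (f w))) (point_symmetry P) a b))"
proof -
  note J = assms(2) and dual = assms(5) and I = assms(9,10) and fr = assms(11,12)
  have o\<Omega>: "open \<Omega>" using J by (simp add: simply_connected_jordan_domain_def)
  have out: "q \<notin> \<Omega>" and cl: "q \<in> closure \<Omega>" if "q \<in> I1 \<union> I2" for q
    using fr that o\<Omega> by (auto simp: frontier_def interior_open)
  have f\<Omega>: "f ` ball 0 1 = \<Omega>" using assms(6) by (simp add: corresponding_harmonic_mapping_def bij_betw_def)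
  have \<phi>d: "\<phi> differentiable (at z)" if "z \<in> \<Omega>" for z
    using assms(3) that by (simp add: minimal_solution_def C2_on_def C1_on_def)
  then have \<phi>c: "continuous_on \<Omega> \<phi>"
    by (intro continuous_at_imp_continuous_on ballI differentiable_imp_continuous_within)
  have \<psi>c: "continuous_on \<Omega> \<psi>"
    using is_dual_has_derivative[OF dual] by (intro continuous_at_imp_continuous_on ballI) (blast intro: has_derivative_continuous)
  obtain H1 H2 h where G: "harmonic_graph H1 H2 h" and f: "\<And>w. w \<in> ball 0 1 \<Longrightarrow> f w = H1 w + cnj (H2 w)"
    and h: "\<And>w. w \<in> ball 0 1 \<Longrightarrow> Re (h w) = \<phi> (f w)" "\<And>w. w \<in> ball 0 1 \<Longrightarrow> Im (h w) = \<psi> (f w)"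
    by (rule harmonic_graph_data[OF assms(6) dual \<phi>d], assumption, rule that)
  interpret harmonic_graph H1 H2 h by (rule G)
  obtain \<theta> r where \<alpha>: "0 < \<alpha>" "\<alpha> < 2 * pi" and r: "0 < r"
    and sec: "\<Omega> \<inter> ball z0 r = {z0 + rcis s t | s t. 0 < s \<and> s < r \<and> \<theta> < t \<and> t < \<theta> + \<alpha>}"
    and sides: "z1 - z0 = rcis (dist z0 z1) \<theta> \<and> z2 - z0 = rcis (dist z0 z2) (\<theta> + \<alpha>) \<or>
         z2 - z0 = rcis (dist z0 z2) \<theta> \<and> z1 - z0 = rcis (dist z0 z1) (\<theta> + \<alpha>)"
    using assms(13) unfolding interior_angle_def by blast
  have disj: "open_segment z0 z1 \<inter> \<Omega> = {}" "open_segment z0 z2 \<inter> \<Omega> = {}" using out I by blast+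
  have blow: "\<forall>p\<in>open_segment z0 z1. filterlim \<phi> F1 (at p within \<Omega>)" "\<forall>p\<in>open_segment z0 z2. filterlim \<phi> F2 (at p within \<Omega>)"
    using assms(16,17) I by auto
  have "\<exists>e0 \<delta>. norm e0 = 1 \<and> \<delta> > 0 \<and> (\<forall>e. norm e = 1 \<longrightarrow> dist e e0 < \<delta> \<longrightarrow> (f \<longlongrightarrow> z0) (at e within ball 0 1))"
    using sides
  proof
    assume s: "z1 - z0 = rcis (dist z0 z1) \<theta> \<and> z2 - z0 = rcis (dist z0 z2) (\<theta> + \<alpha>)"
    show ?thesis
      by (rule vertex_arc[OF G o\<Omega> f f\<Omega> h(1) \<phi>c r \<alpha> sec assms(7,8) conjunct1[OF s] conjunct2[OF s] assms(14,15,18) blow disj]) blast+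
  next
    assume s: "z2 - z0 = rcis (dist z0 z2) \<theta> \<and> z1 - z0 = rcis (dist z0 z1) (\<theta> + \<alpha>)"
    have F: "\<alpha> = pi \<longrightarrow> F2 \<noteq> F1" using assms(18) by auto
    show ?thesis
      by (rule vertex_arc[OF G o\<Omega> f f\<Omega> h(1) \<phi>c r \<alpha> sec assms(8,7) conjunct1[OF s] conjunct2[OF s] assms(15,14) F blow(2,1) disj(2,1)]) blast+
  qed
  then obtain e0 \<delta> where arc: "norm e0 = 1" "\<delta> > 0"
    "\<And>e. norm e = 1 \<Longrightarrow> dist e e0 < \<delta> \<Longrightarrow> (f \<longlongrightarrow> z0) (at e within ball 0 1)" by blast
  define g where "g = boundary_extension \<Omega> \<psi>"
  have z0: "z0 \<notin> \<Omega>"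
  proof
    assume "z0 \<in> \<Omega>"
    then have "z0 \<in> \<Omega> \<inter> ball z0 r" using r by simp
    then show False unfolding sec by auto
  qed
  note vertex = dual_limit_at_vertex[OF dual r \<alpha>(1) sec]
  have lim0: "(\<psi> \<longlongrightarrow> g z0) (at z0 within \<Omega>)" unfolding g_def by (rule boundary_extension_limit[OF z0 vertex])
  have lim\<psi>: "(\<psi> \<longlongrightarrow> g q) (at q within \<Omega>)" if q: "q \<in> I1 \<union> I2" for q
    unfolding g_def
  proof (rule boundary_extension_limit[OF out[OF q] cl[OF q]])
    have "\<exists>c>0. convex (\<Omega> \<inter> ball q c)" if s: "open_segment z0 z' \<subseteq> frontier \<Omega>" "q \<in> open_segment z0 z'" for z'
    proof -
      obtain c e where "c > 0" "\<Omega> \<inter> ball q c = {z \<in> ball q c. 0 < Im (cnj e * (z - q))}"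
        by (rule Jordan_domain_half_disc[OF J s])
      then show ?thesis using half_disc_convex by blast
    qed
    then obtain c where "c > 0" "convex (\<Omega> \<inter> ball q c)" using q fr unfolding I by blast
    then show "\<exists>l. (\<psi> \<longlongrightarrow> l) (at q within \<Omega>)" by (rule dual_limit_at_side[OF dual cl[OF q]])
  qed
  have cont: "continuous_on (\<Omega> \<union> (insert z0 (I1 \<union> I2))) g"
  proof -
    have "continuous_on (\<Omega> \<union> (insert z0 (I1 \<union> I2))) (\<lambda>z. if z \<in> \<Omega> then \<psi> z else g z)"
      by (rule continuous_extension_by_limits[OF o\<Omega> \<psi>c]) (use cl vertex(1) lim0 lim\<psi> in auto)
    also have "(\<lambda>z. if z \<in> \<Omega> then \<psi> z else g z) = g" by (rule ext) (simp add: g_def boundary_extension_def)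
    finally show ?thesis .
  qed
  have c1: "continuous_on (insert z0 (open_segment z0 z1)) g" "continuous_on (insert z0 (open_segment z0 z2)) g"
    unfolding I[symmetric] by (rule continuous_on_subset[OF cont]; blast)+
  obtain Q1 where Q1: "fst Q1 = z1" "lightlike (Q1 - (z0, g z0))" "graph_over g (open_segment z0 z1) = open_segment (z0, g z0) Q1"
    by (rule edge_segment[OF G J f f\<Omega> h assms(7) fr(1)[unfolded I] assms(14) blow(1) _ c1(1)], assumption+)
      (use lim\<psi> I in auto)
  obtain Q2 where Q2: "fst Q2 = z2" "lightlike (Q2 - (z0, g z0))" "graph_over g (open_segment z0 z2) = open_segment (z0, g z0) Q2"
    by (rule edge_segment[OF G J f f\<Omega> h assms(8) fr(2)[unfolded I] assms(15) blow(2) _ c1(2)], assumption+)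
      (use lim\<psi> I in auto)
  have d: "0 < dist z0 z1" "0 < dist z0 z2" using assms(7,8) by auto
  have meet: "closed_segment (z0, g z0) Q1 \<inter> closed_segment (z0, g z0) Q2 = {(z0, g z0)}"
    using sides
  proof
    assume s: "z1 - z0 = rcis (dist z0 z1) \<theta> \<and> z2 - z0 = rcis (dist z0 z2) (\<theta> + \<alpha>)"
    show ?thesis by (rule segments_meet_at_vertex[OF _ _ d refl \<alpha>]) (use s Q1 Q2 in auto)
  next
    assume s: "z2 - z0 = rcis (dist z0 z2) \<theta> \<and> z1 - z0 = rcis (dist z0 z1) (\<theta> + \<alpha>)"
    show ?thesis by (subst Int_commute, rule segments_meet_at_vertex[OF _ _ d(2,1) refl \<alpha>]) (use s Q1 Q2 in auto)
  qed
  have f\<Omega>': "f w \<in> \<Omega>" if "w \<in> ball 0 1" for w using f\<Omega> that by blast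
  have limh: "((\<lambda>w. Im (h w)) \<longlongrightarrow> g z0) (at e within ball 0 1)" if e: "norm e = 1" "dist e e0 < \<delta>" for e
  proof -
    have "filterlim f (at z0 within \<Omega>) (at e within ball 0 1)" unfolding filterlim_at
    proof
      show "\<forall>\<^sub>F w in at e within ball 0 1. f w \<in> \<Omega> \<and> f w \<noteq> z0"
        using f\<Omega>' z0 unfolding eventually_at_filter by (intro always_eventually) metis
    qed (rule arc(3)[OF e])
    then have "((\<lambda>w. \<psi> (f w)) \<longlongrightarrow> g z0) (at e within ball 0 1)" by (rule filterlim_compose[OF lim0])
    moreover have "\<forall>\<^sub>F w in at e within ball 0 1. Im (h w) = \<psi> (f w)" using h(2) by (simp add: eventually_at_filter)
    ultimately show ?thesis using filterlim_cong[OF refl refl, of "\<lambda>w. Im (h w)" "\<lambda>w. \<psi> (f w)"] by simp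
  qed
  have limf: "(hmap \<longlongrightarrow> z0) (at e within ball 0 1)" if e: "norm e = 1" "dist e e0 < \<delta>" for e
  proof -
    have "\<forall>\<^sub>F w in at e within ball 0 1. hmap w = f w" using f by (simp add: eventually_at_filter hmap_def)
    then show ?thesis using filterlim_cong[OF refl refl, of hmap f] arc(3)[OF e] by simp
  qed
  have nonconst: "\<not> h constant_on ball 0 1"
  proof
    assume "h constant_on ball 0 1"
    then obtain k where k: "\<And>w. w \<in> ball 0 1 \<Longrightarrow> h w = k" unfolding constant_on_def by blast
    define p where "p = midpoint z0 z1"
    have p: "p \<in> open_segment z0 z1" using assms(7) by (simp add: p_def midpoint_in_open_segment)
    then obtain c where c: "c > 0" "\<forall>z\<in>\<Omega>. dist z p < c \<longrightarrow> \<bar>Re k\<bar> < (if F1 = at_top then 1 else - 1) * \<phi> z"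
      using filterlim_blow_up[OF assms(14) bspec[OF blow(1) p], of "\<bar>Re k\<bar>"] out I by blast
    obtain z where z: "z \<in> \<Omega>" "dist z p < c" using cl[of p] p I c(1) closure_approachable by blast
    then obtain w where "w \<in> ball 0 1" "z = f w" unfolding f\<Omega>[symmetric] by (metis imageE)
    then have "\<phi> z = Re k" using h(1)[of w] k[of w] by simp
    then show False using c(2) z by (force split: if_splits)
  qed
  note ext = symmetric_extensions[OF arc(1,2) limf limh nonconst, of f \<phi> \<psi>]
  have fh: "f w = hmap w" "\<phi> (f w) = Re (h w)" "\<psi> (f w) = Im (h w)" if "w \<in> ball 0 1" for w
    using f h that by (simp_all add: hmap_def)
  have cont': "continuous_on (\<Omega> \<union> I1 \<union> {z0} \<union> I2) g" by (rule continuous_on_subset[OF cont]) blast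
  show ?thesis
    unfolding Let_def g_def[symmetric]
  proof (intro conjI)
    show "\<exists>Q1 Q2. lightlike (Q1 - (z0, g z0)) \<and> lightlike (Q2 - (z0, g z0)) \<and>
          graph_over g I1 = open_segment (z0, g z0) Q1 \<and> graph_over g I2 = open_segment (z0, g z0) Q2 \<and>
          closed_segment (z0, g z0) Q1 \<inter> closed_segment (z0, g z0) Q2 = {(z0, g z0)}"
      unfolding I using Q1(2,3) Q2(2,3) meet by blast
  qed (rule cont' | rule ext; use fh in simp)+
qed

end
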